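(* Let $(M,\varphi)$ be a compact integrable $G_2$ manifold of constant type whose $G_2$ structure is a Gauduchon $G_2$ structure, i.e. its Lee form $\theta$ satisfies $\delta\theta=0$. Then the characteristic connection $\nabla$ is a $G_2$-instanton if and only if its torsion 3-form $T$ is parallel with respect to the characteristic connection, $\nabla T=0$.
   Context: Manifolds are smooth; compact means compact without boundary. A $G_2$ manifold $(M,\varphi)$ is a 7-manifold with a 3-form $\varphi$ that near each point can be written, in a local coframe $e_1,\dots,e_7$, as $\varphi=e_{127}+e_{135}-e_{146}-e_{236}-e_{245}+e_{347}+e_{567}$, where $e_{ijk}=e_i\wedge e_j\wedge e_k$. It induces the metric $g$ and orientation for which such coframes are oriented orthonormal; $*$ is the Hodge star, $(\cdot,\cdot)$ the induced scalar product on forms, and $\delta=(-1)^k*d*$ the codifferential on $k$-forms. Indices refer to a local orthonormal frame, and repeated indices are summed. The Lee form is $\theta=-\frac13*( *d\varphi\wedge\varphi)$. The $G_2$ structure is integrable if $d{*\varphi}=\theta\wedge*\varphi$. It is of constant type if it is integrable and the function $(d\varphi,*\varphi)$ is constant. On an integrable $G_2$ manifold there is a unique linear connection $\nabla$ (the characteristic connection) with $\nabla g=0$, $\nabla\varphi=0$ and totally skew-symmetric torsion, i.e. $T(X,Y,Z)=g(\nabla_XY-\nabla_YX-[X,Y],Z)$ is a 3-form; explicitly $T=-*d\varphi+*(\theta\wedge\varphi)+\frac16(d\varphi,*\varphi)\varphi$. Curvature of $\nabla$: $R(X,Y)Z=[\nabla_X,\nabla_Y]Z-\nabla_{[X,Y]}Z$,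 $R(X,Y,Z,V)=g(R(X,Y)Z,V)$. $\nabla$ (or its curvature $R$) is a $G_2$-instanton if $R_{abij}\varphi_{abk}=0$ for all $i,j,k$, i.e. the curvature 2-form lies in $\mathfrak g_2\cong\{\alpha\in\Lambda^2: *(\alpha\wedge\varphi)=-\alpha\}$. *)

theory Defs
  imports "HOL-Analysis.Analysis"
begin

section \<open>Smooth functions and smooth 7-manifolds\<close>

type_synonym R7 = "real^7"

definition pd :: "7 \<Rightarrow> (R7 \<Rightarrow> real) \<Rightarrow> R7 \<Rightarrow> real" where
  "pd i f x = frechet_derivative f (at x) (axis i 1)"

text \<open>Meant for open sets \<open>S\<close>: all iterated partial derivatives exist and are differentiable.\<close>

primrec Ck :: "nat \<Rightarrow> R7 set \<Rightarrow> (R7 \<Rightarrow> real) \<Rightarrow> bool" where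
  "Ck 0 S f \<longleftrightarrow> continuous_on S f"
| "Ck (Suc k) S f \<longleftrightarrow> (\<forall>x\<in>S. f differentiable (at x)) \<and> (\<forall>i. Ck k S (pd i f))"

definition smooth_on :: "R7 set \<Rightarrow> (R7 \<Rightarrow> real) \<Rightarrow> bool" where
  "smooth_on S f \<longleftrightarrow> (\<forall>k. Ck k S f)"

text \<open>A chart is a pair of its domain and its coordinate map; an atlas is a set of charts.\<close>

type_synonym 'a chart = "'a set \<times> ('a \<Rightarrow> R7)"

definition chart_image :: "'a chart \<Rightarrow> R7 set" where
  "chart_image c = snd c ` fst c"

definition overlap :: "'a chart \<Rightarrow> 'a chart \<Rightarrow> R7 set" where
  "overlap c c' = snd c ` (fst c \<inter> fst c')"

definition transition :: "'a chart \<Rightarrow> 'a chart \<Rightarrow> R7 \<Rightarrow> R7" where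
  "transition c c' x = snd c' (inv_into (fst c) (snd c) x)"

definition jacobian :: "'a chart \<Rightarrow> 'a chart \<Rightarrow> R7 \<Rightarrow> 7 \<Rightarrow> R7" where
  "jacobian c c' x i = (\<chi> k. pd i (\<lambda>y. transition c c' y $ k) x)"

definition smooth_7_manifold :: "'a topology \<Rightarrow> 'a chart set \<Rightarrow> bool" where
  "smooth_7_manifold X A \<longleftrightarrow>
     Hausdorff_space X \<and> second_countable X \<and> (\<Union>c\<in>A. fst c) = topspace X \<and>
     (\<forall>c\<in>A. openin X (fst c) \<and> open (chart_image c) \<and>
        homeomorphic_map (subtopology X (fst c)) (top_of_set (chart_image c)) (snd c)) \<and>
     (\<forall>c\<in>A. \<forall>c'\<in>A. \<forall>k. smooth_on (overlap c c') (\<lambda>x. transition c c' x $ k))"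

section \<open>Covariant tensors and exterior algebra\<close>

text \<open>
  A covariant \<open>k\<close>-tensor on \<open>\<real>\<^sup>7\<close> is given by its components
  \<open>t [i\<^sub>1, \<dots>, i\<^sub>k]\<close> on the coordinate vectors; only the values on lists of length \<open>k\<close> are
  meaningful.  The index type \<open>7\<close> is the ring of integers modulo 7, so the seventh
  index is the numeral \<open>7 = 0\<close>, and the type carries the seven labels \<open>1, \<dots>, 7\<close>.
\<close>

type_synonym tensor = "7 list \<Rightarrow> real"
type_synonym local_field = "R7 \<Rightarrow> tensor"

definition idx :: "nat \<Rightarrow> 7 list set" where
  "idx k = {is. length is = k}"

definition eval_tensor :: "tensor \<Rightarrow> R7 list \<Rightarrow> real" where
  "eval_tensor t vs = (\<Sum>is\<in>idx (length vs). t is * (\<Prod>a<length vs. (vs ! a) $ (is ! a)))"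

definition alternating :: "nat \<Rightarrow> tensor \<Rightarrow> bool" where
  "alternating k t \<longleftrightarrow>
     (\<forall>is\<in>idx k. \<forall>p. p permutes {..<k} \<longrightarrow> t (permute_list p is) = of_int (sign p) * t is)"

definition covector :: "R7 \<Rightarrow> tensor" where
  "covector v is = v $ hd is"

text \<open>The argument \<open>k\<close> is the degree of \<open>\<alpha>\<close>; normalised by
  \<open>(e\<^sub>i \<and> e\<^sub>j)(u, v) = e\<^sub>i(u) e\<^sub>j(v) - e\<^sub>i(v) e\<^sub>j(u)\<close>.\<close>

definition wedge :: "nat \<Rightarrow> tensor \<Rightarrow> tensor \<Rightarrow> tensor" where
  "wedge k \<alpha> \<beta> is =
     (\<Sum>p | p permutes {..<length is}. of_int (sign p) *
        \<alpha> (take k (permute_list p is)) * \<beta> (drop k (permute_list p is)))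
     / (fact k * fact (length is - k))"

text \<open>For a matrix \<open>E\<close>, whose rows are the covectors \<open>e\<^sub>a\<close>, this is
  \<open>e\<^sub>a \<and> e\<^sub>b \<and> \<dots>\<close> for the list \<open>[a, b, \<dots>]\<close>.\<close>

fun coframe_wedge :: "real^7^7 \<Rightarrow> 7 list \<Rightarrow> tensor" where
  "coframe_wedge E [] = (\<lambda>_. 1)"
| "coframe_wedge E (a # as) = wedge 1 (covector (E $ a)) (coframe_wedge E as)"

definition ext_d :: "local_field \<Rightarrow> local_field" where
  "ext_d \<alpha> x is =
     (\<Sum>j<length is. (-1) ^ j * pd (is ! j) (\<lambda>y. \<alpha> y (take j is @ drop (Suc j) is)) x)"

section \<open>Metric, volume form and Hodge star of a \<open>G\<^sub>2\<close> form\<close>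

definition g2_model :: "real^7^7 \<Rightarrow> tensor" where
  "g2_model E is =
     coframe_wedge E [1,2,7] is + coframe_wedge E [1,3,5] is - coframe_wedge E [1,4,6] is
     - coframe_wedge E [2,3,6] is - coframe_wedge E [2,4,5] is + coframe_wedge E [3,4,7] is
     + coframe_wedge E [5,6,7] is"

definition adapted :: "tensor \<Rightarrow> real^7^7 \<Rightarrow> bool" where
  "adapted \<phi> E \<longleftrightarrow> invertible E \<and> (\<forall>is\<in>idx 3. \<phi> is = g2_model E is)"

text \<open>The stabiliser of the model form lies in \<open>SO(7)\<close>, so the metric and the
  volume form below do not depend on the chosen adapted coframe.\<close>

definition some_coframe :: "tensor \<Rightarrow> real^7^7" where
  "some_coframe \<phi> = (SOME E. adapted \<phi> E)"

definition metric :: "tensor \<Rightarrow> real^7^7" where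
  "metric \<phi> = transpose (some_coframe \<phi>) ** some_coframe \<phi>"

definition volume :: "tensor \<Rightarrow> tensor" where
  "volume \<phi> = coframe_wedge (some_coframe \<phi>) [1,2,3,4,5,6,7]"

definition gprod :: "tensor \<Rightarrow> R7 \<Rightarrow> R7 \<Rightarrow> real" where
  "gprod \<phi> u v = u \<bullet> (metric \<phi> *v v)"

definition raise :: "tensor \<Rightarrow> tensor \<Rightarrow> tensor" where
  "raise \<phi> \<alpha> is =
     (\<Sum>js\<in>idx (length is).
        (\<Prod>a<length is. matrix_inv (metric \<phi>) $ (is ! a) $ (js ! a)) * \<alpha> js)"

text \<open>Scalar product of \<open>k\<close>-forms for which the \<open>e\<^sub>i \<and> e\<^sub>j \<and> \<dots>\<close> with increasing
  indices are orthonormal, and the Hodge star with \<open>\<alpha> \<and> *\<beta> = (\<alpha>, \<beta>) vol\<close>.\<close>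

definition form_inner :: "tensor \<Rightarrow> nat \<Rightarrow> tensor \<Rightarrow> tensor \<Rightarrow> real" where
  "form_inner \<phi> k \<alpha> \<beta> = (\<Sum>is\<in>idx k. raise \<phi> \<alpha> is * \<beta> is) / fact k"

definition hodge :: "tensor \<Rightarrow> nat \<Rightarrow> tensor \<Rightarrow> tensor" where
  "hodge \<phi> k \<alpha> js = (\<Sum>is\<in>idx k. raise \<phi> \<alpha> is * volume \<phi> (is @ js)) / fact k"

definition codiff :: "local_field \<Rightarrow> nat \<Rightarrow> local_field \<Rightarrow> local_field" where
  "codiff \<phi> k \<alpha> x is =
     (-1) ^ k * hodge (\<phi> x) (8 - k) (ext_d (\<lambda>y. hodge (\<phi> y) k (\<alpha> y)) x) is"

definition metric_field :: "local_field \<Rightarrow> local_field" where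
  "metric_field \<phi> x is = metric (\<phi> x) $ (is ! 0) $ (is ! 1)"

definition star_phi :: "local_field \<Rightarrow> local_field" where
  "star_phi \<phi> x = hodge (\<phi> x) 3 (\<phi> x)"

definition lee_form :: "local_field \<Rightarrow> local_field" where
  "lee_form \<phi> x is =
     - (1/3) * hodge (\<phi> x) 6 (wedge 3 (hodge (\<phi> x) 4 (ext_d \<phi> x)) (\<phi> x)) is"

section \<open>Connections in a chart\<close>

text \<open>\<open>\<Gamma> x k i j\<close> is the coefficient of \<open>\<partial>\<^sub>k\<close> in \<open>\<nabla>\<^bsub>\<partial>\<^sub>i\<^esub> \<partial>\<^sub>j\<close>.\<close>

type_synonym christoffel = "R7 \<Rightarrow> 7 \<Rightarrow> 7 \<Rightarrow> 7 \<Rightarrow> real"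
type_synonym vfield = "R7 \<Rightarrow> R7"

definition nabla :: "christoffel \<Rightarrow> vfield \<Rightarrow> vfield \<Rightarrow> vfield" where
  "nabla \<Gamma> V W x =
     (\<chi> k. \<Sum>i\<in>UNIV. V x $ i * (pd i (\<lambda>y. W y $ k) x + (\<Sum>j\<in>UNIV. \<Gamma> x k i j * W x $ j)))"

definition lie_bracket :: "vfield \<Rightarrow> vfield \<Rightarrow> vfield" where
  "lie_bracket V W x =
     (\<chi> k. \<Sum>i\<in>UNIV. V x $ i * pd i (\<lambda>y. W y $ k) x - W x $ i * pd i (\<lambda>y. V y $ k) x)"

definition coord_field :: "7 \<Rightarrow> vfield" where
  "coord_field i x = axis i 1"

definition torsion :: "local_field \<Rightarrow> christoffel \<Rightarrow> vfield \<Rightarrow> vfield \<Rightarrow> vfield \<Rightarrow> R7 \<Rightarrow> real" where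
  "torsion \<phi> \<Gamma> V W Z x =
     gprod (\<phi> x) (nabla \<Gamma> V W x - nabla \<Gamma> W V x - lie_bracket V W x) (Z x)"

definition curvature_op :: "christoffel \<Rightarrow> vfield \<Rightarrow> vfield \<Rightarrow> vfield \<Rightarrow> vfield" where
  "curvature_op \<Gamma> V W Z x =
     nabla \<Gamma> V (nabla \<Gamma> W Z) x - nabla \<Gamma> W (nabla \<Gamma> V Z) x - nabla \<Gamma> (lie_bracket V W) Z x"

definition curvature ::
  "local_field \<Rightarrow> christoffel \<Rightarrow> vfield \<Rightarrow> vfield \<Rightarrow> vfield \<Rightarrow> vfield \<Rightarrow> R7 \<Rightarrow> real" where
  "curvature \<phi> \<Gamma> V W Z U x = gprod (\<phi> x) (curvature_op \<Gamma> V W Z x) (U x)"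

definition torsion_field :: "local_field \<Rightarrow> christoffel \<Rightarrow> local_field" where
  "torsion_field \<phi> \<Gamma> x is =
     torsion \<phi> \<Gamma> (coord_field (is ! 0)) (coord_field (is ! 1)) (coord_field (is ! 2)) x"

definition curvature_field :: "local_field \<Rightarrow> christoffel \<Rightarrow> local_field" where
  "curvature_field \<phi> \<Gamma> x is =
     curvature \<phi> \<Gamma> (coord_field (is ! 0)) (coord_field (is ! 1))
       (coord_field (is ! 2)) (coord_field (is ! 3)) x"

text \<open>Components \<open>(\<nabla>\<^bsub>\<partial>\<^sub>l\<^esub> t)(\<partial>\<^bsub>i\<^sub>1\<^esub>, \<dots>, \<partial>\<^bsub>i\<^sub>k\<^esub>)\<close> for the connection induced on covariant tensors.\<close>

definition cov_deriv :: "christoffel \<Rightarrow> 7 \<Rightarrow> local_field \<Rightarrow> local_field" where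
  "cov_deriv \<Gamma> l t x is =
     pd l (\<lambda>y. t y is) x - (\<Sum>a<length is. \<Sum>m\<in>UNIV. \<Gamma> x m l (is ! a) * t x (is[a := m]))"

section \<open>Tensor fields, connections and \<open>G\<^sub>2\<close> structures on a manifold\<close>

text \<open>Global objects are families of local ones, indexed by the charts of the atlas and
  related by the usual transformation laws.\<close>

type_synonym 'a field = "'a chart \<Rightarrow> local_field"
type_synonym 'a connection = "'a chart \<Rightarrow> christoffel"

definition differential_form :: "'a chart set \<Rightarrow> nat \<Rightarrow> 'a field \<Rightarrow> bool" where
  "differential_form A k t \<longleftrightarrow>
     (\<forall>c\<in>A. \<forall>is\<in>idx k. smooth_on (chart_image c) (\<lambda>x. t c x is)) \<and>
     (\<forall>c\<in>A. \<forall>x\<in>chart_image c. alternating k (t c x)) \<and>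
     (\<forall>c\<in>A. \<forall>c'\<in>A. \<forall>x\<in>overlap c c'. \<forall>is\<in>idx k.
        t c x is = eval_tensor (t c' (transition c c' x)) (map (jacobian c c' x) is))"

definition linear_connection :: "'a chart set \<Rightarrow> 'a connection \<Rightarrow> bool" where
  "linear_connection A \<Gamma> \<longleftrightarrow>
     (\<forall>c\<in>A. \<forall>k i j. smooth_on (chart_image c) (\<lambda>x. \<Gamma> c x k i j)) \<and>
     (\<forall>c\<in>A. \<forall>c'\<in>A. \<forall>x\<in>overlap c c'. \<forall>k i j.
        (\<Sum>m\<in>UNIV. \<Gamma> c x m i j * jacobian c c' x m $ k) =
        pd i (\<lambda>y. jacobian c c' y j $ k) x +
        (\<Sum>a\<in>UNIV. \<Sum>b\<in>UNIV. jacobian c c' x i $ a * jacobian c c' x j $ b *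
           \<Gamma> c' (transition c c' x) k a b))"

definition g2_structure :: "'a chart set \<Rightarrow> 'a field \<Rightarrow> bool" where
  "g2_structure A \<phi> \<longleftrightarrow>
     differential_form A 3 \<phi> \<and>
     (\<forall>c\<in>A. \<forall>x\<in>chart_image c. \<exists>W E. open W \<and> x \<in> W \<and> W \<subseteq> chart_image c \<and>
        (\<forall>a i. smooth_on W (\<lambda>y. E y $ a $ i)) \<and> (\<forall>y\<in>W. adapted (\<phi> c y) (E y)))"

definition integrable_g2 :: "'a chart set \<Rightarrow> 'a field \<Rightarrow> bool" where
  "integrable_g2 A \<phi> \<longleftrightarrow>
     (\<forall>c\<in>A. \<forall>x\<in>chart_image c. \<forall>is\<in>idx 5.
        ext_d (star_phi (\<phi> c)) x is = wedge 1 (lee_form (\<phi> c) x) (star_phi (\<phi> c) x) is)"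

definition constant_type :: "'a chart set \<Rightarrow> 'a field \<Rightarrow> bool" where
  "constant_type A \<phi> \<longleftrightarrow>
     integrable_g2 A \<phi> \<and>
     (\<exists>r. \<forall>c\<in>A. \<forall>x\<in>chart_image c.
        form_inner (\<phi> c x) 4 (ext_d (\<phi> c) x) (star_phi (\<phi> c) x) = r)"

definition gauduchon_g2 :: "'a chart set \<Rightarrow> 'a field \<Rightarrow> bool" where
  "gauduchon_g2 A \<phi> \<longleftrightarrow>
     (\<forall>c\<in>A. \<forall>x\<in>chart_image c. codiff (\<phi> c) 1 (lee_form (\<phi> c)) x [] = 0)"

definition parallel :: "'a chart set \<Rightarrow> 'a connection \<Rightarrow> nat \<Rightarrow> 'a field \<Rightarrow> bool" where
  "parallel A \<Gamma> k t \<longleftrightarrow>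
     (\<forall>c\<in>A. \<forall>x\<in>chart_image c. \<forall>l. \<forall>is\<in>idx k. cov_deriv (\<Gamma> c) l (t c) x is = 0)"

definition characteristic_connection :: "'a chart set \<Rightarrow> 'a field \<Rightarrow> 'a connection \<Rightarrow> bool" where
  "characteristic_connection A \<phi> \<Gamma> \<longleftrightarrow>
     linear_connection A \<Gamma> \<and>
     parallel A \<Gamma> 2 (\<lambda>c. metric_field (\<phi> c)) \<and>
     parallel A \<Gamma> 3 \<phi> \<and>
     (\<forall>c\<in>A. \<forall>x\<in>chart_image c. alternating 3 (torsion_field (\<phi> c) (\<Gamma> c) x))"

definition orthonormal_frame :: "tensor \<Rightarrow> (7 \<Rightarrow> R7) \<Rightarrow> bool" where
  "orthonormal_frame \<phi> F \<longleftrightarrow> (\<forall>a b. gprod \<phi> (F a) (F b) = (if a = b then 1 else 0))"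

definition g2_instanton :: "'a chart set \<Rightarrow> 'a field \<Rightarrow> 'a connection \<Rightarrow> bool" where
  "g2_instanton A \<phi> \<Gamma> \<longleftrightarrow>
     (\<forall>c\<in>A. \<forall>x\<in>chart_image c. \<forall>F. orthonormal_frame (\<phi> c x) F \<longrightarrow>
        (\<forall>i j k. (\<Sum>a\<in>UNIV. \<Sum>b\<in>UNIV.
           eval_tensor (curvature_field (\<phi> c) (\<Gamma> c) x) [F a, F b, F i, F j] *
           eval_tensor (\<phi> c x) [F a, F b, F k]) = 0))"

end

theory Submission
  imports Defs
begin

text \<open>
If \<open>\<nabla>T = 0\<close>, the first Bianchi identity shows that the cyclic sums of the curvature are totally skew,
hence the curvature is pair symmetric. As the holonomy lies in \<open>\<gg>\<^sub>2\<close>, the curvature is then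
\<open>\<gg>\<^sub>2\<close>-valued in its form indices as well.

Conversely, \<open>T\<close> is determined by the tensor \<open>S\<close> obtained by contracting two of its indices with \<open>\<phi>\<close>,
whose skew part is given by \<open>\<theta>\<close>. For an instanton the second covariant derivatives of a tensor \<open>t\<close>
contract with \<open>\<phi>\<close> to a first-order expression:
\<open>\<phi> p i j \<nabla>\<^sub>i \<nabla>\<^sub>j t = - (1/2) S a p \<nabla>\<^sub>a t\<close>. Together with the Bianchi identity
this yields three global vector fields, built from \<open>S\<close>, \<open>\<theta>\<close> and their first derivatives, whose
divergences are, each under the vanishing of the preceding ones, positive multiples of
\<open>|sym \<nabla>\<theta>|\<^sup>2\<close>, \<open>|\<nabla>\<theta>|\<^sup>2\<close> and \<open>|\<nabla>S|\<^sup>2\<close>. Divergences integrate to zero over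
the compact manifold, so \<open>\<nabla>S = 0\<close> and \<open>\<nabla>T = 0\<close>.
\<close>

section \<open>The model form\<close>

text \<open>An instanton annihilates every curvature term in which the two derivative indices are
  contracted with \<phi>. This is why the three vector fields are curls formed with \<phi>: second
  derivatives enter their divergences only in the combination that the torsion turns back into first
  derivatives, and no curvature is ever estimated. The order of the three fields is forced. The part
  of \<nabla>S that is skew in its first two indices is a linear expression in \<nabla>\<theta>, so
  \<theta> has to be treated before S; and the field that detects the skew part of \<nabla>\<theta>
  has a sign only once the symmetric part is gone. The first curl leaves cubic terms in S, \<theta>
  and their derivatives; multiples of |\<theta>|^2 \<theta> and |S|^2 \<theta>, with coefficients -7
  and 1/4, are added to absorb them. Constant type enters as constancy of the trace of S, the
  Gauduchon condition as vanishing of the trace of \<nabla>\<theta>. All algebra takes place at one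
  point, in a frame in which \<phi> has constant components, so that frames are never
  differentiated.\<close>

lemma UNIV_7: "(UNIV::7 set) = {0,1,2,3,4,5,6}"
proof -
  have "(x::7) \<in> {0,1,2,3,4,5,6}" for x
  proof (induct x)
    case (of_int z)
    then have "z=0 \<or> z=1 \<or> z=2\<or> z=3\<or> z=4\<or> z=5\<or> z=6" by simp arith
    then show ?case by auto
  qed
  then show ?thesis by auto
qed

lemma forall_7: "(\<forall>i::7. P i) \<longleftrightarrow> P 0 \<and> P 1 \<and> P 2 \<and> P 3 \<and> P 4 \<and> P 5 \<and> P 6"
proof -
  have "(\<forall>i::7. P i) \<longleftrightarrow> (\<forall>i\<in>UNIV. P i)" by simp
  then show ?thesis unfolding UNIV_7 by simp
qed

lemma sum_7: "(\<Sum>i\<in>(UNIV::7 set). f i) = f 0 + f 1 + f 2 + f 3 + f 4 + f 5 + (f 6 :: 'a::comm_monoid_add)"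
  unfolding UNIV_7 by (simp add: ac_simps)

lemma neq7 [simp]:
  "(0::7) \<noteq> 1" "(0::7) \<noteq> 2" "(0::7) \<noteq> 3" "(0::7) \<noteq> 4" "(0::7) \<noteq> 5" "(0::7) \<noteq> 6" "(1::7) \<noteq> 0" "(1::7) \<noteq> 2" "(1::7) \<noteq> 3" "(1::7) \<noteq> 4" "(1::7) \<noteq> 5" "(1::7) \<noteq> 6" "(2::7) \<noteq> 0" "(2::7) \<noteq> 1" "(2::7) \<noteq> 3" "(2::7) \<noteq> 4" "(2::7) \<noteq> 5" "(2::7) \<noteq> 6" "(3::7) \<noteq> 0" "(3::7) \<noteq> 1" "(3::7) \<noteq> 2" "(3::7) \<noteq> 4" "(3::7) \<noteq> 5" "(3::7) \<noteq> 6" "(4::7) \<noteq> 0" "(4::7) \<noteq> 1" "(4::7) \<noteq> 2" "(4::7) \<noteq> 3" "(4::7) \<noteq> 5" "(4::7) \<noteq> 6" "(5::7) \<noteq> 0" "(5::7) \<noteq> 1" "(5::7) \<noteq> 2" "(5::7) \<noteq> 3" "(5::7) \<noteq> 4" "(5::7) \<noteq> 6" "(6::7) \<noteq> 0" "(6::7) \<noteq> 1" "(6::7) \<noteq> 2" "(6::7) \<noteq> 3" "(6::7) \<noteq> 4" "(6::7) \<noteq> 5"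
  by simp_all

text \<open>An auxiliary linear order on the indices. Skew arrays then have to be compared only on
  increasing index lists.\<close>

definition idx7 :: "7 \<Rightarrow> nat" where
  "idx7 i = (if i = 0 then 0 else if i = 1 then 1 else if i = 2 then 2 else if i = 3 then 3
     else if i = 4 then 4 else if i = 5 then 5 else 6)"

text \<open>Since \<open>7 = 0\<close> in the type \<open>7\<close>, the coframe index 7 of the model form appears as 0.\<close>

definition cross_tab :: "7 \<Rightarrow> 7 \<Rightarrow> 7 \<times> real" where
  "cross_tab i j =
   [[(0, 0), (2, 1), (1, -1), (4, 1), (3, -1), (6, 1), (5, -1)],
    [(2, -1), (0, 0), (0, 1), (5, 1), (6, -1), (3, -1), (4, 1)],
    [(1, 1), (0, -1), (0, 0), (6, -1), (5, -1), (4, 1), (3, 1)],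
    [(4, -1), (5, -1), (6, 1), (0, 0), (0, 1), (1, 1), (2, -1)],
    [(3, 1), (6, 1), (5, 1), (0, -1), (0, 0), (2, -1), (1, -1)],
    [(6, -1), (3, 1), (4, -1), (1, -1), (2, 1), (0, 0), (0, 1)],
    [(5, 1), (4, -1), (3, -1), (2, 1), (1, 1), (0, -1), (0, 0)]] ! idx7 i ! idx7 j"

lemma cross_tab:
    "cross_tab 0 0 = (0, 0)" "cross_tab 0 1 = (2, 1)" "cross_tab 0 2 = (1, -1)" "cross_tab 0 3 = (4, 1)" "cross_tab 0 4 = (3, -1)" "cross_tab 0 5 = (6, 1)" "cross_tab 0 6 = (5, -1)"
    "cross_tab 1 0 = (2, -1)" "cross_tab 1 1 = (0, 0)" "cross_tab 1 2 = (0, 1)" "cross_tab 1 3 = (5, 1)" "cross_tab 1 4 = (6, -1)" "cross_tab 1 5 = (3, -1)" "cross_tab 1 6 = (4, 1)"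
    "cross_tab 2 0 = (1, 1)" "cross_tab 2 1 = (0, -1)" "cross_tab 2 2 = (0, 0)" "cross_tab 2 3 = (6, -1)" "cross_tab 2 4 = (5, -1)" "cross_tab 2 5 = (4, 1)" "cross_tab 2 6 = (3, 1)"
    "cross_tab 3 0 = (4, -1)" "cross_tab 3 1 = (5, -1)" "cross_tab 3 2 = (6, 1)" "cross_tab 3 3 = (0, 0)" "cross_tab 3 4 = (0, 1)" "cross_tab 3 5 = (1, 1)" "cross_tab 3 6 = (2, -1)"
    "cross_tab 4 0 = (3, 1)" "cross_tab 4 1 = (6, 1)" "cross_tab 4 2 = (5, 1)" "cross_tab 4 3 = (0, -1)" "cross_tab 4 4 = (0, 0)" "cross_tab 4 5 = (2, -1)" "cross_tab 4 6 = (1, -1)"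
    "cross_tab 5 0 = (6, -1)" "cross_tab 5 1 = (3, 1)" "cross_tab 5 2 = (4, -1)" "cross_tab 5 3 = (1, -1)" "cross_tab 5 4 = (2, 1)" "cross_tab 5 5 = (0, 0)" "cross_tab 5 6 = (0, 1)"
    "cross_tab 6 0 = (5, 1)" "cross_tab 6 1 = (4, -1)" "cross_tab 6 2 = (3, -1)" "cross_tab 6 3 = (2, 1)" "cross_tab 6 4 = (1, 1)" "cross_tab 6 5 = (0, -1)" "cross_tab 6 6 = (0, 0)"
  by (simp_all add: cross_tab_def idx7_def)

definition ph :: "7 \<Rightarrow> 7 \<Rightarrow> 7 \<Rightarrow> real" where
  "ph i j k = (if k = fst (cross_tab i j) then snd (cross_tab i j) else 0)"
lemma ph_skew12: "ph j i k = - ph i j k"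
proof -
  have "\<forall>i j k. ph j i k = - ph i j k"
    unfolding forall_7 by (simp add: ph_def cross_tab)
  then show ?thesis by blast
qed
lemma ph_cyc: "ph j k i = ph i j k"
proof -
  have "\<forall>i j k. ph j k i = ph i j k"
    unfolding forall_7 by (simp add: ph_def cross_tab)
  then show ?thesis by blast
qed
definition dl :: "7 \<Rightarrow> 7 \<Rightarrow> real" where "dl i j = (if i = j then 1 else 0)"

text \<open>The dual 4-form, encoded through the identity that contracts \<phi> once with itself
  instead of through its monomials. \<open>ph_eps\<close> shows that it is the Hodge dual of
  \<phi>.\<close>

definition ps :: "7 \<Rightarrow> 7 \<Rightarrow> 7 \<Rightarrow> 7 \<Rightarrow> real" where
  "ps i j k l = (\<Sum>a\<in>UNIV. ph i j a * ph k l a) - dl i k * dl j l + dl i l * dl j k"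

text \<open>For each pair of indices at most one third index gives a nonzero entry of
  \<open>ph\<close>, so a contraction over the third index has a single term. The component checks
  below stay small for this reason.\<close>

lemma sum_ph: "(\<Sum>a\<in>UNIV. ph i j a * f a) = snd (cross_tab i j) * f (fst (cross_tab i j))"
  by (simp add: ph_def if_distrib if_distribR cong: if_cong)

text \<open>The one swap that the definition does not make evident; skewness in the first and in the
  last pair comes directly from \<open>ph\<close>.\<close>

lemma ps_skew23: "ps i k j l = - ps i j k l"
proof -
  have "\<forall>i j k l. ps i k j l = - ps i j k l"
    unfolding forall_7 ps_def sum_ph by (simp add: ph_def cross_tab dl_def)
  then show ?thesis by blast
qed

lemma ph_skew23: "ph i k j = - ph i j k"
  by (metis ph_cyc ph_skew12)

lemma ps_skew12: "ps j i k l = - ps i j k l"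
  by (simp add: ps_def ph_skew12[of j i] sum_negf)

lemma ps_skew34: "ps i j l k = - ps i j k l"
  by (simp add: ps_def ph_skew12[of l k] sum_negf)

lemma idx7: "idx7 0 = 0" "idx7 1 = 1" "idx7 2 = 2" "idx7 3 = 3" "idx7 4 = 4" "idx7 5 = 5" "idx7 6 = 6"
  by (simp_all add: idx7_def)

lemma idx7_cases: "idx7 i < idx7 j \<or> i = j \<or> idx7 j < idx7 i"
proof -
  have "\<forall>i j. idx7 i < idx7 j \<or> i = j \<or> idx7 j < idx7 i"
    unfolding forall_7 by (simp add: idx7)
  then show ?thesis by blast
qed

definition after :: "7 \<Rightarrow> 7 set" where "after i = {j. idx7 i < idx7 j}"

lemma after: "after 0 = {1,2,3,4,5,6}" "after 1 = {2,3,4,5,6}" "after 2 = {3,4,5,6}"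
    "after 3 = {4,5,6}" "after 4 = {5,6}" "after 5 = {6}" "after 6 = {}"
  unfolding after_def set_eq_iff forall_7 by (simp_all add: idx7)

lemma skew2_eqI:
  fixes F G :: "7 \<Rightarrow> 7 \<Rightarrow> real"
  assumes F: "\<And>i j. F j i = - F i j" and G: "\<And>i j. G j i = - G i j"
    and E: "\<forall>i. \<forall>j\<in>after i. F i j = G i j"
  shows "F i j = G i j"
proof -
  have "F i j = G i j" if "idx7 i < idx7 j" for i j using E that by (auto simp: after_def)
  then show ?thesis
    using idx7_cases[of i j] F[of i j] G[of i j] F[of i i] G[of i i] by auto
qed

text \<open>Reduces 343 component equations to the 35 with increasing indices. The argument sorts
  the difference of the two arrays, which is skew as well.\<close>

lemma skew3_eqI:
  fixes F G :: "7 \<Rightarrow> 7 \<Rightarrow> 7 \<Rightarrow> real"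
  assumes F1: "\<And>i j k. F j i k = - F i j k" and F2: "\<And>i j k. F i k j = - F i j k"
    and G1: "\<And>i j k. G j i k = - G i j k" and G2: "\<And>i j k. G i k j = - G i j k"
    and E: "\<forall>i. \<forall>j\<in>after i. \<forall>k\<in>after j. F i j k = G i j k"
  shows "F i j k = G i j k"
proof -
  let ?D = "\<lambda>i j k. F i j k - G i j k"
  have s: "?D j i k = - ?D i j k" "?D i k j = - ?D i j k" for i j k
    using F1[of j i k] F2[of i k j] G1[of j i k] G2[of i k j] by simp_all
  have 0: "?D i j k = 0" if "idx7 i < idx7 j" "idx7 j < idx7 k" for i j k
    using E that by (auto simp: after_def)
  have 1: "?D i j k = 0" if "i = j \<or> j = k" for i j k
    using that s(1)[of i i k] s(2)[of i j j] by auto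
  have 2: "?D i j k = 0" if "idx7 i < idx7 k" for i j k
  proof -
    consider "idx7 i < idx7 j" "idx7 j < idx7 k" | "i = j" | "j = k" | "idx7 j < idx7 i" | "idx7 k < idx7 j"
      using idx7_cases[of i j] idx7_cases[of j k] by blast
    then show ?thesis
      by cases (use that 0[of i j k] 0[of j i k] 0[of i k j] 1[of i j k] s(1)[of i j k] s(2)[of i j k] in auto)
  qed
  have "?D i j k = 0"
  proof -
    consider "idx7 i < idx7 k" | "i = k" | "idx7 k < idx7 i" using idx7_cases[of i k] by blast
    then show ?thesis
    proof cases
      case 1 then show ?thesis by (rule 2)
    next
      case c: 2
      then show ?thesis using s(1)[of i j i] 1[of j i i] by auto
    next
      case 3
      then show ?thesis using 2[where i=k and j=j and k=i] s(1)[where i=i and j=j and k=k] s(2)[where i=j and j=i and k=k] s(1)[where i=j and j=k and k=i] by simp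
    qed
  qed
  then show ?thesis by simp
qed

text \<open>Both sides are skew in m, n and in i, j, k, so the table is consulted only for
  increasing pairs and increasing triples.\<close>

lemma ps_ph:
  "(\<Sum>r\<in>UNIV. ph r m n * ps r i j k) =
     dl i m * ph n j k - dl i n * ph m j k + dl j m * ph n k i - dl j n * ph m k i
     + dl k m * ph n i j - dl k n * ph m i j"
proof -
  have *: "\<forall>m. \<forall>n\<in>after m. \<forall>i. \<forall>j\<in>after i. \<forall>k\<in>after j.
      snd (cross_tab m n) * ps (fst (cross_tab m n)) i j k =
      dl i m * ph n j k - dl i n * ph m j k + dl j m * ph n k i - dl j n * ph m k i
     + dl k m * ph n i j - dl k n * ph m i j"
    unfolding forall_7 after ball_simps ps_def sum_ph by (simp add: ph_def cross_tab dl_def)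
  have a: "(\<Sum>r\<in>UNIV. ph r m n * f r) = (\<Sum>r\<in>UNIV. ph m n r * f r)" for m n f
    by (simp add: ph_cyc)
  let ?L = "\<lambda>m n i j k. \<Sum>r\<in>UNIV. ph r m n * ps r i j k"
  let ?R = "\<lambda>m n i j k. dl i m * ph n j k - dl i n * ph m j k + dl j m * ph n k i - dl j n * ph m k i
     + dl k m * ph n i j - dl k n * ph m i j"
  have 1: "?L m n i j k = ?R m n i j k" if "n \<in> after m" for m n
  proof (rule skew3_eqI[where F = "?L m n" and G = "?R m n"])
    show "\<forall>i. \<forall>j\<in>after i. \<forall>k\<in>after j. ?L m n i j k = ?R m n i j k"
      using * that unfolding a sum_ph by blast
    fix i j k
    have p: "ph x i k = - ph x k i" "ph x k j = - ph x j k" "ph x j i = - ph x i j" for x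
      by (rule ph_skew23)+
    have q: "ps r j i k = - ps r i j k" "ps r i k j = - ps r i j k" for r
      by (rule ps_skew23, rule ps_skew34)
    show "?L m n j i k = - ?L m n i j k" "?L m n i k j = - ?L m n i j k"
      by (simp_all add: q sum_negf)
    show "?R m n j i k = - ?R m n i j k" "?R m n i k j = - ?R m n i j k"
      by (simp_all add: p)
  qed
  show ?thesis
  proof (rule skew2_eqI[where F = "\<lambda>m n. ?L m n i j k" and G = "\<lambda>m n. ?R m n i j k"])
    show "\<forall>m. \<forall>n\<in>after m. ?L m n i j k = ?R m n i j k" using 1 by blast
    fix m n
    have p: "ph r n m = - ph r m n" for r by (rule ph_skew23)
    show "?L n m i j k = - ?L m n i j k" by (simp add: p sum_negf)
    show "?R n m i j k = - ?R m n i j k" by simp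
  qed
qed

abbreviation sum7 :: "(7 \<Rightarrow> 'b::comm_monoid_add) \<Rightarrow> 'b" (binder "\<Sum>\<^sub>7" 10) where
  "sum7 f \<equiv> sum f UNIV"

lemma sum_dl [simp]:
  "(\<Sum>\<^sub>7i. dl i k * f i) = f k" "(\<Sum>\<^sub>7i. dl k i * f i) = f k"
  "(\<Sum>\<^sub>7i. f i * dl i k) = f k" "(\<Sum>\<^sub>7i. f i * dl k i) = f k"
  by (simp_all add: dl_def if_distrib if_distribR cong: if_cong)

lemma ph_ph: "(\<Sum>\<^sub>7q. ph k l q * ph i j q) = dl k i * dl l j - dl k j * dl l i + ps k l i j"
  by (simp add: ps_def)

lemma ph_ph6: "(\<Sum>\<^sub>7i. \<Sum>\<^sub>7j. ph k i j * ph l i j) = 6 * dl k l"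
proof -
  have "\<forall>k l. (\<Sum>\<^sub>7i. \<Sum>\<^sub>7j. ph k i j * ph l i j) = 6 * dl k l"
    unfolding sum_ph unfolding forall_7 sum_7 by (simp add: ph_def cross_tab dl_def)
  then show ?thesis by blast
qed

section \<open>Contractions with \<phi>: the tensor S and the form \<theta>\<close>

definition cph :: "(7 \<Rightarrow> 7 \<Rightarrow> real) \<Rightarrow> 7 \<Rightarrow> real" where
  "cph A p = (\<Sum>\<^sub>7i. \<Sum>\<^sub>7j. ph p i j * A i j)"

text \<open>Applied to the torsion this is the tensor S of the overview. On 3-forms the map is
  injective, by \<open>T_of_S\<close>.\<close>

definition Sof :: "(7 \<Rightarrow> 7 \<Rightarrow> 7 \<Rightarrow> real) \<Rightarrow> 7 \<Rightarrow> 7 \<Rightarrow> real" where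
  "Sof T l p = cph (T l) p"

text \<open>The factor is chosen so that \<open>thof (Sof T)\<close> is the Lee form when
  \<open>T\<close> is the characteristic torsion; see \<open>lee_frame\<close>.\<close>

definition thof :: "(7 \<Rightarrow> 7 \<Rightarrow> real) \<Rightarrow> 7 \<Rightarrow> real" where
  "thof S q = - cph S q / 6"

lemma sum7_ph: "(\<Sum>\<^sub>7i. \<Sum>\<^sub>7j. ph p i j * A i j) = (\<Sum>\<^sub>7i. snd (cross_tab p i) * A i (fst (cross_tab p i)))"
  by (simp add: sum_ph)

lemma skew_normal:
  fixes T :: "7 \<Rightarrow> 7 \<Rightarrow> 7 \<Rightarrow> real"
  assumes "\<And>i j k. T j i k = - T i j k" "\<And>i j k. T i k j = - T i j k"
  shows "idx7 j < idx7 i \<Longrightarrow> T i j k = - T j i k" "idx7 k < idx7 j \<Longrightarrow> T i j k = - T i k j"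
    "T i i k = 0" "T i k k = 0" "T i k i = 0"
  using assms(1)[of i j k] assms(2)[of i j k] assms(1)[of i i k] assms(2)[of i k k]
    assms(1)[of k i i] assms(2)[of k i i]  by auto

text \<open>The 3-forms contain no G_2 summand isomorphic to g_2, so the skew part of S can only be
  \<phi> contracted with a vector. The components show that the vector is a multiple of
  \<theta>.\<close>

lemma Sof_skew:
  assumes T: "\<And>i j k. T j i k = - T i j k" "\<And>i j k. T i k j = - T i j k"
  shows "Sof T l p - Sof T p l = - 2 * (\<Sum>\<^sub>7q. ph l p q * thof (Sof T) q)"
proof -
  have "\<forall>l p. Sof T l p - Sof T p l = - 2 * (\<Sum>\<^sub>7q. ph l p q * thof (Sof T) q)"
    unfolding sum_ph Sof_def thof_def cph_def sum7_ph forall_7 sum_7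
    by (simp add: cross_tab idx7 skew_normal[of T, OF T])
  then show ?thesis by blast
qed

text \<open>Under G_2 the 3-forms split as 1 + 7 + 27, and S retains all three pieces: its trace,
  its skew part and its trace-free symmetric part. The coefficients invert the map on each piece.
  For T = \<phi>, for instance, S is 6 times the identity and 4 = 18 - 42/3.\<close>

lemma T_of_S:
  assumes T: "\<And>i j k. T j i k = - T i j k" "\<And>i j k. T i k j = - T i j k"
  shows "4 * T j k l = (\<Sum>\<^sub>7a. Sof T j a * ph a k l + Sof T k a * ph a l j + Sof T l a * ph a j k)
     - (\<Sum>\<^sub>7a. Sof T a a) / 3 * ph j k l + 2 * (\<Sum>\<^sub>7q. thof (Sof T) q * ps q j k l)"
proof -
  let ?L = "\<lambda>j k l. 4 * T j k l"
  let ?R = "\<lambda>j k l. (\<Sum>\<^sub>7a. Sof T j a * ph a k l + Sof T k a * ph a l j + Sof T l a * ph a j k)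
     - (\<Sum>\<^sub>7a. Sof T a a) / 3 * ph j k l + 2 * (\<Sum>\<^sub>7q. thof (Sof T) q * ps q j k l)"
  show ?thesis
  proof (rule skew3_eqI[where F = ?L and G = ?R])
    have 1: "\<forall>j. \<forall>k\<in>after j. \<forall>l\<in>after k. 4 * T j k l =
        (\<Sum>\<^sub>7a. ph k l a * Sof T a j) + (\<Sum>\<^sub>7a. ph l j a * Sof T k a) + (\<Sum>\<^sub>7a. ph j k a * Sof T l a)
        - (\<Sum>\<^sub>7a. Sof T a a) / 3 * ph j k l"
      unfolding sum_ph Sof_def cph_def sum7_ph forall_7 after ball_simps sum_7
      by (simp add: ph_def cross_tab idx7 skew_normal[of T, OF T] add_divide_distrib diff_divide_distrib)
    \<comment> \<open>The term with \<open>ps\<close> is a contraction of the skew part of S. It is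
      rewritten this way so that the component check \<open>1\<close> involves \<open>ph\<close>
      only.\<close>
    have 2: "(\<Sum>\<^sub>7q. thof (Sof T) q * ps q j k l) = (\<Sum>\<^sub>7a. ph k l a * (Sof T a j - Sof T j a)) / 2"
      if "j \<noteq> k" "j \<noteq> l" for j k l
    proof -
      have "(\<Sum>\<^sub>7q. thof (Sof T) q * ps q j k l) = (\<Sum>\<^sub>7q. \<Sum>\<^sub>7a. thof (Sof T) q * (ph q j a * ph k l a))"
        using that by (simp add: ps_def dl_def sum_distrib_left)
      also have "\<dots> = (\<Sum>\<^sub>7a. \<Sum>\<^sub>7q. thof (Sof T) q * (ph q j a * ph k l a))" by (rule sum.swap)
      also have "\<dots> = (\<Sum>\<^sub>7a. ph k l a * (\<Sum>\<^sub>7q. ph j a q * thof (Sof T) q))"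
        by (simp add: sum_distrib_left ph_cyc[of j _ _] ac_simps)
      also have "\<dots> = (\<Sum>\<^sub>7a. ph k l a * ((Sof T j a - Sof T a j) / - 2))"
        by (intro sum.cong refl arg_cong2[where f = "(*)"]) (simp add: Sof_skew[of T, OF T])
      finally show ?thesis by (simp add: sum_divide_distrib) (rule sum.cong, simp_all add: field_simps)
    qed
    show "\<forall>i. \<forall>j\<in>after i. \<forall>k\<in>after j. ?L i j k = ?R i j k"
    proof (intro allI ballI)
      fix i j k assume ijk: "j \<in> after i" "k \<in> after j"
      then have ne: "i \<noteq> j" "i \<noteq> k" by (auto simp: after_def)
      have c: "(\<Sum>\<^sub>7a. f a * ph a j k) = (\<Sum>\<^sub>7a. ph j k a * f a)" for f j k
        by (intro sum.cong refl) (metis ph_cyc mult.commute)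
      have h1: "4 * T i j k = (\<Sum>\<^sub>7a. ph j k a * Sof T a i) + (\<Sum>\<^sub>7a. ph k i a * Sof T j a)
          + (\<Sum>\<^sub>7a. ph i j a * Sof T k a) - (\<Sum>\<^sub>7a. Sof T a a) / 3 * ph i j k"
        using 1 ijk by blast
      show "?L i j k = ?R i j k"
        unfolding h1 2[OF ne] sum.distrib c
        by (simp add: sum_subtractf right_diff_distrib diff_divide_distrib)
    qed
  next
    fix i j k
    show "?L j i k = - ?L i j k" "?L i k j = - ?L i j k"
      using T(1)[of j i k] T(2)[of i j k] by simp_all
    have p: "ph x i k = - ph x k i" "ph x k j = - ph x j k" "ph x j i = - ph x i j" for x
      by (rule ph_skew23)+
    have q: "ps r j i k = - ps r i j k" "ps r i k j = - ps r i j k" for r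
      by (rule ps_skew23, rule ps_skew34)
    have r: "ph j k i = ph i j k" by (rule ph_cyc)
    show "?R j i k = - ?R i j k" "?R i k j = - ?R i j k"
      by (simp_all add: p q r sum.distrib sum_negf sum_subtractf)
  qed
qed

lemma sum_rot3: "(\<Sum>\<^sub>7a b c. f a b c) = (\<Sum>\<^sub>7b c a. f a b c :: 'b::comm_monoid_add)"
proof -
  have "(\<Sum>\<^sub>7a b c. f a b c) = (\<Sum>\<^sub>7b a c. f a b c)" by (rule sum.swap)
  also have "\<dots> = (\<Sum>\<^sub>7b c a. f a b c)" by (intro sum.cong refl sum.swap)
  finally show ?thesis .
qed

lemma sum_swap22: "(\<Sum>\<^sub>7a b c d. f a b c d) = (\<Sum>\<^sub>7c d a b. f a b c d :: 'b::comm_monoid_add)"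
proof -
  have "(\<Sum>\<^sub>7a b c d. f a b c d) = (\<Sum>\<^sub>7a c d b. f a b c d)"
    by (intro sum.cong refl sum_rot3)
  also have "\<dots> = (\<Sum>\<^sub>7c d a b. f a b c d)" by (rule sum_rot3)
  finally show ?thesis .
qed

lemma ph_rot: "ph i j k = ph j k i"
  by (rule ph_cyc[symmetric])

lemma ph_ph': "(\<Sum>\<^sub>7q. ph k l q * ph q i j) = dl k i * dl l j - dl k j * dl l i + ps k l i j"
  using ph_ph[of k l i j] by (simp add: ph_rot[of _ i j])

lemma dl_sym: "dl i j = dl j i" by (simp add: dl_def)

lemma ps_pair: "ps k l i j = ps i j k l"
  unfolding ps_def by (simp add: mult.commute dl_sym[of k] dl_sym[of l])

lemma ps_cyc3: "ps i j k l = ps j k i l"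
  using ps_skew12[of i j k l] ps_skew23[of j k i l] by simp

lemma ps_rot: "ps i j k l = - ps j k l i"
  using ps_cyc3[of i j k l] ps_skew34[of j k l i] by simp

lemma cph_swap: "cph (\<lambda>k l. cph (\<lambda>i j. F i j k l) p) q = cph (\<lambda>i j. cph (\<lambda>k l. F i j k l) q) p"
proof -
  have "cph (\<lambda>k l. cph (\<lambda>i j. F i j k l) p) q = (\<Sum>\<^sub>7k l i j. ph q k l * (ph p i j * F i j k l))"
    by (simp add: cph_def sum_distrib_left)
  also have "\<dots> = (\<Sum>\<^sub>7i j k l. ph q k l * (ph p i j * F i j k l))" by (rule sum_swap22)
  also have "\<dots> = cph (\<lambda>i j. cph (\<lambda>k l. F i j k l) q) p"
    by (simp add: cph_def sum_distrib_left ac_simps)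
  finally show ?thesis .
qed

lemma cph_transpose: "cph (\<lambda>i j. A j i) p = - cph A p"
proof -
  have "cph (\<lambda>i j. A j i) p = (\<Sum>\<^sub>7j i. ph p i j * A j i)" unfolding cph_def by (rule sum.swap)
  also have "\<dots> = - cph A p"
  proof -
    have "ph p i j * A j i = - (ph p j i * A j i)" for i j using ph_skew23[of p i j] by simp
    then show ?thesis by (simp add: cph_def sum_negf)
  qed
  finally show ?thesis .
qed

lemma cph_linear:
  "cph (\<lambda>i j. A i j + B i j) p = cph A p + cph B p"
  "cph (\<lambda>i j. A i j - B i j) p = cph A p - cph B p"
  "cph (\<lambda>i j. c * A i j) p = c * cph A p"
  "cph (\<lambda>i j. - A i j) p = - cph A p"
  "cph (\<lambda>i j. 0) p = 0"
  by (simp_all add: cph_def sum.distrib sum_subtractf sum_distrib_left algebra_simps sum_negf)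

text \<open>The product of two copies of \<phi>, read as an operator on 2-tensors. Its rearrangement
  \<open>psc\<close> trades a contraction with \<open>ps\<close> for two contractions with
  \<open>ph\<close>, and is the usual way to remove \<open>ps\<close> below.\<close>

lemma contr1: "(\<Sum>\<^sub>7q. ph k l q * cph A q) = A k l - A l k + (\<Sum>\<^sub>7i j. ps k l i j * A i j)"
proof -
  have "(\<Sum>\<^sub>7q. ph k l q * cph A q) = (\<Sum>\<^sub>7q i j. ph k l q * ph q i j * A i j)"
    by (simp add: cph_def sum_distrib_left mult.assoc)
  also have "\<dots> = (\<Sum>\<^sub>7i j q. ph k l q * ph q i j * A i j)" by (rule sum_rot3)
  also have "\<dots> = (\<Sum>\<^sub>7i j. (dl k i * dl l j - dl k j * dl l i + ps k l i j) * A i j)"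
    by (simp add: ph_ph' flip: sum_distrib_right)
  also have "\<dots> = (\<Sum>\<^sub>7i. dl k i * (\<Sum>\<^sub>7j. dl l j * A i j)) - (\<Sum>\<^sub>7i. dl l i * (\<Sum>\<^sub>7j. dl k j * A i j))
      + (\<Sum>\<^sub>7i j. ps k l i j * A i j)"
    by (simp add: sum.distrib sum_subtractf sum_distrib_left algebra_simps del: sum_dl)
  finally show ?thesis by simp
qed

lemma psc: "(\<Sum>\<^sub>7i j. ps k l i j * A i j) = (\<Sum>\<^sub>7q. ph k l q * cph A q) - A k l + A l k"
  using contr1[of k l A] by simp

lemma ps_ph4: "(\<Sum>\<^sub>7k l. ps i j k l * ph m k l) = 4 * ph m i j"
proof -
  have 1: "cph (ph m) q = 6 * dl q m" for q using ph_ph6[of q m] by (simp add: cph_def)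
  have "(\<Sum>\<^sub>7k l. ps i j k l * ph m k l) = (\<Sum>\<^sub>7q. ph i j q * cph (ph m) q) - ph m i j + ph m j i"
    by (rule psc)
  also have "(\<Sum>\<^sub>7q. ph i j q * cph (ph m) q) = 6 * (\<Sum>\<^sub>7q. ph i j q * dl q m)"
    by (simp add: 1 sum_distrib_left mult.left_commute del: sum_dl)
  also have "\<dots> = 6 * ph m i j" by (simp add: ph_rot[of m i j])
  finally show ?thesis using ph_skew23[of m j i] by simp
qed

section \<open>Pointwise identities for the torsion\<close>

text \<open>The first jet of the torsion at one point, as arrays in an adapted frame, with
  \<open>D\<close> in the role of \<nabla>T. \<open>star\<close> is what the Bianchi identity gives
  for an instanton, and \<open>trace\<close> expresses constant type. The assumptions are split
  between this locale and \<open>g2_jet\<close> because the divergence of S, proved here, is needed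
  to establish the further ones.\<close>

locale g2_jet0 =
  fixes T :: "7 \<Rightarrow> 7 \<Rightarrow> 7 \<Rightarrow> real" and D :: "7 \<Rightarrow> 7 \<Rightarrow> 7 \<Rightarrow> 7 \<Rightarrow> real"
  assumes T_skew: "\<And>i j k. T j i k = - T i j k" "\<And>i j k. T i k j = - T i j k"
    and D_skew: "\<And>i j k l. D i k j l = - D i j k l" "\<And>i j k l. D i j l k = - D i j k l"
    and star: "\<And>k l p. 2 * cph (\<lambda>i j. D i j k l) p = Sof (D k) l p - Sof (D l) k p"
    and trace: "\<And>i. (\<Sum>\<^sub>7p. Sof (D i) p p) = 0"
begin

definition "S = Sof T"
definition "\<theta> = thof S"
definition "DS i = Sof (D i)"
definition "M i = thof (DS i)"
text \<open>The curl of S in its first index; \<open>C'\<close> is the curl in the second index.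
  They differ because S is not symmetric.\<close>

definition "C p q = cph (\<lambda>i j. DS i j q) p"
definition "C' q k = cph (\<lambda>l p. DS l k p) q"

lemma D_cyc: "D i j k l = D i k l j"
  using D_skew(1)[of i k j l] D_skew(2)[of i k l j] by simp

lemma S_skew: "S l p = S p l - 2 * (\<Sum>\<^sub>7q. ph l p q * \<theta> q)"
  using Sof_skew[of T l p, OF T_skew] by (simp add: S_def \<theta>_def)

lemma DS_skew: "DS i l p = DS i p l - 2 * (\<Sum>\<^sub>7q. ph l p q * M i q)"
  using Sof_skew[of "D i" l p, OF D_skew] by (simp add: DS_def M_def)

lemma DS_trace: "(\<Sum>\<^sub>7p. DS i p p) = 0" using trace by (simp add: DS_def)

lemma cph_DS: "cph (DS i) q = - 6 * M i q" by (simp add: M_def thof_def)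

lemma cph_D: "cph (D i j) q = DS i j q" by (simp add: DS_def Sof_def)

lemma star': "2 * cph (\<lambda>i j. D i j k l) p = DS k l p - DS l k p"
  using star by (simp add: DS_def)

text \<open>Setting l = p in \<open>star\<close> and summing makes the divergence of S appear on
  both sides, with the factors 2 and 1. The remaining term is the derivative of the trace.\<close>

lemma DS_div2: "(\<Sum>\<^sub>7i. DS i k i) = 0"
proof -
  have "(\<Sum>\<^sub>7p. cph (\<lambda>i j. D i j k p) p) = (\<Sum>\<^sub>7p i j. ph p i j * D i j k p)"
    by (simp add: cph_def)
  also have "\<dots> = (\<Sum>\<^sub>7i j p. ph p i j * D i j k p)" by (rule sum_rot3)
  also have "\<dots> = (\<Sum>\<^sub>7i j p. - (ph i j p * D i k j p))"
  proof (intro sum.cong refl)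
    fix i j p show "ph p i j * D i j k p = - (ph i j p * D i k j p)"
      using D_skew(1)[of i k j p] ph_rot[of p i j] by simp
  qed
  also have "\<dots> = - (\<Sum>\<^sub>7i. DS i k i)" by (simp add: DS_def Sof_def cph_def sum_negf)
  finally have 1: "(\<Sum>\<^sub>7p. cph (\<lambda>i j. D i j k p) p) = - (\<Sum>\<^sub>7i. DS i k i)" .
  have "(\<Sum>\<^sub>7p. 2 * cph (\<lambda>i j. D i j k p) p) = (\<Sum>\<^sub>7p. DS k p p) - (\<Sum>\<^sub>7p. DS p k p)"
    by (simp add: star' sum_subtractf)
  then show ?thesis using 1 DS_trace[of k] by (simp flip: sum_distrib_left)
qed

end

text \<open>\<open>div_th\<close> is the Gauduchon condition, and \<open>dS_th\<close> is the
  derivative of the relation S\<theta> = 0, which holds for instantons by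
  \<open>S_th\<close>.\<close>

locale g2_jet = g2_jet0 +
  assumes div_th: "(\<Sum>\<^sub>7i. thof (Sof (D i)) i) = 0"
    and dS_th: "\<And>i l. (\<Sum>\<^sub>7q. Sof (D i) l q * thof (Sof T) q + Sof T l q * thof (Sof (D i)) q) = 0"
begin

lemma M_trace: "(\<Sum>\<^sub>7i. M i i) = 0" using div_th by (simp add: DS_def M_def)

text \<open>A contraction of \<open>star\<close> with \<phi> in k and l. The two contractions on the
  left commute, which produces the curl with its indices exchanged relative to the right.\<close>

lemma C_sym: "C p q = C q p"
proof -
  have "cph (\<lambda>k l. 2 * cph (\<lambda>i j. D i j k l) p) q = 2 * cph (\<lambda>i j. cph (D i j) q) p"
    by (simp add: cph_linear cph_swap[of "\<lambda>i j k l. D i j k l"])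
  also have "\<dots> = 2 * C p q" by (simp add: C_def cph_D)
  finally have 1: "cph (\<lambda>k l. 2 * cph (\<lambda>i j. D i j k l) p) q = 2 * C p q" .
  have "cph (\<lambda>k l. 2 * cph (\<lambda>i j. D i j k l) p) q = cph (\<lambda>k l. DS k l p) q - cph (\<lambda>k l. DS l k p) q"
    unfolding star' by (rule cph_linear)
  also have "\<dots> = 2 * C q p" using cph_transpose[of "\<lambda>k l. DS k l p" q] by (simp add: C_def)
  finally show ?thesis using 1 by simp
qed

text \<open>\<phi> contracted with the symmetric \<open>C\<close> is zero. Expanding the product of
  the two copies of \<phi> leaves the divergence and the trace of \<nabla>S, which vanish, and a
  term with \<open>ps\<close> that equals four times the curl of \<theta>.\<close>

lemma curl_M: "cph M r = 0"
proof -
  have "(\<Sum>\<^sub>7q p. ph r p q * C p q) = 0"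
  proof -
    have "cph C r = cph (\<lambda>i j. C j i) r" by (simp add: C_sym[symmetric] cong: if_cong)
    then have "(\<Sum>\<^sub>7p q. ph r p q * C p q) = 0" using cph_transpose[of C r] by (simp add: cph_def)
    then show ?thesis by (subst sum.swap)
  qed
  moreover have "(\<Sum>\<^sub>7p. ph r p q * C p q) = DS q r q - DS r q q + (\<Sum>\<^sub>7i j. ps q r i j * DS i j q)" for q
    using contr1[of q r "\<lambda>i j. DS i j q"] by (simp add: C_def ph_rot[of q r])
  ultimately have 1: "(\<Sum>\<^sub>7q. DS q r q) - (\<Sum>\<^sub>7q. DS r q q) + (\<Sum>\<^sub>7q i j. ps q r i j * DS i j q) = 0"
    by (simp add: sum.distrib sum_subtractf)
  have "(\<Sum>\<^sub>7q i j. ps q r i j * DS i j q) = 4 * cph M r"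
  proof -
    let ?X = "\<Sum>\<^sub>7q i j. ps q r i j * DS i j q"
    have s: "?X = (\<Sum>\<^sub>7i j q. ps q r i j * DS i j q)" by (rule sum_rot3)
    \<comment> \<open>Exchanging the two indices of S costs a term in \<nabla>\<theta>. Since
      \<open>ps\<close> is skew in the corresponding indices, \<open>?X\<close> returns with the
      opposite sign and can be solved for.\<close>
    have "?X = (\<Sum>\<^sub>7i j q. ps q r i j * DS i q j) - 2 * (\<Sum>\<^sub>7i j q. ps q r i j * (\<Sum>\<^sub>7s. ph j q s * M i s))"
      unfolding s by (subst DS_skew) (simp add: sum_subtractf sum_distrib_left algebra_simps)
    also have "(\<Sum>\<^sub>7i j q. ps q r i j * DS i q j) = (\<Sum>\<^sub>7i q j. ps q r i j * DS i q j)"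
      by (intro sum.cong refl sum.swap)
    also have "\<dots> = (\<Sum>\<^sub>7i q j. - (ps j r i q * DS i q j))"
    proof (intro sum.cong refl)
      fix i q j
      have "ps q r i j = - ps j r i q"
        using ps_rot[of q r i j] ps_rot[of j q r i] ps_skew12[of q j r i] ps_skew34[of j r i q]
          ps_rot[of j r i q] ps_rot[of r i j q] ps_skew34[of r i j q] by simp
      then show "ps q r i j * DS i q j = - (ps j r i q * DS i q j)" by simp
    qed
    also have "\<dots> = - ?X" unfolding s by (simp add: sum_negf)
    finally have "?X = - (\<Sum>\<^sub>7i j q. ps q r i j * (\<Sum>\<^sub>7s. ph j q s * M i s))" by simp
    also have "\<dots> = - (\<Sum>\<^sub>7i j q s. ps q r i j * ph j q s * M i s)"
      by (simp add: sum_distrib_left mult.assoc)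
    also have "(\<Sum>\<^sub>7i j q s. ps q r i j * ph j q s * M i s) = (\<Sum>\<^sub>7i s j q. ps q r i j * ph j q s * M i s)"
      by (intro sum.cong refl sum_rot3[symmetric])
    also have "\<dots> = (\<Sum>\<^sub>7i s. (\<Sum>\<^sub>7j q. ps r i j q * ph s j q) * - M i s)"
    proof -
      have a: "ps q r i j * ph j q s = - (ps r i j q * ph s j q)" for q i j s
        using ps_rot[of q r i j] by (simp add: ph_rot[of s j q])
      have "ps q r i j * ph j q s * M i s = (ps r i j q * ph s j q) * - M i s" for q i j s
        by (simp add: a)
      then show ?thesis by (simp only: sum_distrib_right)
    qed
    also have "\<dots> = - 4 * (\<Sum>\<^sub>7i s. ph r i s * M i s)"
      unfolding ps_ph4 by (simp add: sum_distrib_left sum_negf ph_rot[of _ r] mult.assoc)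
    finally show ?thesis by (simp add: cph_def)
  qed
  with 1 DS_div2[of r] DS_trace[of r] show ?thesis by simp
qed

text \<open>Vanishing of the curl puts the skew part of \<nabla>\<theta> into the summand g_2 of the
  2-forms, on which \<open>ps\<close> acts as multiplication by -2.\<close>

lemma psM: "(\<Sum>\<^sub>7i j. ps k l i j * M i j) = M l k - M k l"
  using psc[of k l M] by (simp add: curl_M)

end

section \<open>The part of \<nabla>S that is determined by \<nabla>\<theta>\<close>

context g2_jet begin

lemma C'_C: "C' q k = C q k - 4 * M k q + 2 * M q k"
proof -
  have "C' q k = C q k - 2 * cph (\<lambda>l p. \<Sum>\<^sub>7r. ph k p r * M l r) q"
    unfolding C'_def C_def DS_skew[of _ k] by (simp add: cph_linear)
  also have "cph (\<lambda>l p. \<Sum>\<^sub>7r. ph k p r * M l r) q = (\<Sum>\<^sub>7l p r. ph q l p * ph p r k * M l r)"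
    by (simp add: cph_def sum_distrib_left ph_rot[of k] mult.assoc)
  also have "\<dots> = (\<Sum>\<^sub>7l r p. ph q l p * ph p r k * M l r)" by (intro sum.cong refl sum.swap)
  also have "\<dots> = (\<Sum>\<^sub>7l r. (dl q r * dl l k - dl q k * dl l r + ps q l r k) * M l r)"
    by (simp add: ph_ph' flip: sum_distrib_right)
  also have "\<dots> = (\<Sum>\<^sub>7l. dl l k * (\<Sum>\<^sub>7r. dl q r * M l r)) - dl q k * (\<Sum>\<^sub>7l r. dl l r * M l r) + (\<Sum>\<^sub>7l r. ps q l r k * M l r)"
    by (simp add: sum.distrib sum_subtractf sum_distrib_left algebra_simps del: sum_dl)
  also have "(\<Sum>\<^sub>7l r. ps q l r k * M l r) = - (\<Sum>\<^sub>7l r. ps k q l r * M l r)"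
  proof -
    have "ps q l r k = - ps k q l r" for l r using ps_rot[of k q l r] by simp
    then show ?thesis by (simp add: sum_negf)
  qed
  finally show ?thesis by (simp add: M_trace psM)
qed

text \<open>Another contraction of \<open>star\<close>, now in l and p, expresses \<open>C'\<close>
  by \<nabla>\<theta> and the divergence \<open>Y\<close> of the torsion. As \<open>Y\<close> is
  skew, the symmetric part of this equation together with \<open>C'_C\<close> determines the
  symmetric \<open>C\<close>, and then \<open>C'\<close>.\<close>

lemma C'_M: "C' q k = 6 * M q k" and C_M: "C q k = 4 * (M q k + M k q)"
proof -
  define Y where "Y k q = (\<Sum>\<^sub>7i. D i k q i)" for k q
  have Y: "Y q k = - Y k q" for q k
    using D_skew(1)[of _ q k] by (simp add: Y_def sum_negf)
  have main: "C' q k = 6 * Y k q + 6 * M k q" for q k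
  proof -
    have "cph (\<lambda>l p. 2 * cph (\<lambda>i j. D i j k l) p) q = cph (DS k) q - C' q k"
      unfolding star' by (simp add: cph_linear C'_def)
    then have 1: "cph (\<lambda>l p. 2 * cph (\<lambda>i j. D i j k l) p) q = - 6 * M k q - C' q k"
      by (simp add: cph_DS)
    have "cph (\<lambda>l p. 2 * cph (\<lambda>i j. D i j k l) p) q = 2 * (\<Sum>\<^sub>7l p. ph q l p * cph (\<lambda>i j. D i j k l) p)"
      by (simp only: cph_linear) (simp add: cph_def)
    also have "\<dots> = 2 * (\<Sum>\<^sub>7l. D q l k l - D l q k l + (\<Sum>\<^sub>7i j. ps q l i j * D i j k l))"
      by (simp only: contr1)
    also have "\<dots> = 2 * (Y k q + (\<Sum>\<^sub>7l i j. ps q l i j * D i j k l))"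
    proof -
      have "D q l k l = 0" for l using D_skew(1)[of q l k l] D_skew(2)[of q k l l] by simp
      moreover have "D l q k l = - D l k q l" for l by (rule D_skew(1))
      ultimately show ?thesis by (simp add: Y_def sum.distrib)
    qed
    also have "(\<Sum>\<^sub>7l i j. ps q l i j * D i j k l) = (\<Sum>\<^sub>7i j l. ps q l i j * D i j k l)"
      by (rule sum_rot3)
    also have "\<dots> = (\<Sum>\<^sub>7i l j. ps q l i j * D i j k l)" by (intro sum.cong refl sum.swap)
    also have "\<dots> = - (\<Sum>\<^sub>7i l j. ps q i l j * D i k l j)"
    proof -
      have "ps q l i j * D i j k l = - (ps q i l j * D i k l j)" for i l j
        using ps_skew23[of q l i j] D_cyc[of i j k l] by simp
      then show ?thesis by (simp add: sum_negf)
    qed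
    also have "(\<Sum>\<^sub>7i l j. ps q i l j * D i k l j) = (\<Sum>\<^sub>7i. (\<Sum>\<^sub>7s. ph q i s * DS i k s) - D i k q i + D i k i q)"
      by (simp only: psc cph_D)
    also have "\<dots> = C' q k - 2 * Y k q"
    proof -
      have "D i k i q = - D i k q i" for i by (rule D_skew(2))
      then show ?thesis by (simp add: C'_def cph_def Y_def sum.distrib sum_subtractf sum_negf flip: sum_distrib_left)
    qed
    finally show ?thesis using 1 by simp
  qed
  have C: "C q k = 4 * (M q k + M k q)" for q k
    using main[of q k] main[of k q] Y[of q k] C'_C[of q k] C'_C[of k q] C_sym[of k q] by simp
  then show "C q k = 4 * (M q k + M k q)" .
  show "C' q k = 6 * M q k" using C[of q k] C'_C[of q k] by simp
qed

text \<open>This lemma, \<open>ps_DS\<close> and \<open>psM_contr\<close> evaluate the terms that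
  appear when \<nabla>T, rewritten by \<open>T_of_S\<close>, is contracted with \<phi> in
  \<open>star\<close>.\<close>

lemma cph_DS_contr:
  "(\<Sum>\<^sub>7i j a. ph p i j * (DS i k a * ph a l j)) = DS l k p + (\<Sum>\<^sub>7i a. ps p i a l * DS i k a)"
proof -
  have "(\<Sum>\<^sub>7i j a. ph p i j * (DS i k a * ph a l j)) = (\<Sum>\<^sub>7i a j. ph p i j * (DS i k a * ph a l j))"
    by (intro sum.cong refl sum.swap)
  also have "\<dots> = (\<Sum>\<^sub>7i a. (\<Sum>\<^sub>7j. ph p i j * ph a l j) * DS i k a)"
    by (simp only: sum_distrib_right) (simp add: ac_simps)
  also have "\<dots> = (\<Sum>\<^sub>7i. dl i l * (\<Sum>\<^sub>7a. dl p a * DS i k a)) - dl p l * (\<Sum>\<^sub>7i a. dl i a * DS i k a)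
      + (\<Sum>\<^sub>7i a. ps p i a l * DS i k a)"
    unfolding ph_ph by (simp add: sum.distrib sum_subtractf sum_distrib_left algebra_simps del: sum_dl)
  finally show ?thesis by (simp add: DS_div2)
qed

lemma ps_DS: "(\<Sum>\<^sub>7i a. ps p i a l * DS i k a) = - (\<Sum>\<^sub>7s. ph l p s * C' s k) + DS l k p - DS p k l"
proof -
  have "ps p i a l = - ps l p i a" for i a using ps_rot[of l p i a] by simp
  then have "(\<Sum>\<^sub>7i a. ps p i a l * DS i k a) = - (\<Sum>\<^sub>7i a. ps l p i a * DS i k a)"
    by (simp add: sum_negf)
  then show ?thesis by (simp add: psc C'_def)
qed

lemma psM_contr:
  "(\<Sum>\<^sub>7i j q. ph p i j * (M i q * ps q j k l)) =
     - (\<Sum>\<^sub>7a. ph a k l * M a p) + (\<Sum>\<^sub>7a. ph p l a * M k a) + (\<Sum>\<^sub>7a. ph p a k * M l a)"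
proof -
  have "(\<Sum>\<^sub>7i j q. ph p i j * (M i q * ps q j k l)) = (\<Sum>\<^sub>7i q j. ph p i j * (M i q * ps q j k l))"
    by (intro sum.cong refl sum.swap)
  also have "\<dots> = - (\<Sum>\<^sub>7i q. (\<Sum>\<^sub>7j. ph j p i * ps j q k l) * M i q)"
  proof -
    have "ph p i j * (M i q * ps q j k l) = - (ph j p i * ps j q k l * M i q)" for i j q
      using ps_skew12[of q j k l] ph_rot[of j p i] by simp
    then show ?thesis by (simp only: sum_negf sum_distrib_right)
  qed
  also have "\<dots> = - (\<Sum>\<^sub>7i q. dl q p * (ph i k l * M i q)) + (\<Sum>\<^sub>7i q. dl q i * (M i q * ph p k l))
     - dl k p * (\<Sum>\<^sub>7i q. ph i l q * M i q) + (\<Sum>\<^sub>7i q. dl k i * (ph p l q * M i q))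
     - dl l p * (\<Sum>\<^sub>7i q. ph i q k * M i q) + (\<Sum>\<^sub>7i q. dl l i * (ph p q k * M i q))"
    unfolding ps_ph by (simp add: sum.distrib sum_subtractf sum_distrib_left algebra_simps del: sum_dl)
  also have "(\<Sum>\<^sub>7i q. ph i l q * M i q) = 0"
  proof -
    have "ph i l q = - ph l i q" for i q by (rule ph_skew12)
    then show ?thesis using curl_M[of l] by (simp add: cph_def sum_negf)
  qed
  also have "(\<Sum>\<^sub>7i q. ph i q k * M i q) = 0"
    using curl_M[of k] by (simp add: cph_def ph_rot[of k])
  also have "(\<Sum>\<^sub>7i q. dl k i * (ph p l q * M i q)) = (\<Sum>\<^sub>7q. ph p l q * M k q)"
    by (subst sum.swap) simp
  also have "(\<Sum>\<^sub>7i q. dl l i * (ph p q k * M i q)) = (\<Sum>\<^sub>7q. ph p q k * M l q)"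
    by (subst sum.swap) simp
  finally show ?thesis by (simp add: M_trace flip: sum_distrib_right)
qed

text \<open>Substituting \<open>T_of_S\<close> for \<nabla>T in \<open>star\<close> yields an
  equation in \<nabla>S, its two curls and \<nabla>\<theta>. The curls are already known in terms of
  \<nabla>\<theta>, so the part of \<nabla>S that is skew in its first two indices is given by
  \<nabla>\<theta> alone.\<close>

lemma E_formula:
  "2 * (DS k l p - DS l k p) =
     (\<Sum>\<^sub>7a. ph a k l * (3 * M p a + M a p)) - (\<Sum>\<^sub>7a. ph l p a * (3 * M a k + M k a))
     + (\<Sum>\<^sub>7a. ph k p a * (3 * M a l + M l a))"
proof -
  have D: "4 * D i j k l = (\<Sum>\<^sub>7a. DS i j a * ph a k l) + (\<Sum>\<^sub>7a. DS i k a * ph a l j) - (\<Sum>\<^sub>7a. DS i l a * ph a k j)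
      + 2 * (\<Sum>\<^sub>7q. M i q * ps q j k l)" for i j
  proof -
    have "ph a j k = - ph a k j" for a by (rule ph_skew23)
    then show ?thesis
      using T_of_S[of "D i" j k l, OF D_skew] DS_trace[of i]
      by (simp add: M_def DS_def sum.distrib sum_negf sum_subtractf)
  qed
  have "4 * cph (\<lambda>i j. D i j k l) p = cph (\<lambda>i j. 4 * D i j k l) p" by (rule cph_linear(3)[symmetric])
  also have "\<dots> = (\<Sum>\<^sub>7i j a. ph p i j * (DS i j a * ph a k l)) + (\<Sum>\<^sub>7i j a. ph p i j * (DS i k a * ph a l j))
     - (\<Sum>\<^sub>7i j a. ph p i j * (DS i l a * ph a k j)) + 2 * (\<Sum>\<^sub>7i j q. ph p i j * (M i q * ps q j k l))"
    unfolding D cph_def by (simp add: distrib_left right_diff_distrib sum.distrib sum_subtractf sum_distrib_left ac_simps)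
  also have "(\<Sum>\<^sub>7i j a. ph p i j * (DS i j a * ph a k l)) = (\<Sum>\<^sub>7a. ph a k l * C p a)"
  proof -
    have "(\<Sum>\<^sub>7i j a. ph p i j * (DS i j a * ph a k l)) = (\<Sum>\<^sub>7a i j. ph p i j * (DS i j a * ph a k l))"
      by (rule sum_rot3[symmetric])
    then show ?thesis by (simp add: C_def cph_def sum_distrib_left ac_simps)
  qed
  finally have 1: "4 * cph (\<lambda>i j. D i j k l) p = (\<Sum>\<^sub>7a. ph a k l * C p a)
      + (2 * DS l k p - (\<Sum>\<^sub>7s. ph l p s * C' s k) - DS p k l)
      - (2 * DS k l p - (\<Sum>\<^sub>7s. ph k p s * C' s l) - DS p l k)
      + 2 * (- (\<Sum>\<^sub>7a. ph a k l * M a p) + (\<Sum>\<^sub>7a. ph p l a * M k a) + (\<Sum>\<^sub>7a. ph p a k * M l a))"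
    unfolding cph_DS_contr ps_DS psM_contr by simp
  have 2: "DS p k l = DS p l k - 2 * (\<Sum>\<^sub>7q. ph k l q * M p q)" by (rule DS_skew)
  have 3: "(\<Sum>\<^sub>7a. ph p l a * M k a) = - (\<Sum>\<^sub>7a. ph l p a * M k a)"
    using ph_skew12[of p l] by (simp add: sum_negf)
  have 4: "(\<Sum>\<^sub>7a. ph p a k * M l a) = (\<Sum>\<^sub>7a. ph k p a * M l a)" "(\<Sum>\<^sub>7q. ph k l q * M p q) = (\<Sum>\<^sub>7a. ph a k l * M p a)"
    using ph_rot[of k p] ph_rot[of _ k l] by simp_all
  have 5: "(\<Sum>\<^sub>7a. ph a k l * C p a) = 4 * (\<Sum>\<^sub>7a. ph a k l * M p a) + 4 * (\<Sum>\<^sub>7a. ph a k l * M a p)"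
    by (simp add: C_M distrib_left sum.distrib sum_distrib_left mult.left_commute)
  have 6: "(\<Sum>\<^sub>7s. ph x y s * C' s z) = 6 * (\<Sum>\<^sub>7s. ph x y s * M s z)" for x y z
    by (simp add: C'_M sum_distrib_left mult.left_commute)
  have 7: "(\<Sum>\<^sub>7a. f a * (3 * g a + h a)) = 3 * (\<Sum>\<^sub>7a. f a * g a) + (\<Sum>\<^sub>7a. f a * h a)" for f g h :: "7 \<Rightarrow> real"
    by (simp add: distrib_left sum.distrib sum_distrib_left mult.left_commute)
  show ?thesis
    using 1 star'[of k l p] unfolding 2 3 4 5 6 7 by simp
qed

end

section \<open>Cubic relations between S, \<theta> and their derivatives\<close>

context g2_jet begin

text \<open>Up to sign the matrix of the cross product with \<theta>. By \<open>S_P\<close> the skew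
  part of S is the negative of it.\<close>

definition "P x y = (\<Sum>\<^sub>7l. ph x y l * \<theta> l)"
definition tr3 :: "(7 \<Rightarrow> 7 \<Rightarrow> real) \<Rightarrow> (7 \<Rightarrow> 7 \<Rightarrow> real) \<Rightarrow> (7 \<Rightarrow> 7 \<Rightarrow> real) \<Rightarrow> real" where
  "tr3 X Y Z = (\<Sum>\<^sub>7a k b. X a k * Y a b * Z k b)"
definition "Mt a b = M b a"
definition "tMt = (\<Sum>\<^sub>7a b. \<theta> a * M a b * \<theta> b)"

lemma P_skew: "P y x = - P x y"
proof -
  have "ph y x l = - ph x y l" for l by (rule ph_skew12)
  then show ?thesis by (simp add: P_def sum_negf)
qed

lemma S_P: "S l p = S p l - 2 * P l p" by (simp add: P_def S_skew[of l p])

lemma tMt_swap: "(\<Sum>\<^sub>7a b. \<theta> a * M b a * \<theta> b) = tMt"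
  unfolding tMt_def by (subst sum.swap) (simp add: ac_simps)

text \<open>The identity |u \<times> v|^2 = |u|^2 |v|^2 - (u, v)^2 of the seven-dimensional cross
  product, with u = \<theta> and polarised in v.\<close>

lemma PP: "(\<Sum>\<^sub>7a. P a k * P a b) = dl k b * (\<Sum>\<^sub>7l. \<theta> l * \<theta> l) - \<theta> k * \<theta> b"
proof -
  have "(\<Sum>\<^sub>7a. P a k * P a b) = (\<Sum>\<^sub>7a l m. ph a k l * \<theta> l * (ph a b m * \<theta> m))"
    by (simp add: P_def sum_product)
  also have "\<dots> = (\<Sum>\<^sub>7l m a. ph a k l * \<theta> l * (ph a b m * \<theta> m))" by (rule sum_rot3)
  also have "\<dots> = (\<Sum>\<^sub>7l m. (\<Sum>\<^sub>7a. ph k l a * ph b m a) * (\<theta> l * \<theta> m))"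
  proof -
    have "ph a k l * \<theta> l * (ph a b m * \<theta> m) = ph k l a * ph b m a * (\<theta> l * \<theta> m)" for a l m
      using ph_rot[of a k l] ph_rot[of a b m] by simp
    then show ?thesis by (simp only: sum_distrib_right)
  qed
  also have "\<dots> = dl k b * (\<Sum>\<^sub>7l m. dl l m * (\<theta> l * \<theta> m)) - (\<Sum>\<^sub>7l m. dl k m * (dl l b * (\<theta> l * \<theta> m)))
      + (\<Sum>\<^sub>7l m. ps k l b m * (\<theta> l * \<theta> m))"
    unfolding ph_ph by (simp only: left_diff_distrib distrib_right sum.distrib sum_subtractf sum_distrib_left mult.assoc)
  also have "(\<Sum>\<^sub>7l m. ps k l b m * (\<theta> l * \<theta> m)) = 0"
  proof -
    have x: "ps k l b m * (\<theta> l * \<theta> m) = - (ps k m b l * (\<theta> m * \<theta> l))" for l m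
      using ps_skew23[of k m b l] ps_skew34[of k b m l] ps_skew23[of k b l m] by simp
    have "(\<Sum>\<^sub>7l m. ps k l b m * (\<theta> l * \<theta> m)) = - (\<Sum>\<^sub>7l m. ps k m b l * (\<theta> m * \<theta> l))"
      unfolding sum_negf[symmetric] by (intro sum.cong refl x)
    also have "(\<Sum>\<^sub>7l m. ps k m b l * (\<theta> m * \<theta> l)) = (\<Sum>\<^sub>7m l. ps k m b l * (\<theta> m * \<theta> l))"
      by (rule sum.swap)
    finally show ?thesis by simp
  qed
  finally show ?thesis by simp
qed

lemma tr3_PP: "tr3 P P Z = (\<Sum>\<^sub>7l. \<theta> l * \<theta> l) * (\<Sum>\<^sub>7k. Z k k) - (\<Sum>\<^sub>7k b. \<theta> k * Z k b * \<theta> b)"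
proof -
  have "tr3 P P Z = (\<Sum>\<^sub>7k b a. P a k * P a b * Z k b)" unfolding tr3_def by (rule sum_rot3)
  also have "\<dots> = (\<Sum>\<^sub>7k b. (dl k b * (\<Sum>\<^sub>7l. \<theta> l * \<theta> l) - \<theta> k * \<theta> b) * Z k b)"
    by (simp add: PP flip: sum_distrib_right)
  also have "\<dots> = (\<Sum>\<^sub>7k. \<Sum>\<^sub>7b. dl k b * ((\<Sum>\<^sub>7l. \<theta> l * \<theta> l) * Z k b)) - (\<Sum>\<^sub>7k b. \<theta> k * Z k b * \<theta> b)"
    by (simp add: algebra_simps sum_subtractf del: sum_dl)
  finally show ?thesis by (simp add: sum_distrib_left)
qed

lemma tr3_PM: "tr3 P P M = - tMt" "tr3 P P Mt = - tMt"
  using tMt_swap by (simp_all add: tr3_PP M_trace Mt_def tMt_def)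

lemma tr3_S_swap: "(\<Sum>\<^sub>7a k b. S a k * P k b * Z a b) = tr3 S P Z + 2 * tr3 P P Z"
proof -
  have "(\<Sum>\<^sub>7a k b. S a k * P k b * Z a b) = (\<Sum>\<^sub>7k a b. S a k * P k b * Z a b)" by (rule sum.swap)
  also have "\<dots> = (\<Sum>\<^sub>7k a b. (S k a + 2 * P k a) * P k b * Z a b)"
  proof (intro sum.cong refl)
    fix k a b show "S a k * P k b * Z a b = (S k a + 2 * P k a) * P k b * Z a b"
      using S_P[of a k] P_skew[of a k] by simp
  qed
  finally show ?thesis by (simp add: tr3_def algebra_simps sum.distrib sum_distrib_left)
qed

text \<open>The derivative of S\<theta> = 0, contracted with \<phi> and with \<theta>, has two
  terms. In one the curl \<open>C\<close> is evaluated on \<theta> twice, which is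
  \<open>8 * tMt\<close> by \<open>C_M\<close>; the other is the negative of the trace in
  question.\<close>

lemma tr3_M: "tr3 S P Mt = 8 * tMt"
proof -
  have "0 = (\<Sum>\<^sub>7p. \<theta> p * (\<Sum>\<^sub>7a l. ph p a l * (\<Sum>\<^sub>7q. DS a l q * \<theta> q + S l q * M a q)))"
    using dS_th by (simp add: S_def \<theta>_def DS_def M_def)
  also have "\<dots> = (\<Sum>\<^sub>7p. \<theta> p * (\<Sum>\<^sub>7a l q. ph p a l * DS a l q * \<theta> q)) + (\<Sum>\<^sub>7p. \<theta> p * (\<Sum>\<^sub>7a l q. ph p a l * S l q * M a q))"
    by (simp add: sum.distrib sum_distrib_left distrib_left mult.assoc)
  also have "(\<Sum>\<^sub>7p. \<theta> p * (\<Sum>\<^sub>7a l q. ph p a l * DS a l q * \<theta> q)) = (\<Sum>\<^sub>7p. \<theta> p * (\<Sum>\<^sub>7q. C p q * \<theta> q))"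
  proof -
    have "(\<Sum>\<^sub>7a l q. ph p a l * DS a l q * \<theta> q) = (\<Sum>\<^sub>7q a l. ph p a l * DS a l q * \<theta> q)" for p
      by (rule sum_rot3[symmetric])
    then show ?thesis by (simp add: C_def cph_def sum_distrib_right)
  qed
  also have "\<dots> = 8 * tMt"
  proof -
    have "(\<Sum>\<^sub>7p. \<theta> p * (\<Sum>\<^sub>7q. C p q * \<theta> q)) = 4 * (\<Sum>\<^sub>7p q. \<theta> p * M p q * \<theta> q) + 4 * (\<Sum>\<^sub>7p q. \<theta> p * M q p * \<theta> q)"
      by (simp add: C_M sum_distrib_left sum.distrib algebra_simps)
    then show ?thesis using tMt_swap by (simp add: tMt_def)
  qed
  also have "(\<Sum>\<^sub>7p. \<theta> p * (\<Sum>\<^sub>7a l q. ph p a l * S l q * M a q)) = - tr3 S P Mt"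
  proof -
    have "(\<Sum>\<^sub>7p. \<theta> p * (\<Sum>\<^sub>7a l q. ph p a l * S l q * M a q)) = (\<Sum>\<^sub>7p a l q. \<theta> p * (ph p a l * S l q * M a q))"
      by (simp add: sum_distrib_left)
    also have "\<dots> = (\<Sum>\<^sub>7a l p q. \<theta> p * (ph p a l * S l q * M a q))" by (rule sum_rot3)
    also have "\<dots> = (\<Sum>\<^sub>7a l q p. \<theta> p * (ph p a l * S l q * M a q))" by (intro sum.cong refl sum.swap)
    also have "\<dots> = (\<Sum>\<^sub>7a l q. P a l * S l q * M a q)"
    proof -
      have "\<theta> p * (ph p a l * S l q * M a q) = ph a l p * \<theta> p * (S l q * M a q)" for a l q p
        using ph_rot[of p a l] by simp
      then show ?thesis by (simp only: P_def sum_distrib_right mult.assoc)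
    qed
    also have "\<dots> = (\<Sum>\<^sub>7l q a. P a l * S l q * M a q)" by (rule sum_rot3)
    also have "\<dots> = - tr3 S P Mt"
    proof -
      have "P a l * S l q * M a q = - (S l q * P l a * Mt q a)" for a l q
        using P_skew[of a l] by (simp add: Mt_def)
      then show ?thesis by (simp add: tr3_def sum_negf)
    qed
    finally show ?thesis .
  qed
  finally show ?thesis by simp
qed

text \<open>The sum pairs the curl \<open>C\<close> with \<open>M\<close>. By \<open>C_M\<close> the
  curl is 4 times the symmetrisation of \<open>M\<close>, and a symmetrisation pairs with
  \<open>M\<close> to half its own square norm.\<close>

lemma curl_S_M:
  "(\<Sum>\<^sub>7i j k. ph i j k * (\<Sum>\<^sub>7l. DS j k l * M i l)) = 2 * (\<Sum>\<^sub>7i l. (M i l + M l i)\<^sup>2)"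
proof -
  have "(\<Sum>\<^sub>7i j k. ph i j k * (\<Sum>\<^sub>7l. DS j k l * M i l)) = (\<Sum>\<^sub>7i l. C i l * M i l)"
  proof (rule sum.cong[OF refl])
    fix i
    have "(\<Sum>\<^sub>7j k. ph i j k * (\<Sum>\<^sub>7l. DS j k l * M i l)) = (\<Sum>\<^sub>7j k l. ph i j k * DS j k l * M i l)"
      by (simp add: sum_distrib_left mult.assoc)
    also have "\<dots> = (\<Sum>\<^sub>7l j k. ph i j k * DS j k l * M i l)" by (rule sum_rot3[symmetric])
    finally show "(\<Sum>\<^sub>7j k. ph i j k * (\<Sum>\<^sub>7l. DS j k l * M i l)) = (\<Sum>\<^sub>7l. C i l * M i l)"
      by (simp add: C_def cph_def sum_distrib_right)
  qed
  moreover have "(\<Sum>\<^sub>7i l. C i l * M i l) = (\<Sum>\<^sub>7i l. C i l * M l i)"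
    using sum.swap[of "\<lambda>i l. C i l * M i l" UNIV UNIV] by (simp add: C_sym)
  moreover have "2 * (M i l + M l i)\<^sup>2 * 2 = C i l * M i l + C i l * M l i" for i l
    by (simp add: C_M power2_eq_square algebra_simps)
  then have "(\<Sum>\<^sub>7i l. C i l * M i l) + (\<Sum>\<^sub>7i l. C i l * M l i) = 4 * (\<Sum>\<^sub>7i l. (M i l + M l i)\<^sup>2)"
    by (simp add: sum_distrib_left flip: sum.distrib)
  ultimately show ?thesis by simp
qed

text \<open>\<open>E_formula\<close> is paired with the tensor product of \<theta> and S; all
  resulting traces reduce to \<open>tMt\<close> by \<open>tr3_M\<close> and \<open>tr3_PM\<close>.
  The number 28 is the origin of the coefficient -7 in \<open>V1\<close>: half of it, 14, has to be
  compensated by |\<theta>|^2 \<theta>, whose divergence is \<open>2 * tMt\<close>.\<close>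

lemma first_order_relation:
  "(\<Sum>\<^sub>7l a k. \<theta> l * S a k * DS l a k) - (\<Sum>\<^sub>7l a k. \<theta> l * S a k * DS a k l) = 28 * tMt"
proof -
  have E: "2 * (DS l a k - DS a k l) = (\<Sum>\<^sub>7b. ph b l a * (3 * M k b + M b k)) - (\<Sum>\<^sub>7b. ph a k b * (3 * M b l + M l b))
     + (\<Sum>\<^sub>7b. ph l k b * (3 * M b a + M a b)) + 4 * (\<Sum>\<^sub>7b. ph k l b * M a b)" for l a k
    using E_formula[of l a k] DS_skew[of a k l] by simp
  have t: "(\<Sum>\<^sub>7l a k. \<theta> l * S a k * (\<Sum>\<^sub>7b. f l a k b)) = (\<Sum>\<^sub>7a k b l. \<theta> l * S a k * f l a k b)" for f
  proof -
    have "(\<Sum>\<^sub>7l a k b. \<theta> l * S a k * f l a k b) = (\<Sum>\<^sub>7a k l b. \<theta> l * S a k * f l a k b)" by (rule sum_rot3)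
    also have "\<dots> = (\<Sum>\<^sub>7a k b l. \<theta> l * S a k * f l a k b)" by (intro sum.cong refl sum.swap)
    finally show ?thesis by (simp add: sum_distrib_left)
  qed
  have t1: "(\<Sum>\<^sub>7l a k. \<theta> l * S a k * (\<Sum>\<^sub>7b. ph b l a * (3 * M k b + M b k))) = 3 * tr3 S P M + tr3 S P Mt"
  proof -
    have "\<theta> l * S a k * (ph b l a * (3 * M k b + M b k)) = 3 * (S a k * (ph a b l * \<theta> l) * M k b) + S a k * (ph a b l * \<theta> l) * M b k" for a b k l
      using ph_rot[of a b l] by (simp add: algebra_simps)
    then show ?thesis unfolding t
      by (simp only: sum.distrib) (simp add: tr3_def P_def Mt_def sum_distrib_left sum_distrib_right)
  qed
  have t2: "(\<Sum>\<^sub>7l a k. \<theta> l * S a k * (\<Sum>\<^sub>7b. ph a k b * (3 * M b l + M l b))) = - 24 * tMt"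
  proof -
    have "(\<Sum>\<^sub>7l a k. \<theta> l * S a k * (\<Sum>\<^sub>7b. ph a k b * (3 * M b l + M l b)))
        = (\<Sum>\<^sub>7a k b l. \<theta> l * S a k * (ph a k b * (3 * M b l + M l b)))" by (rule t)
    also have "\<dots> = (\<Sum>\<^sub>7b l a k. \<theta> l * S a k * (ph a k b * (3 * M b l + M l b)))" by (rule sum_swap22)
    also have "\<dots> = (\<Sum>\<^sub>7b l. cph S b * (\<theta> l * (3 * M b l + M l b)))"
    proof -
      have "\<theta> l * S a k * (ph a k b * (3 * M b l + M l b)) = ph b a k * S a k * (\<theta> l * (3 * M b l + M l b))" for a k b l
        using ph_rot[of b a k] by simp
      then show ?thesis by (simp only: cph_def sum_distrib_right)
    qed
    also have "\<dots> = - 18 * (\<Sum>\<^sub>7b l. \<theta> b * M b l * \<theta> l) - 6 * (\<Sum>\<^sub>7b l. \<theta> b * M l b * \<theta> l)"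
    proof -
      have "cph S b = - 6 * \<theta> b" for b by (simp add: \<theta>_def thof_def)
      then have "cph S b * (\<theta> l * (3 * M b l + M l b)) = - 18 * (\<theta> b * M b l * \<theta> l) - 6 * (\<theta> b * M l b * \<theta> l)" for b l
        by (simp add: algebra_simps)
      then show ?thesis by (simp only: sum_subtractf sum_distrib_left)
    qed
    finally show ?thesis using tMt_swap by (simp add: tMt_def)
  qed
  have t3: "(\<Sum>\<^sub>7l a k. \<theta> l * S a k * (\<Sum>\<^sub>7b. ph l k b * (3 * M b a + M a b)))
      = 3 * (tr3 S P Mt - 2 * tMt) + (tr3 S P M - 2 * tMt)"
  proof -
    have "\<theta> l * S a k * (ph l k b * (3 * M b a + M a b)) = 3 * (S a k * (ph k b l * \<theta> l) * Mt a b) + S a k * (ph k b l * \<theta> l) * M a b" for a b k l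
      using ph_rot[of l k b] by (simp add: algebra_simps Mt_def)
    then have "(\<Sum>\<^sub>7l a k. \<theta> l * S a k * (\<Sum>\<^sub>7b. ph l k b * (3 * M b a + M a b)))
      = 3 * (\<Sum>\<^sub>7a k b. S a k * P k b * Mt a b) + (\<Sum>\<^sub>7a k b. S a k * P k b * M a b)" unfolding t
      by (simp only: sum.distrib) (simp add: P_def sum_distrib_left sum_distrib_right)
    then show ?thesis by (simp add: tr3_S_swap tr3_PM)
  qed
  have t4: "(\<Sum>\<^sub>7l a k. \<theta> l * S a k * (\<Sum>\<^sub>7b. ph k l b * M a b)) = - (tr3 S P M - 2 * tMt)"
  proof -
    have "\<theta> l * S a k * (ph k l b * M a b) = - (S a k * (ph k b l * \<theta> l) * M a b)" for a b k l
      using ph_skew23[of k l b] by (simp add: algebra_simps)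
    then have "(\<Sum>\<^sub>7l a k. \<theta> l * S a k * (\<Sum>\<^sub>7b. ph k l b * M a b)) = - (\<Sum>\<^sub>7a k b. S a k * P k b * M a b)" unfolding t
      by (simp only: sum_negf) (simp add: P_def sum_distrib_left sum_distrib_right)
    then show ?thesis by (simp add: tr3_S_swap tr3_PM)
  qed
  have t6: "(\<Sum>\<^sub>7l a k. \<theta> l * S a k * (f1 l a k - f2 l a k + f3 l a k + 4 * f4 l a k)) =
     (\<Sum>\<^sub>7l a k. \<theta> l * S a k * f1 l a k) - (\<Sum>\<^sub>7l a k. \<theta> l * S a k * f2 l a k)
     + (\<Sum>\<^sub>7l a k. \<theta> l * S a k * f3 l a k) + 4 * (\<Sum>\<^sub>7l a k. \<theta> l * S a k * f4 l a k)" for f1 f2 f3 f4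
    by (simp add: distrib_left right_diff_distrib sum.distrib sum_subtractf sum_distrib_left mult.left_commute[of _ 4])
  have "2 * ((\<Sum>\<^sub>7l a k. \<theta> l * S a k * DS l a k) - (\<Sum>\<^sub>7l a k. \<theta> l * S a k * DS a k l))
    = (\<Sum>\<^sub>7l a k. \<theta> l * S a k * (2 * (DS l a k - DS a k l)))"
    by (simp add: sum_distrib_left sum_subtractf algebra_simps)
  also have "\<dots> = 56 * tMt"
    unfolding E t6 t1 t2 t3 t4 using tr3_M by simp
  finally show ?thesis by simp
qed

text \<open>The second-order terms of the divergences below have been replaced by first-order
  ones through the curl identity.\<close>

lemma div_curl_S_th:
  "(\<Sum>\<^sub>7i j k. ph i j k * (\<Sum>\<^sub>7l. DS j k l * M i l)) - (\<Sum>\<^sub>7l a k. \<theta> l * S a k * DS a k l) / 2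
    - 14 * (\<Sum>\<^sub>7a b. \<theta> a * M a b * \<theta> b) + (\<Sum>\<^sub>7l a k. \<theta> l * S a k * DS l a k) / 2
   = 2 * (\<Sum>\<^sub>7i l. (M i l + M l i)\<^sup>2)"
  using first_order_relation by (simp add: curl_S_M tMt_def)

end

text \<open>Since the torsion is totally skew, a skew \<nabla>\<theta> means that the vector field
  dual to \<theta> is Killing.\<close>

locale g2_jet_killing = g2_jet +
  assumes M_skew: "\<And>i j. M j i = - M i j"
begin

lemma tMt_0: "tMt = 0"
proof -
  have x: "\<theta> a * M b a * \<theta> b = - (\<theta> a * M a b * \<theta> b)" for a b using M_skew[of a b] by simp
  have "(\<Sum>\<^sub>7a b. \<theta> a * M b a * \<theta> b) = - tMt"
    unfolding tMt_def sum_negf[symmetric] by (intro sum.cong refl x)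
  then show ?thesis using tMt_swap by simp
qed

lemma phph: "(\<Sum>\<^sub>7p. ph i j p * ph k p b) = - (dl i k * dl j b - dl i b * dl j k + ps i j k b)"
proof -
  have "ph i j p * ph k p b = - (ph i j p * ph k b p)" for p using ph_skew23[of k p b] by simp
  then show ?thesis by (simp only: sum_negf ph_ph)
qed

text \<open>For skew \<open>M\<close> the trace term drops out, the other product of Kronecker
  symbols gives \<open>M\<close> once, and \<open>ps\<close> acts by -2 and gives it twice
  more.\<close>

lemma phph_M: "(\<Sum>\<^sub>7j p k. ph i j p * (ph k p b * M j k)) = 3 * M i b"
proof -
  have "(\<Sum>\<^sub>7j p k. ph i j p * (ph k p b * M j k)) = (\<Sum>\<^sub>7j k p. ph i j p * (ph k p b * M j k))"
    by (intro sum.cong refl sum.swap)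
  also have "\<dots> = (\<Sum>\<^sub>7j k. (\<Sum>\<^sub>7p. ph i j p * ph k p b) * M j k)"
    by (simp only: sum_distrib_right mult.assoc)
  also have "\<dots> = - (\<Sum>\<^sub>7j k. dl i k * (dl j b * M j k)) + dl i b * (\<Sum>\<^sub>7j k. dl j k * M j k) - (\<Sum>\<^sub>7j k. ps i j k b * M j k)"
    unfolding phph by (simp add: sum.distrib sum_subtractf sum_distrib_left sum_negf algebra_simps del: sum_dl)
  also have "(\<Sum>\<^sub>7j k. ps i j k b * M j k) = (\<Sum>\<^sub>7j k. ps i b j k * M j k)"
    using ps_cyc3[of i _ _ b] ps_pair[of i b] by simp
  finally show ?thesis using M_skew[of i b] M_trace by (simp add: psM)
qed

text \<open>The first sum is \<open>phph_M\<close> paired with \<open>M\<close>. The second, which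
  stands for the second derivatives in the divergence of \<open>V2\<close>, consists of cubic traces
  that are multiples of \<open>tMt\<close>, and \<open>tMt\<close> vanishes for skew
  \<open>M\<close>.\<close>

lemma div_curl_th_th:
  "(\<Sum>\<^sub>7i j p. ph i j p * (\<Sum>\<^sub>7k. M j k * (\<Sum>\<^sub>7b. ph k p b * M i b)))
    - (\<Sum>\<^sub>7a p. S a p * (\<Sum>\<^sub>7k. M a k * (\<Sum>\<^sub>7b. ph k p b * \<theta> b))) / 2 = 3 * (\<Sum>\<^sub>7i b. (M i b)\<^sup>2)"
proof -
  have "(\<Sum>\<^sub>7j p. ph i j p * (\<Sum>\<^sub>7k. M j k * (\<Sum>\<^sub>7b. ph k p b * M i b))) = 3 * (\<Sum>\<^sub>7b. (M i b)\<^sup>2)" for i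
  proof -
    have "(\<Sum>\<^sub>7j p. ph i j p * (\<Sum>\<^sub>7k. M j k * (\<Sum>\<^sub>7b. ph k p b * M i b)))
        = (\<Sum>\<^sub>7j p k b. ph i j p * (ph k p b * M j k) * M i b)"
      by (simp add: sum_distrib_left ac_simps)
    also have "\<dots> = (\<Sum>\<^sub>7j p b k. ph i j p * (ph k p b * M j k) * M i b)" by (intro sum.cong refl sum.swap)
    also have "\<dots> = (\<Sum>\<^sub>7j b p k. ph i j p * (ph k p b * M j k) * M i b)" by (intro sum.cong refl sum.swap)
    also have "\<dots> = (\<Sum>\<^sub>7b j p k. ph i j p * (ph k p b * M j k) * M i b)" by (rule sum.swap)
    also have "\<dots> = (\<Sum>\<^sub>7b. (\<Sum>\<^sub>7j p k. ph i j p * (ph k p b * M j k)) * M i b)"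
      by (simp only: sum_distrib_right)
    finally show ?thesis by (simp add: phph_M sum_distrib_left power2_eq_square mult.assoc)
  qed
  moreover have "(\<Sum>\<^sub>7a p. S a p * (\<Sum>\<^sub>7k. M a k * (\<Sum>\<^sub>7b. ph k p b * \<theta> b))) = (\<Sum>\<^sub>7a p k. - (S a p * P p k * M a k))"
  proof -
    have "M a k * (\<Sum>\<^sub>7b. ph k p b * \<theta> b) = - (P p k * M a k)" for a k p
      using P_skew[of k p] by (simp add: P_def)
    then show ?thesis by (simp add: sum_distrib_left ac_simps)
  qed
  moreover have "\<dots> = 0"
  proof -
    have "tr3 S P M = - tr3 S P Mt"
    proof -
      have "Z * M k b = - (Z * Mt k b)" for Z k b using M_skew[of k b] by (simp add: Mt_def)
      then show ?thesis unfolding tr3_def by (simp only: sum_negf)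
    qed
    then show ?thesis using tr3_M tr3_PM tMt_0 by (simp add: sum_negf tr3_S_swap)
  qed
  ultimately show ?thesis by (simp add: sum_distrib_left)
qed

end

locale g2_jet_parallel_lee = g2_jet +
  assumes M_0: "\<And>i j. M i j = 0"
begin

text \<open>The failure of symmetry in the last two indices (\<open>DS_skew\<close>) and in the
  first two (\<open>E_formula\<close>) is linear in \<nabla>\<theta>. With \<nabla>\<theta> = 0 the
  tensor \<nabla>S is totally symmetric.\<close>

lemma DS_sym: "DS i l p = DS i p l" "DS i l p = DS l i p"
  using DS_skew[of i l p] E_formula[of i l p] by (simp_all add: M_0)

text \<open>Of the three terms in the product of two copies of \<phi> one survives:
  \<open>ps\<close> is skew in indices in which \<nabla>S is symmetric, and one product of Kronecker
  symbols produces a trace of \<nabla>S.\<close>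

lemma curl_S_S_aux:
  "(\<Sum>\<^sub>7j p. ph i j p * (\<Sum>\<^sub>7k a. (\<Sum>\<^sub>7l. DS j k l * Z l a) * ph k a p)) = (\<Sum>\<^sub>7a l. DS i a l * Z l a)"
proof -
  have "(\<Sum>\<^sub>7j p. ph i j p * (\<Sum>\<^sub>7k a. (\<Sum>\<^sub>7l. DS j k l * Z l a) * ph k a p))
      = (\<Sum>\<^sub>7j p k a. ph i j p * ph k a p * (\<Sum>\<^sub>7l. DS j k l * Z l a))"
    by (simp add: sum_distrib_left ac_simps)
  also have "\<dots> = (\<Sum>\<^sub>7j k a p. ph i j p * ph k a p * (\<Sum>\<^sub>7l. DS j k l * Z l a))"
    by (intro sum.cong refl sum_rot3)
  also have "\<dots> = (\<Sum>\<^sub>7j k a. (dl i k * dl j a - dl i a * dl j k + ps i j k a) * (\<Sum>\<^sub>7l. DS j k l * Z l a))"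
    by (simp only: ph_ph flip: sum_distrib_right)
  also have "\<dots> = (\<Sum>\<^sub>7j k. dl i k * (\<Sum>\<^sub>7a. dl j a * (\<Sum>\<^sub>7l. DS j k l * Z l a)))
     - (\<Sum>\<^sub>7j k. dl j k * (\<Sum>\<^sub>7a. dl i a * (\<Sum>\<^sub>7l. DS j k l * Z l a)))
     + (\<Sum>\<^sub>7j k a. ps i j k a * (\<Sum>\<^sub>7l. DS j k l * Z l a))"
    by (simp add: algebra_simps sum.distrib sum_subtractf sum_distrib_left del: sum_dl)
  also have "(\<Sum>\<^sub>7j k a. ps i j k a * (\<Sum>\<^sub>7l. DS j k l * Z l a)) = 0"
  proof -
    have x: "ps i j k a * (\<Sum>\<^sub>7l. DS j k l * Z l a) = - (ps i k j a * (\<Sum>\<^sub>7l. DS k j l * Z l a))" for j k a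
      using ps_skew23[of i j k a] DS_sym(2)[of j k] by simp
    have "(\<Sum>\<^sub>7j k a. ps i j k a * (\<Sum>\<^sub>7l. DS j k l * Z l a)) = - (\<Sum>\<^sub>7j k a. ps i k j a * (\<Sum>\<^sub>7l. DS k j l * Z l a))"
      unfolding sum_negf[symmetric] by (intro sum.cong refl x)
    also have "(\<Sum>\<^sub>7j k a. ps i k j a * (\<Sum>\<^sub>7l. DS k j l * Z l a)) = (\<Sum>\<^sub>7k j a. ps i k j a * (\<Sum>\<^sub>7l. DS k j l * Z l a))"
      by (rule sum.swap)
    finally show ?thesis by simp
  qed
  also have "(\<Sum>\<^sub>7j k. dl j k * (\<Sum>\<^sub>7a. dl i a * (\<Sum>\<^sub>7l. DS j k l * Z l a))) = 0"
  proof -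
    have "(\<Sum>\<^sub>7j k. dl j k * (\<Sum>\<^sub>7a. dl i a * (\<Sum>\<^sub>7l. DS j k l * Z l a))) = (\<Sum>\<^sub>7j l. DS j j l * Z l i)"
      by simp
    also have "\<dots> = (\<Sum>\<^sub>7l j. DS j j l * Z l i)" by (rule sum.swap)
    also have "\<dots> = (\<Sum>\<^sub>7l. (\<Sum>\<^sub>7j. DS l j j) * Z l i)"
    proof -
      have "DS j j l = DS l j j" for j l using DS_sym[of j j l] DS_sym[of j l j] by simp
      then show ?thesis by (simp only: sum_distrib_right)
    qed
    finally show ?thesis by (simp add: DS_trace)
  qed
  finally show ?thesis using DS_sym(2)[of i] by simp
qed

text \<open>The second sum vanishes because exchanging its two factors S, the pair (b, p) with the
  pair (l, a), leaves the totally symmetric \<nabla>S unchanged and reverses the sign of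
  \<phi>.\<close>

lemma div_curl_S_S:
  "(\<Sum>\<^sub>7i j p. ph i j p * (\<Sum>\<^sub>7k a. (\<Sum>\<^sub>7l. DS j k l * DS i l a) * ph k a p))
    - (\<Sum>\<^sub>7b p. S b p * (\<Sum>\<^sub>7k a. (\<Sum>\<^sub>7l. DS b k l * S l a) * ph k a p)) / 2 = (\<Sum>\<^sub>7i a l. (DS i a l)\<^sup>2)"
proof -
  let ?W = "\<lambda>b p k a l. S b p * (DS b k l * S l a * ph k a p)"
  have "(\<Sum>\<^sub>7b p. S b p * (\<Sum>\<^sub>7k a. (\<Sum>\<^sub>7l. DS b k l * S l a) * ph k a p)) = (\<Sum>\<^sub>7b p k a l. ?W b p k a l)"
    by (simp add: sum_distrib_left sum_distrib_right)
  also have "\<dots> = 0"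
  proof -
    let ?X = "\<Sum>\<^sub>7b p k a l. ?W b p k a l"
    have "?X = (\<Sum>\<^sub>7k a b p l. ?W b p k a l)" by (rule sum_swap22)
    also have "\<dots> = (\<Sum>\<^sub>7k a l b p. ?W b p k a l)" by (intro sum.cong refl sum_rot3[symmetric])
    also have "\<dots> = (\<Sum>\<^sub>7k a l b p. - ?W l a k p b)"
    proof (intro sum.cong refl)
      fix k a l b p
      show "?W b p k a l = - ?W l a k p b"
      proof -
        have "DS b k l = DS l k b" using DS_sym(2)[of b k l] DS_sym(1)[of k b l] DS_sym(2)[of k l b] by (simp only:)
        moreover have "ph k a p = - ph k p a" by (rule ph_skew23)
        ultimately show ?thesis by simp
      qed
    qed
    also have "\<dots> = (\<Sum>\<^sub>7k. \<Sum>\<^sub>7b p. \<Sum>\<^sub>7a l. - ?W l a k p b)"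
      by (intro sum.cong refl sum_swap22)
    also have "\<dots> = (\<Sum>\<^sub>7k. \<Sum>\<^sub>7p b. \<Sum>\<^sub>7a l. - ?W l a k p b)"
      by (intro sum.cong refl sum.swap)
    also have "\<dots> = (\<Sum>\<^sub>7k p b l a. - ?W l a k p b)" by (intro sum.cong refl sum.swap)
    also have "\<dots> = - (\<Sum>\<^sub>7k a l b p. ?W b p k a l)" by (simp only: sum_negf)
    also have "(\<Sum>\<^sub>7k a l b p. ?W b p k a l) = (\<Sum>\<^sub>7k a b p l. ?W b p k a l)"
      by (intro sum.cong refl sum_rot3)
    also have "\<dots> = ?X" by (rule sum_swap22[symmetric])
    finally show ?thesis by simp
  qed
  finally show ?thesis
    unfolding curl_S_S_aux using DS_sym(1) by (simp add: power2_eq_square)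
qed

end

section \<open>The first Bianchi identity and the exchange of the index pairs of the
  curvature\<close>

locale g2_bianchi =
  fixes R D :: "7 \<Rightarrow> 7 \<Rightarrow> 7 \<Rightarrow> 7 \<Rightarrow> real" and T :: "7 \<Rightarrow> 7 \<Rightarrow> 7 \<Rightarrow> real"
  assumes R_skew: "\<And>i j k l. R j i k l = - R i j k l" "\<And>i j k l. R i j l k = - R i j k l"
    and T_skew: "\<And>i j k. T j i k = - T i j k" "\<And>i j k. T i k j = - T i j k"
    and D_skew: "\<And>i j k l. D i k j l = - D i j k l" "\<And>i j k l. D i j l k = - D i j k l"
    and bianchi: "\<And>i j k l. R i j k l + R j k i l + R k i j l = D i j k l + D j k i l + D k i j l
      + (\<Sum>\<^sub>7a. T i j a * T a k l + T j k a * T a i l + T k i a * T a j l)"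
begin

text \<open>The signed combination of four Bianchi identities that proves pair symmetry in the
  torsion-free case. The quadratic torsion terms \<open>Q\<close> form a 4-form and cancel in it, so
  the failure of pair symmetry is linear in \<nabla>T.\<close>

lemma octahedron: "2 * (R i j k l - R k l i j) = D i j k l - D j i k l - D k l i j + D l k i j"
proof -
  define Q where "Q i j k l = (\<Sum>\<^sub>7a. T i j a * T a k l + T j k a * T a i l + T k i a * T a j l)" for i j k l
  have Tl: "T a k l = T k l a" for k l a using T_skew(1)[of a k l] T_skew(2)[of k a l] by simp
  have Tr: "T k l a = T a k l" for k l a by (rule Tl[symmetric])
  have Q1: "Q j i k l = - Q i j k l" for i j k l
    unfolding Q_def sum_negf[symmetric]
  proof (intro sum.cong refl)
    fix a
    have "T j l a = T a j l" "T a i k = - T k i a" "T l i a = - T a i l" "T a j k = T j k a" "T a l k = - T a k l" "T j i a = - T i j a"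
      "T i k a = - T k i a" "T k j a = - T j k a"
      using Tr[of j l a] Tr[of l i a] Tl[of a j k] Tl[of a i k] T_skew(2)[of a k l] T_skew(2)[of a i l] T_skew(1)[of k i a] T_skew(1)[of i j a] T_skew(1)[of j k a]
      by simp_all
    note e = this
    show "T j i a * T a k l + T i k a * T a j l + T k j a * T a i l =
      - (T i j a * T a k l + T j k a * T a i l + T k i a * T a j l)"
      by (simp add: e)
  qed
  have Q2: "Q i j l k = - Q i j k l" for i j k l
    unfolding Q_def sum_negf[symmetric]
  proof (intro sum.cong refl)
    fix a
    have "T j l a = T a j l" "T a i k = - T k i a" "T l i a = - T a i l" "T a j k = T j k a" "T a l k = - T a k l"
      using Tr[of j l a] Tr[of l i a] Tl[of a j k] Tl[of a i k] T_skew(2)[of a k l] T_skew(2)[of a i l] T_skew(1)[of k i a]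
      by simp_all
    note e = this
    show "T i j a * T a l k + T j l a * T a i k + T l i a * T a j k =
      - (T i j a * T a k l + T j k a * T a i l + T k i a * T a j l)"
      by (simp add: e)
  qed
  have Q3: "Q k l i j = Q i j k l" for i j k l
    unfolding Q_def
  proof (intro sum.cong refl)
    fix a
    have "T k l a = T a k l" "T a i j = T i j a" "T l i a = - T a i l" "T a k j = - T j k a" "T i k a = - T k i a" "T a l j = - T a j l"
      using Tr[of k l a] Tl[of a i j] Tr[of l i a] T_skew(2)[of a i l] Tl[of a k j] T_skew(1)[of j k a] T_skew(1)[of k i a] T_skew(2)[of a j l]
      by simp_all
    note e = this
    show "T k l a * T a i j + T l i a * T a k j + T i k a * T a l j =
      T i j a * T a k l + T j k a * T a i l + T k i a * T a j l"
      by (simp add: e)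
  qed
  note B = bianchi[folded Q_def]
  have "R j k l i = - R j k i l" "R i k l j = R k i j l" "R l i k j = - R l i j k" "R i j l k = - R i j k l"
    "R j l i k = R l j k i" "R k l j i = - R k l i j"
    using R_skew(2)[of j k i l] R_skew(1)[of k i l j] R_skew(2)[of k i j l] R_skew(2)[of l i j k] R_skew(2)[of i j k l]
      R_skew(1)[of l j i k] R_skew(2)[of l j k i] R_skew(2)[of k l i j] by - linarith+
  note r = this
  have Dc: "D a c d b = D a b c d" "D a d b c = D a b c d" "D a b d c = - D a b c d" "D a d c b = - D a b c d" for a b c d
    using D_skew(1)[of a c b d] D_skew(2)[of a c d b] D_skew(1)[of a d b c] D_skew(2)[of a b d c] D_skew(2)[of a b c d]
      D_skew(2)[of a d c b] D_skew(1)[of a c d b] D_skew(2)[of a c b d] by - linarith+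
  have q: "Q k l i j = Q i j k l" "Q l i j k = Q j k l i" by (simp_all only: Q3[of i j k l] Q3[of j k l i])
  note d = Dc(1)[of i k l j] Dc(3)[of i j l k] Dc(1)[of j k l i] Dc(3)[of j k i l] Dc(2)[of j l i k]
      Dc(2)[of k l i j] Dc(4)[of k l j i] Dc(1)[of l j k i] Dc(2)[of l k i j] Dc(3)[of l i k j]
  have "2 * (R i j k l - R k l i j) = (R i j k l + R j k i l + R k i j l) + (R j k l i + R k l j i + R l j k i)
      - (R k l i j + R l i k j + R i k l j) - (R l i j k + R i j l k + R j l i k)"
    unfolding r by simp
  also have "\<dots> = D i j k l - D j i k l - D k l i j + D l k i j"
    unfolding B q d by simp
  finally show ?thesis .
qed

end

locale g2_instanton_curvature = g2_bianchi +
  assumes hol: "\<And>i j p. (\<Sum>\<^sub>7k l. R i j k l * ph k l p) = 0"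
    and inst: "\<And>k l p. (\<Sum>\<^sub>7i j. R i j k l * ph i j p) = 0"
begin

lemma cph_R: "cph (\<lambda>i j. R i j k l) p = 0" "cph (\<lambda>i j. R k l i j) p = 0"
  using inst[of k l p] hol[of k l p] by (simp_all add: cph_def ph_rot[of p] mult.commute)

text \<open>Contraction of \<open>octahedron\<close> with \<phi>: both index pairs of the curvature
  lie in g_2, so the curvature disappears and a linear equation for \<nabla>T remains.\<close>

lemma star: "2 * cph (\<lambda>i j. D i j k l) p = Sof (D k) l p - Sof (D l) k p"
proof -
  have "0 = cph (\<lambda>i j. 2 * (R i j k l - R k l i j)) p" by (simp add: cph_linear cph_R)
  also have "\<dots> = cph (\<lambda>i j. D i j k l) p - cph (\<lambda>i j. D j i k l) p - cph (\<lambda>i j. D k l i j) p + cph (\<lambda>i j. D l k i j) p"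
    by (simp only: octahedron cph_linear)
  finally show ?thesis using cph_transpose[of "\<lambda>i j. D i j k l" p] by (simp add: Sof_def)
qed

text \<open>Contract the Bianchi identity with \<phi> in i, j, k. The curvature vanishes by the
  instanton condition and the derivative terms are divergences of S, so the quadratic torsion terms
  vanish too. They pair S with T in two skew indices; only the skew part of S counts there, and it
  is \<phi> contracted with \<theta>.\<close>

lemma S_th:
  assumes div: "\<And>l. (\<Sum>\<^sub>7i. Sof (D i) l i) = 0"
  shows "(\<Sum>\<^sub>7q. Sof T l q * thof (Sof T) q) = 0"
proof -
  have c: "(\<Sum>\<^sub>7i j k. ph i j k * X j k i) = (\<Sum>\<^sub>7i j k. ph i j k * X i j k)"
       "(\<Sum>\<^sub>7i j k. ph i j k * X k i j) = (\<Sum>\<^sub>7i j k. ph i j k * X i j k)" for X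
  proof -
    have "(\<Sum>\<^sub>7i j k. ph i j k * X i j k) = (\<Sum>\<^sub>7j k i. ph i j k * X i j k)" by (rule sum_rot3)
    also have "\<dots> = (\<Sum>\<^sub>7j k i. ph j k i * X i j k)" by (simp only: ph_cyc)
    finally show "(\<Sum>\<^sub>7i j k. ph i j k * X k i j) = (\<Sum>\<^sub>7i j k. ph i j k * X i j k)" by simp
    have "(\<Sum>\<^sub>7i j k. ph i j k * X j k i) = (\<Sum>\<^sub>7j k i. ph i j k * X j k i)" by (rule sum_rot3)
    also have "\<dots> = (\<Sum>\<^sub>7j k i. ph j k i * X j k i)" by (simp only: ph_cyc)
    finally show "(\<Sum>\<^sub>7i j k. ph i j k * X j k i) = (\<Sum>\<^sub>7i j k. ph i j k * X i j k)" .
  qed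
  define Y where "Y i j k = (\<Sum>\<^sub>7a. T i j a * T a k l)" for i j k
  have R0: "(\<Sum>\<^sub>7i j k. ph i j k * R i j k l) = 0"
  proof -
    have "(\<Sum>\<^sub>7i j k. ph i j k * R i j k l) = (\<Sum>\<^sub>7k i j. ph i j k * R i j k l)" by (rule sum_rot3[symmetric])
    then show ?thesis using inst by (simp add: mult.commute)
  qed
  have D0: "(\<Sum>\<^sub>7i j k. ph i j k * D i j k l) = 0"
  proof -
    have "D i j k l = D i l j k" for i j k using D_skew(1)[of i l j k] D_skew(2)[of i j l k] by simp
    then have "(\<Sum>\<^sub>7i j k. ph i j k * D i j k l) = (\<Sum>\<^sub>7i. Sof (D i) l i)" by (simp add: Sof_def cph_def)
    then show ?thesis by (simp add: div)
  qed
  have "(\<Sum>\<^sub>7i j k. ph i j k * (R i j k l + R j k i l + R k i j l)) =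
    (\<Sum>\<^sub>7i j k. ph i j k * (D i j k l + D j k i l + D k i j l + (Y i j k + Y j k i + Y k i j)))"
    by (simp only: bianchi Y_def sum.distrib)
  then have "(\<Sum>\<^sub>7i j k. ph i j k * Y i j k) = 0"
    by (simp add: distrib_left sum.distrib c[of "\<lambda>i j k. R i j k l"] c[of "\<lambda>i j k. D i j k l"] c[of Y] R0 D0)
  also have "(\<Sum>\<^sub>7i j k. ph i j k * Y i j k) = (\<Sum>\<^sub>7k a i j. ph k i j * T a i j * T a k l)"
  proof -
    have Ta: "T i j a = T a i j" for a i j using T_skew(1)[of a i j] T_skew(2)[of i a j] by simp
    have "(\<Sum>\<^sub>7i j k. ph i j k * Y i j k) = (\<Sum>\<^sub>7i j k a. ph k i j * T a i j * T a k l)"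
      by (simp add: Y_def sum_distrib_left Ta mult.assoc ph_rot[of _ _ k for k] cong: sum.cong)
    also have "\<dots> = (\<Sum>\<^sub>7k a i j. ph k i j * T a i j * T a k l)" by (rule sum_swap22)
    finally show ?thesis .
  qed
  also have "\<dots> = (\<Sum>\<^sub>7k a. Sof T a k * T a k l)" by (simp add: Sof_def cph_def sum_distrib_right)
  finally have A: "(\<Sum>\<^sub>7k a. Sof T a k * T a k l) = 0" .
  have "(\<Sum>\<^sub>7k a. Sof T a k * T a k l) = (\<Sum>\<^sub>7k a. Sof T k a * T a k l) - 2 * (\<Sum>\<^sub>7k a q. ph a k q * thof (Sof T) q * T a k l)"
  proof -
    have "Sof T a k * T a k l = Sof T k a * T a k l - 2 * (\<Sum>\<^sub>7q. ph a k q * thof (Sof T) q * T a k l)" for a k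
    proof -
      have "Sof T a k = Sof T k a - 2 * (\<Sum>\<^sub>7q. ph a k q * thof (Sof T) q)"
        using Sof_skew[of T a k, OF T_skew] by simp
      then show ?thesis by (simp add: left_diff_distrib sum_distrib_right)
    qed
    then show ?thesis by (simp only: sum_subtractf sum_distrib_left)
  qed
  also have "(\<Sum>\<^sub>7k a. Sof T k a * T a k l) = - (\<Sum>\<^sub>7k a. Sof T a k * T a k l)"
  proof -
    have "(\<Sum>\<^sub>7k a. Sof T k a * T a k l) = (\<Sum>\<^sub>7a k. Sof T k a * T a k l)" by (rule sum.swap)
    moreover have "Sof T k a * T a k l = - (Sof T k a * T k a l)" for a k using T_skew(1)[of k a l] by simp
    ultimately show ?thesis by (simp only: sum_negf)
  qed
  also have "(\<Sum>\<^sub>7k a q. ph a k q * thof (Sof T) q * T a k l) = (\<Sum>\<^sub>7q. Sof T l q * thof (Sof T) q)"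
  proof -
    have "T a k l = T l a k" for a k using T_skew(1)[of l a k] T_skew(2)[of a l k] by simp
    then have "(\<Sum>\<^sub>7k a q. ph a k q * thof (Sof T) q * T a k l) = (\<Sum>\<^sub>7k a q. ph q a k * T l a k * thof (Sof T) q)"
      by (simp add: ph_rot[of q a k for q a k] ac_simps cong: sum.cong)
    also have "\<dots> = (\<Sum>\<^sub>7a k q. ph q a k * T l a k * thof (Sof T) q)" by (rule sum.swap)
    also have "\<dots> = (\<Sum>\<^sub>7q a k. ph q a k * T l a k * thof (Sof T) q)" by (rule sum_rot3[symmetric])
    finally show ?thesis by (simp add: Sof_def cph_def sum_distrib_right)
  qed
  finally show ?thesis using A by simp
qed

end

section \<open>Smooth functions\<close>

lemma has_derivative_pd:
  assumes "f differentiable (at x)"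
  shows "(f has_derivative (\<lambda>h. \<Sum>i\<in>UNIV. h $ i * pd i f x)) (at x)"
proof -
  let ?D = "frechet_derivative f (at x)"
  have D: "(f has_derivative ?D) (at x)" using assms by (simp add: frechet_derivative_works)
  then have lin: "linear ?D" by (simp add: has_derivative_linear)
  have "?D h = (\<Sum>i\<in>UNIV. h $ i * pd i f x)" for h
  proof -
    have "?D h = ?D (\<Sum>i\<in>UNIV. h $ i *\<^sub>R axis i 1)" by (simp add: basis_expansion flip: scalar_mult_eq_scaleR)
    also have "\<dots> = (\<Sum>i\<in>UNIV. h $ i * pd i f x)"
      unfolding pd_def by (simp add: linear_sum[OF lin] linear_cmul[OF lin])
    finally show ?thesis .
  qed
  then have "?D = (\<lambda>h. \<Sum>i\<in>UNIV. h $ i * pd i f x)" by blast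
  with D show ?thesis by simp
qed

lemma pd_eqI: "(f has_derivative f') (at x) \<Longrightarrow> pd i f x = f' (axis i 1)"
  unfolding pd_def by (simp add: frechet_derivative_at[symmetric])

lemma pd_const [simp]: "pd i (\<lambda>x. c) = (\<lambda>x. 0)"
  by (rule ext) (rule trans[OF pd_eqI[OF has_derivative_const]], simp)

lemma pd_add:
  "f differentiable (at x) \<Longrightarrow> g differentiable (at x) \<Longrightarrow> pd i (\<lambda>y. f y + g y) x = pd i f x + pd i g x"
  by (rule trans[OF pd_eqI[OF has_derivative_add[OF has_derivative_pd has_derivative_pd]]])
     (simp_all add: axis_def if_distrib if_distribR cong: if_cong)

lemma pd_mult:
  "f differentiable (at x) \<Longrightarrow> g differentiable (at x) \<Longrightarrow>
   pd i (\<lambda>y. f y * g y) x = pd i f x * g x + f x * pd i g x"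
  by (rule trans[OF pd_eqI[OF has_derivative_mult[OF has_derivative_pd has_derivative_pd]]])
     (simp_all add: axis_def if_distrib if_distribR cong: if_cong)

lemma pd_minus: "f differentiable (at x) \<Longrightarrow> pd i (\<lambda>y. - f y) x = - pd i f x"
  using pd_mult[of "\<lambda>y. -1" x f i] by simp

lemma pd_diff:
  "f differentiable (at x) \<Longrightarrow> g differentiable (at x) \<Longrightarrow> pd i (\<lambda>y. f y - g y) x = pd i f x - pd i g x"
  using pd_add[of f x "\<lambda>y. - g y" i] by (simp add: pd_minus)

lemma pd_cmult: "f differentiable (at x) \<Longrightarrow> pd i (\<lambda>y. c * f y) x = c * pd i f x"
  using pd_mult[of "\<lambda>y. c" x f i] by simp

lemma pd_sum:
  assumes "\<And>a. a \<in> A \<Longrightarrow> f a differentiable (at x)"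
  shows "pd i (\<lambda>y. \<Sum>a\<in>A. f a y) x = (\<Sum>a\<in>A. pd i (f a) x)"
  using assms
proof (induction A rule: infinite_finite_induct)
  case (insert a A)
  then show ?case
    by (simp add: pd_add differentiable_sum)
qed simp_all

lemma pd_cong:
  assumes "open S" "x \<in> S" "\<And>y. y \<in> S \<Longrightarrow> f y = g y"
  shows "pd i f x = pd i g x"
proof -
  have "(f has_derivative D) (at x) \<longleftrightarrow> (g has_derivative D) (at x)" for D
    using assms has_derivative_transform_within_open[of f D x UNIV S g]
      has_derivative_transform_within_open[of g D x UNIV S f] by auto
  then show ?thesis unfolding pd_def frechet_derivative_def by presburger
qed

lemma differentiable_cong_open:
  assumes "open S" "x \<in> S" "\<And>y. y \<in> S \<Longrightarrow> f y = g y" "f differentiable (at x)"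
  shows "g differentiable (at x)"
  using assms has_derivative_transform_within_open[of f _ x UNIV S g] unfolding differentiable_def by blast

lemma pd_inverse:
  assumes "f differentiable (at x)" "f x \<noteq> 0"
  shows "pd i (\<lambda>y. inverse (f y)) x = - (pd i f x * (inverse (f x) * inverse (f x)))"
  by (rule trans[OF pd_eqI[OF Deriv.has_derivative_inverse[OF assms(2) has_derivative_pd[OF assms(1)]]]])
     (simp add: axis_def if_distrib if_distribR cong: if_cong)

lemma Ck_cong:
  assumes "open S" "\<And>y. y \<in> S \<Longrightarrow> f y = g y" "Ck k S f"
  shows "Ck k S g"
  using assms(2,3)
proof (induction k arbitrary: f g)
  case 0 then show ?case using continuous_on_cong[of S S f g] by simp
next
  case (Suc k)
  have "Ck k S (pd i g)" for i
  proof (rule Suc.IH)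
    show "pd i f y = pd i g y" if "y \<in> S" for y
      by (rule pd_cong[OF assms(1) that]) (rule Suc.prems(1))
    show "Ck k S (pd i f)" using Suc.prems(2) by simp
  qed
  moreover have "\<forall>x\<in>S. g differentiable (at x)"
  proof
    fix x assume "x \<in> S"
    with Suc.prems show "g differentiable (at x)"
      by (intro differentiable_cong_open[OF assms(1), of x f g]) auto
  qed
  ultimately show ?case by simp
qed

lemma Ck_SucD: "Ck (Suc k) S f \<Longrightarrow> Ck k S f"
proof (induction k arbitrary: f)
  case 0 then show ?case
    by (auto intro!: continuous_at_imp_continuous_on differentiable_imp_continuous_within)
qed auto

lemma Ck_const: "Ck k S (\<lambda>x. c)"
  by (induction k arbitrary: c) auto

lemma Ck_add:
  assumes "open S" "Ck k S f" "Ck k S g" shows "Ck k S (\<lambda>x. f x + g x)"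
  using assms(2,3)
proof (induction k arbitrary: f g)
  case 0 then show ?case by (simp add: continuous_on_add)
next
  case (Suc k)
  have "Ck k S (pd i (\<lambda>x. f x + g x))" for i
  proof (rule Ck_cong[OF assms(1)])
    show "Ck k S (\<lambda>x. pd i f x + pd i g x)" using Suc.prems by (intro Suc.IH) simp_all
  qed (use Suc.prems in \<open>simp add: pd_add\<close>)
  then show ?case using Suc.prems by auto
qed

lemma Ck_mult:
  assumes "open S" "Ck k S f" "Ck k S g" shows "Ck k S (\<lambda>x. f x * g x)"
  using assms(2,3)
proof (induction k arbitrary: f g)
  case 0 then show ?case by (simp add: continuous_on_mult)
next
  case (Suc k)
  have "Ck k S (pd i (\<lambda>x. f x * g x))" for i
  proof (rule Ck_cong[OF assms(1)])
    show "Ck k S (\<lambda>x. pd i f x * g x + f x * pd i g x)"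
      using Suc.prems Suc.prems[THEN Ck_SucD] by (intro Ck_add[OF assms(1)] Suc.IH) simp_all
  qed (use Suc.prems in \<open>simp add: pd_mult\<close>)
  then show ?case using Suc.prems by auto
qed

lemma Ck_inverse:
  assumes "open S" "Ck k S f" "\<And>x. x \<in> S \<Longrightarrow> f x \<noteq> 0" shows "Ck k S (\<lambda>x. inverse (f x))"
  using assms(2,3)
proof (induction k arbitrary: f)
  case 0 then show ?case by (auto intro!: continuous_on_inverse)
next
  case (Suc k)
  have c: "Ck k S (\<lambda>x. inverse (f x))"
    by (rule Suc.IH[OF Ck_SucD[OF Suc.prems(1)] Suc.prems(2)])
  have "Ck k S (pd i (\<lambda>x. inverse (f x)))" for i
  proof (rule Ck_cong[OF assms(1)])
    show "Ck k S (\<lambda>x. - 1 * (pd i f x * (inverse (f x) * inverse (f x))))"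
      using Suc.prems by (intro Ck_mult[OF assms(1)] Ck_const c) simp
  qed (use Suc.prems in \<open>simp add: pd_inverse\<close>)
  then show ?case using Suc.prems by (auto intro!: differentiable_inverse)
qed

lemma smooth_on_pd: "smooth_on S f \<Longrightarrow> smooth_on S (pd i f)"
  unfolding smooth_on_def using Ck.simps(2) by blast

lemma smooth_on_differentiable: "smooth_on S f \<Longrightarrow> x \<in> S \<Longrightarrow> f differentiable (at x)"
  unfolding smooth_on_def using Ck.simps(2) by blast

lemma smooth_on_continuous: "smooth_on S f \<Longrightarrow> continuous_on S f"
  unfolding smooth_on_def using Ck.simps(1) by blast

lemma smooth_on_cong: "open S \<Longrightarrow> smooth_on S f \<Longrightarrow> (\<And>y. y \<in> S \<Longrightarrow> f y = g y) \<Longrightarrow> smooth_on S g"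
  unfolding smooth_on_def using Ck_cong by blast

lemma smooth_on_const: "smooth_on S (\<lambda>x. c)" by (simp add: smooth_on_def Ck_const)

lemma smooth_on_add: "open S \<Longrightarrow> smooth_on S f \<Longrightarrow> smooth_on S g \<Longrightarrow> smooth_on S (\<lambda>x. f x + g x)"
  by (simp add: smooth_on_def Ck_add)

lemma smooth_on_mult: "open S \<Longrightarrow> smooth_on S f \<Longrightarrow> smooth_on S g \<Longrightarrow> smooth_on S (\<lambda>x. f x * g x)"
  by (simp add: smooth_on_def Ck_mult)

lemma smooth_on_minus: "open S \<Longrightarrow> smooth_on S f \<Longrightarrow> smooth_on S (\<lambda>x. - f x)"
  using smooth_on_mult[OF _ smooth_on_const[of S "-1"], of f] by simp

lemma smooth_on_diff: "open S \<Longrightarrow> smooth_on S f \<Longrightarrow> smooth_on S g \<Longrightarrow> smooth_on S (\<lambda>x. f x - g x)"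
  using smooth_on_add[of S f "\<lambda>x. - g x"] smooth_on_minus[of S g] by simp

lemma smooth_on_sum:
  assumes "open S" "\<And>a. a \<in> A \<Longrightarrow> smooth_on S (f a)"
  shows "smooth_on S (\<lambda>x. \<Sum>a\<in>A. f a x)"
  using assms(2) by (induction A rule: infinite_finite_induct) (simp_all add: smooth_on_const smooth_on_add[OF assms(1)])

lemma smooth_on_prod:
  assumes "open S" "\<And>a. a \<in> A \<Longrightarrow> smooth_on S (f a)"
  shows "smooth_on S (\<lambda>x. \<Prod>a\<in>A. f a x)"
  using assms(2) by (induction A rule: infinite_finite_induct) (simp_all add: smooth_on_const smooth_on_mult[OF assms(1)])

lemma smooth_on_inverse:
  "open S \<Longrightarrow> smooth_on S f \<Longrightarrow> (\<And>x. x \<in> S \<Longrightarrow> f x \<noteq> 0) \<Longrightarrow> smooth_on S (\<lambda>x. inverse (f x))"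
  by (simp add: smooth_on_def Ck_inverse)

lemma Ck_local:
  assumes "\<And>x. x \<in> S \<Longrightarrow> \<exists>W. open W \<and> x \<in> W \<and> Ck k W f" shows "Ck k S f"
  using assms
proof (induction k arbitrary: f)
  case 0
  show ?case
  proof (simp, intro continuous_at_imp_continuous_on ballI)
    fix x assume "x \<in> S"
    then obtain W where "open W" "x \<in> W" "continuous_on W f" using 0 by auto
    then show "isCont f x" by (simp add: continuous_on_eq_continuous_at)
  qed
next
  case (Suc k)
  have "Ck k S (pd i f)" for i
  proof (rule Suc.IH)
    fix x assume "x \<in> S"
    then show "\<exists>W. open W \<and> x \<in> W \<and> Ck k W (pd i f)" using Suc.prems[of x] by auto
  qed
  moreover have "f differentiable (at x)" if "x \<in> S" for x using Suc.prems[OF that] by auto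
  ultimately show ?case by simp
qed

lemma smooth_on_local:
  "(\<And>x. x \<in> S \<Longrightarrow> \<exists>W. open W \<and> x \<in> W \<and> smooth_on W f) \<Longrightarrow> smooth_on S f"
  unfolding smooth_on_def by (metis Ck_local)

section \<open>Symmetry of second partial derivatives\<close>

lemma has_real_derivative_pd:
  fixes z :: R7
  assumes "f differentiable (at (z + s *\<^sub>R axis i 1))"
  shows "((\<lambda>s. f (z + s *\<^sub>R axis i 1)) has_real_derivative pd i f (z + s *\<^sub>R axis i 1)) (at s)"
proof -
  have "((\<lambda>s. z + s *\<^sub>R axis i 1) has_derivative (\<lambda>h. h *\<^sub>R axis i 1)) (at s)"
    by (auto intro!: derivative_eq_intros)
  note * = has_derivative_compose[OF this has_derivative_pd[OF assms]]
  have "(\<Sum>k\<in>UNIV. (h *\<^sub>R axis i 1) $ k * pd k f z') = pd i f z' * h" for h z'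
    by (simp add: axis_def if_distrib if_distribR mult.commute cong: if_cong)
  then have "(\<lambda>h. \<Sum>k\<in>UNIV. (h *\<^sub>R axis i 1) $ k * pd k f z') = (*) (pd i f z')" for z'
    by (intro ext)
  with * show ?thesis unfolding has_field_derivative_def by simp
qed

text \<open>The mean value theorem used twice: in direction i for the increment over j, then in
  direction j for the partial derivative. The intermediate point depends on the order of the two
  directions.\<close>

lemma second_difference:
  fixes x :: R7
  assumes "open S" "smooth_on S f" "h > 0"
    and sq: "\<And>s t. 0 \<le> s \<Longrightarrow> s \<le> h \<Longrightarrow> 0 \<le> t \<Longrightarrow> t \<le> h \<Longrightarrow> x + s *\<^sub>R axis i 1 + t *\<^sub>R axis j 1 \<in> S"
  shows "\<exists>s t. 0 \<le> s \<and> s \<le> h \<and> 0 \<le> t \<and> t \<le> h \<and>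
    f (x + h *\<^sub>R axis i 1 + h *\<^sub>R axis j 1) - f (x + h *\<^sub>R axis i 1) - f (x + h *\<^sub>R axis j 1) + f x
      = h * h * pd j (pd i f) (x + s *\<^sub>R axis i 1 + t *\<^sub>R axis j 1)"
proof -
  let ?ei = "axis i 1 :: R7" and ?ej = "axis j 1 :: R7"
  have d: "g differentiable (at (x + s *\<^sub>R ?ei + t *\<^sub>R ?ej))" if "smooth_on S g" "0 \<le> s" "s \<le> h" "0 \<le> t" "t \<le> h" for g s t
    using smooth_on_differentiable[OF that(1) sq[OF that(2-)]] .
  let ?g = "\<lambda>s. f ((x + h *\<^sub>R ?ej) + s *\<^sub>R ?ei) - f (x + s *\<^sub>R ?ei)"
  have "\<exists>s>0. s < h \<and> ?g h - ?g 0 = (h - 0) * (pd i f ((x + h *\<^sub>R ?ej) + s *\<^sub>R ?ei) - pd i f (x + s *\<^sub>R ?ei))"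
  proof (rule MVT2[OF assms(3)])
    fix s assume s: "0 \<le> s" "s \<le> h"
    have e: "x + s *\<^sub>R ?ei + t *\<^sub>R ?ej = (x + t *\<^sub>R ?ej) + s *\<^sub>R ?ei" for t by (simp add: ac_simps)
    show "(?g has_real_derivative pd i f ((x + h *\<^sub>R ?ej) + s *\<^sub>R ?ei) - pd i f (x + s *\<^sub>R ?ei)) (at s)"
      using d[OF assms(2) s, of h] d[OF assms(2) s, of 0] assms(3)
      by (intro DERIV_diff has_real_derivative_pd) (simp_all add: e)
  qed
  then obtain s where s: "0 < s" "s < h"
    "?g h - ?g 0 = h * (pd i f ((x + h *\<^sub>R ?ej) + s *\<^sub>R ?ei) - pd i f (x + s *\<^sub>R ?ei))" by auto
  let ?k = "\<lambda>t. pd i f ((x + s *\<^sub>R ?ei) + t *\<^sub>R ?ej)"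
  have "\<exists>t>0. t < h \<and> ?k h - ?k 0 = (h - 0) * pd j (pd i f) ((x + s *\<^sub>R ?ei) + t *\<^sub>R ?ej)"
    by (rule MVT2[OF assms(3)], rule has_real_derivative_pd, rule d[OF smooth_on_pd[OF assms(2)]]) (use s in auto)
  then obtain t where t: "0 < t" "t < h" "?k h - ?k 0 = h * pd j (pd i f) ((x + s *\<^sub>R ?ei) + t *\<^sub>R ?ej)"
    by auto
  have "?g h - ?g 0 = h * (?k h - ?k 0)" using s(3) by (simp add: ac_simps)
  then have "?g h - ?g 0 = h * h * pd j (pd i f) ((x + s *\<^sub>R ?ei) + t *\<^sub>R ?ej)" unfolding t(3) by simp
  then show ?thesis using s t by (intro exI[of _ s] exI[of _ t]) (simp add: ac_simps)
qed

text \<open>The second difference quotient is symmetric in the two directions, so in every small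
  square both mixed derivatives attain its value, at possibly different points. Continuity at x
  makes them equal.\<close>

lemma pd_commute:
  assumes S: "open S" "smooth_on S f" "x \<in> S"
  shows "pd i (pd j f) x = pd j (pd i f) x"
proof (rule ccontr)
  let ?a = "pd i (pd j f)" and ?b = "pd j (pd i f)"
  assume ne: "?a x \<noteq> ?b x"
  define e where "e = \<bar>?a x - ?b x\<bar> / 2"
  have "e > 0" using ne by (simp add: e_def)
  have "isCont ?a x" "isCont ?b x"
    using S smooth_on_continuous[OF smooth_on_pd[OF smooth_on_pd[OF S(2)]]]
    by (auto simp: continuous_on_eq_continuous_at)
  then obtain d1 d2 where d1: "d1 > 0" "\<And>y. dist y x < d1 \<Longrightarrow> dist (?a y) (?a x) < e"
    and d2: "d2 > 0" "\<And>y. dist y x < d2 \<Longrightarrow> dist (?b y) (?b x) < e"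
    using \<open>e > 0\<close> unfolding continuous_at_eps_delta by blast
  obtain d3 where d3: "d3 > 0" "\<And>y. dist y x < d3 \<Longrightarrow> y \<in> S"
    using S(1,3) unfolding open_dist by blast
  \<comment> \<open>Two displacements of length at most \<open>h\<close> stay within distance
    \<open>2 * h\<close>, so a third of the smallest radius suffices for all three
    conditions.\<close>
  define h where "h = min d1 (min d2 d3) / 3"
  have h: "h > 0" "2 * h < d1" "2 * h < d2" "2 * h < d3" using d1(1) d2(1) d3(1) by (auto simp: h_def min_def)
  have dist: "dist (x + s *\<^sub>R axis k 1 + t *\<^sub>R axis l 1) x \<le> 2 * h"
    if "0 \<le> s" "s \<le> h" "0 \<le> t" "t \<le> h" for s t and k l :: 7
  proof -
    have "dist (x + s *\<^sub>R axis k 1 + t *\<^sub>R axis l 1) x = norm (s *\<^sub>R axis k 1 + t *\<^sub>R axis l 1 :: R7)"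
      by (simp add: dist_norm add.assoc)
    also have "\<dots> \<le> norm (s *\<^sub>R axis k 1 :: R7) + norm (t *\<^sub>R axis l 1 :: R7)" by (rule norm_triangle_ineq)
    also have "\<dots> = s + t" using that by simp
    finally show ?thesis using that by simp
  qed
  have in_S: "x + s *\<^sub>R axis k 1 + t *\<^sub>R axis l 1 \<in> S"
    if "0 \<le> s" "s \<le> h" "0 \<le> t" "t \<le> h" for s t and k l :: 7
    using d3(2) dist[OF that, of k l] h by fastforce
  obtain s t where st: "0 \<le> s" "s \<le> h" "0 \<le> t" "t \<le> h"
    "f (x + h *\<^sub>R axis i 1 + h *\<^sub>R axis j 1) - f (x + h *\<^sub>R axis i 1) - f (x + h *\<^sub>R axis j 1) + f x
      = h * h * ?b (x + s *\<^sub>R axis i 1 + t *\<^sub>R axis j 1)"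
    using second_difference[OF S(1,2) h(1) in_S, of i j] by blast
  obtain s' t' where st': "0 \<le> s'" "s' \<le> h" "0 \<le> t'" "t' \<le> h"
    "f (x + h *\<^sub>R axis j 1 + h *\<^sub>R axis i 1) - f (x + h *\<^sub>R axis j 1) - f (x + h *\<^sub>R axis i 1) + f x
      = h * h * ?a (x + s' *\<^sub>R axis j 1 + t' *\<^sub>R axis i 1)"
    using second_difference[OF S(1,2) h(1) in_S, of j i] by blast
  have "h * h * ?b (x + s *\<^sub>R axis i 1 + t *\<^sub>R axis j 1) = h * h * ?a (x + s' *\<^sub>R axis j 1 + t' *\<^sub>R axis i 1)"
  proof -
    have c: "x + h *\<^sub>R axis j 1 + h *\<^sub>R axis i 1 = x + h *\<^sub>R axis i 1 + h *\<^sub>R axis j 1"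
      by (simp add: ac_simps)
    show ?thesis using st(5) st'(5) unfolding c by linarith
  qed
  then have "?b (x + s *\<^sub>R axis i 1 + t *\<^sub>R axis j 1) = ?a (x + s' *\<^sub>R axis j 1 + t' *\<^sub>R axis i 1)"
    using h by simp
  moreover have "dist (?b (x + s *\<^sub>R axis i 1 + t *\<^sub>R axis j 1)) (?b x) < e"
    using dist[OF st(1-4), of i j] h by (intro d2(2)) simp
  moreover have "dist (?a (x + s' *\<^sub>R axis j 1 + t' *\<^sub>R axis i 1)) (?a x) < e"
    using dist[OF st'(1-4), of j i] h by (intro d1(2)) simp
  ultimately show False unfolding e_def dist_real_def by (auto simp: abs_if split: if_splits)
qed

section \<open>Tensor components and covariant derivatives\<close>

lemma idx_0 [simp]: "idx 0 = {[]}" by (auto simp: idx_def)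

lemma idx_Suc: "idx (Suc n) = (\<lambda>(i, is). i # is) ` (UNIV \<times> idx n)"
  by (auto simp: idx_def length_Suc_conv image_iff)

lemma finite_idx [simp]: "finite (idx n)"
  by (induction n) (auto simp: idx_Suc)

lemma length_idx [simp]: "is \<in> idx n \<longleftrightarrow> length is = n" by (simp add: idx_def)

lemma sum_idx_Suc: "(\<Sum>is\<in>idx (Suc n). f is) = (\<Sum>\<^sub>7i. \<Sum>is\<in>idx n. f (i # is) :: 'b::comm_monoid_add)"
proof -
  have "(\<Sum>is\<in>idx (Suc n). f is) = (\<Sum>(i, is)\<in>UNIV \<times> idx n. f (i # is))"
    unfolding idx_Suc by (subst sum.reindex) (auto simp: inj_on_def case_prod_unfold)
  then show ?thesis by (simp add: sum.cartesian_product)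
qed

text \<open>The value of \<open>t\<close> on the vectors \<open>F a\<close>, in a form suited to
  induction on the index list; \<open>eval_tensor_map\<close> links it to
  \<open>eval_tensor\<close>. No condition is imposed on \<open>F\<close>, which serves for adapted
  frames, for Jacobians and for raising indices.\<close>

fun fr :: "(7 \<Rightarrow> R7) \<Rightarrow> tensor \<Rightarrow> tensor" where
  "fr F t [] = t []"
| "fr F t (a # as) = (\<Sum>\<^sub>7i. F a $ i * fr F (\<lambda>js. t (i # js)) as)"

lemma eval_tensor_Cons: "eval_tensor t (v # vs) = (\<Sum>\<^sub>7i. v $ i * eval_tensor (\<lambda>js. t (i # js)) vs)"
  unfolding eval_tensor_def length_Cons sum_idx_Suc prod.lessThan_Suc_shift nth_Cons_0 nth_Cons_Suc sum_distrib_left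
  by (simp only: mult.left_commute)

lemma eval_tensor_map: "eval_tensor t (map F is) = fr F t is"
proof (induction "is" arbitrary: t)
  case Nil
  then show ?case by (simp add: eval_tensor_def)
qed (simp add: eval_tensor_Cons)

lemma fr_cong: "(\<And>js. length js = length as \<Longrightarrow> t js = u js) \<Longrightarrow> fr F t as = fr F u as"
proof (induction as arbitrary: t u)
  case (Cons a as)
  have "fr F (\<lambda>js. t (i # js)) as = fr F (\<lambda>js. u (i # js)) as" for i
    by (rule Cons.IH) (simp add: Cons.prems)
  then show ?case by simp
qed simp

lemma fr_append: "fr F t (as @ bs) = fr F (\<lambda>is. fr F (\<lambda>js. t (is @ js)) bs) as"
  by (induction as arbitrary: t) auto

lemma fr_sum: "fr F (\<lambda>is. \<Sum>x\<in>X. f x is) as = (\<Sum>x\<in>X. fr F (f x) as)"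
proof (induction as arbitrary: f)
  case (Cons a as)
  then have "fr F (\<lambda>is. \<Sum>x\<in>X. f x is) (a # as) = (\<Sum>\<^sub>7i. \<Sum>x\<in>X. F a $ i * fr F (\<lambda>js. f x (i # js)) as)"
    by (simp add: sum_distrib_left)
  also have "\<dots> = (\<Sum>x\<in>X. fr F (f x) (a # as))" by (subst sum.swap) simp
  finally show ?case .
qed simp

lemma fr_cmult: "fr F (\<lambda>is. c * f is) as = c * fr F f as"
  by (induction as arbitrary: f) (simp_all add: sum_distrib_left ac_simps)

lemma fr_multc: "fr F (\<lambda>is. f is * c) as = fr F f as * c"
  using fr_cmult[of F c f as] by (simp add: mult.commute)

lemma fr_add: "fr F (\<lambda>is. f is + g is) as = fr F f as + fr F g as"
  by (induction as arbitrary: f g) (simp_all add: distrib_left sum.distrib)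

lemma fr_diff: "fr F (\<lambda>is. f is - g is) as = fr F f as - fr F g as"
  by (induction as arbitrary: f g) (simp_all add: right_diff_distrib sum_subtractf)

lemma fr_zero: "fr F (\<lambda>is. 0) as = 0"
  by (induction as) simp_all

lemma fr_minus: "fr F (\<lambda>is. - f is) as = - fr F f as"
  using fr_cmult[of F "-1" f as] by simp

lemma fr_swap: "fr F (\<lambda>is. fr F' (\<lambda>js. f is js) bs) as = fr F' (\<lambda>js. fr F (\<lambda>is. f is js) as) bs"
proof (induction as arbitrary: f)
  case (Cons a as)
  then have "fr F (\<lambda>is. fr F' (\<lambda>js. f is js) bs) (a # as)
     = (\<Sum>\<^sub>7i. fr F' (\<lambda>js. F a $ i * fr F (\<lambda>is. f (i # is) js) as) bs)" by (simp add: fr_cmult)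
  then show ?case by (simp add: fr_sum)
qed simp

section \<open>Contraction and its behaviour under a change of frame\<close>

fun cn :: "(7 \<Rightarrow> 7 \<Rightarrow> real) \<Rightarrow> nat \<Rightarrow> tensor \<Rightarrow> tensor \<Rightarrow> real" where
  "cn G 0 f g = f [] * g []"
| "cn G (Suc n) f g = (\<Sum>\<^sub>7k. \<Sum>\<^sub>7l. G k l * cn G n (\<lambda>ks. f (k # ks)) (\<lambda>ls. g (l # ls)))"

lemma cn_cong:
  "(\<And>ks. length ks = n \<Longrightarrow> f ks = f' ks) \<Longrightarrow> (\<And>ks. length ks = n \<Longrightarrow> g ks = g' ks) \<Longrightarrow> cn G n f g = cn G n f' g'"
proof (induction n arbitrary: f f' g g')
  case (Suc n)
  have "cn G n (\<lambda>ks. f (k # ks)) (\<lambda>ks. g (l # ks)) = cn G n (\<lambda>ks. f' (k # ks)) (\<lambda>ks. g' (l # ks))" for k l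
    by (rule Suc.IH) (simp_all add: Suc.prems)
  then show ?case by simp
qed simp

lemma cn_add1: "cn G n (\<lambda>ks. f ks + f' ks) g = cn G n f g + cn G n f' g"
  by (induction n arbitrary: f f' g) (simp_all add: distrib_left distrib_right sum.distrib)

lemma cn_add2: "cn G n f (\<lambda>ks. g ks + g' ks) = cn G n f g + cn G n f g'"
  by (induction n arbitrary: f g g') (simp_all add: distrib_left distrib_right sum.distrib)

lemma cn_cmult1: "cn G n (\<lambda>ks. c * f ks) g = c * cn G n f g"
  by (induction n arbitrary: f g) (simp_all add: sum_distrib_left ac_simps)

lemma cn_cmult2: "cn G n f (\<lambda>ks. c * g ks) = c * cn G n f g"
  by (induction n arbitrary: f g) (simp_all add: sum_distrib_left ac_simps)

lemma cn_zero1: "cn G n (\<lambda>ks. 0) g = 0" using cn_cmult1[of G n 0 "\<lambda>_. 0" g] by simp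
lemma cn_zero2: "cn G n f (\<lambda>ks. 0) = 0" using cn_cmult2[of G n f 0 "\<lambda>_. 0"] by simp

lemma cn_sum1: "finite X \<Longrightarrow> cn G n (\<lambda>ks. \<Sum>x\<in>X. f x ks) g = (\<Sum>x\<in>X. cn G n (f x) g)"
  by (induction X rule: finite_induct) (simp_all add: cn_zero1 cn_add1)

lemma cn_sum2: "finite X \<Longrightarrow> cn G n f (\<lambda>ks. \<Sum>x\<in>X. g x ks) = (\<Sum>x\<in>X. cn G n f (g x))"
  by (induction X rule: finite_induct) (simp_all add: cn_zero2 cn_add2)

lemma fr_cn1: "fr F (\<lambda>is. cn G n (f is) g) as = cn G n (\<lambda>ks. fr F (\<lambda>is. f is ks) as) g"
  by (induction n arbitrary: f g) (simp_all add: fr_multc fr_sum fr_cmult)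

lemma fr_cn2: "fr F (\<lambda>is. cn G n f (g is)) as = cn G n f (\<lambda>ks. fr F (\<lambda>is. g is ks) as)"
  by (induction n arbitrary: f g) (simp_all add: fr_cmult fr_sum)

lemma cn_transform:
  assumes G': "\<And>k l. G' k l = (\<Sum>\<^sub>7a b. G a b * (F a $ k * F b $ l))"
  shows "cn G n (fr F f) (fr F g) = cn G' n f g"
proof (induction n arbitrary: f g)
  case (Suc n)
  have "cn G (Suc n) (fr F f) (fr F g) =
      (\<Sum>\<^sub>7a b. G a b * (\<Sum>\<^sub>7k l. F a $ k * F b $ l * cn G' n (\<lambda>ks. f (k # ks)) (\<lambda>ks. g (l # ks))))"
    by (simp add: cn_sum1 cn_sum2 cn_cmult1 cn_cmult2 Suc sum_distrib_left mult.assoc)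
  also have "\<dots> = (\<Sum>\<^sub>7a b k l. G a b * (F a $ k * F b $ l) * cn G' n (\<lambda>ks. f (k # ks)) (\<lambda>ks. g (l # ks)))"
    by (simp add: sum_distrib_left ac_simps)
  also have "\<dots> = (\<Sum>\<^sub>7k l a b. G a b * (F a $ k * F b $ l) * cn G' n (\<lambda>ks. f (k # ks)) (\<lambda>ks. g (l # ks)))"
    by (rule sum_swap22)
  also have "\<dots> = cn G' (Suc n) f g" by (simp add: G' sum_distrib_right)
  finally show ?case .
qed simp

text \<open>\<open>m\<close> is the number of free indices of \<open>t\<close> and \<open>n\<close>
  the number of contracted ones: the last \<open>n\<close> of \<open>t\<close> meet the first
  \<open>n\<close> of \<open>u\<close>, with \<open>G\<close> as inverse metric. For
  \<open>n = 0\<close> this is the tensor product.\<close>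

definition ctr :: "(7 \<Rightarrow> 7 \<Rightarrow> real) \<Rightarrow> nat \<Rightarrow> nat \<Rightarrow> tensor \<Rightarrow> tensor \<Rightarrow> tensor" where
  "ctr G n m t u is = cn G n (\<lambda>ks. t (take m is @ ks)) (\<lambda>ls. u (ls @ drop m is))"

lemma ctr_append: "length as = m \<Longrightarrow> ctr G n m t u (as @ bs) = cn G n (\<lambda>ks. t (as @ ks)) (\<lambda>ls. u (ls @ bs))"
  by (simp add: ctr_def)

text \<open>Used in two ways: with \<open>G = dl\<close> for an orthonormal frame \<open>F\<close>,
  and with \<open>G\<close> and \<open>G'\<close> the inverse metrics in two charts and
  \<open>F\<close> the Jacobian between them.\<close>

lemma fr_ctr:
  assumes G': "\<And>k l. G' k l = (\<Sum>\<^sub>7a b. G a b * (F a $ k * F b $ l))" and "length as = m"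
  shows "fr F (ctr G' n m t u) (as @ bs) = ctr G n m (fr F t) (fr F u) (as @ bs)"
proof -
  have "fr F (ctr G' n m t u) (as @ bs) = fr F (\<lambda>is. fr F (\<lambda>js. cn G' n (\<lambda>ks. t (is @ ks)) (\<lambda>ls. u (ls @ js))) bs) as"
    unfolding fr_append using assms(2) by (intro fr_cong) (simp add: ctr_append)
  also have "\<dots> = cn G' n (\<lambda>ks. fr F (\<lambda>is. t (is @ ks)) as) (\<lambda>ls. fr F (\<lambda>js. u (ls @ js)) bs)"
    by (simp add: fr_cn1 fr_cn2)
  also have "\<dots> = cn G n (fr F (\<lambda>ks. fr F (\<lambda>is. t (is @ ks)) as)) (fr F (\<lambda>ls. fr F (\<lambda>js. u (ls @ js)) bs))"
    by (rule cn_transform[OF G', symmetric])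
  also have "\<dots> = cn G n (\<lambda>ks. fr F t (as @ ks)) (\<lambda>ls. fr F u (ls @ bs))"
    unfolding fr_append by (subst fr_swap) (rule refl)
  finally show ?thesis using assms(2) by (simp add: ctr_append)
qed

text \<open>An endomorphism acting as a derivation on covariant tensors. With Christoffel symbols it
  is the correction term of the covariant derivative, with the curvature it is the right-hand side
  of the Ricci identity.\<close>

definition act :: "(7 \<Rightarrow> 7 \<Rightarrow> real) \<Rightarrow> tensor \<Rightarrow> tensor" where
  "act A t is = (\<Sum>a<length is. \<Sum>\<^sub>7m. A m (is ! a) * t (is[a := m]))"

lemma act_Nil [simp]: "act A t [] = 0" by (simp add: act_def)

lemma act_Cons [simp]: "act A t (i # is) = (\<Sum>\<^sub>7m. A m i * t (m # is)) + act A (\<lambda>js. t (i # js)) is"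
  by (simp add: act_def sum.lessThan_Suc_shift del: sum.lessThan_Suc)

lemma act_append: "act A t (as @ bs) = act A (\<lambda>is. t (is @ bs)) as + act A (\<lambda>js. t (as @ js)) bs"
  by (induction as arbitrary: t) simp_all

lemma act_cong: "(\<And>js. length js = length is \<Longrightarrow> t js = u js) \<Longrightarrow> act A t is = act A u is"
  unfolding act_def by (intro sum.cong refl arg_cong2[where f = "(*)"]) simp

lemma act_sum: "act A (\<lambda>is. \<Sum>x\<in>X. f x is) js = (\<Sum>x\<in>X. act A (f x) js)"
proof -
  have "act A (\<lambda>is. \<Sum>x\<in>X. f x is) js = (\<Sum>a<length js. \<Sum>x\<in>X. \<Sum>\<^sub>7m. A m (js ! a) * f x (js[a := m]))"
    unfolding act_def sum_distrib_left by (intro sum.cong refl sum.swap)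
  then show ?thesis unfolding act_def by (subst (asm) sum.swap)
qed

lemma act_cmult: "act A (\<lambda>is. c * f is) js = c * act A f js"
  by (simp add: act_def sum_distrib_left ac_simps)

lemma act_add: "act A (\<lambda>is. f is + g is) js = act A f js + act A g js"
  by (simp add: act_def sum.distrib distrib_left)

lemma act_diff: "act A (\<lambda>is. f is - g is) js = act A f js - act A g js"
  by (simp add: act_def sum_subtractf right_diff_distrib)

lemma act_diff1: "act (\<lambda>m k. A m k - B m k) t js = act A t js - act B t js"
  by (simp add: act_def sum_subtractf left_diff_distrib)

lemma act_cmult1: "act (\<lambda>m k. c * A m k) t js = c * act A t js"
  by (simp add: act_def sum_distrib_left ac_simps)

lemma act_zero1: "act (\<lambda>m k. 0) t js = 0" by (simp add: act_def)

lemma act_sum1: "act (\<lambda>m k. \<Sum>x\<in>X. A x m k) t js = (\<Sum>x\<in>X. act (A x) t js)"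
proof -
  have "act (\<lambda>m k. \<Sum>x\<in>X. A x m k) t js = (\<Sum>a<length js. \<Sum>x\<in>X. \<Sum>\<^sub>7m. A x m (js ! a) * t (js[a := m]))"
    unfolding act_def sum_distrib_right by (intro sum.cong refl sum.swap)
  then show ?thesis unfolding act_def by (subst (asm) sum.swap)
qed

text \<open>On covariant tensors composition is reversed, hence B A - A B on the right.\<close>

lemma act_commutator:
  "act A (act B t) js - act B (act A t) js = act (\<lambda>n k. \<Sum>\<^sub>7m. B n m * A m k - A n m * B m k) t js"
proof (induction js arbitrary: t)
  case (Cons i js)
  let ?C = "\<lambda>n k. \<Sum>\<^sub>7m. B n m * A m k - A n m * B m k"
  have 1: "act A (act B t) (i # js) = (\<Sum>\<^sub>7m n. A m i * (B n m * t (n # js))) + (\<Sum>\<^sub>7m. A m i * act B (\<lambda>ks. t (m # ks)) js)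
     + ((\<Sum>\<^sub>7n. B n i * act A (\<lambda>ks. t (n # ks)) js) + act A (act B (\<lambda>ks. t (i # ks))) js)" for A B
  proof -
    have "act A (\<lambda>js. act B t (i # js)) js = (\<Sum>\<^sub>7n. B n i * act A (\<lambda>ks. t (n # ks)) js) + act A (act B (\<lambda>ks. t (i # ks))) js"
      by (simp add: act_add act_sum act_cmult)
    then show ?thesis by (simp add: distrib_left sum.distrib sum_distrib_left)
  qed
  have 2: "(\<Sum>\<^sub>7m n. A m i * (B n m * t (n # js))) = (\<Sum>\<^sub>7n m. B n m * A m i * t (n # js))" for A B
    by (subst sum.swap) (simp add: ac_simps)
  show ?case
    unfolding 1 2 using Cons[of "\<lambda>ks. t (i # ks)"]
    by (simp add: sum_distrib_right sum_subtractf left_diff_distrib)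
qed simp

lemma cov_deriv_act: "cov_deriv \<Gamma> l t x is = pd l (\<lambda>y. t y is) x - act (\<lambda>m k. \<Gamma> x m l k) (t x) is"
  by (simp add: cov_deriv_def act_def)

definition smooth_field :: "R7 set \<Rightarrow> nat \<Rightarrow> local_field \<Rightarrow> bool" where
  "smooth_field U k t \<longleftrightarrow> (\<forall>is\<in>idx k. smooth_on U (\<lambda>x. t x is))"

lemma smooth_fieldD: "smooth_field U k t \<Longrightarrow> length is = k \<Longrightarrow> smooth_on U (\<lambda>x. t x is)"
  by (simp add: smooth_field_def)

lemma smooth_on_cn:
  assumes U: "open U" and G: "\<And>k l. smooth_on U (\<lambda>y. G y k l)"
    and "\<And>ks. length ks = n \<Longrightarrow> smooth_on U (\<lambda>y. f y ks)" "\<And>ks. length ks = n \<Longrightarrow> smooth_on U (\<lambda>y. g y ks)"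
  shows "smooth_on U (\<lambda>y. cn (G y) n (f y) (g y))"
  using assms(3,4)
proof (induction n arbitrary: f g)
  case 0
  then show ?case by (simp add: smooth_on_mult[OF U])
next
  case (Suc n)
  have "smooth_on U (\<lambda>y. cn (G y) n (\<lambda>ks. f y (k # ks)) (\<lambda>ks. g y (l # ks)))" for k l
    by (rule Suc.IH) (simp_all add: Suc.prems)
  then show ?case by (simp add: smooth_on_sum[OF U] smooth_on_mult[OF U] G)
qed

lemma smooth_field_ctr:
  assumes "open U" "\<And>k l. smooth_on U (\<lambda>y. G y k l)"
    "smooth_field U (m + n) t" "smooth_field U (n + r) u"
  shows "smooth_field U (m + r) (\<lambda>y. ctr (G y) n m (t y) (u y))"
  unfolding smooth_field_def ctr_def using assms
  by (intro ballI smooth_on_cn) (simp_all add: smooth_fieldD)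

lemma smooth_on_act:
  assumes U: "open U" and "\<And>m k. smooth_on U (\<lambda>y. A y m k)" "smooth_field U (length is) t"
  shows "smooth_on U (\<lambda>y. act (A y) (t y) is)"
  unfolding act_def using assms(2,3)
  by (intro smooth_on_sum[OF U] smooth_on_mult[OF U]) (simp_all add: smooth_fieldD)

lemma act_cn1: "act A (\<lambda>is. cn G n (f is) g) as = cn G n (\<lambda>ks. act A (\<lambda>is. f is ks) as) g"
proof -
  have m: "act A (\<lambda>is. f is * c) as = act A f as * c" for f c as
    using act_cmult[of A c f as] by (simp add: mult.commute)
  show ?thesis by (induction n arbitrary: f g) (simp_all add: m act_sum act_cmult)
qed

lemma act_cn2: "act A (\<lambda>is. cn G n f (g is)) as = cn G n f (\<lambda>ks. act A (\<lambda>is. g is ks) as)"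
  by (induction n arbitrary: f g) (simp_all add: act_sum act_cmult)

lemma differentiable_cn:
  assumes "\<And>k l. (\<lambda>y. G y k l) differentiable (at x)"
    "\<And>ks. length ks = n \<Longrightarrow> (\<lambda>y. f y ks) differentiable (at x)"
    "\<And>ks. length ks = n \<Longrightarrow> (\<lambda>y. g y ks) differentiable (at x)"
  shows "(\<lambda>y. cn (G y) n (f y) (g y)) differentiable (at x)"
  using assms(2,3)
proof (induction n arbitrary: f g)
  case (Suc n)
  have "(\<lambda>y. cn (G y) n (\<lambda>ks. f y (k # ks)) (\<lambda>ks. g y (l # ks))) differentiable (at x)" for k l
    by (rule Suc.IH) (simp_all add: Suc.prems)
  then show ?case by (simp add: assms(1) differentiable_sum differentiable_mult)
qed (simp add: differentiable_mult)

text \<open>The hypothesis on \<open>pd i G\<close> says that \<open>G\<close> is parallel for the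
  connection matrix \<open>A\<close>. The two terms that it produces are exactly those that turn the
  derivatives of \<open>f\<close> and \<open>g\<close> into covariant ones.\<close>

lemma pd_cn:
  assumes dG: "\<And>k l. (\<lambda>y. G y k l) differentiable (at x)"
    and G': "\<And>k l. pd i (\<lambda>y. G y k l) x = - (\<Sum>\<^sub>7m. A k m * G x m l) - (\<Sum>\<^sub>7m. A l m * G x k m)"
    and "\<And>ks. length ks = n \<Longrightarrow> (\<lambda>y. f y ks) differentiable (at x)"
    and "\<And>ks. length ks = n \<Longrightarrow> (\<lambda>y. g y ks) differentiable (at x)"
  shows "pd i (\<lambda>y. cn (G y) n (f y) (g y)) x =
    cn (G x) n (\<lambda>ks. pd i (\<lambda>y. f y ks) x - act A (f x) ks) (g x)
    + cn (G x) n (f x) (\<lambda>ks. pd i (\<lambda>y. g y ks) x - act A (g x) ks)"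
  using assms(3,4)
proof (induction n arbitrary: f g)
  case 0
  then show ?case by (simp add: pd_mult)
next
  case (Suc n)
  let ?N = "\<lambda>k l. cn (G x) n (\<lambda>ks. f x (k # ks)) (\<lambda>ks. g x (l # ks))"
  let ?f = "\<lambda>ks. pd i (\<lambda>y. f y ks) x - act A (f x) ks" and ?g = "\<lambda>ks. pd i (\<lambda>y. g y ks) x - act A (g x) ks"
  have d: "(\<lambda>y. cn (G y) n (\<lambda>ks. f y (k # ks)) (\<lambda>ks. g y (l # ks))) differentiable (at x)" for k l
    by (rule differentiable_cn[OF dG]) (simp_all add: Suc.prems)
  have IH: "pd i (\<lambda>y. cn (G y) n (\<lambda>ks. f y (k # ks)) (\<lambda>ks. g y (l # ks))) x =
     cn (G x) n (\<lambda>ks. ?f (k # ks)) (\<lambda>ks. g x (l # ks)) + (\<Sum>\<^sub>7m. A m k * ?N m l)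
     + (cn (G x) n (\<lambda>ks. f x (k # ks)) (\<lambda>ks. ?g (l # ks)) + (\<Sum>\<^sub>7m. A m l * ?N k m))" for k l
  proof -
    have s1: "(\<lambda>ks. pd i (\<lambda>y. f y (k # ks)) x - act A (\<lambda>ks. f x (k # ks)) ks)
      = (\<lambda>ks. ?f (k # ks) + (\<Sum>\<^sub>7m. A m k * f x (m # ks)))" by (rule ext) simp
    have s2: "(\<lambda>ks. pd i (\<lambda>y. g y (l # ks)) x - act A (\<lambda>ks. g x (l # ks)) ks)
      = (\<lambda>ks. ?g (l # ks) + (\<Sum>\<^sub>7m. A m l * g x (m # ks)))" by (rule ext) simp
    have "pd i (\<lambda>y. cn (G y) n (\<lambda>ks. f y (k # ks)) (\<lambda>ks. g y (l # ks))) x =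
      cn (G x) n (\<lambda>ks. pd i (\<lambda>y. f y (k # ks)) x - act A (\<lambda>ks. f x (k # ks)) ks) (\<lambda>ks. g x (l # ks))
      + cn (G x) n (\<lambda>ks. f x (k # ks)) (\<lambda>ks. pd i (\<lambda>y. g y (l # ks)) x - act A (\<lambda>ks. g x (l # ks)) ks)"
      by (rule Suc.IH) (simp_all add: Suc.prems)
    then show ?thesis
      unfolding s1 s2 cn_add1 cn_add2 by (simp only: cn_sum1 cn_sum2 finite cn_cmult1 cn_cmult2)
  qed
  have "pd i (\<lambda>y. cn (G y) (Suc n) (f y) (g y)) x = (\<Sum>\<^sub>7k l.
     pd i (\<lambda>y. G y k l) x * ?N k l + G x k l * pd i (\<lambda>y. cn (G y) n (\<lambda>ks. f y (k # ks)) (\<lambda>ks. g y (l # ks))) x)"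
    using d dG by (simp add: pd_sum pd_mult differentiable_sum differentiable_mult)
  also have "\<dots> = (\<Sum>\<^sub>7k l. G x k l * cn (G x) n (\<lambda>ks. ?f (k # ks)) (\<lambda>ks. g x (l # ks)))
     + (\<Sum>\<^sub>7k l. G x k l * cn (G x) n (\<lambda>ks. f x (k # ks)) (\<lambda>ks. ?g (l # ks)))
     + (\<Sum>\<^sub>7k l m. G x k l * A m k * ?N m l) + (\<Sum>\<^sub>7k l m. G x k l * A m l * ?N k m)
     - (\<Sum>\<^sub>7k l m. A k m * G x m l * ?N k l) - (\<Sum>\<^sub>7k l m. A l m * G x k m * ?N k l)"
    unfolding IH G'
    by (simp add: distrib_left distrib_right left_diff_distrib sum.distrib sum_subtractf sum_distrib_left sum_distrib_right sum_negf mult.assoc)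
  also have "(\<Sum>\<^sub>7k l m. G x k l * A m k * ?N m l) = (\<Sum>\<^sub>7k l m. A k m * G x m l * ?N k l)"
  proof -
    have "(\<Sum>\<^sub>7k l m. G x k l * A m k * ?N m l) = (\<Sum>\<^sub>7m k l. G x k l * A m k * ?N m l)" by (rule sum_rot3[symmetric])
    also have "\<dots> = (\<Sum>\<^sub>7m l k. G x k l * A m k * ?N m l)" by (intro sum.cong refl sum.swap)
    finally show ?thesis by (simp add: mult.commute)
  qed
  also have "(\<Sum>\<^sub>7k l m. G x k l * A m l * ?N k m) = (\<Sum>\<^sub>7k l m. A l m * G x k m * ?N k l)"
  proof -
    have "(\<Sum>\<^sub>7k l m. G x k l * A m l * ?N k m) = (\<Sum>\<^sub>7k m l. G x k l * A m l * ?N k m)" by (intro sum.cong refl sum.swap)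
    then show ?thesis by (simp add: mult.commute)
  qed
  finally show ?case by simp
qed

text \<open>The derivative index becomes the first index, so that the result is again a tensor field
  in the same encoding and the operation can be iterated.\<close>

definition nabt :: "christoffel \<Rightarrow> local_field \<Rightarrow> local_field" where
  "nabt \<Gamma> t x is = cov_deriv \<Gamma> (hd is) t x (tl is)"

lemma nabt_Cons [simp]: "nabt \<Gamma> t x (l # is) = cov_deriv \<Gamma> l t x is"
  by (simp add: nabt_def)

lemma smooth_field_nabt:
  assumes U: "open U" and "\<And>k i j. smooth_on U (\<lambda>x. \<Gamma> x k i j)" "smooth_field U k t"
  shows "smooth_field U (Suc k) (nabt \<Gamma> t)"
  unfolding smooth_field_def nabt_def cov_deriv_act using assms(2,3)
  by (auto intro!: smooth_on_diff[OF U] smooth_on_pd smooth_on_act[OF U] simp: smooth_fieldD)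

lemma cov_deriv_ctr:
  assumes U: "open U" "x \<in> U" and G: "\<And>k l. smooth_on U (\<lambda>y. G y k l)"
    and G': "\<And>k l. pd i (\<lambda>y. G y k l) x = - (\<Sum>\<^sub>7m. \<Gamma> x k i m * G x m l) - (\<Sum>\<^sub>7m. \<Gamma> x l i m * G x k m)"
    and t: "smooth_field U (m + n) t" and u: "smooth_field U (n + r) u" and len: "length is = m + r"
  shows "cov_deriv \<Gamma> i (\<lambda>y. ctr (G y) n m (t y) (u y)) x is =
    ctr (G x) n m (cov_deriv \<Gamma> i t x) (u x) is + ctr (G x) n m (t x) (cov_deriv \<Gamma> i u x) is"
proof -
  define as bs where "as = take m is" and "bs = drop m is"
  have ab: "is = as @ bs" "length as = m" "length bs = r" using len by (auto simp: as_def bs_def)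
  let ?A = "\<lambda>m k. \<Gamma> x m i k"
  have "pd i (\<lambda>y. ctr (G y) n m (t y) (u y) is) x =
     cn (G x) n (\<lambda>ks. pd i (\<lambda>y. t y (as @ ks)) x - act ?A (\<lambda>ks. t x (as @ ks)) ks) (\<lambda>ls. u x (ls @ bs))
     + cn (G x) n (\<lambda>ks. t x (as @ ks)) (\<lambda>ls. pd i (\<lambda>y. u y (ls @ bs)) x - act ?A (\<lambda>ls. u x (ls @ bs)) ls)"
    unfolding ab(1) ctr_append[OF ab(2)]
  proof (rule pd_cn)
    fix ks :: "7 list" assume "length ks = n"
    then show "(\<lambda>y. t y (as @ ks)) differentiable at x" "(\<lambda>y. u y (ks @ bs)) differentiable at x"
      using ab by (auto intro!: smooth_on_differentiable[OF _ U(2)] smooth_fieldD[OF t] smooth_fieldD[OF u])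
  qed (use G' smooth_on_differentiable[OF G U(2)] in auto)
  moreover have "act ?A (ctr (G x) n m (t x) (u x)) is =
     cn (G x) n (\<lambda>ks. act ?A (\<lambda>as. t x (as @ ks)) as) (\<lambda>ls. u x (ls @ bs))
     + cn (G x) n (\<lambda>ks. t x (as @ ks)) (\<lambda>ls. act ?A (\<lambda>bs. u x (ls @ bs)) bs)"
  proof -
    have "act ?A (\<lambda>as. ctr (G x) n m (t x) (u x) (as @ bs)) as
        = act ?A (\<lambda>as. cn (G x) n (\<lambda>ks. t x (as @ ks)) (\<lambda>ls. u x (ls @ bs))) as"
      by (rule act_cong) (simp add: ab ctr_append)
    then show ?thesis unfolding ab(1) act_append by (simp add: ctr_append ab act_cn1 act_cn2)
  qed
  moreover have "(\<lambda>ks. pd i (\<lambda>y. t y (as @ ks)) x - act ?A (\<lambda>ks. t x (as @ ks)) ks)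
     = (\<lambda>ks. cov_deriv \<Gamma> i t x (as @ ks) + act ?A (\<lambda>as. t x (as @ ks)) as)"
    "(\<lambda>ls. pd i (\<lambda>y. u y (ls @ bs)) x - act ?A (\<lambda>ls. u x (ls @ bs)) ls)
     = (\<lambda>ls. cov_deriv \<Gamma> i u x (ls @ bs) + act ?A (\<lambda>bs. u x (ls @ bs)) bs)"
    by (auto simp: cov_deriv_act act_append)
  ultimately show ?thesis
    unfolding cov_deriv_act[of \<Gamma> i "\<lambda>y. ctr (G y) n m (t y) (u y)"] by (simp add: ab ctr_append cn_add1 cn_add2)
qed

section \<open>Curvature and the Ricci identity\<close>

lemma pd_act:
  assumes "\<And>m k. (\<lambda>y. A y m k) differentiable (at x)"
    "\<And>js. length js = length is \<Longrightarrow> (\<lambda>y. t y js) differentiable (at x)"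
  shows "pd i (\<lambda>y. act (A y) (t y) is) x =
    act (\<lambda>m k. pd i (\<lambda>y. A y m k) x) (t x) is + act (A x) (\<lambda>js. pd i (\<lambda>y. t y js) x) is"
  unfolding act_def using assms
  by (simp add: pd_sum pd_mult differentiable_sum differentiable_mult sum.distrib)

definition riem :: "christoffel \<Rightarrow> 7 \<Rightarrow> 7 \<Rightarrow> R7 \<Rightarrow> 7 \<Rightarrow> 7 \<Rightarrow> real" where
  "riem \<Gamma> i j x n k = pd i (\<lambda>y. \<Gamma> y n j k) x - pd j (\<lambda>y. \<Gamma> y n i k) x
     + (\<Sum>\<^sub>7m. \<Gamma> x n i m * \<Gamma> x m j k - \<Gamma> x n j m * \<Gamma> x m i k)"

text \<open>The second partial derivatives cancel by \<open>pd_commute\<close>, and the mixed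
  first-order terms cancel in pairs. Products of Christoffel symbols combine through
  \<open>act_commutator\<close> into the curvature; the derivative index itself contributes the
  torsion term.\<close>

lemma ricci_identity:
  assumes U: "open U" "x \<in> U" and \<Gamma>: "\<And>k i j. smooth_on U (\<lambda>x. \<Gamma> x k i j)"
    and t: "smooth_field U (length is) t"
  shows "nabt \<Gamma> (nabt \<Gamma> t) x (i # j # is) - nabt \<Gamma> (nabt \<Gamma> t) x (j # i # is)
    = - act (riem \<Gamma> i j x) (t x) is - (\<Sum>\<^sub>7m. (\<Gamma> x m i j - \<Gamma> x m j i) * cov_deriv \<Gamma> m t x is)"
proof -
  let ?A = "\<lambda>i m k. \<Gamma> x m i k"
  have d\<Gamma>: "(\<lambda>y. \<Gamma> y m i k) differentiable (at x)" for m i k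
    using smooth_on_differentiable[OF \<Gamma> U(2)] .
  have dt: "(\<lambda>y. t y js) differentiable (at x)" "(\<lambda>y. pd i (\<lambda>y. t y js) y) differentiable (at x)"
    if "length js = length is" for js i
    using smooth_on_differentiable[OF _ U(2)] smooth_on_pd smooth_fieldD[OF t that] by blast+
  have 1: "nabt \<Gamma> (nabt \<Gamma> t) x (i # j # is) = pd i (pd j (\<lambda>y. t y is)) x
      - act (\<lambda>m k. pd i (\<lambda>y. \<Gamma> y m j k) x) (t x) is - act (?A j) (\<lambda>js. pd i (\<lambda>y. t y js) x) is
      - (\<Sum>\<^sub>7m. \<Gamma> x m i j * cov_deriv \<Gamma> m t x is)
      - act (?A i) (\<lambda>js. pd j (\<lambda>y. t y js) x) is + act (?A i) (act (?A j) (t x)) is" for i j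
  proof -
    have "pd i (\<lambda>y. cov_deriv \<Gamma> j t y is) x = pd i (pd j (\<lambda>y. t y is)) x
       - pd i (\<lambda>y. act (\<lambda>m k. \<Gamma> y m j k) (t y) is) x"
      unfolding cov_deriv_act
      by (rule pd_diff) (use dt smooth_on_differentiable[OF smooth_on_act[OF U(1) \<Gamma> t] U(2)] in auto)
    also have "pd i (\<lambda>y. act (\<lambda>m k. \<Gamma> y m j k) (t y) is) x = act (\<lambda>m k. pd i (\<lambda>y. \<Gamma> y m j k) x) (t x) is
       + act (?A j) (\<lambda>js. pd i (\<lambda>y. t y js) x) is"
      by (rule pd_act) (use d\<Gamma> dt in auto)
    finally have 2: "pd i (\<lambda>y. cov_deriv \<Gamma> j t y is) x = pd i (pd j (\<lambda>y. t y is)) x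
       - (act (\<lambda>m k. pd i (\<lambda>y. \<Gamma> y m j k) x) (t x) is + act (?A j) (\<lambda>js. pd i (\<lambda>y. t y js) x) is)" .
    have "nabt \<Gamma> (nabt \<Gamma> t) x (i # j # is) = pd i (\<lambda>y. cov_deriv \<Gamma> j t y is) x
       - (\<Sum>\<^sub>7m. \<Gamma> x m i j * cov_deriv \<Gamma> m t x is) - act (?A i) (cov_deriv \<Gamma> j t x) is"
      by (simp add: cov_deriv_act[of \<Gamma> i "nabt \<Gamma> t"])
    moreover have "act (?A i) (cov_deriv \<Gamma> j t x) is = act (?A i) (\<lambda>js. pd j (\<lambda>y. t y js) x) is - act (?A i) (act (?A j) (t x)) is"
    proof -
      have "cov_deriv \<Gamma> j t x = (\<lambda>js. pd j (\<lambda>y. t y js) x - act (?A j) (t x) js)"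
        by (rule ext) (rule cov_deriv_act)
      then show ?thesis by (simp add: act_diff)
    qed
    ultimately show ?thesis using 2 by simp
  qed
  have 3: "act (riem \<Gamma> i j x) (t x) is = act (\<lambda>m k. pd i (\<lambda>y. \<Gamma> y m j k) x) (t x) is
     - act (\<lambda>m k. pd j (\<lambda>y. \<Gamma> y m i k) x) (t x) is
     - act (\<lambda>n k. \<Sum>\<^sub>7m. \<Gamma> x n j m * \<Gamma> x m i k - \<Gamma> x n i m * \<Gamma> x m j k) (t x) is"
    unfolding act_diff1[symmetric]
    by (rule arg_cong[where f = "\<lambda>A. act A (t x) is"]) (simp add: riem_def fun_eq_iff sum_subtractf)
  have "pd i (pd j (\<lambda>y. t y is)) x = pd j (pd i (\<lambda>y. t y is)) x"
    by (rule pd_commute[OF U(1) _ U(2)]) (rule smooth_fieldD[OF t refl])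
  then show ?thesis
    unfolding 1 3 using act_commutator[of "?A i" "?A j" "t x" "is"]
    by (simp add: left_diff_distrib sum_subtractf)
qed

section \<open>Determinants and inverses of matrix-valued functions\<close>

lemma smooth_on_det:
  assumes "open U" "\<And>i j. smooth_on U (\<lambda>x. A x $ i $ j)"
  shows "smooth_on U (\<lambda>x. det (A x :: real^7^7))"
  unfolding det_def by (intro smooth_on_sum smooth_on_mult smooth_on_prod smooth_on_const assms)

lemma matrix_inv_left_right:
  fixes A :: "real^'n^'n"
  assumes "invertible A"
  shows "A ** matrix_inv A = mat 1" "matrix_inv A ** A = mat 1"
  using someI_ex[OF assms[unfolded invertible_def]] by (simp_all add: matrix_inv_def)

lemma matrix_inv_cramer:
  fixes A :: "real^'n^'n"
  assumes "det A \<noteq> 0"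
  shows "matrix_inv A $ k $ l = det (\<chi> i j. if j = k then axis l 1 $ i else A $ i $ j) / det A"
proof -
  have "A ** matrix_inv A = mat 1" using assms by (simp add: matrix_inv_left_right invertible_det_nz)
  then have "A *v (matrix_inv A *v axis l 1) = axis l 1" by (simp add: matrix_vector_mul_assoc)
  then have "matrix_inv A *v axis l 1 = (\<chi> k. det (\<chi> i j. if j = k then axis l 1 $ i else A $ i $ j) / det A)"
    using cramer[OF assms] by blast
  moreover have "(matrix_inv A *v axis l 1) $ k = matrix_inv A $ k $ l"
    by (simp add: matrix_vector_mult_def axis_def if_distrib cong: if_cong)
  ultimately show ?thesis by simp
qed

lemma smooth_on_matrix_inv:
  assumes U: "open U" and A: "\<And>i j. smooth_on U (\<lambda>x. A x $ i $ j)" and nz: "\<And>x. x \<in> U \<Longrightarrow> det (A x :: real^7^7) \<noteq> 0"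
  shows "smooth_on U (\<lambda>x. matrix_inv (A x) $ k $ l)"
proof (rule smooth_on_cong[OF U])
  have "smooth_on U (\<lambda>x. (\<chi> i j. if j = k then axis l 1 $ i else A x $ i $ j) $ i $ j)" for i j
    by (cases "j = k") (simp_all add: smooth_on_const A)
  then show "smooth_on U (\<lambda>x. det (\<chi> i j. if j = k then axis l 1 $ i else A x $ i $ j) * inverse (det (A x)))"
    by (intro smooth_on_mult[OF U] smooth_on_det[OF U] smooth_on_inverse[OF U] A nz)
qed (simp add: matrix_inv_cramer nz divide_inverse)

lemma pd_prod:
  assumes "finite I" "\<And>a. a \<in> I \<Longrightarrow> f a differentiable (at x)"
  shows "pd i (\<lambda>y. \<Prod>a\<in>I. f a y) x = (\<Sum>r\<in>I. pd i (f r) x * (\<Prod>a\<in>I - {r}. f a x))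
    \<and> (\<lambda>y. \<Prod>a\<in>I. f a y) differentiable (at x)"
  using assms
proof (induction I)
  case (insert a I)
  have "(\<Prod>b\<in>insert a I - {r}. f b x) = f a x * (\<Prod>b\<in>I - {r}. f b x)" if "r \<in> I" for r
  proof -
    have "insert a I - {r} = insert a (I - {r})" using that insert.hyps by auto
    then show ?thesis using insert.hyps by simp
  qed
  then show ?case
    using insert by (auto simp: pd_mult differentiable_mult sum_distrib_left ac_simps intro!: sum.cong)
qed simp

lemma pd_det:
  fixes A :: "R7 \<Rightarrow> real^7^7"
  assumes "\<And>i j. (\<lambda>y. A y $ i $ j) differentiable (at x)"
  shows "pd l (\<lambda>y. det (A y)) x =
    (\<Sum>\<^sub>7r. det (\<chi> a. if a = r then (\<chi> b. pd l (\<lambda>y. A y $ r $ b) x) else A x $ a))"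
proof -
  let ?S = "{p. p permutes (UNIV::7 set)}"
  have "pd l (\<lambda>y. det (A y)) x = (\<Sum>p\<in>?S. pd l (\<lambda>y. of_int (sign p) * (\<Prod>a\<in>UNIV. A y $ a $ p a)) x)"
    unfolding det_def using assms by (intro pd_sum differentiable_mult) (simp_all add: pd_prod)
  also have "\<dots> = (\<Sum>p\<in>?S. \<Sum>\<^sub>7r. of_int (sign p) * (pd l (\<lambda>y. A y $ r $ p r) x * (\<Prod>a\<in>UNIV - {r}. A x $ a $ p a)))"
    using assms by (intro sum.cong refl) (simp add: pd_cmult pd_prod sum_distrib_left)
  also have "\<dots> = (\<Sum>\<^sub>7r. \<Sum>p\<in>?S. of_int (sign p) * (pd l (\<lambda>y. A y $ r $ p r) x * (\<Prod>a\<in>UNIV - {r}. A x $ a $ p a)))"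
    by (rule sum.swap)
  also have "\<dots> = (\<Sum>\<^sub>7r. det (\<chi> a. if a = r then (\<chi> b. pd l (\<lambda>y. A y $ r $ b) x) else A x $ a))"
    unfolding det_def
  proof (intro sum.cong refl arg_cong2[where f = "(*)"])
    fix r :: 7 and p
    show "pd l (\<lambda>y. A y $ r $ p r) x * (\<Prod>a\<in>UNIV - {r}. A x $ a $ p a) =
      (\<Prod>i\<in>UNIV. (\<chi> a. if a = r then \<chi> b. pd l (\<lambda>y. A y $ r $ b) x else A x $ a) $ i $ p i)"
      by (subst prod.remove[of UNIV r]) (auto intro!: prod.cong)
  qed
  finally show ?thesis .
qed

lemma det_row_combination:
  fixes A :: "real^'n^'n"
  shows "det (\<chi> a. if a = r then (\<Sum>m\<in>UNIV. c m *s A $ m) else A $ a) = c r * det A"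
proof -
  have "det (\<chi> a. if a = r then (\<Sum>m\<in>UNIV. c m *s A $ m) else A $ a)
      = (\<Sum>m\<in>UNIV. c m * det (\<chi> a. if a = r then A $ m else A $ a))"
    by (simp add: det_linear_row_sum det_row_mul[symmetric])
  also have "\<dots> = (\<Sum>m\<in>UNIV. if m = r then c r * det A else 0)"
  proof (intro sum.cong refl)
    fix m
    have "det (\<chi> a. if a = r then A $ m else A $ a) = 0" if "m \<noteq> r"
      using that by (intro det_identical_rows[of m r]) (auto simp: row_def vec_eq_iff)
    moreover have "(\<chi> a. if a = r then A $ r else A $ a) = A" by (auto simp: vec_eq_iff)
    ultimately show "c m * det (\<chi> a. if a = r then A $ m else A $ a) = (if m = r then c r * det A else 0)" by auto
  qed
  finally show ?thesis by simp
qed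

text \<open>Jacobi's formula for a matrix whose derivative is c A. Replacing row r by a combination
  of all rows leaves only the diagonal coefficient, since every other row is then repeated.\<close>

lemma pd_det_linear:
  fixes A :: "R7 \<Rightarrow> real^7^7"
  assumes "\<And>i j. (\<lambda>y. A y $ i $ j) differentiable (at x)"
    and "\<And>i j. pd l (\<lambda>y. A y $ i $ j) x = (\<Sum>\<^sub>7m. c i m * A x $ m $ j)"
  shows "pd l (\<lambda>y. det (A y)) x = (\<Sum>\<^sub>7r. c r r) * det (A x)"
proof -
  have "(\<chi> b. pd l (\<lambda>y. A y $ r $ b) x) = (\<Sum>\<^sub>7m. c r m *s A x $ m)" for r
    by (simp add: vec_eq_iff assms(2))
  then show ?thesis
    unfolding pd_det[OF assms(1)] by (simp only: det_row_combination sum_distrib_right)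
qed

section \<open>Metric connections with skew torsion\<close>

text \<open>\<open>torsion_skew\<close> is skewness of the lowered torsion in its last two indices.
  Skewness in the first two holds by construction, so the torsion is a 3-form.\<close>

locale metric_chart =
  fixes U :: "R7 set" and gm :: "R7 \<Rightarrow> real^7^7" and \<Gamma> :: christoffel
  assumes open_U: "open U"
    and gm_smooth: "\<And>i j. smooth_on U (\<lambda>x. gm x $ i $ j)"
    and gm_sym: "\<And>x i j. x \<in> U \<Longrightarrow> gm x $ i $ j = gm x $ j $ i"
    and gm_det: "\<And>x. x \<in> U \<Longrightarrow> det (gm x) > 0"
    and \<Gamma>_smooth: "\<And>k i j. smooth_on U (\<lambda>x. \<Gamma> x k i j)"
    and gm_parallel: "\<And>x l i j. x \<in> U \<Longrightarrow> pd l (\<lambda>y. gm y $ i $ j) x =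
       (\<Sum>\<^sub>7m. \<Gamma> x m l i * gm x $ m $ j) + (\<Sum>\<^sub>7m. \<Gamma> x m l j * gm x $ i $ m)"
    and torsion_skew: "\<And>x i j k. x \<in> U \<Longrightarrow>
       (\<Sum>\<^sub>7m. (\<Gamma> x m i k - \<Gamma> x m k i) * gm x $ m $ j) = - (\<Sum>\<^sub>7m. (\<Gamma> x m i j - \<Gamma> x m j i) * gm x $ m $ k)"
begin

definition G :: "R7 \<Rightarrow> 7 \<Rightarrow> 7 \<Rightarrow> real" where "G x k l = matrix_inv (gm x) $ k $ l"

definition T :: local_field where
  "T x is = (\<Sum>\<^sub>7m. (\<Gamma> x m (is ! 0) (is ! 1) - \<Gamma> x m (is ! 1) (is ! 0)) * gm x $ m $ (is ! 2))"

lemma G_smooth: "smooth_on U (\<lambda>x. G x k l)"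
  unfolding G_def by (rule smooth_on_matrix_inv[OF open_U gm_smooth]) (use gm_det in force)

lemma G_gm: "x \<in> U \<Longrightarrow> (\<Sum>\<^sub>7m. G x k m * gm x $ m $ l) = dl k l"
  and gm_G: "x \<in> U \<Longrightarrow> (\<Sum>\<^sub>7m. gm x $ k $ m * G x m l) = dl k l"
proof -
  assume "x \<in> U"
  then have "invertible (gm x)" using gm_det[of x] by (simp add: invertible_det_nz)
  then have "matrix_inv (gm x) ** gm x = mat 1" "gm x ** matrix_inv (gm x) = mat 1"
    by (simp_all add: matrix_inv_left_right)
  then show "(\<Sum>\<^sub>7m. G x k m * gm x $ m $ l) = dl k l" "(\<Sum>\<^sub>7m. gm x $ k $ m * G x m l) = dl k l"
    by (simp_all add: G_def dl_def matrix_matrix_mult_def mat_def vec_eq_iff)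
qed

lemma G_sym: assumes "x \<in> U" shows "G x k l = G x l k"
proof -
  have "G x k l = (\<Sum>\<^sub>7m. G x k m * (\<Sum>\<^sub>7n. gm x $ m $ n * G x l n))"
  proof -
    have "(\<Sum>\<^sub>7n. gm x $ m $ n * G x l n) = dl l m" for m
      using G_gm[OF assms, of l m] by (simp add: gm_sym[OF assms, of m] mult.commute)
    then show ?thesis by simp
  qed
  also have "\<dots> = (\<Sum>\<^sub>7m n. G x k m * gm x $ m $ n * G x l n)" by (simp add: sum_distrib_left mult.assoc)
  also have "\<dots> = (\<Sum>\<^sub>7n m. G x k m * gm x $ m $ n * G x l n)" by (rule sum.swap)
  also have "\<dots> = G x l k" by (simp add: G_gm[OF assms] flip: sum_distrib_right)
  finally show ?thesis .
qed

lemma diff_gm: "x \<in> U \<Longrightarrow> (\<lambda>y. gm y $ i $ j) differentiable (at x)"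
  by (rule smooth_on_differentiable[OF gm_smooth])

lemma diff_G: "x \<in> U \<Longrightarrow> (\<lambda>y. G y i j) differentiable (at x)"
  by (rule smooth_on_differentiable[OF G_smooth])

lemma diff_\<Gamma>: "x \<in> U \<Longrightarrow> (\<lambda>y. \<Gamma> y k i j) differentiable (at x)"
  by (rule smooth_on_differentiable[OF \<Gamma>_smooth])

text \<open>Obtained by differentiating G g = 1 and inserting that g is parallel; the Christoffel
  symbols act with the opposite sign on upper indices.\<close>

lemma G_parallel:
  assumes x: "x \<in> U"
  shows "pd i (\<lambda>y. G y k l) x = - (\<Sum>\<^sub>7m. \<Gamma> x k i m * G x m l) - (\<Sum>\<^sub>7m. \<Gamma> x l i m * G x k m)"
proof -
  have 1: "(\<Sum>\<^sub>7m. pd i (\<lambda>y. G y k m) x * gm x $ m $ p) = - (\<Sum>\<^sub>7n. (\<Sum>\<^sub>7m. \<Gamma> x n i m * G x k m) * gm x $ n $ p) - \<Gamma> x k i p" for p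
  proof -
    have "0 = pd i (\<lambda>y. \<Sum>\<^sub>7m. G y k m * gm y $ m $ p) x"
      using pd_cong[OF open_U x, of "\<lambda>y. \<Sum>\<^sub>7m. G y k m * gm y $ m $ p" "\<lambda>_. dl k p" i] by (simp add: G_gm)
    also have "\<dots> = (\<Sum>\<^sub>7m. pd i (\<lambda>y. G y k m) x * gm x $ m $ p) + (\<Sum>\<^sub>7m. G x k m * pd i (\<lambda>y. gm y $ m $ p) x)"
      using diff_gm[OF x] diff_G[OF x] by (simp add: pd_sum pd_mult differentiable_mult sum.distrib)
    also have "(\<Sum>\<^sub>7m. G x k m * pd i (\<lambda>y. gm y $ m $ p) x)
      = (\<Sum>\<^sub>7m n. G x k m * (\<Gamma> x n i m * gm x $ n $ p)) + (\<Sum>\<^sub>7m n. G x k m * gm x $ m $ n * \<Gamma> x n i p)"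
      by (simp add: gm_parallel[OF x] distrib_left sum.distrib sum_distrib_left ac_simps)
    also have "(\<Sum>\<^sub>7m n. G x k m * gm x $ m $ n * \<Gamma> x n i p) = (\<Sum>\<^sub>7n m. G x k m * gm x $ m $ n * \<Gamma> x n i p)"
      by (rule sum.swap)
    also have "\<dots> = \<Gamma> x k i p" by (simp add: G_gm[OF x] flip: sum_distrib_right)
    also have "(\<Sum>\<^sub>7m n. G x k m * (\<Gamma> x n i m * gm x $ n $ p)) = (\<Sum>\<^sub>7n m. G x k m * (\<Gamma> x n i m * gm x $ n $ p))"
      by (rule sum.swap)
    finally show ?thesis by (simp add: sum_distrib_left sum_distrib_right ac_simps)
  qed
  have "pd i (\<lambda>y. G y k l) x = (\<Sum>\<^sub>7p. (\<Sum>\<^sub>7m. pd i (\<lambda>y. G y k m) x * gm x $ m $ p) * G x p l)"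
  proof -
    have "(\<Sum>\<^sub>7p. (\<Sum>\<^sub>7m. pd i (\<lambda>y. G y k m) x * gm x $ m $ p) * G x p l)
      = (\<Sum>\<^sub>7p m. pd i (\<lambda>y. G y k m) x * (gm x $ m $ p * G x p l))" by (simp add: sum_distrib_right mult.assoc)
    also have "\<dots> = (\<Sum>\<^sub>7m p. pd i (\<lambda>y. G y k m) x * (gm x $ m $ p * G x p l))" by (rule sum.swap)
    also have "\<dots> = pd i (\<lambda>y. G y k l) x" by (simp add: gm_G[OF x] flip: sum_distrib_left)
    finally show ?thesis by simp
  qed
  also have "\<dots> = - (\<Sum>\<^sub>7p n. (\<Sum>\<^sub>7m. \<Gamma> x n i m * G x k m) * (gm x $ n $ p * G x p l)) - (\<Sum>\<^sub>7p. \<Gamma> x k i p * G x p l)"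
    unfolding 1 by (simp add: left_diff_distrib sum_subtractf sum_distrib_right mult.assoc sum_negf)
  also have "(\<Sum>\<^sub>7p n. (\<Sum>\<^sub>7m. \<Gamma> x n i m * G x k m) * (gm x $ n $ p * G x p l))
    = (\<Sum>\<^sub>7n p. (\<Sum>\<^sub>7m. \<Gamma> x n i m * G x k m) * (gm x $ n $ p * G x p l))" by (rule sum.swap)
  also have "\<dots> = (\<Sum>\<^sub>7m. \<Gamma> x l i m * G x k m)" by (simp add: gm_G[OF x] flip: sum_distrib_left)
  finally show ?thesis by simp
qed

lemma pd_det_gm:
  assumes x: "x \<in> U"
  shows "pd l (\<lambda>y. det (gm y)) x = 2 * (\<Sum>\<^sub>7m. \<Gamma> x m l m) * det (gm x)"
proof -
  \<comment> \<open>The two Christoffel terms in the derivative of g act on different sides.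
    Inserting G g = 1 brings the second one to the left, so that \<open>pd_det_linear\<close>
    applies.\<close>
  let ?C = "\<lambda>i m. \<Gamma> x m l i + (\<Sum>\<^sub>7n p. gm x $ i $ n * \<Gamma> x n l p * G x p m)"
  have "pd l (\<lambda>y. det (gm y)) x = (\<Sum>\<^sub>7r. ?C r r) * det (gm x)"
  proof (rule pd_det_linear[where c = "?C", OF diff_gm[OF x]])
    fix i j
    have "(\<Sum>\<^sub>7m. (\<Sum>\<^sub>7n p. gm x $ i $ n * \<Gamma> x n l p * G x p m) * gm x $ m $ j)
      = (\<Sum>\<^sub>7m n p. gm x $ i $ n * \<Gamma> x n l p * (G x p m * gm x $ m $ j))"
      by (simp add: sum_distrib_right mult.assoc)
    also have "\<dots> = (\<Sum>\<^sub>7n p m. gm x $ i $ n * \<Gamma> x n l p * (G x p m * gm x $ m $ j))" by (rule sum_rot3)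
    also have "\<dots> = (\<Sum>\<^sub>7n. gm x $ i $ n * \<Gamma> x n l j)" by (simp add: G_gm[OF x] flip: sum_distrib_left)
    also have "\<dots> = (\<Sum>\<^sub>7n. \<Gamma> x n l j * gm x $ i $ n)" by (simp add: mult.commute)
    finally have f: "(\<Sum>\<^sub>7m. (\<Sum>\<^sub>7n p. gm x $ i $ n * \<Gamma> x n l p * G x p m) * gm x $ m $ j)
      = (\<Sum>\<^sub>7n. \<Gamma> x n l j * gm x $ i $ n)" .
    show "pd l (\<lambda>y. gm y $ i $ j) x = (\<Sum>\<^sub>7m. ?C i m * gm x $ m $ j)"
      by (simp only: gm_parallel[OF x] distrib_right sum.distrib f)
  qed
  moreover have "(\<Sum>\<^sub>7r n p. gm x $ r $ n * \<Gamma> x n l p * G x p r) = (\<Sum>\<^sub>7m. \<Gamma> x m l m)"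
  proof -
    have "(\<Sum>\<^sub>7r n p. gm x $ r $ n * \<Gamma> x n l p * G x p r) = (\<Sum>\<^sub>7n p r. gm x $ r $ n * \<Gamma> x n l p * G x p r)" by (rule sum_rot3)
    also have "\<dots> = (\<Sum>\<^sub>7n p. (\<Sum>\<^sub>7r. G x p r * gm x $ r $ n) * \<Gamma> x n l p)"
      by (simp only: sum_distrib_right) (simp add: ac_simps)
    finally show ?thesis by (simp add: G_gm[OF x])
  qed
  ultimately show ?thesis by (simp add: sum.distrib)
qed

section \<open>Volume density and divergence\<close>

definition \<mu> :: "R7 \<Rightarrow> real" where "\<mu> x = sqrt (det (gm x))"

lemma diff_det: "x \<in> U \<Longrightarrow> (\<lambda>y. det (gm y)) differentiable (at x)"
  by (rule smooth_on_differentiable[OF smooth_on_det[OF open_U gm_smooth]])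

lemma \<mu>_pos: "x \<in> U \<Longrightarrow> \<mu> x > 0" using gm_det by (simp add: \<mu>_def)

lemma \<mu>_deriv:
  assumes x: "x \<in> U"
  shows "\<mu> differentiable (at x)" "pd l \<mu> x = (\<Sum>\<^sub>7m. \<Gamma> x m l m) * \<mu> x"
proof -
  have "(sqrt has_real_derivative inverse (sqrt (det (gm x))) / 2) (at (det (gm x)))"
    using DERIV_real_sqrt[OF gm_det[OF x]] .
  then have "((\<lambda>y. sqrt (det (gm y))) has_derivative
     (\<lambda>h. (\<Sum>\<^sub>7i. h $ i * pd i (\<lambda>y. det (gm y)) x) * (inverse (sqrt (det (gm x))) / 2))) (at x)"
    by (rule DERIV_compose_FDERIV[where g = "\<lambda>y. det (gm y)", OF _ has_derivative_pd[OF diff_det[OF x]]])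
  then have *: "(\<mu> has_derivative
     (\<lambda>h. (\<Sum>\<^sub>7i. h $ i * pd i (\<lambda>y. det (gm y)) x) * (inverse (sqrt (det (gm x))) / 2))) (at x)"
    unfolding \<mu>_def[abs_def] .
  then show "\<mu> differentiable (at x)" unfolding differentiable_def by blast
  have "sqrt (det (gm x)) * sqrt (det (gm x)) = det (gm x)" using gm_det[OF x] by simp
  then show "pd l \<mu> x = (\<Sum>\<^sub>7m. \<Gamma> x m l m) * \<mu> x"
    unfolding pd_eqI[OF *] using gm_det[OF x]
    by (simp add: axis_def if_distrib if_distribR pd_det_gm[OF x] \<mu>_def field_simps cong: if_cong)
qed

lemma T_skew:
  "T x [j, i, k] = - T x [i, j, k]" "x \<in> U \<Longrightarrow> T x [i, k, j] = - T x [i, j, k]"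
  using torsion_skew[of x i k j] by (simp_all add: T_def left_diff_distrib flip: sum_negf)

lemma \<tau>_T:
  assumes x: "x \<in> U" shows "\<Gamma> x m i j - \<Gamma> x m j i = (\<Sum>\<^sub>7k. G x m k * T x [i, j, k])"
proof -
  have "(\<Sum>\<^sub>7k. G x m k * T x [i, j, k]) = (\<Sum>\<^sub>7k n. G x m k * ((\<Gamma> x n i j - \<Gamma> x n j i) * gm x $ n $ k))"
    by (simp add: T_def sum_distrib_left)
  also have "\<dots> = (\<Sum>\<^sub>7n k. G x m k * ((\<Gamma> x n i j - \<Gamma> x n j i) * gm x $ n $ k))" by (rule sum.swap)
  also have "\<dots> = (\<Sum>\<^sub>7n. (\<Sum>\<^sub>7k. G x m k * gm x $ k $ n) * (\<Gamma> x n i j - \<Gamma> x n j i))"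
  proof -
    have "G x m k * ((\<Gamma> x n i j - \<Gamma> x n j i) * gm x $ n $ k) = G x m k * gm x $ k $ n * (\<Gamma> x n i j - \<Gamma> x n j i)" for k n
      using gm_sym[OF x, of n k] by simp
    then show ?thesis by (simp only: sum_distrib_right)
  qed
  finally show ?thesis by (simp add: G_gm[OF x])
qed

text \<open>The difference of the two sides is a trace of the torsion, a contraction of the
  symmetric G with two skew indices.\<close>

lemma trace_\<tau>:
  assumes x: "x \<in> U" shows "(\<Sum>\<^sub>7i. \<Gamma> x i i m) = (\<Sum>\<^sub>7i. \<Gamma> x i m i)"
proof -
  have e: "(\<Sum>\<^sub>7i. \<Gamma> x i i m - \<Gamma> x i m i) = (\<Sum>\<^sub>7i k. G x i k * T x [i, m, k])" by (simp add: \<tau>_T[OF x])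
  have "(\<Sum>\<^sub>7i k. G x i k * T x [i, m, k]) = (\<Sum>\<^sub>7k i. G x i k * T x [i, m, k])" by (rule sum.swap)
  also have "\<dots> = - (\<Sum>\<^sub>7i k. G x i k * T x [i, m, k])"
  proof -
    have a: "T x [i, m, k] = - T x [k, m, i]" for i k
      using T_skew(1)[of x m i k] T_skew(2)[OF x, of m i k] T_skew(1)[of x k m i] by simp
    have "G x i k * T x [i, m, k] = - (G x k i * T x [k, m, i])" for i k
      using G_sym[OF x, of i k] a[of i k] by simp
    then show ?thesis unfolding sum_negf[symmetric] by (intro sum.cong refl)
  qed
  finally show ?thesis using e by (simp add: sum_subtractf)
qed

text \<open>The formula for the Levi-Civita divergence holds unchanged, because the trace of the
  torsion, the only possible difference, is zero by \<open>trace_\<tau>\<close>. This is what makes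
  divergences for \<nabla> integrate to zero.\<close>

lemma divergence:
  assumes x: "x \<in> U" and V: "smooth_field U 1 V"
  shows "(\<Sum>\<^sub>7i. pd i (\<lambda>y. \<mu> y * (\<Sum>\<^sub>7j. G y i j * V y [j])) x) = \<mu> x * (\<Sum>\<^sub>7i j. G x i j * cov_deriv \<Gamma> i V x [j])"
proof -
  have dV: "(\<lambda>y. V y [j]) differentiable (at x)" for j
    using smooth_on_differentiable[OF smooth_fieldD[OF V] x, of "[j]"] by simp
  let ?V = "\<lambda>i. \<Sum>\<^sub>7j. G x i j * V x [j]"
  have 1: "pd i (\<lambda>y. \<Sum>\<^sub>7j. G y i j * V y [j]) x = (\<Sum>\<^sub>7j. G x i j * cov_deriv \<Gamma> i V x [j]) - (\<Sum>\<^sub>7m. \<Gamma> x i i m * ?V m)" for i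
  proof -
    have "pd i (\<lambda>y. \<Sum>\<^sub>7j. G y i j * V y [j]) x = (\<Sum>\<^sub>7j. pd i (\<lambda>y. G y i j) x * V x [j] + G x i j * pd i (\<lambda>y. V y [j]) x)"
      using dV diff_G[OF x] by (simp add: pd_sum pd_mult differentiable_mult)
    also have "\<dots> = (\<Sum>\<^sub>7j. G x i j * pd i (\<lambda>y. V y [j]) x) - (\<Sum>\<^sub>7j m. \<Gamma> x i i m * (G x m j * V x [j]))
        - (\<Sum>\<^sub>7j m. \<Gamma> x j i m * G x i m * V x [j])"
      by (simp add: G_parallel[OF x] left_diff_distrib sum.distrib sum_subtractf sum_negf sum_distrib_right mult.assoc)
    also have "(\<Sum>\<^sub>7j m. \<Gamma> x i i m * (G x m j * V x [j])) = (\<Sum>\<^sub>7m. \<Gamma> x i i m * ?V m)"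
      by (subst sum.swap) (simp add: sum_distrib_left)
    also have "(\<Sum>\<^sub>7j m. \<Gamma> x j i m * G x i m * V x [j]) = (\<Sum>\<^sub>7m. G x i m * (\<Sum>\<^sub>7j. \<Gamma> x j i m * V x [j]))"
      by (subst sum.swap) (simp add: sum_distrib_left ac_simps)
    finally show ?thesis
      by (simp add: cov_deriv_act right_diff_distrib sum_subtractf)
  qed
  have dGV: "(\<lambda>y. \<Sum>\<^sub>7j. G y i j * V y [j]) differentiable (at x)" for i
    using dV diff_G[OF x] by (simp add: differentiable_sum differentiable_mult)
  have "(\<Sum>\<^sub>7i. pd i (\<lambda>y. \<mu> y * (\<Sum>\<^sub>7j. G y i j * V y [j])) x)
    = (\<Sum>\<^sub>7i. (\<Sum>\<^sub>7m. \<Gamma> x m i m) * \<mu> x * ?V i) + \<mu> x * (\<Sum>\<^sub>7i j. G x i j * cov_deriv \<Gamma> i V x [j])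
      - \<mu> x * (\<Sum>\<^sub>7i m. \<Gamma> x i i m * ?V m)"
    by (simp add: pd_mult[OF \<mu>_deriv(1)[OF x] dGV] \<mu>_deriv(2)[OF x] 1 right_diff_distrib sum.distrib sum_subtractf
      flip: sum_distrib_left)
  also have "(\<Sum>\<^sub>7i m. \<Gamma> x i i m * ?V m) = (\<Sum>\<^sub>7m. (\<Sum>\<^sub>7i. \<Gamma> x i i m) * ?V m)"
    by (subst sum.swap) (simp only: sum_distrib_right)
  also have "\<dots> = (\<Sum>\<^sub>7i. (\<Sum>\<^sub>7m. \<Gamma> x m i m) * ?V i)" unfolding trace_\<tau>[OF x] ..
  finally show ?thesis by (simp add: sum_distrib_left ac_simps)
qed

section \<open>The curvature with four lower indices and its Bianchi identity\<close>

definition Rl :: "R7 \<Rightarrow> 7 \<Rightarrow> 7 \<Rightarrow> 7 \<Rightarrow> 7 \<Rightarrow> real" where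
  "Rl x i j k l = (\<Sum>\<^sub>7n. riem \<Gamma> i j x n k * gm x $ n $ l)"

lemma Rl_skew12: "Rl x j i k l = - Rl x i j k l"
proof -
  have "riem \<Gamma> j i x n k * gm x $ n $ l = - (riem \<Gamma> i j x n k * gm x $ n $ l)" for n
    by (simp add: riem_def sum_subtractf algebra_simps)
  then show ?thesis unfolding Rl_def sum_negf[symmetric] by (intro sum.cong refl)
qed

text \<open>The Ricci identity applied to the metric, all of whose covariant derivatives
  vanish.\<close>

lemma Rl_skew34:
  assumes x: "x \<in> U" shows "Rl x i j l k = - Rl x i j k l"
proof -
  define t :: local_field where "t = (\<lambda>x is. gm x $ (is ! 0) $ (is ! 1))"
  have t: "smooth_field U (length [k, l]) t" by (simp add: smooth_field_def t_def gm_smooth)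
  have c0: "cov_deriv \<Gamma> m t y [a, b] = 0" if "y \<in> U" for m y a b
    using gm_parallel[OF that, of m a b] by (simp add: cov_deriv_act t_def)
  have "nabt \<Gamma> (nabt \<Gamma> t) x [i, j, k, l] = 0" for i j k l
  proof -
    have "pd i (\<lambda>y. cov_deriv \<Gamma> j t y [k, l]) x = 0"
      using pd_cong[OF open_U x, of "\<lambda>y. cov_deriv \<Gamma> j t y [k, l]" "\<lambda>_. 0"] c0 by simp
    then show ?thesis by (simp add: cov_deriv_act[of _ _ "nabt \<Gamma> t"] c0[OF x])
  qed
  with ricci_identity[where \<Gamma> = \<Gamma>, OF open_U x \<Gamma>_smooth t, where i = i and j = j]
  have "act (riem \<Gamma> i j x) (t x) [k, l] = 0" by (simp add: c0[OF x])
  then have "(\<Sum>\<^sub>7m. riem \<Gamma> i j x m k * gm x $ m $ l) + (\<Sum>\<^sub>7m. riem \<Gamma> i j x m l * gm x $ k $ m) = 0"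
    by (simp add: t_def)
  then show ?thesis using gm_sym[OF x, of k] by (simp add: Rl_def)
qed

text \<open>Lowering an index commutes with differentiation because the metric is parallel: the
  Christoffel terms of the lowered index cancel those from the derivative of the metric.\<close>

lemma cov_deriv_T:
  assumes x: "x \<in> U"
  shows "cov_deriv \<Gamma> i T x [j, k, l] = (\<Sum>\<^sub>7n. (pd i (\<lambda>y. \<Gamma> y n j k) x - pd i (\<lambda>y. \<Gamma> y n k j) x
     + (\<Sum>\<^sub>7m. \<Gamma> x n i m * (\<Gamma> x m j k - \<Gamma> x m k j) - \<Gamma> x m i j * (\<Gamma> x n m k - \<Gamma> x n k m)
        - \<Gamma> x m i k * (\<Gamma> x n j m - \<Gamma> x n m j))) * gm x $ n $ l)"
proof -
  let ?t = "\<lambda>n j k. \<Gamma> x n j k - \<Gamma> x n k j"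
  have "pd i (\<lambda>y. T y [j, k, l]) x = (\<Sum>\<^sub>7n. (pd i (\<lambda>y. \<Gamma> y n j k) x - pd i (\<lambda>y. \<Gamma> y n k j) x) * gm x $ n $ l
     + ?t n j k * ((\<Sum>\<^sub>7m. \<Gamma> x m i n * gm x $ m $ l) + (\<Sum>\<^sub>7m. \<Gamma> x m i l * gm x $ n $ m)))"
    unfolding T_def using diff_\<Gamma>[OF x] diff_gm[OF x]
    by (simp add: pd_sum pd_mult pd_diff differentiable_mult differentiable_diff gm_parallel[OF x])
  also have "\<dots> = (\<Sum>\<^sub>7n. (pd i (\<lambda>y. \<Gamma> y n j k) x - pd i (\<lambda>y. \<Gamma> y n k j) x) * gm x $ n $ l)
     + (\<Sum>\<^sub>7n m. ?t n j k * \<Gamma> x m i n * gm x $ m $ l) + (\<Sum>\<^sub>7n m. ?t n j k * \<Gamma> x m i l * gm x $ n $ m)"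
    by (simp add: sum.distrib distrib_left sum_distrib_left mult.assoc)
  also have "(\<Sum>\<^sub>7n m. ?t n j k * \<Gamma> x m i n * gm x $ m $ l) = (\<Sum>\<^sub>7n m. \<Gamma> x n i m * ?t m j k * gm x $ n $ l)"
    by (subst sum.swap) (simp add: mult.commute)
  finally have 1: "pd i (\<lambda>y. T y [j, k, l]) x = (\<Sum>\<^sub>7n. (pd i (\<lambda>y. \<Gamma> y n j k) x - pd i (\<lambda>y. \<Gamma> y n k j) x) * gm x $ n $ l)
     + (\<Sum>\<^sub>7n m. \<Gamma> x n i m * ?t m j k * gm x $ n $ l) + (\<Sum>\<^sub>7n m. ?t n j k * \<Gamma> x m i l * gm x $ n $ m)" .
  have 2: "(\<Sum>\<^sub>7m. \<Gamma> x m i j * T x [m, k, l]) = (\<Sum>\<^sub>7n m. \<Gamma> x m i j * ?t n m k * gm x $ n $ l)"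
     "(\<Sum>\<^sub>7m. \<Gamma> x m i k * T x [j, m, l]) = (\<Sum>\<^sub>7n m. \<Gamma> x m i k * ?t n j m * gm x $ n $ l)"
     "(\<Sum>\<^sub>7m. \<Gamma> x m i l * T x [j, k, m]) = (\<Sum>\<^sub>7n m. ?t n j k * \<Gamma> x m i l * gm x $ n $ m)"
    unfolding T_def sum_distrib_left by (subst sum.swap, simp add: ac_simps)+
  show ?thesis
    unfolding cov_deriv_act act_Cons act_Nil 1 2
    by (simp only: distrib_right left_diff_distrib sum.distrib sum_subtractf sum_distrib_right)
qed

text \<open>Before the last index is lowered the identity is pure algebra in the Christoffel symbols
  and their first derivatives; this is \<open>n\<close>. Passing from partial to covariant
  derivatives of the torsion leaves its quadratic terms, which \<open>s\<close> writes with the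
  inverse metric.\<close>

lemma bianchi:
  assumes x: "x \<in> U"
  shows "Rl x i j k l + Rl x j k i l + Rl x k i j l =
    cov_deriv \<Gamma> i T x [j, k, l] + cov_deriv \<Gamma> j T x [k, i, l] + cov_deriv \<Gamma> k T x [i, j, l]
    + (\<Sum>\<^sub>7a b. G x a b * (T x [i, j, a] * T x [b, k, l] + T x [j, k, a] * T x [b, i, l] + T x [k, i, a] * T x [b, j, l]))"
proof -
  let ?t = "\<lambda>n j k. \<Gamma> x n j k - \<Gamma> x n k j"
  have s: "(\<Sum>\<^sub>7a b. G x a b * (T x [i, j, a] * T x [b, k, l])) = (\<Sum>\<^sub>7n. (\<Sum>\<^sub>7m. ?t m i j * ?t n m k) * gm x $ n $ l)" for i j k
  proof -
    have "(\<Sum>\<^sub>7a b. G x a b * (T x [i, j, a] * T x [b, k, l])) = (\<Sum>\<^sub>7b a. G x a b * (T x [i, j, a] * T x [b, k, l]))"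
      by (rule sum.swap)
    also have "\<dots> = (\<Sum>\<^sub>7b. (\<Sum>\<^sub>7a. G x b a * T x [i, j, a]) * T x [b, k, l])"
    proof -
      have "G x a b * (T x [i, j, a] * T x [b, k, l]) = G x b a * T x [i, j, a] * T x [b, k, l]" for a b
        using G_sym[OF x, of a b] by simp
      then show ?thesis by (simp only: sum_distrib_right)
    qed
    also have "\<dots> = (\<Sum>\<^sub>7b. ?t b i j * T x [b, k, l])" by (simp add: \<tau>_T[OF x])
    also have "\<dots> = (\<Sum>\<^sub>7b n. ?t b i j * ?t n b k * gm x $ n $ l)"
      unfolding T_def sum_distrib_left by (simp add: mult.assoc)
    also have "\<dots> = (\<Sum>\<^sub>7n b. ?t b i j * ?t n b k * gm x $ n $ l)" by (rule sum.swap)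
    finally show ?thesis by (simp only: sum_distrib_right)
  qed
  have n: "riem \<Gamma> i j x n k + riem \<Gamma> j k x n i + riem \<Gamma> k i x n j =
       pd i (\<lambda>y. \<Gamma> y n j k) x - pd i (\<lambda>y. \<Gamma> y n k j) x + (\<Sum>\<^sub>7m. \<Gamma> x n i m * ?t m j k - \<Gamma> x m i j * ?t n m k - \<Gamma> x m i k * ?t n j m)
       + (pd j (\<lambda>y. \<Gamma> y n k i) x - pd j (\<lambda>y. \<Gamma> y n i k) x + (\<Sum>\<^sub>7m. \<Gamma> x n j m * ?t m k i - \<Gamma> x m j k * ?t n m i - \<Gamma> x m j i * ?t n k m))
       + (pd k (\<lambda>y. \<Gamma> y n i j) x - pd k (\<lambda>y. \<Gamma> y n j i) x + (\<Sum>\<^sub>7m. \<Gamma> x n k m * ?t m i j - \<Gamma> x m k i * ?t n m j - \<Gamma> x m k j * ?t n i m))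
       + ((\<Sum>\<^sub>7m. ?t m i j * ?t n m k) + (\<Sum>\<^sub>7m. ?t m j k * ?t n m i) + (\<Sum>\<^sub>7m. ?t m k i * ?t n m j))" for n
    by (simp add: riem_def algebra_simps sum.distrib sum_subtractf)
  have "Rl x i j k l + Rl x j k i l + Rl x k i j l
      = (\<Sum>\<^sub>7n. (riem \<Gamma> i j x n k + riem \<Gamma> j k x n i + riem \<Gamma> k i x n j) * gm x $ n $ l)"
    by (simp only: Rl_def distrib_right sum.distrib)
  then show ?thesis
    unfolding n distrib_left sum.distrib s cov_deriv_T[OF x]
    by (simp only: distrib_right sum.distrib)
qed

end

section \<open>Adapted frames\<close>

text \<open>The induction step has a double sum, over permutations p of k + 1 positions and q of k
  positions. Its terms depend only on p composed with the lift of q, so every permutation is counted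
  k! times, and this is the factor that \<open>wedge\<close> divides by.\<close>

lemma coframe_wedge_formula:
  "length is = length as \<Longrightarrow> coframe_wedge E as is =
     (\<Sum>p | p permutes {..<length as}. of_int (sign p) * (\<Prod>b<length as. E $ (as ! b) $ (is ! p b)))"
proof (induction as arbitrary: "is")
  case Nil
  then show ?case by simp
next
  case (Cons a as)
  define k where "k = length as"
  define S where "S = {q. q permutes {..<k}}"
  define S' where "S' = {p. p permutes {..<Suc k}}"
  have len: "length is = Suc k" using Cons.prems by (simp add: k_def)
  define g where "g r = of_int (sign r) * (\<Prod>b<Suc k. E $ ((a # as) ! b) $ (is ! r b))" for r :: "nat \<Rightarrow> nat"
  \<comment> \<open>Shifts a permutation by one position and fixes position 0, which belongs to the
    first covector.\<close>
  define lift where "lift q = map_permutation {..<k} Suc q" for q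
  have lift: "lift q permutes {..<Suc k}" "sign (lift q) = sign q" "lift q 0 = 0"
    "\<And>b. b < k \<Longrightarrow> lift q (Suc b) = Suc (q b)" if "q \<in> S" for q
  proof -
    have q: "q permutes {..<k}" using that by (simp add: S_def)
    have "lift q permutes Suc ` {..<k}" unfolding lift_def
      by (rule map_permutation_permutes[OF _ q]) (auto simp: bij_betw_def)
    then show "lift q permutes {..<Suc k}" by (rule permutes_subset) auto
    show "sign (lift q) = sign q" unfolding lift_def by (rule sign_map_permutation[OF _ q]) auto
    show "lift q 0 = 0" by (auto simp: lift_def map_permutation_def restrict_id_def)
    show "lift q (Suc b) = Suc (q b)" if "b < k" for b
      unfolding lift_def using that by (intro map_permutation_apply) auto
  qed
  have drop: "coframe_wedge E as (drop 1 (permute_list p is)) =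
      (\<Sum>q\<in>S. of_int (sign q) * (\<Prod>b<k. E $ (as ! b) $ (is ! p (Suc (q b)))))" for p
  proof -
    have l: "length (drop 1 (permute_list p is)) = length as" by (simp add: len k_def)
    have "drop 1 (permute_list p is) ! q b = is ! p (Suc (q b))" if "q \<in> S" "b < k" for q b
    proof -
      have "q b < k" using permutes_in_image[of q "{..<k}" b] that by (simp add: S_def)
      then show ?thesis by (simp add: permute_list_def len nth_append del: upt_Suc)
    qed
    then show ?thesis unfolding Cons.IH[OF l] S_def k_def[symmetric]
      by (intro sum.cong refl arg_cong2[where f = "(*)"] prod.cong) (auto simp: S_def)
  qed
  have hd: "covector (E $ a) (take 1 (permute_list p is)) = E $ a $ (is ! p 0)" for p
    by (simp add: covector_def permute_list_def len take_map hd_map del: upt_Suc)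
  have "coframe_wedge E (a # as) is = (\<Sum>p\<in>S'. \<Sum>q\<in>S. of_int (sign p * sign q) *
      (E $ a $ (is ! p 0) * (\<Prod>b<k. E $ (as ! b) $ (is ! p (Suc (q b)))))) / fact k"
    by (simp add: wedge_def len drop[unfolded One_nat_def] hd[unfolded One_nat_def] S'_def sum_distrib_left ac_simps)
  also have "(\<Sum>p\<in>S'. \<Sum>q\<in>S. of_int (sign p * sign q) * (E $ a $ (is ! p 0) * (\<Prod>b<k. E $ (as ! b) $ (is ! p (Suc (q b))))))
    = (\<Sum>q\<in>S. \<Sum>p\<in>S'. of_int (sign p * sign q) * (E $ a $ (is ! p 0) * (\<Prod>b<k. E $ (as ! b) $ (is ! p (Suc (q b))))))"
    by (rule sum.swap)
  also have "\<dots> = (\<Sum>q\<in>S. \<Sum>p\<in>S'. g (p \<circ> lift q))"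
  proof (intro sum.cong refl)
    fix q p assume q: "q \<in> S" and p: "p \<in> S'"
    have "sign (p \<circ> lift q) = sign p * sign q"
      using sign_compose[of p "lift q"] lift(1,2)[OF q] p
      by (simp add: S'_def permutation_permutes) (metis finite_lessThan permutation_permutes)
    moreover have "(\<Prod>b<k. E $ (as ! b) $ (is ! (p \<circ> lift q) (Suc b))) = (\<Prod>b<k. E $ (as ! b) $ (is ! p (Suc (q b))))"
      by (rule prod.cong) (simp_all add: lift(4)[OF q])
    ultimately show "of_int (sign p * sign q) * (E $ a $ (is ! p 0) * (\<Prod>b<k. E $ (as ! b) $ (is ! p (Suc (q b))))) = g (p \<circ> lift q)"
      by (simp add: g_def prod.lessThan_Suc_shift lift(3)[OF q] del: prod.lessThan_Suc)
  qed
  also have "\<dots> = (\<Sum>q\<in>S. \<Sum>p\<in>S'. g p)"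
    unfolding S'_def by (intro sum.cong refl sum_permutations_compose_right[symmetric] lift(1))
  also have "\<dots> = fact k * (\<Sum>p\<in>S'. g p)"
    using card_permutations[of "{..<k}" k] by (simp add: S_def)
  finally show ?case by (simp add: g_def S'_def k_def)
qed

lemma alternating_coframe_wedge: "alternating (length as) (coframe_wedge E as)"
  unfolding alternating_def
proof (intro ballI allI impI)
  fix "is" and p assume "is \<in> idx (length as)" and p: "p permutes {..<length as}"
  then have len: "length is = length as" by simp
  let ?S = "{q. q permutes {..<length as}}"
  have "coframe_wedge E as (permute_list p is) = (\<Sum>q\<in>?S. of_int (sign q) * (\<Prod>b<length as. E $ (as ! b) $ (is ! p (q b))))"
  proof -
    have "permute_list p is ! q b = is ! p (q b)" if "q permutes {..<length as}" "b < length as" for q b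
      using permutes_in_image[OF that(1), of b] that(2) by (intro permute_list_nth) (simp_all add: len p)
    then show ?thesis
      by (subst coframe_wedge_formula) (auto simp: len intro!: sum.cong prod.cong)
  qed
  also have "\<dots> = of_int (sign p) * (\<Sum>q\<in>?S. of_int (sign (p \<circ> q)) * (\<Prod>b<length as. E $ (as ! b) $ (is ! (p \<circ> q) b)))"
    unfolding sum_distrib_left
  proof (intro sum.cong refl)
    fix q assume "q \<in> ?S"
    then have "sign (p \<circ> q) = sign p * sign q"
      using p by (intro sign_compose) (auto simp: permutation_permutes)
    then show "of_int (sign q) * (\<Prod>b<length as. E $ (as ! b) $ (is ! p (q b))) =
      of_int (sign p) * (of_int (sign (p \<circ> q)) * (\<Prod>b<length as. E $ (as ! b) $ (is ! (p \<circ> q) b)))"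
      by (simp add: sign_def)
  qed
  also have "(\<Sum>q\<in>?S. of_int (sign (p \<circ> q)) * (\<Prod>b<length as. E $ (as ! b) $ (is ! (p \<circ> q) b))) = coframe_wedge E as is"
    unfolding coframe_wedge_formula[OF len]
    by (rule sum.reindex_bij_witness[of _ "\<lambda>q. inv p \<circ> q" "\<lambda>q. p \<circ> q"])
       (use p in \<open>auto simp: permutes_compose permutes_inv permutes_inv_o o_assoc\<close>)
  finally show "coframe_wedge E as (permute_list p is) = of_int (sign p) * coframe_wedge E as is" .
qed

lemma sum_idx_prod: "(\<Sum>is\<in>idx k. \<Prod>a<k. f a (is ! a)) = (\<Prod>a<k. \<Sum>\<^sub>7i. f a i :: real)"
proof (induction k arbitrary: f)
  case (Suc k)
  have "(\<Sum>is\<in>idx (Suc k). \<Prod>a<Suc k. f a (is ! a)) = (\<Sum>\<^sub>7i. f 0 i * (\<Sum>is\<in>idx k. \<Prod>a<k. f (Suc a) (is ! a)))"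
    by (simp add: sum_idx_Suc prod.lessThan_Suc_shift sum_distrib_left del: prod.lessThan_Suc)
  also have "(\<Sum>is\<in>idx k. \<Prod>a<k. f (Suc a) (is ! a)) = (\<Prod>a<k. \<Sum>\<^sub>7i. f (Suc a) i)"
    by (rule Suc.IH)
  finally show ?case by (simp add: prod.lessThan_Suc_shift sum_distrib_right del: prod.lessThan_Suc)
qed simp

lemma fr_coframe_wedge:
  assumes "length cs = length as"
  shows "fr F (coframe_wedge E as) cs = coframe_wedge (\<chi> a b. \<Sum>\<^sub>7i. E $ a $ i * F b $ i) as cs"
proof -
  let ?k = "length as" and ?S = "{p. p permutes {..<length as}}"
  have "fr F (coframe_wedge E as) cs = (\<Sum>is\<in>idx ?k. \<Sum>p\<in>?S. of_int (sign p) *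
      ((\<Prod>b<?k. E $ (as ! b) $ (is ! p b)) * (\<Prod>b<?k. F (cs ! b) $ (is ! b))))"
    unfolding eval_tensor_map[symmetric] eval_tensor_def
    using assms by (simp add: coframe_wedge_formula sum_distrib_right mult.assoc)
  also have "\<dots> = (\<Sum>p\<in>?S. \<Sum>is\<in>idx ?k. of_int (sign p) *
      ((\<Prod>b<?k. E $ (as ! b) $ (is ! p b)) * (\<Prod>b<?k. F (cs ! b) $ (is ! b))))" by (rule sum.swap)
  also have "\<dots> = (\<Sum>p\<in>?S. of_int (sign p) * (\<Prod>b<?k. \<Sum>\<^sub>7i. E $ (as ! b) $ i * F (cs ! p b) $ i))"
  proof (intro sum.cong refl)
    fix p assume "p \<in> ?S"
    then have p: "p permutes {..<?k}" by simp
    have ip: "inv p permutes {..<?k}" by (rule permutes_inv[OF p])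
    have "(\<Sum>is\<in>idx ?k. of_int (sign p) * ((\<Prod>b<?k. E $ (as ! b) $ (is ! p b)) * (\<Prod>b<?k. F (cs ! b) $ (is ! b))))
       = of_int (sign p) * (\<Sum>is\<in>idx ?k. \<Prod>b<?k. E $ (as ! inv p b) $ (is ! b) * F (cs ! b) $ (is ! b))"
      unfolding sum_distrib_left
    proof (intro sum.cong refl arg_cong2[where f = "(*)"])
      fix "is" :: "7 list"
      have "(\<Prod>b<?k. E $ (as ! b) $ (is ! p b)) = (\<Prod>b<?k. E $ (as ! inv p b) $ (is ! p (inv p b)))"
        using prod.permute[OF ip, of "\<lambda>b. E $ (as ! b) $ (is ! p b)"] by (simp add: o_def)
      then show "(\<Prod>b<?k. E $ (as ! b) $ (is ! p b)) * (\<Prod>b<?k. F (cs ! b) $ (is ! b)) =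
        (\<Prod>b<?k. E $ (as ! inv p b) $ (is ! b) * F (cs ! b) $ (is ! b))"
        by (simp add: permutes_inverses[OF p] prod.distrib)
    qed
    also have "\<dots> = of_int (sign p) * (\<Prod>b<?k. \<Sum>\<^sub>7i. E $ (as ! inv p b) $ i * F (cs ! b) $ i)"
      by (simp only: sum_idx_prod[where f = "\<lambda>b i. E $ (as ! inv p b) $ i * F (cs ! b) $ i"])
    also have "(\<Prod>b<?k. \<Sum>\<^sub>7i. E $ (as ! inv p b) $ i * F (cs ! b) $ i) = (\<Prod>b<?k. \<Sum>\<^sub>7i. E $ (as ! b) $ i * F (cs ! p b) $ i)"
      using prod.permute[OF p, of "\<lambda>b. \<Sum>\<^sub>7i. E $ (as ! inv p b) $ i * F (cs ! b) $ i"]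
      by (simp add: o_def permutes_inverses[OF p])
    finally show "(\<Sum>is\<in>idx ?k. of_int (sign p) * ((\<Prod>b<?k. E $ (as ! b) $ (is ! p b)) * (\<Prod>b<?k. F (cs ! b) $ (is ! b))))
      = of_int (sign p) * (\<Prod>b<?k. \<Sum>\<^sub>7i. E $ (as ! b) $ i * F (cs ! p b) $ i)" .
  qed
  also have "\<dots> = coframe_wedge (\<chi> a b. \<Sum>\<^sub>7i. E $ a $ i * F b $ i) as cs"
    by (simp add: coframe_wedge_formula[OF assms])
  finally show ?thesis .
qed

lemma fr_permute:
  assumes p: "p permutes {..<length as}"
  shows "fr F (\<lambda>is. t (permute_list p is)) as = fr F t (permute_list p as)"
proof -
  let ?k = "length as"
  have ip: "inv p permutes {..<?k}" by (rule permutes_inv[OF p])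
  have "fr F t (permute_list p as) = (\<Sum>is\<in>idx ?k. t is * (\<Prod>a<?k. F (as ! p a) $ (is ! a)))"
    unfolding eval_tensor_map[symmetric] eval_tensor_def
    using p by (auto intro!: sum.cong prod.cong arg_cong2[where f = "(*)"] simp: permute_list_nth)
  also have "\<dots> = (\<Sum>is\<in>idx ?k. t (permute_list p is) * (\<Prod>a<?k. F (as ! p a) $ (permute_list p is ! a)))"
  proof (rule sum.reindex_bij_witness[of _ "permute_list p" "permute_list (inv p)"])
    fix js :: "7 list" assume "js \<in> idx ?k"
    then have l: "length js = ?k" by simp
    show 1: "permute_list p (permute_list (inv p) js) = js"
      using permute_list_compose[of p js "inv p"] p l by (simp add: permutes_inv_o)
    show "permute_list (inv p) (permute_list p js) = js"
      using permute_list_compose[of "inv p" js p] ip l by (simp add: permutes_inv_o[OF p])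
    show "t (permute_list p (permute_list (inv p) js)) * (\<Prod>a<?k. F (as ! p a) $ (permute_list p (permute_list (inv p) js) ! a))
      = t js * (\<Prod>a<?k. F (as ! p a) $ (js ! a))" unfolding 1 ..
  qed auto
  also have "\<dots> = fr F (\<lambda>is. t (permute_list p is)) as"
  proof -
    have "(\<Prod>a<?k. F (as ! p a) $ (permute_list p is ! a)) = (\<Prod>a<?k. F (as ! a) $ (is ! a))" if "length is = ?k" for "is"
    proof -
      have "(\<Prod>a<?k. F (as ! p a) $ (permute_list p is ! a)) = (\<Prod>a<?k. F (as ! p a) $ (is ! p a))"
        using p that by (intro prod.cong refl) (simp add: permute_list_nth)
      also have "\<dots> = (\<Prod>a<?k. F (as ! a) $ (is ! a))"
        using prod.permute[OF p, of "\<lambda>a. F (as ! a) $ (is ! a)"] by (simp add: o_def)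
      finally show ?thesis .
    qed
    then show ?thesis unfolding eval_tensor_map[symmetric] eval_tensor_def by (auto intro!: sum.cong)
  qed
  finally show ?thesis ..
qed

lemma alternating_transpose:
  assumes "alternating k t" "length is = k" "a < k" "b < k" "a \<noteq> b"
  shows "t (permute_list (Transposition.transpose a b) is) = - t is"
proof -
  have "Transposition.transpose a b permutes {..<k}" using assms by (simp add: permutes_swap_id)
  then show ?thesis using assms unfolding alternating_def by (simp add: sign_swap_id)
qed

text \<open>With 7 = 0 the list runs through the index type in the order 1, ..., 6, 0. Rows and
  columns are permuted alike, so the determinant does not depend on the enumeration.\<close>

lemma det_coframe_wedge: "coframe_wedge M [1,2,3,4,5,6,7] [1,2,3,4,5,6,7] = det M"
proof -
  define e where "e = (\<lambda>b. [1,2,3,4,5,6,7::7] ! b)"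
  have e: "bij_betw e {..<7} UNIV"
  proof -
    have "e ` {..<length [1,2,3,4,5,6,7::7]} = set [1,2,3,4,5,6,7]"
      unfolding e_def set_conv_nth by blast
    also have "\<dots> = UNIV" unfolding UNIV_7 by auto
    finally have "e ` {..<length [1,2,3,4,5,6,7::7]} = UNIV" .
    moreover have "length [1,2,3,4,5,6,7::7] = 7" by simp
    ultimately have "e ` {..<7} = UNIV" by (simp only:)
    moreover from this have "inj_on e {..<7}" by (intro eq_card_imp_inj_on) simp_all
    ultimately show ?thesis by (simp add: bij_betw_def)
  qed
  have m: "bij_betw (map_permutation {..<7} e) {p. p permutes {..<7}} {p. p permutes UNIV}"
    using bij_betw_permutations[OF e]
    by (simp add: map_permutation_def[abs_def] restrict_id_def[abs_def] bij_betw_imp_surj_on[OF e])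
  have "det M = (\<Sum>p | p permutes {..<7::nat}. of_int (sign (map_permutation {..<7} e p)) * (\<Prod>i\<in>UNIV. M $ i $ map_permutation {..<7} e p i))"
    unfolding det_def
    by (rule sum.reindex_bij_betw[symmetric, OF m])
  also have "\<dots> = (\<Sum>p | p permutes {..<7}. of_int (sign p) * (\<Prod>b<7. M $ e b $ e (p b)))"
  proof (intro sum.cong refl arg_cong2[where f = "(*)"])
    fix p :: "nat \<Rightarrow> nat" assume "p \<in> {p. p permutes {..<7}}"
    then have p: "p permutes {..<7}" by simp
    show "real_of_int (sign (map_permutation {..<7} e p)) = of_int (sign p)"
      using sign_map_permutation[OF _ p, of e] e by (simp add: bij_betw_def)
    have "(\<Prod>i\<in>UNIV. M $ i $ map_permutation {..<7} e p i) = (\<Prod>b<7. M $ e b $ map_permutation {..<7} e p (e b))"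
      by (rule prod.reindex_bij_betw[OF e, symmetric])
    also have "\<dots> = (\<Prod>b<7. M $ e b $ e (p b))"
      using e by (intro prod.cong refl) (simp add: map_permutation_apply bij_betw_def)
    finally show "(\<Prod>i\<in>UNIV. M $ i $ map_permutation {..<7} e p i) = (\<Prod>b<7. M $ e b $ e (p b))" .
  qed
  also have "\<dots> = coframe_wedge M [1,2,3,4,5,6,7] [1,2,3,4,5,6,7]"
  proof -
    have "length [1,2,3,4,5,6,7::7] = 7" by simp
    then show ?thesis by (simp only: coframe_wedge_formula[OF refl] e_def)
  qed
  finally show ?thesis ..
qed

section \<open>The Levi-Civita symbol and forms of top degree\<close>

lemma alternating_swap:
  assumes "alternating k t" "k = length xs + length ys + 2"
  shows "t (xs @ b # a # ys) = - t (xs @ a # b # ys)"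
proof -
  let ?n = "length xs"
  have p: "Transposition.transpose ?n (Suc ?n) permutes {..<k}" using assms(2) by (simp add: permutes_swap_id)
  have "permute_list (Transposition.transpose ?n (Suc ?n)) (xs @ a # b # ys) = xs @ b # a # ys"
    using assms(2) p by (intro nth_equalityI)
      (auto simp: permute_list_nth nth_append Transposition.transpose_def nth_Cons split: nat.splits)
  then show ?thesis using alternating_transpose[OF assms(1), of "xs @ a # b # ys" ?n "Suc ?n"] assms(2) by simp
qed

text \<open>The Levi-Civita symbol, normalised on 1, ..., 6, 0. Moving 0 past six entries is an even
  permutation, so it also equals 1 on the increasing list 0, ..., 6; this is
  \<open>eps_0\<close>.\<close>

definition eps :: "7 list \<Rightarrow> real" where "eps = coframe_wedge (mat 1) [1,2,3,4,5,6,7]"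

lemma alternating_eps: "alternating 7 eps"
proof -
  have "length [1,2,3,4,5,6,7::7] = 7" by simp
  with alternating_coframe_wedge[of "[1,2,3,4,5,6,7]" "mat 1"] show ?thesis by (simp only: eps_def)
qed

lemma eps_1: "eps [1,2,3,4,5,6,7] = 1"
  by (simp only: eps_def det_coframe_wedge det_I)

lemma eps_swap:
  "eps [b,a,c,d,e,f,g] = - eps [a,b,c,d,e,f,g]" "eps [a,c,b,d,e,f,g] = - eps [a,b,c,d,e,f,g]"
  "eps [a,b,d,c,e,f,g] = - eps [a,b,c,d,e,f,g]" "eps [a,b,c,e,d,f,g] = - eps [a,b,c,d,e,f,g]"
  "eps [a,b,c,d,f,e,g] = - eps [a,b,c,d,e,f,g]" "eps [a,b,c,d,e,g,f] = - eps [a,b,c,d,e,f,g]"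
  using alternating_swap[OF alternating_eps, of "[]" "[c,d,e,f,g]" b a] alternating_swap[OF alternating_eps, of "[a]" "[d,e,f,g]" c b]
    alternating_swap[OF alternating_eps, of "[a,b]" "[e,f,g]" d c] alternating_swap[OF alternating_eps, of "[a,b,c]" "[f,g]" e d]
    alternating_swap[OF alternating_eps, of "[a,b,c,d]" "[g]" f e] alternating_swap[OF alternating_eps, of "[a,b,c,d,e]" "[]" g f]
  by simp_all

lemma eps_sort:
  "idx7 b < idx7 a \<Longrightarrow> eps [a,b,c,d,e,f,g] = - eps [b,a,c,d,e,f,g]"
  "idx7 c < idx7 b \<Longrightarrow> eps [a,b,c,d,e,f,g] = - eps [a,c,b,d,e,f,g]"
  "idx7 d < idx7 c \<Longrightarrow> eps [a,b,c,d,e,f,g] = - eps [a,b,d,c,e,f,g]"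
  "idx7 e < idx7 d \<Longrightarrow> eps [a,b,c,d,e,f,g] = - eps [a,b,c,e,d,f,g]"
  "idx7 f < idx7 e \<Longrightarrow> eps [a,b,c,d,e,f,g] = - eps [a,b,c,d,f,e,g]"
  "idx7 g < idx7 f \<Longrightarrow> eps [a,b,c,d,e,f,g] = - eps [a,b,c,d,e,g,f]"
  by (rule eps_swap)+

lemma eps_equal:
  "eps [a,a,c,d,e,f,g] = 0" "eps [a,b,b,d,e,f,g] = 0" "eps [a,b,c,c,e,f,g] = 0"
  "eps [a,b,c,d,d,f,g] = 0" "eps [a,b,c,d,e,e,g] = 0" "eps [a,b,c,d,e,f,f] = 0"
  using eps_swap(1)[of a a c d e f g] eps_swap(2)[of a b b d e f g] eps_swap(3)[of a b c c e f g]
    eps_swap(4)[of a b c d d f g] eps_swap(5)[of a b c d e e g] eps_swap(6)[of a b c d e f f] by simp_all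

lemma eps_0: "eps [0,1,2,3,4,5,6] = 1"
proof -
  have "eps [0,1,2,3,4,5,6] = eps [1,2,3,4,5,6,0]"
    by (simp only: eps_swap(1)[of 0 1] eps_swap(2)[of _ 0 2] eps_swap(3)[of _ _ 0 3] eps_swap(4)[of _ _ _ 0 4]
      eps_swap(5)[of _ _ _ _ 0 5] eps_swap(6)[of _ _ _ _ _ 0 6] minus_minus)
  moreover have "(7::7) = 0" by simp
  ultimately show ?thesis using eps_1 by (simp only:)
qed

lemma skew4_eqI:
  fixes F G :: "7 \<Rightarrow> 7 \<Rightarrow> 7 \<Rightarrow> 7 \<Rightarrow> real"
  assumes F: "\<And>i j k l. F j i k l = - F i j k l" "\<And>i j k l. F i k j l = - F i j k l" "\<And>i j k l. F i j l k = - F i j k l"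
    and G: "\<And>i j k l. G j i k l = - G i j k l" "\<And>i j k l. G i k j l = - G i j k l" "\<And>i j k l. G i j l k = - G i j k l"
    and E: "\<forall>i. \<forall>j\<in>after i. \<forall>k\<in>after j. \<forall>l\<in>after k. F i j k l = G i j k l"
  shows "F i j k l = G i j k l"
proof (rule skew3_eqI[where F = "F i" and G = "G i"])
  let ?D = "\<lambda>i j k l. F i j k l - G i j k l"
  have s: "?D i j k l = - ?D j i k l" "?D i j k l = - ?D i k j l" "?D i j k l = - ?D i j l k" for i j k l
    using F(1)[of i j k l] F(2)[of i j k l] F(3)[of i j k l] G(1)[of i j k l] G(2)[of i j k l] G(3)[of i j k l] by simp_all
  have z: "?D i j k l = 0" if "i = j \<or> j = k \<or> k = l" for i j k l
    using that s(1)[of i i k l] s(2)[of i j j l] s(3)[of i j k k] by auto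
  have b: "?D i j k l = 0" if "idx7 i < idx7 j" "idx7 j < idx7 k" "idx7 k < idx7 l" for i j k l
    using E that by (auto simp: after_def)
  show "\<forall>j. \<forall>k\<in>after j. \<forall>l\<in>after k. F i j k l = G i j k l"
  proof (intro allI ballI)
    fix j k l assume "k \<in> after j" "l \<in> after k"
    then have jkl: "idx7 j < idx7 k" "idx7 k < idx7 l" by (auto simp: after_def)
    consider "idx7 i < idx7 j" | "i = j" | "idx7 j < idx7 i" "idx7 i < idx7 k" | "i = k"
      | "idx7 k < idx7 i" "idx7 i < idx7 l" | "i = l" | "idx7 l < idx7 i"
      using idx7_cases[of i j] idx7_cases[of i k] idx7_cases[of i l] by blast
    then have "?D i j k l = 0"
    proof cases
      case 1 then show ?thesis using b jkl by blast
    next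
      case 2 then show ?thesis using z by blast
    next
      case 3 then show ?thesis using s(1)[of i j k l] b[of j i k l] jkl by simp
    next
      case 4 then show ?thesis using s(1)[of i j k l] z[of j i k l] by simp
    next
      case 5 then show ?thesis using s(1)[of i j k l] s(2)[of j i k l] b[of j k i l] jkl by simp
    next
      case 6 then show ?thesis using s(1)[of i j k l] s(2)[of j i k l] z[of j k i l] by simp
    next
      case 7 then show ?thesis using s(1)[of i j k l] s(2)[of j i k l] s(3)[of j k i l] b[of j k l i] jkl by simp
    qed
    then show "F i j k l = G i j k l" by simp
  qed
qed (rule F G)+

text \<open>Identifies \<open>ps\<close> with the Hodge dual of \<phi>. The factor 6 counts the
  orderings of a, b, c.\<close>

lemma ph_eps: "(\<Sum>\<^sub>7a b c. ph a b c * eps [a,b,c,i,j,k,l]) = 6 * ps i j k l"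
proof (rule skew4_eqI[where F = "\<lambda>i j k l. \<Sum>\<^sub>7a b c. ph a b c * eps [a,b,c,i,j,k,l]" and G = "\<lambda>i j k l. 6 * ps i j k l"])
  show "\<forall>i. \<forall>j\<in>after i. \<forall>k\<in>after j. \<forall>l\<in>after k.
      (\<Sum>\<^sub>7a b c. ph a b c * eps [a,b,c,i,j,k,l]) = 6 * ps i j k l"
    unfolding ps_def sum_ph unfolding forall_7 after ball_simps sum_7
    by (simp add: ph_def dl_def cross_tab eps_sort eps_equal eps_0 idx7)
next
  fix i j k l
  have e: "eps [a,b,c,j,i,k,l] = - eps [a,b,c,i,j,k,l]" "eps [a,b,c,i,k,j,l] = - eps [a,b,c,i,j,k,l]"
    "eps [a,b,c,i,j,l,k] = - eps [a,b,c,i,j,k,l]" for a b c by (rule eps_swap)+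
  show "(\<Sum>\<^sub>7a b c. ph a b c * eps [a,b,c,j,i,k,l]) = - (\<Sum>\<^sub>7a b c. ph a b c * eps [a,b,c,i,j,k,l])"
   "(\<Sum>\<^sub>7a b c. ph a b c * eps [a,b,c,i,k,j,l]) = - (\<Sum>\<^sub>7a b c. ph a b c * eps [a,b,c,i,j,k,l])"
   "(\<Sum>\<^sub>7a b c. ph a b c * eps [a,b,c,i,j,l,k]) = - (\<Sum>\<^sub>7a b c. ph a b c * eps [a,b,c,i,j,k,l])"
    by (simp_all only: e mult_minus_right sum_negf)
  show "6 * ps j i k l = - (6 * ps i j k l)" "6 * ps i k j l = - (6 * ps i j k l)" "6 * ps i j l k = - (6 * ps i j k l)"
    using ps_skew12[of j i k l] ps_skew23[of i k j l] ps_skew34[of i j l k] by simp_all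
qed

lemma alternating_repeated:
  assumes "alternating k t" "length is = k" "\<not> distinct is" shows "t is = 0"
proof -
  obtain a b where ab: "a < k" "b < k" "a \<noteq> b" "is ! a = is ! b"
    using assms(2,3) by (auto simp: distinct_conv_nth)
  have "permute_list (Transposition.transpose a b) is = is"
    using ab assms(2) by (intro nth_equalityI) (auto simp: permute_list_def Transposition.transpose_def)
  then show ?thesis using alternating_transpose[OF assms(1,2) ab(1-3)] by simp
qed

lemma alternating_7:
  assumes t: "alternating 7 t" and len: "length is = 7"
  shows "t is = t [1,2,3,4,5,6,7] * eps is"
proof (cases "distinct is")
  case False
  then show ?thesis using alternating_repeated[OF t len] alternating_repeated[OF alternating_eps len] by simp
next
  case True
  let ?L = "[1,2,3,4,5,6,7::7]"
  have L: "length ?L = 7" "set ?L = UNIV" by (simp, unfold UNIV_7, auto)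
  have "distinct ?L" by simp
  moreover have "set is = UNIV"
  proof -
    have "card (set is) = CARD(7)" using True len by (simp add: distinct_card)
    then show ?thesis by (intro card_subset_eq) auto
  qed
  ultimately have "mset is = mset ?L" using True L(2) set_eq_iff_mset_eq_distinct by metis
  then obtain p where p: "p permutes {..<length ?L}" "permute_list p ?L = is"
    using mset_eq_permutation by blast
  then have p7: "p permutes {..<7}" using L(1) by (simp only:)
  have "t is = of_int (sign p) * t ?L" "eps is = of_int (sign p) * eps ?L"
    using t alternating_eps p7 p(2) L(1) unfolding alternating_def by (metis length_idx)+
  then show ?thesis by (simp only: eps_1) simp
qed

lemma coframe_wedge_7: "length is = 7 \<Longrightarrow> coframe_wedge M [1,2,3,4,5,6,7] is = det M * eps is"
proof -
  have "length [1,2,3,4,5,6,7::7] = 7" by simp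
  then have "alternating 7 (coframe_wedge M [1,2,3,4,5,6,7])"
    using alternating_coframe_wedge[of "[1,2,3,4,5,6,7]" M] by (simp only:)
  then show "length is = 7 \<Longrightarrow> coframe_wedge M [1,2,3,4,5,6,7] is = det M * eps is"
    using alternating_7 det_coframe_wedge by metis
qed

lemma fr_eps: "length is = 7 \<Longrightarrow> fr R eps is = det (\<chi> a b. R b $ a) * eps is"
proof -
  assume l: "length is = 7"
  have "fr R eps is = coframe_wedge (\<chi> a b. \<Sum>\<^sub>7i. mat 1 $ a $ i * R b $ i) [1,2,3,4,5,6,7] is"
    unfolding eps_def using l by (intro fr_coframe_wedge) simp
  also have "(\<chi> a b. \<Sum>\<^sub>7i. mat 1 $ a $ i * R b $ i) = (\<chi> a b. R b $ a)"
    by (simp add: vec_eq_iff mat_def if_distrib if_distribR cong: if_cong)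
  finally show ?thesis by (simp only: coframe_wedge_7[OF l])
qed

lemma coframe_wedge_3:
  "coframe_wedge E [a,b,c] [i,j,k] =
     E $ a $ i * (E $ b $ j * E $ c $ k - E $ b $ k * E $ c $ j)
     - E $ a $ j * (E $ b $ i * E $ c $ k - E $ b $ k * E $ c $ i)
     + E $ a $ k * (E $ b $ i * E $ c $ j - E $ b $ j * E $ c $ i)"
proof -
  have f12: "finite {2::nat}" "1 \<notin> {2::nat}" "finite {1,2::nat}" "0 \<notin> {1,2::nat}" by auto
  have s: "{..<3::nat} = insert 0 (insert 1 {2})" by auto
  have "coframe_wedge E [a,b,c] [i,j,k] =
    (\<Sum>p | p permutes insert 0 (insert 1 {2::nat}). of_int (sign p) * (E $ a $ ([i,j,k] ! p 0) * (E $ b $ ([i,j,k] ! p 1) * E $ c $ ([i,j,k] ! p 2))))"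
    by (subst coframe_wedge_formula) (simp_all add: s[unfolded numeral_3_eq_3] numeral_2_eq_2)
  then show ?thesis
    unfolding sum_over_permutations_insert[OF f12(3,4)] sum_over_permutations_insert[OF f12(1,2)]
    unfolding permutes_sing
    by (simp add: sign_swap_id permutation_swap_id sign_compose sign_id permutation_compose)
       (simp add: Transposition.transpose_def algebra_simps numeral_2_eq_2)
qed

text \<open>The point where the table \<open>ph\<close> is compared with the seven monomials of
  \<open>g2_model\<close>. The index 7 of the monomials has to be rewritten as 0.\<close>

lemma sum_ph_E:
  "(\<Sum>\<^sub>7a b c. ph a b c * (E $ a $ i * (E $ b $ j * E $ c $ k))) = g2_model E [i,j,k]"
proof -
  have seven: "(7::7) = 0" by simp
  show ?thesis
    unfolding g2_model_def coframe_wedge_3 sum_ph sum_7 seven by (simp add: cross_tab algebra_simps)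
qed

definition phl :: tensor where "phl is = ph (is ! 0) (is ! 1) (is ! 2)"

lemma g2_model_fr: "g2_model E [i,j,k] = fr (\<lambda>i. \<chi> a. E $ a $ i) phl [i,j,k]"
  unfolding sum_ph_E[symmetric] by (simp add: phl_def sum_distrib_left ac_simps)

lemma fr_split:
  assumes "\<And>is js. length is = length as \<Longrightarrow> length js = length bs \<Longrightarrow> t (is @ js) = u is * v js"
  shows "fr F t (as @ bs) = fr F u as * fr F v bs"
proof -
  have "fr F t (as @ bs) = fr F (\<lambda>is. fr F (\<lambda>js. u is * v js) bs) as"
    unfolding fr_append by (intro fr_cong) (simp add: assms)
  then show ?thesis by (simp add: fr_cmult fr_multc)
qed

lemma length_7E:
  assumes "length is = (7::nat)" obtains a b c d e f g where "is = [a,b,c,d,e,f,g]"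
  using assms by (auto simp: numeral_eq_Suc length_Suc_conv)

text \<open>The components of i_u \<phi> \<and> i_v \<phi> \<and> \<phi>, Bryant's bilinear form
  with values in the 7-forms. It is built from \<phi> alone and recovers the product of metric and
  volume form.\<close>

definition bryant :: "(7 \<Rightarrow> 7 \<Rightarrow> 7 \<Rightarrow> real) \<Rightarrow> 7 \<Rightarrow> 7 \<Rightarrow> real" where
  "bryant f i j = (\<Sum>is\<in>idx 7. f i (is!0) (is!1) * f j (is!2) (is!3) * f (is!4) (is!5) (is!6) * eps is)"

text \<open>The factor 144 = 6 * 4 * 6 comes from \<open>ph_eps\<close>, \<open>ps_ph4\<close> and
  \<open>ph_ph6\<close> in turn.\<close>

lemma bryant_ph: "bryant ph i j = 144 * dl i j"
proof -
  have s: "(\<Sum>is\<in>idx 7. h is) = (\<Sum>\<^sub>7a b c d e f g. h [a,b,c,d,e,f,g])" for h :: "7 list \<Rightarrow> real"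
    by (simp add: numeral_eq_Suc sum_idx_Suc)
  have e: "eps [a,b,c,d,e,f,g] = eps [e,f,g,a,b,c,d]" for a b c d e f g
    using eps_swap(4)[of a b c d e f g] eps_swap(3)[of a b c e d f g] eps_swap(2)[of a b c]
      eps_swap by smt
  have "bryant ph i j = (\<Sum>\<^sub>7a b c d. ph i a b * ph j c d * (\<Sum>\<^sub>7e f g. ph e f g * eps [e,f,g,a,b,c,d]))"
  proof -
    have "ph i a b * ph j c d * ph e f g * eps [a,b,c,d,e,f,g] = ph i a b * ph j c d * (ph e f g * eps [e,f,g,a,b,c,d])" for a b c d e f g
      using e[of a b c d e f g] by simp
    moreover have "bryant ph i j = (\<Sum>\<^sub>7a b c d e f g. ph i a b * ph j c d * ph e f g * eps [a,b,c,d,e,f,g])"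
      unfolding bryant_def s by (simp add: eval_nat_numeral)
    ultimately show ?thesis by (simp only: sum_distrib_left)
  qed
  also have "\<dots> = 6 * (\<Sum>\<^sub>7a b. ph i a b * (\<Sum>\<^sub>7c d. ps a b c d * ph j c d))"
    unfolding ph_eps by (simp add: sum_distrib_left ac_simps)
  also have "\<dots> = 24 * (\<Sum>\<^sub>7a b. ph i a b * ph j a b)" unfolding ps_ph4 by (simp add: sum_distrib_left ac_simps)
  finally show ?thesis by (simp add: ph_ph6)
qed

text \<open>The form is natural under linear maps: the seven contracted slots turn
  \<open>eps\<close> into \<open>det E\<close> times \<open>eps\<close>, and each of the two free
  slots receives one factor E.\<close>

lemma bryant_g2_model:
  "bryant (\<lambda>i j k. g2_model E [i,j,k]) i j = 144 * det E * (Finite_Cartesian_Product.transpose E ** E) $ i $ j"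
proof -
  let ?F = "\<lambda>i. \<chi> a. E $ a $ i"
  let ?t = "\<lambda>p q is. ph p (is!0) (is!1) * ph q (is!2) (is!3) * ph (is!4) (is!5) (is!6)"
  have 1: "g2_model E [i,a,b] * g2_model E [j,c,d] * g2_model E [e,f,g] =
     (\<Sum>\<^sub>7p q. E $ p $ i * E $ q $ j * fr ?F (?t p q) [a,b,c,d,e,f,g])" for a b c d e f g
  proof -
    have g: "g2_model E [i,a,b] = (\<Sum>\<^sub>7p. E $ p $ i * fr ?F (\<lambda>is. ph p (is!0) (is!1)) [a,b])" for i a b
      unfolding g2_model_fr fr.simps(2)[of _ _ i] by (simp add: phl_def del: fr.simps)
    have s1: "fr ?F (?t p q) ([a,b] @ ([c,d] @ [e,f,g])) =
       fr ?F (\<lambda>is. ph p (is!0) (is!1)) [a,b] * fr ?F (\<lambda>is. ph q (is!0) (is!1) * phl (drop 2 is)) ([c,d] @ [e,f,g])" for p q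
      by (rule fr_split) (auto simp: phl_def numeral_eq_Suc length_Suc_conv)
    have s2: "fr ?F (\<lambda>is. ph q (is!0) (is!1) * phl (drop 2 is)) ([c,d] @ [e,f,g])
      = fr ?F (\<lambda>is. ph q (is!0) (is!1)) [c,d] * fr ?F phl [e,f,g]" for q
      by (rule fr_split) (auto simp: numeral_eq_Suc length_Suc_conv)
    have 2: "fr ?F (?t p q) [a,b,c,d,e,f,g] = fr ?F (\<lambda>is. ph p (is!0) (is!1)) [a,b]
      * (fr ?F (\<lambda>is. ph q (is!0) (is!1)) [c,d] * fr ?F phl [e,f,g])" for p q
      using s1[of p q] s2[of q] by (simp del: fr.simps)
    show ?thesis
      unfolding g[of i] g[of j] g2_model_fr[of E e] 2
      by (simp only: sum_distrib_left sum_distrib_right, subst sum.swap) (simp add: ac_simps del: fr.simps)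
  qed
  have "bryant (\<lambda>i j k. g2_model E [i,j,k]) i j = (\<Sum>is\<in>idx 7. \<Sum>\<^sub>7p q. E $ p $ i * E $ q $ j * (fr ?F (?t p q) is * eps is))"
    unfolding bryant_def
  proof (intro sum.cong refl)
    fix "is" :: "7 list" assume "is \<in> idx 7"
    then obtain a b c d e f g where "is": "is = [a,b,c,d,e,f,g]" by (auto elim: length_7E)
    show "g2_model E [i, is ! 0, is ! 1] * g2_model E [j, is ! 2, is ! 3] * g2_model E [is ! 4, is ! 5, is ! 6] * eps is =
      (\<Sum>\<^sub>7p q. E $ p $ i * E $ q $ j * (fr ?F (?t p q) is * eps is))"
      using 1[of a b c d e f g] by (simp add: "is" sum_distrib_right mult.assoc del: fr.simps)
  qed
  also have "\<dots> = (\<Sum>\<^sub>7p q. E $ p $ i * E $ q $ j * (\<Sum>is\<in>idx 7. fr ?F (?t p q) is * eps is))"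
    by (subst sum.swap, intro sum.cong refl, subst sum.swap) (simp add: sum_distrib_left)
  also have "\<dots> = (\<Sum>\<^sub>7p q. E $ p $ i * E $ q $ j * (det E * (144 * dl p q)))"
  proof -
    have "(\<Sum>is\<in>idx 7. fr ?F t is * eps is) = det E * (\<Sum>cs\<in>idx 7. t cs * eps cs)" for t
    proof -
      have ev: "fr F u is = (\<Sum>js\<in>idx 7. u js * (\<Prod>a<7. F (is!a) $ (js!a)))" if "is \<in> idx 7" for F u "is"
        using that unfolding eval_tensor_map[symmetric] eval_tensor_def by simp
      have "(\<Sum>is\<in>idx 7. fr ?F t is * eps is) = (\<Sum>is\<in>idx 7. \<Sum>cs\<in>idx 7. t cs * (eps is * (\<Prod>a<7. ?F (is ! a) $ (cs ! a))))"
        by (rule sum.cong[OF refl]) (simp only: ev sum_distrib_right mult.assoc, simp only: mult.commute)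
      also have "\<dots> = (\<Sum>cs\<in>idx 7. t cs * (\<Sum>is\<in>idx 7. eps is * (\<Prod>a<7. ?F (is ! a) $ (cs ! a))))"
        by (subst sum.swap) (simp only: sum_distrib_left)
      also have "\<dots> = (\<Sum>cs\<in>idx 7. t cs * fr (\<lambda>c. E $ c) eps cs)"
        by (intro sum.cong refl) (simp only: ev vec_lambda_beta)
      also have "\<dots> = det E * (\<Sum>cs\<in>idx 7. t cs * eps cs)"
      proof -
        have "(\<chi> a b. E $ b $ a) = Finite_Cartesian_Product.transpose E" by (simp add: Finite_Cartesian_Product.transpose_def)
        then have "fr (\<lambda>c. E $ c) eps cs = det E * eps cs" if "length cs = 7" for cs
          using fr_eps[OF that, of "\<lambda>c. E $ c"] by (simp add: det_transpose)
        then show ?thesis by (simp add: sum_distrib_left ac_simps)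
      qed
      finally show ?thesis .
    qed
    then show ?thesis using bryant_ph unfolding bryant_def by simp
  qed
  also have "\<dots> = 144 * det E * (\<Sum>\<^sub>7p q. dl p q * (E $ p $ i * E $ q $ j))"
    by (simp add: sum_distrib_left ac_simps del: sum_dl)
  finally show ?thesis
    by (simp add: matrix_matrix_mult_def Finite_Cartesian_Product.transpose_def)
qed

text \<open>By \<open>bryant_g2_model\<close> the form \<phi> determines det E times the metric. The
  determinant of this matrix is a power of det E with odd exponent, so det E is determined, and then
  the metric. No description of the stabiliser of \<phi> is involved.\<close>

lemma adapted_unique:
  assumes "adapted \<phi> E" "adapted \<phi> E'"
  shows "Finite_Cartesian_Product.transpose E ** E = Finite_Cartesian_Product.transpose E' ** E'" "det E = det E'"
proof -
  let ?g = "\<lambda>E. Finite_Cartesian_Product.transpose E ** E :: real^7^7"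
  have b: "bryant (\<lambda>i j k. \<phi> [i,j,k]) i j = 144 * det E * ?g E $ i $ j" if "adapted \<phi> E" for E i j
    using that bryant_g2_model[of E i j] by (simp add: adapted_def)
  have nz: "det E \<noteq> 0" "det E' \<noteq> 0" using assms by (simp_all add: adapted_def invertible_det_nz)
  have eq: "det E * ?g E $ i $ j = det E' * ?g E' $ i $ j" for i j
    using b[OF assms(1), of i j] b[OF assms(2), of i j] by simp
  have "det (\<chi> i. det E *s ?g E $ i) = det (\<chi> i. det E' *s ?g E' $ i)"
    using eq by (intro arg_cong[where f = det]) (simp add: vec_eq_iff)
  \<comment> \<open>Scaling seven rows by det E contributes seven factors, and the determinant of
    the metric two more.\<close>
  then have "det E ^ 9 = det E' ^ 9"
    by (simp add: det_rows_mul det_mul det_transpose power2_eq_square) (simp add: numeral_eq_Suc ac_simps)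
  moreover have "root 9 (det M ^ 9) = det M" for M :: "real^7^7" by (rule odd_real_root_power_cancel) simp
  ultimately show "det E = det E'" by metis
  then show "?g E = ?g E'" using eq nz by (simp add: vec_eq_iff)
qed

lemma fr_fr: "fr H (fr F t) is = fr (\<lambda>a. \<Sum>\<^sub>7b. H a $ b *\<^sub>R F b) t is"
proof (induction "is" arbitrary: t)
  case (Cons a "is")
  have "fr H (fr F t) (a # is) = (\<Sum>\<^sub>7b i. H a $ b * (F b $ i * fr H (fr F (\<lambda>js. t (i # js))) is))"
    by (simp add: fr_sum fr_cmult sum_distrib_left)
  also have "\<dots> = (\<Sum>\<^sub>7i b. H a $ b * (F b $ i * fr H (fr F (\<lambda>js. t (i # js))) is))" by (rule sum.swap)
  finally show ?case by (simp add: Cons sum_distrib_right mult.assoc)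
qed simp

lemma fr_axis: "fr (\<lambda>a. axis a 1) t is = t is"
  by (induction "is" arbitrary: t) (simp_all add: axis_def if_distrib if_distribR cong: if_cong)

text \<open>\<open>H\<close> is the coframe dual to \<open>F\<close>, so evaluation on
  \<open>F\<close> is undone by evaluation with \<open>H\<close>. This is how identities proved in a
  frame return to coordinates.\<close>

lemma fr_inject:
  assumes FE: "\<And>i j. (\<Sum>\<^sub>7a. H i $ a * F a $ j) = dl i j"
    and eq: "\<And>as. length as = length is \<Longrightarrow> fr F t as = fr F u as"
  shows "t is = u is"
proof -
  have H: "(\<lambda>a. \<Sum>\<^sub>7b. H a $ b *\<^sub>R F b) = (\<lambda>a. axis a 1)"
    using FE by (auto simp: fun_eq_iff vec_eq_iff axis_def dl_def)
  have "t is = fr H (fr F t) is" for t by (simp add: fr_fr H fr_axis)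
  then show ?thesis using fr_cong[of "is" "fr F t" "fr F u" H] eq by metis
qed

lemma cn_idx: "cn G n f g = (\<Sum>ks\<in>idx n. \<Sum>ls\<in>idx n. (\<Prod>a<n. G (ks ! a) (ls ! a)) * (f ks * g ls))"
proof (induction n arbitrary: f g)
  case (Suc n)
  have "(\<Sum>ks\<in>idx (Suc n). \<Sum>ls\<in>idx (Suc n). (\<Prod>a<Suc n. G (ks ! a) (ls ! a)) * (f ks * g ls))
    = (\<Sum>\<^sub>7k. \<Sum>ks\<in>idx n. \<Sum>\<^sub>7l. \<Sum>ls\<in>idx n. G k l * ((\<Prod>a<n. G (ks ! a) (ls ! a)) * (f (k # ks) * g (l # ls))))"
    by (simp add: sum_idx_Suc prod.lessThan_Suc_shift mult.assoc del: prod.lessThan_Suc)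
  also have "\<dots> = (\<Sum>\<^sub>7k l. \<Sum>ks\<in>idx n. \<Sum>ls\<in>idx n. G k l * ((\<Prod>a<n. G (ks ! a) (ls ! a)) * (f (k # ks) * g (l # ls))))"
    by (intro sum.cong refl sum.swap)
  finally show ?case by (simp add: Suc sum_distrib_left)
qed simp

lemma cn_dl: "cn dl n f g = (\<Sum>as\<in>idx n. f as * g as)"
proof (induction n arbitrary: f g)
  case (Suc n)
  have "cn dl (Suc n) f g = (\<Sum>\<^sub>7k l. dl k l * (\<Sum>as\<in>idx n. f (k # as) * g (l # as)))" by (simp add: Suc)
  then show ?case by (simp add: sum_idx_Suc)
qed simp

section \<open>Adapted frames, scalar products and the Hodge star\<close>

definition adapted_frame :: "tensor \<Rightarrow> (7 \<Rightarrow> R7) \<Rightarrow> bool" where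
  "adapted_frame \<phi> F \<longleftrightarrow> (\<exists>E. adapted \<phi> E \<and> F = (\<lambda>a. \<chi> i. matrix_inv E $ i $ a))"

lemma some_coframe_adapted: "adapted \<phi> E \<Longrightarrow> adapted \<phi> (some_coframe \<phi>)"
  using someI[of "adapted \<phi>" E] by (simp only: some_coframe_def)

lemma metric_adapted: "adapted \<phi> E \<Longrightarrow> metric \<phi> = Finite_Cartesian_Product.transpose E ** E"
  unfolding metric_def using adapted_unique(1)[OF some_coframe_adapted] by blast

lemma volume_adapted: "adapted \<phi> E \<Longrightarrow> length is = 7 \<Longrightarrow> volume \<phi> is = det E * eps is"
  unfolding volume_def using adapted_unique(2)[OF some_coframe_adapted, of \<phi> E E] by (simp only: coframe_wedge_7)

lemma adapted_frame_exists: "adapted \<phi> E \<Longrightarrow> \<exists>F. adapted_frame \<phi> F"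
  unfolding adapted_frame_def by blast

definition dual_coframe :: "real^7^7 \<Rightarrow> (7 \<Rightarrow> R7) \<Rightarrow> bool" where
  "dual_coframe H F \<longleftrightarrow> (\<forall>a b. (\<Sum>\<^sub>7i. H $ a $ i * F b $ i) = dl a b) \<and> (\<forall>i j. (\<Sum>\<^sub>7a. F a $ i * H $ a $ j) = dl i j)"

lemma dual_coframeD:
  assumes "dual_coframe H F"
  shows "(\<Sum>\<^sub>7i. H $ a $ i * F b $ i) = dl a b" "(\<Sum>\<^sub>7a. F a $ i * H $ a $ j) = dl i j"
  using assms by (simp_all add: dual_coframe_def)

lemma adapted_frame_coframe:
  assumes "adapted_frame \<phi> F"
  shows "\<exists>H. dual_coframe H F \<and> adapted \<phi> H"
proof -
  obtain E where E: "adapted \<phi> E" "F = (\<lambda>a. \<chi> i. matrix_inv E $ i $ a)" using assms by (auto simp: adapted_frame_def)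
  have "invertible E" using E(1) by (simp add: adapted_def)
  from matrix_inv_left_right[OF this]
  have "(\<Sum>\<^sub>7i. E $ a $ i * F b $ i) = dl a b" "(\<Sum>\<^sub>7a. F a $ i * E $ a $ j) = dl i j" for a b i j
    by (simp_all add: E(2) vec_eq_iff matrix_matrix_mult_def mat_def dl_def)
  then show ?thesis using E(1) unfolding dual_coframe_def by blast
qed

lemma adapted_frame_G:
  assumes "adapted_frame \<phi> F"
  shows "matrix_inv (metric \<phi>) $ i $ j = (\<Sum>\<^sub>7a. F a $ i * F a $ j)" "invertible (metric \<phi>)"
proof -
  obtain H where HF: "dual_coframe H F" and A: "adapted \<phi> H"
    using adapted_frame_coframe[OF assms] by blast
  note H = dual_coframeD[OF HF]
  let ?K = "(\<chi> i j. \<Sum>\<^sub>7a. F a $ i * F a $ j) :: real^7^7"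
  have g: "metric \<phi> $ i $ j = (\<Sum>\<^sub>7a. H $ a $ i * H $ a $ j)" for i j
    by (simp add: metric_adapted[OF A] matrix_matrix_mult_def Finite_Cartesian_Product.transpose_def)
  have "(\<Sum>\<^sub>7k. (\<Sum>\<^sub>7a. F a $ i * F a $ k) * (\<Sum>\<^sub>7b. H $ b $ k * H $ b $ j)) = dl i j" for i j
  proof -
    have "(\<Sum>\<^sub>7k. (\<Sum>\<^sub>7a. F a $ i * F a $ k) * (\<Sum>\<^sub>7b. H $ b $ k * H $ b $ j))
      = (\<Sum>\<^sub>7k a b. H $ b $ k * F a $ k * (F a $ i * H $ b $ j))"
      unfolding sum_product by (intro sum.cong refl) (simp only: ac_simps)
    also have "\<dots> = (\<Sum>\<^sub>7a b k. H $ b $ k * F a $ k * (F a $ i * H $ b $ j))" by (rule sum_rot3)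
    also have "\<dots> = (\<Sum>\<^sub>7a b. dl b a * (F a $ i * H $ b $ j))" by (simp add: H(1) flip: sum_distrib_right)
    finally show ?thesis by (simp add: H(2))
  qed
  then have 1: "?K ** metric \<phi> = mat 1" by (simp add: vec_eq_iff matrix_matrix_mult_def g mat_def dl_def)
  then show inv: "invertible (metric \<phi>)" by (meson invertible_left_inverse)
  have "?K = ?K ** (metric \<phi> ** matrix_inv (metric \<phi>))" by (simp add: matrix_inv_left_right[OF inv])
  also have "\<dots> = matrix_inv (metric \<phi>)" by (simp add: matrix_mul_assoc 1)
  finally have "matrix_inv (metric \<phi>) = ?K" ..
  then show "matrix_inv (metric \<phi>) $ i $ j = (\<Sum>\<^sub>7a. F a $ i * F a $ j)" by simp
qed

lemma adapted_frame_phi: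
  assumes "adapted_frame \<phi> F" shows "fr F \<phi> [a,b,c] = ph a b c"
proof -
  obtain H where HF: "dual_coframe H F" and A: "adapted \<phi> H"
    using adapted_frame_coframe[OF assms] by blast
  note H = dual_coframeD[OF HF]
  have "fr F \<phi> [a,b,c] = fr F (fr (\<lambda>i. \<chi> a. H $ a $ i) phl) [a,b,c]"
  proof (rule fr_cong)
    fix js :: "7 list" assume "length js = length [a,b,c]"
    then have l: "length js = 3" by simp
    then obtain i j k where js: "js = [i,j,k]" by (auto simp: length_Suc_conv numeral_3_eq_3)
    have "\<phi> js = g2_model H js" using A l unfolding adapted_def by (metis length_idx)
    then show "\<phi> js = fr (\<lambda>i. \<chi> a. H $ a $ i) phl js" by (simp only: js g2_model_fr)
  qed
  also have "\<dots> = fr (\<lambda>a. axis a 1) phl [a,b,c]"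
  proof -
    have "(\<lambda>a. \<Sum>\<^sub>7b. F a $ b *\<^sub>R (\<chi> c. H $ c $ b)) = (\<lambda>a. axis a 1)"
      by (auto simp: fun_eq_iff vec_eq_iff axis_def H(1)[unfolded dl_def] mult.commute[of "F _ $ _"])
    then show ?thesis by (simp only: fr_fr)
  qed
  finally show ?thesis by (simp only: fr_axis) (simp add: phl_def)
qed

lemma adapted_frame_volume:
  assumes "adapted_frame \<phi> F" "length is = 7" shows "fr F (volume \<phi>) is = eps is"
proof -
  obtain H where HF: "dual_coframe H F" and A: "adapted \<phi> H"
    using adapted_frame_coframe[OF assms(1)] by blast
  note H = dual_coframeD[OF HF]
  have "fr F (volume \<phi>) is = fr F (coframe_wedge H [1,2,3,4,5,6,7]) is"
    using assms(2) by (intro fr_cong) (simp only: volume_adapted[OF A] coframe_wedge_7)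
  also have "\<dots> = coframe_wedge (\<chi> a b. \<Sum>\<^sub>7i. H $ a $ i * F b $ i) [1,2,3,4,5,6,7] is"
    using assms(2) by (intro fr_coframe_wedge) simp
  also have "(\<chi> a b. \<Sum>\<^sub>7i. H $ a $ i * F b $ i) = mat 1" by (simp add: vec_eq_iff H(1) mat_def dl_def)
  finally show ?thesis by (simp only: eps_def)
qed

lemma raise_inner:
  assumes "adapted_frame \<phi> F"
  shows "(\<Sum>is\<in>idx k. raise \<phi> \<alpha> is * \<beta> is) = (\<Sum>as\<in>idx k. fr F \<alpha> as * fr F \<beta> as)"
proof -
  let ?G = "\<lambda>i j. matrix_inv (metric \<phi>) $ i $ j"
  have sym: "?G i j = ?G j i" for i j by (simp add: adapted_frame_G[OF assms] mult.commute)
  have "(\<Sum>is\<in>idx k. raise \<phi> \<alpha> is * \<beta> is) = (\<Sum>is\<in>idx k. \<Sum>js\<in>idx k. (\<Prod>a<k. ?G (is ! a) (js ! a)) * (\<alpha> js * \<beta> is))"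
    by (intro sum.cong refl) (simp add: raise_def sum_distrib_right mult.assoc)
  also have "\<dots> = (\<Sum>js\<in>idx k. \<Sum>is\<in>idx k. (\<Prod>a<k. ?G (js ! a) (is ! a)) * (\<alpha> js * \<beta> is))"
    by (subst sum.swap) (simp only: sym)
  also have "\<dots> = cn ?G k \<alpha> \<beta>" by (simp only: cn_idx)
  also have "\<dots> = cn dl k (fr F \<alpha>) (fr F \<beta>)"
    by (rule cn_transform[symmetric])
       (simp add: adapted_frame_G[OF assms] flip: sum_distrib_left)
  finally show ?thesis by (simp only: cn_dl)
qed

lemma fr_hodge:
  assumes "adapted_frame \<phi> F"
  shows "fr F (hodge \<phi> k \<alpha>) js = (\<Sum>as\<in>idx k. fr F \<alpha> as * fr F (volume \<phi>) (as @ js)) / fact k"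
proof -
  have "hodge \<phi> k \<alpha> = (\<lambda>js. inverse (fact k) * (\<Sum>as\<in>idx k. fr F \<alpha> as * fr F (\<lambda>is. volume \<phi> (is @ js)) as))"
    by (simp add: fun_eq_iff hodge_def raise_inner[OF assms] field_simps)
  then have "fr F (hodge \<phi> k \<alpha>) js = inverse (fact k) * (\<Sum>as\<in>idx k. fr F \<alpha> as * fr F (\<lambda>js. fr F (\<lambda>is. volume \<phi> (is @ js)) as) js)"
    by (simp only: fr_cmult fr_sum)
  also have "\<dots> = inverse (fact k) * (\<Sum>as\<in>idx k. fr F \<alpha> as * fr F (volume \<phi>) (as @ js))"
    by (subst fr_swap) (simp only: fr_append)
  finally show ?thesis by (simp add: field_simps)
qed

section \<open>The wedge product with a 1-form\<close>

lemma alternating_move: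
  "alternating k t \<Longrightarrow> k = length xs + length ys + 1 \<Longrightarrow> t (xs @ b # ys) = (-1) ^ length xs * t (b # xs @ ys)"
proof (induction xs arbitrary: ys rule: rev_induct)
  case (snoc x xs)
  have "t ((xs @ [x]) @ b # ys) = - t (xs @ b # x # ys)"
    using alternating_swap[OF snoc.prems(1), of xs ys x b] snoc.prems(2) by simp
  also have "t (xs @ b # x # ys) = (-1) ^ length xs * t (b # xs @ x # ys)"
    using snoc.prems by (intro snoc.IH) auto
  finally show ?case by simp
qed simp

lemma alternating_permute_tail:
  assumes t: "alternating k t" and q: "q permutes {1..<Suc k}" and len: "length L = Suc k"
  shows "t (drop 1 (permute_list q L)) = of_int (sign q) * t (drop 1 L)"
proof -
  define r where "r = map_permutation {1..<Suc k} (\<lambda>i. i - 1) q"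
  have bij: "bij_betw (\<lambda>i. i - 1) {1..<Suc k} {..<k}"
    by (rule bij_betw_byWitness[of _ Suc]) auto
  have r: "r permutes {..<k}" unfolding r_def by (rule map_permutation_permutes[OF bij q])
  have s: "sign r = sign q" unfolding r_def
    by (rule sign_map_permutation[OF _ q]) (use bij in \<open>auto simp: bij_betw_def\<close>)
  have rq: "Suc (r i) = q (Suc i)" if "i < k" for i
  proof -
    have "r (Suc i - 1) = q (Suc i) - 1"
      unfolding r_def using that bij by (intro map_permutation_apply) (auto simp: bij_betw_def)
    moreover have "q (Suc i) \<in> {1..<Suc k}" using permutes_in_image[OF q, of "Suc i"] that by simp
    ultimately show ?thesis by simp
  qed
  have "drop 1 (permute_list q L) = permute_list r (drop 1 L)"
  proof (rule nth_equalityI)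
    fix i assume "i < length (drop 1 (permute_list q L))"
    then have i: "i < k" by (simp add: len)
    have "r i < k" using permutes_in_image[OF r, of i] i by simp
    then show "drop 1 (permute_list q L) ! i = permute_list r (drop 1 L) ! i"
      using i by (simp add: permute_list_def len rq del: upt_Suc)
  qed simp
  then show ?thesis using t r s len unfolding alternating_def by (simp add: idx_def)
qed

text \<open>Every permutation is uniquely the transposition of 0 and some b composed with a
  permutation that fixes 0. The k! choices of the latter contribute equally and cancel the
  normalisation of \<open>wedge\<close>.\<close>

lemma wedge_1:
  assumes t: "alternating k \<beta>" and len: "length is = Suc k"
  shows "wedge 1 \<alpha> \<beta> is = (\<Sum>b<Suc k. (-1) ^ b * (\<alpha> [is ! b] * \<beta> (take b is @ drop (Suc b) is)))"
proof -
  let ?f = "\<lambda>p. of_int (sign p) * \<alpha> (take 1 (permute_list p is)) * \<beta> (drop 1 (permute_list p is))"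
  have set: "{..<Suc k} = insert 0 {1..<Suc k}" by auto
  let ?Q = "{q. q permutes {1..<Suc k}}"
  have eq: "?f (Transposition.transpose 0 b \<circ> q) = (-1) ^ b * (\<alpha> [is ! b] * \<beta> (take b is @ drop (Suc b) is))"
    if b: "b < Suc k" and q: "q permutes {1..<Suc k}" for b q
  proof -
    define L where "L = permute_list (Transposition.transpose 0 b) is"
    have tr: "Transposition.transpose 0 b permutes {..<Suc k}" using b by (intro permutes_swap_id) auto
    have q': "q permutes {..<Suc k}" by (rule permutes_subset[OF q]) auto
    have pl: "permute_list (Transposition.transpose 0 b \<circ> q) is = permute_list q L"
      unfolding L_def using q' len by (intro permute_list_compose) simp_all
    have q0: "q 0 = 0" using q by (simp add: permutes_def)
    have lenL: "length L = Suc k" by (simp add: L_def len)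
    have hd: "take 1 (permute_list q L) = [is ! b]"
      by (simp add: permute_list_def lenL q0 L_def len upt_conv_Cons del: upt_Suc)
    \<comment> \<open>After the transposition the former first entry stands b - 1 places away from
      the front of the tail. Moving it there gives b - 1 signs, and the transposition itself gives
      one more.\<close>
    have tl: "of_int (sign (Transposition.transpose 0 b)) * \<beta> (drop 1 L) = (-1) ^ b * \<beta> (take b is @ drop (Suc b) is)"
    proof (cases b)
      case 0
      then show ?thesis by (simp add: L_def)
    next
      case (Suc c)
      obtain i js where ij: "is = i # js" using len by (cases "is") auto
      have c: "c < length js" using b len by (simp add: Suc ij)
      have "drop 1 L = take c js @ i # drop (Suc c) js"
      proof (rule nth_equalityI)
        show "length (drop 1 L) = length (take c js @ i # drop (Suc c) js)" using c len by (simp add: lenL ij)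
        fix m assume "m < length (drop 1 L)"
        then have m: "m < k" by (simp add: lenL)
        then have "drop 1 L ! m = is ! Transposition.transpose 0 b (Suc m)"
          by (simp add: L_def permute_list_def len del: upt_Suc)
        then show "drop 1 L ! m = (take c js @ i # drop (Suc c) js) ! m"
          using c m len by (auto simp: ij Suc nth_append Transposition.transpose_def nth_Cons')
      qed
      then have "\<beta> (drop 1 L) = (-1) ^ c * \<beta> (i # take c js @ drop (Suc c) js)"
        using alternating_move[OF t, of "take c js" "drop (Suc c) js" i] c len by (simp add: ij)
      then show ?thesis by (simp add: Suc ij sign_swap_id)
    qed
    have sg: "sign (Transposition.transpose 0 b \<circ> q) = sign (Transposition.transpose 0 b) * sign q"
      using tr q' by (intro sign_compose) (auto simp: permutation_permutes)
    have "?f (Transposition.transpose 0 b \<circ> q) =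
        of_int (sign q * sign q) * \<alpha> [is ! b] * (of_int (sign (Transposition.transpose 0 b)) * \<beta> (drop 1 L))"
      unfolding pl sg alternating_permute_tail[OF t q lenL] hd by (simp only: of_int_mult ac_simps)
    moreover have "sign q * sign q = (1::int)" by (simp add: sign_def)
    ultimately show ?thesis unfolding tl by (simp only: of_int_1 mult_1 ac_simps)
  qed
  have "(\<Sum>p | p permutes {..<Suc k}. ?f p) = (\<Sum>b\<in>{..<Suc k}. \<Sum>q\<in>?Q. ?f (Transposition.transpose 0 b \<circ> q))"
    unfolding set by (rule sum_over_permutations_insert) auto
  also have "\<dots> = (\<Sum>b<Suc k. \<Sum>q\<in>?Q. (-1) ^ b * (\<alpha> [is ! b] * \<beta> (take b is @ drop (Suc b) is)))"
    by (intro sum.cong refl eq) auto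
  also have "\<dots> = fact k * (\<Sum>b<Suc k. (-1) ^ b * (\<alpha> [is ! b] * \<beta> (take b is @ drop (Suc b) is)))"
    by (simp only: sum_constant sum_distrib_left) (simp only: card_permutations[of "{1..<Suc k}" k] card_atLeastLessThan diff_Suc_1 finite_atLeastLessThan of_nat_fact flip: sum_distrib_left)
  finally show ?thesis unfolding wedge_def len by simp
qed

text \<open>\<open>\<sigma>\<close> is a permutation given as the list of its values, so that
  concrete rearrangements of slots can be written down and simplified.\<close>

lemma fr_reorder:
  assumes "distinct \<sigma>" "set \<sigma> = {..<length as}"
  shows "fr F (\<lambda>is. t (map ((!) is) \<sigma>)) as = fr F t (map ((!) as) \<sigma>)"
proof -
  have len: "length \<sigma> = length as" using assms distinct_card[of \<sigma>] by simp
  define p where "p i = (if i < length as then \<sigma> ! i else i)" for i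
  have "bij_betw p {..<length as} {..<length as}"
  proof -
    have "bij_betw ((!) \<sigma>) {..<length \<sigma>} (set \<sigma>)" by (rule bij_betw_nth) (simp_all add: assms)
    then have "bij_betw ((!) \<sigma>) {..<length as} {..<length as}" by (simp add: len assms)
    then show ?thesis by (rule bij_betw_cong[THEN iffD1, rotated]) (simp add: p_def)
  qed
  then have p: "p permutes {..<length as}" by (rule bij_imp_permutes) (simp add: p_def)
  have pl: "permute_list p js = map ((!) js) \<sigma>" if "length js = length as" for js :: "7 list"
    by (rule nth_equalityI) (simp_all add: permute_list_def that len p_def)
  have "fr F (\<lambda>is. t (map ((!) is) \<sigma>)) as = fr F (\<lambda>is. t (permute_list p is)) as"
    by (rule fr_cong) (simp add: pl)
  then show ?thesis by (simp only: fr_permute[OF p] pl)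
qed

lemma metric_nth: "adapted \<phi> E \<Longrightarrow> metric \<phi> $ i $ j = (\<Sum>\<^sub>7k. E $ k $ i * E $ k $ j)"
  by (simp add: metric_adapted Finite_Cartesian_Product.transpose_def matrix_matrix_mult_def)

lemma det_metric: "adapted \<phi> E \<Longrightarrow> det (metric \<phi>) = (det E)\<^sup>2"
  by (simp add: metric_adapted det_mul det_transpose power2_eq_square)

section \<open>Torsion and curvature on coordinate vector fields\<close>

lemma pd_axis [simp]: "pd i (\<lambda>y. coord_field j y $ k) x = 0"
  by (simp add: coord_field_def)

lemma sum_coord [simp]: "(\<Sum>\<^sub>7i. coord_field j x $ i * f i) = f j" "(\<Sum>\<^sub>7i. f i * coord_field j x $ i) = f j"
  by (simp_all add: coord_field_def axis_def if_distrib if_distribR cong: if_cong)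

lemma nabla_coord: "nabla \<Gamma> (coord_field i) W x $ k = pd i (\<lambda>y. W y $ k) x + (\<Sum>\<^sub>7j. \<Gamma> x k i j * W x $ j)"
  by (simp add: nabla_def)

lemma nabla_coord_coord: "nabla \<Gamma> (coord_field i) (coord_field j) x $ k = \<Gamma> x k i j"
  by (simp add: nabla_coord)

lemma lie_bracket_coord: "lie_bracket (coord_field i) (coord_field j) = (\<lambda>x. 0)"
  by (simp add: lie_bracket_def fun_eq_iff vec_eq_iff)

lemma gprod_coord: "gprod \<phi> u (coord_field k x) = (\<Sum>\<^sub>7m. u $ m * metric \<phi> $ m $ k)"
  by (simp add: gprod_def inner_vec_def matrix_vector_mult_def)

lemma torsion_field_coord:
  "torsion_field \<phi> \<Gamma> x [i,j,k] = (\<Sum>\<^sub>7m. (\<Gamma> x m i j - \<Gamma> x m j i) * metric (\<phi> x) $ m $ k)"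
  by (simp add: torsion_field_def torsion_def gprod_coord nabla_coord_coord lie_bracket_coord)

lemma curvature_field_coord:
  assumes "\<And>k i j. (\<lambda>y. \<Gamma> y k i j) differentiable (at x)"
  shows "curvature_field \<phi> \<Gamma> x [i,j,k,l] = (\<Sum>\<^sub>7n. riem \<Gamma> i j x n k * metric (\<phi> x) $ n $ l)"
proof -
  have 0: "nabla \<Gamma> (\<lambda>x. 0) W = (\<lambda>x. 0)" for W by (simp add: nabla_def fun_eq_iff vec_eq_iff)
  have "curvature_op \<Gamma> (coord_field i) (coord_field j) (coord_field k) x $ n = riem \<Gamma> i j x n k" for n
    by (simp add: curvature_op_def lie_bracket_coord 0 nabla_coord nabla_coord_coord riem_def sum_subtractf)
  then show ?thesis by (simp add: curvature_field_def curvature_def gprod_coord)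
qed

section \<open>The torsion and the Lee form in an adapted frame\<close>

text \<open>The data of a G_2 manifold with characteristic connection read in a single chart, with
  \<open>U\<close> as the chart image.\<close>

locale g2_chart =
  fixes U :: "R7 set" and \<phi> :: local_field and \<Gamma> :: christoffel
  assumes open_chart: "open U"
    and \<phi>_smooth: "smooth_field U 3 \<phi>"
    and \<phi>_alternating: "\<And>x. x \<in> U \<Longrightarrow> alternating 3 (\<phi> x)"
    and local_coframe: "\<And>x. x \<in> U \<Longrightarrow> \<exists>W E. open W \<and> x \<in> W \<and> W \<subseteq> U \<and>
        (\<forall>a i. smooth_on W (\<lambda>y. E y $ a $ i)) \<and> (\<forall>y\<in>W. adapted (\<phi> y) (E y))"
    and smooth_\<Gamma>: "\<And>k i j. smooth_on U (\<lambda>x. \<Gamma> x k i j)"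
    and metric_parallel: "\<And>x l is. x \<in> U \<Longrightarrow> length is = 2 \<Longrightarrow> cov_deriv \<Gamma> l (metric_field \<phi>) x is = 0"
    and \<phi>_parallel: "\<And>x l is. x \<in> U \<Longrightarrow> length is = 3 \<Longrightarrow> cov_deriv \<Gamma> l \<phi> x is = 0"
    and torsion_alternating: "\<And>x. x \<in> U \<Longrightarrow> alternating 3 (torsion_field \<phi> \<Gamma> x)"
begin

abbreviation gm :: "R7 \<Rightarrow> real^7^7" where "gm x \<equiv> metric (\<phi> x)"

lemma coframe: "x \<in> U \<Longrightarrow> \<exists>E. adapted (\<phi> x) E"
  using local_coframe by blast

text \<open>The metric is defined by a pointwise choice of coframe. Its smoothness follows because a
  smooth adapted coframe exists near each point and, by \<open>adapted_unique\<close>, yields the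
  same metric there.\<close>

sublocale metric_chart U "\<lambda>x. metric (\<phi> x)" \<Gamma>
proof
  show "open U" by (rule open_chart)
  show "smooth_on U (\<lambda>x. gm x $ i $ j)" for i j
  proof (rule smooth_on_local)
    fix x assume "x \<in> U"
    then obtain W E where W: "open W" "x \<in> W" "\<And>a i. smooth_on W (\<lambda>y. E y $ a $ i)" "\<And>y. y \<in> W \<Longrightarrow> adapted (\<phi> y) (E y)"
      using local_coframe by metis
    have "smooth_on W (\<lambda>y. gm y $ i $ j)"
    proof (rule smooth_on_cong[OF W(1)])
      show "smooth_on W (\<lambda>y. \<Sum>\<^sub>7k. E y $ k $ i * E y $ k $ j)"
        using W(1,3) by (intro smooth_on_sum smooth_on_mult)
    qed (simp add: metric_nth[OF W(4)])
    then show "\<exists>W. open W \<and> x \<in> W \<and> smooth_on W (\<lambda>y. gm y $ i $ j)" using W(1,2) by blast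
  qed
  fix x assume x: "x \<in> U"
  obtain E where E: "adapted (\<phi> x) E" using coframe[OF x] by blast
  show "gm x $ i $ j = gm x $ j $ i" for i j by (simp add: metric_nth[OF E] mult.commute)
  have "det E \<noteq> 0" using E by (simp add: adapted_def invertible_det_nz)
  then show "det (gm x) > 0" by (simp add: det_metric[OF E])
  show "pd l (\<lambda>y. gm y $ i $ j) x = (\<Sum>\<^sub>7m. \<Gamma> x m l i * gm x $ m $ j) + (\<Sum>\<^sub>7m. \<Gamma> x m l j * gm x $ i $ m)" for l i j
    using metric_parallel[OF x, of "[i,j]" l] by (simp add: cov_deriv_act metric_field_def)
  show "(\<Sum>\<^sub>7m. (\<Gamma> x m i k - \<Gamma> x m k i) * gm x $ m $ j) = - (\<Sum>\<^sub>7m. (\<Gamma> x m i j - \<Gamma> x m j i) * gm x $ m $ k)" for i j k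
    using alternating_swap[OF torsion_alternating[OF x], of "[i]" "[]" k j] by (simp add: torsion_field_coord)
qed (rule smooth_\<Gamma>)

lemma torsion_field_T: "torsion_field \<phi> \<Gamma> x [i,j,k] = T x [i,j,k]"
  by (simp add: torsion_field_coord T_def)

lemma curvature_field_Rl: "x \<in> U \<Longrightarrow> curvature_field \<phi> \<Gamma> x [i,j,k,l] = Rl x i j k l"
  by (simp add: curvature_field_coord diff_\<Gamma> Rl_def)

lemma T_smooth: "smooth_field U 3 T"
  unfolding smooth_field_def T_def
  by (intro ballI smooth_on_sum smooth_on_mult smooth_on_diff open_chart smooth_\<Gamma> gm_smooth)

lemma frame_exists: "x \<in> U \<Longrightarrow> \<exists>F. adapted_frame (\<phi> x) F"
  using coframe adapted_frame_exists by blast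

lemma frame_G: "adapted_frame (\<phi> x) F \<Longrightarrow> G x i j = (\<Sum>\<^sub>7a b. dl a b * (F a $ i * F b $ j))"
  by (simp add: G_def adapted_frame_G)

text \<open>The density \<open>\<mu>\<close> is the absolute value of det E. For a smooth coframe
  the sign \<open>s\<close> of det E is constant near x, so the volume form is locally a constant
  multiple of the density.\<close>

lemma local_det:
  assumes x: "x \<in> U"
  obtains W E s where "open W" "x \<in> W" "W \<subseteq> U" "s \<noteq> 0" "\<forall>y\<in>W. adapted (\<phi> y) (E y) \<and> det (E y) = s * \<mu> y"
proof -
  obtain W E where W: "open W" "x \<in> W" "W \<subseteq> U" "\<And>a i. smooth_on W (\<lambda>y. E y $ a $ i)" "\<And>y. y \<in> W \<Longrightarrow> adapted (\<phi> y) (E y)"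
    using local_coframe[OF x] by metis
  have \<mu>: "\<mu> y = \<bar>det (E y)\<bar>" if "y \<in> W" for y by (simp add: \<mu>_def det_metric[OF W(5)[OF that]])
  have nz: "det (E y) \<noteq> 0" if "y \<in> W" for y using W(5)[OF that] by (simp add: adapted_def invertible_det_nz)
  have cont: "continuous_on W (\<lambda>y. det (E y))"
    by (rule smooth_on_continuous[OF smooth_on_det[OF W(1,4)]])
  define s where "s = sgn (det (E x))"
  define V where "V = W \<inter> (\<lambda>y. s * det (E y)) -` {0<..}"
  have "open V" unfolding V_def
    by (rule continuous_open_preimage[OF _ W(1)]) (intro continuous_intros cont, simp)
  moreover have "x \<in> V" using W(2) nz[OF W(2)] by (auto simp: V_def s_def sgn_if)
  moreover have "det (E y) = s * \<mu> y" if "y \<in> V" for y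
  proof -
    have y: "y \<in> W" "s * det (E y) > 0" using that by (auto simp: V_def)
    have s: "s = 1 \<or> s = -1" using nz[OF W(2)] by (auto simp: s_def sgn_if)
    then show ?thesis using y(2) by (auto simp: \<mu>[OF y(1)])
  qed
  moreover have "s \<noteq> 0" using nz[OF W(2)] by (simp add: s_def sgn_0_0)
  moreover have "V \<subseteq> W" by (auto simp: V_def)
  ultimately show ?thesis using that[of V s E] W by (meson subset_iff subset_trans)
qed

end

text \<open>A skew endomorphism that annihilates \<phi> lies in g_2. Contracting the hypothesis with
  \<phi> shows that \<open>ps\<close> acts on A as -2; then \<open>contr1\<close> makes \<phi>
  contracted with \<open>cph A\<close> vanish, and one more contraction isolates
  \<open>cph A\<close>.\<close>

lemma skew_stabilizer:
  assumes A: "\<And>k l. A l k = - A k l"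
    and stab: "\<And>k l m. (\<Sum>\<^sub>7n. A k n * ph n l m) + (\<Sum>\<^sub>7n. A l n * ph k n m) + (\<Sum>\<^sub>7n. A m n * ph k l n) = 0"
  shows "cph A p = 0"
proof -
  let ?B = "\<lambda>k l. \<Sum>\<^sub>7i j. ps k l i j * A i j"
  have 1: "(\<Sum>\<^sub>7l m. ph q l m * (\<Sum>\<^sub>7n. A k n * ph n l m)) = 6 * A k q" for k q
  proof -
    have "(\<Sum>\<^sub>7l m. ph q l m * (\<Sum>\<^sub>7n. A k n * ph n l m)) = (\<Sum>\<^sub>7l m n. A k n * (ph q l m * ph n l m))"
      by (simp add: sum_distrib_left ac_simps)
    also have "\<dots> = (\<Sum>\<^sub>7n l m. A k n * (ph q l m * ph n l m))" by (rule sum_rot3[symmetric])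
    also have "\<dots> = (\<Sum>\<^sub>7n. A k n * (6 * dl q n))" by (simp only: ph_ph6 flip: sum_distrib_left)
    finally show ?thesis by (simp add: mult.left_commute[of _ 6] flip: sum_distrib_left)
  qed
  have 2: "(\<Sum>\<^sub>7l m. ph q l m * (\<Sum>\<^sub>7n. A l n * ph k n m)) = - A k q + ?B k q" for k q
  proof -
    have "(\<Sum>\<^sub>7l m. ph q l m * (\<Sum>\<^sub>7n. A l n * ph k n m)) = (\<Sum>\<^sub>7l m n. ph q l m * ph k n m * A l n)"
      by (simp add: sum_distrib_left ac_simps)
    also have "\<dots> = (\<Sum>\<^sub>7l n m. ph q l m * ph k n m * A l n)" by (intro sum.cong refl sum.swap)
    also have "\<dots> = (\<Sum>\<^sub>7l n. (dl q k * dl l n - dl q n * dl l k + ps q l k n) * A l n)"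
      by (simp only: ph_ph flip: sum_distrib_right)
    also have "\<dots> = (\<Sum>\<^sub>7l n. dl q k * (dl l n * A l n)) - (\<Sum>\<^sub>7l n. dl q n * (dl l k * A l n)) + (\<Sum>\<^sub>7l n. ps q l k n * A l n)"
      by (simp only: left_diff_distrib distrib_right sum.distrib sum_subtractf mult.assoc)
    also have "(\<Sum>\<^sub>7l n. ps q l k n * A l n) = ?B k q"
    proof -
      have "ps q l k n = ps k q l n" for l n using ps_skew23[of q l k n] ps_skew12[of q k l n] by simp
      then show ?thesis by simp
    qed
    also have "A l l = 0" for l using A[of l l] by simp
    then have "(\<Sum>\<^sub>7l n. dl q k * (dl l n * A l n)) = 0" by (simp flip: sum_distrib_left)
    finally show ?thesis by (simp add: sum_distrib_left[symmetric])
  qed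
  have 3: "(\<Sum>\<^sub>7l m. ph q l m * (\<Sum>\<^sub>7n. A m n * ph k l n)) = (\<Sum>\<^sub>7l m. ph q l m * (\<Sum>\<^sub>7n. A l n * ph k n m))" for k q
  proof -
    have "(\<Sum>\<^sub>7l m. ph q l m * (\<Sum>\<^sub>7n. A m n * ph k l n)) = (\<Sum>\<^sub>7m l. ph q l m * (\<Sum>\<^sub>7n. A m n * ph k l n))" by (rule sum.swap)
    also have "\<dots> = (\<Sum>\<^sub>7m l. ph q m l * (\<Sum>\<^sub>7n. A m n * ph k n l))"
    proof (intro sum.cong refl)
      fix m l
      have "A m n * ph k l n = - (A m n * ph k n l)" for n using ph_skew23[of k n l] by simp
      then show "ph q l m * (\<Sum>\<^sub>7n. A m n * ph k l n) = ph q m l * (\<Sum>\<^sub>7n. A m n * ph k n l)"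
        using ph_skew23[of q m l] by (simp add: sum_negf)
    qed
    finally show ?thesis .
  qed
  have B: "?B k q = - 2 * A k q" for k q
  proof -
    have "0 = (\<Sum>\<^sub>7l m. ph q l m * ((\<Sum>\<^sub>7n. A k n * ph n l m) + (\<Sum>\<^sub>7n. A l n * ph k n m) + (\<Sum>\<^sub>7n. A m n * ph k l n)))"
      by (simp add: stab)
    also have "\<dots> = 6 * A k q + 2 * (- A k q + ?B k q)"
      by (simp only: distrib_left sum.distrib 1 2 3)
    finally show ?thesis by simp
  qed
  have "(\<Sum>\<^sub>7q. ph k l q * cph A q) = 0" for k l using contr1[of k l A] B[of k l] A[of k l] by simp
  then have "0 = (\<Sum>\<^sub>7k l. ph p k l * (\<Sum>\<^sub>7q. ph k l q * cph A q))" by simp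
  also have "\<dots> = (\<Sum>\<^sub>7k l q. ph p k l * ph q k l * cph A q)"
    by (simp add: sum_distrib_left ph_rot[of q k l for q k l] mult.assoc cong: sum.cong)
  also have "\<dots> = (\<Sum>\<^sub>7q k l. ph p k l * ph q k l * cph A q)" by (rule sum_rot3[symmetric])
  also have "\<dots> = 6 * cph A p" by (simp add: ph_ph6 mult.assoc[of 6] flip: sum_distrib_right sum_distrib_left)
  finally show ?thesis by simp
qed

lemma cn_dl_1: "cn dl 1 f g = (\<Sum>\<^sub>7a. f [a] * g [a])"
  and cn_dl_2: "cn dl 2 f g = (\<Sum>\<^sub>7a b. f [a,b] * g [a,b])"
  by (simp_all add: cn_dl sum_idx_Suc numeral_eq_Suc)

text \<open>The hypothesis says that \<open>F\<close> intertwines the endomorphism \<open>A\<close>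
  in coordinates with \<open>B\<close> in the frame.\<close>

lemma fr_act:
  assumes "\<And>c m. (\<Sum>\<^sub>7k. F c $ k * A m k) = (\<Sum>\<^sub>7n. B n c * F n $ m)"
  shows "fr F (act A t) cs = act B (fr F t) cs"
proof (induction cs arbitrary: t)
  case (Cons c cs)
  have "fr F (act A t) (c # cs) = (\<Sum>\<^sub>7k m. F c $ k * A m k * fr F (\<lambda>is. t (m # is)) cs) + (\<Sum>\<^sub>7k. F c $ k * act B (fr F (\<lambda>is. t (k # is))) cs)"
    by (simp add: fr_add fr_sum fr_cmult distrib_left sum.distrib Cons sum_distrib_left mult.assoc)
  also have "(\<Sum>\<^sub>7k m. F c $ k * A m k * fr F (\<lambda>is. t (m # is)) cs) = (\<Sum>\<^sub>7m k. F c $ k * A m k * fr F (\<lambda>is. t (m # is)) cs)"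
    by (rule sum.swap)
  also have "\<dots> = (\<Sum>\<^sub>7m n. B n c * F n $ m * fr F (\<lambda>is. t (m # is)) cs)"
    by (simp only: assms flip: sum_distrib_right)
  also have "\<dots> = (\<Sum>\<^sub>7n m. B n c * F n $ m * fr F (\<lambda>is. t (m # is)) cs)" by (rule sum.swap)
  also have "(\<Sum>\<^sub>7k. F c $ k * act B (fr F (\<lambda>is. t (k # is))) cs) = act B (\<lambda>js. fr F t (c # js)) cs"
    by (simp add: act_sum act_cmult)
  finally show ?case by (simp add: sum_distrib_left mult.assoc)
qed simp

lemma fr_swap_hd: "fr F (\<lambda>is. t (is ! 1 # is ! 0 # drop 2 is)) (i # j # as) = fr F t (j # i # as)"
proof -
  have "fr F (\<lambda>is. t (is ! 1 # is ! 0 # drop 2 is)) (i # j # as) = (\<Sum>\<^sub>7k l. F i $ k * (F j $ l * fr F (\<lambda>is. t (l # k # is)) as))"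
    by (simp add: sum_distrib_left)
  also have "\<dots> = (\<Sum>\<^sub>7l k. F i $ k * (F j $ l * fr F (\<lambda>is. t (l # k # is)) as))" by (rule sum.swap)
  finally show ?thesis by (simp add: sum_distrib_left mult.left_commute)
qed

lemma smooth_field_cmult: "open U \<Longrightarrow> smooth_field U k t \<Longrightarrow> smooth_field U k (\<lambda>x is. c * t x is)"
  by (auto simp: smooth_field_def intro!: smooth_on_mult smooth_on_const)

context metric_chart begin

definition RL :: local_field where "RL x is = Rl x (is ! 0) (is ! 1) (is ! 2) (is ! 3)"

lemma RL_Rl: "RL x [i,j,k,l] = Rl x i j k l" by (simp add: RL_def)

lemma riem_RL: assumes "x \<in> U" shows "riem \<Gamma> i j x n k = (\<Sum>\<^sub>7a. G x a n * RL x [i,j,k,a])"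
proof -
  have "(\<Sum>\<^sub>7a. G x a n * RL x [i,j,k,a]) = (\<Sum>\<^sub>7a b. riem \<Gamma> i j x b k * (gm x $ b $ a * G x a n))"
    by (simp add: RL_def Rl_def sum_distrib_left ac_simps)
  also have "\<dots> = (\<Sum>\<^sub>7b a. riem \<Gamma> i j x b k * (gm x $ b $ a * G x a n))" by (rule sum.swap)
  also have "\<dots> = (\<Sum>\<^sub>7b. riem \<Gamma> i j x b k * dl b n)" by (simp only: gm_G[OF assms] flip: sum_distrib_left)
  finally show ?thesis by simp
qed

lemma smooth_field_nabla: "smooth_field U k t \<Longrightarrow> smooth_field U (Suc k) (nabt \<Gamma> t)"
  by (rule smooth_field_nabt[OF open_U \<Gamma>_smooth])

lemma smooth_field_contraction:
  "smooth_field U (m + n) t \<Longrightarrow> smooth_field U (n + r) u \<Longrightarrow> smooth_field U (m + r) (\<lambda>y. ctr (G y) n m (t y) (u y))"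
  by (rule smooth_field_ctr[OF open_U G_smooth])

lemma nabt_cmult:
  assumes "x \<in> U" "smooth_field U k t" "length is = k"
  shows "nabt \<Gamma> (\<lambda>y is. c * t y is) x (l # is) = c * nabt \<Gamma> t x (l # is)"
  using smooth_on_differentiable[OF smooth_fieldD[OF assms(2,3)] assms(1)]
  by (simp add: cov_deriv_act act_cmult pd_cmult right_diff_distrib)

lemma cov_deriv_cong:
  assumes "x \<in> U" "\<And>y js. y \<in> U \<Longrightarrow> length js = length is \<Longrightarrow> t y js = u y js"
  shows "cov_deriv \<Gamma> l t x is = cov_deriv \<Gamma> l u x is"
  unfolding cov_deriv_act using assms
  by (intro arg_cong2[where f = "(-)"] pd_cong[OF open_U] act_cong) auto

lemma cov_deriv_T_skew:
  assumes x: "x \<in> U"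
  shows "cov_deriv \<Gamma> i T x [k, j, l] = - cov_deriv \<Gamma> i T x [j, k, l]" "cov_deriv \<Gamma> i T x [j, l, k] = - cov_deriv \<Gamma> i T x [j, k, l]"
proof -
  have pm: "pd i (\<lambda>y. - T y [a, b, c]) x = - pd i (\<lambda>y. T y [a, b, c]) x" for a b c
  proof (rule pd_minus)
    have "smooth_on U (\<lambda>y. T y [a,b,c])" unfolding T_def
      by (intro smooth_on_sum smooth_on_mult smooth_on_diff open_U \<Gamma>_smooth gm_smooth)
    then show "(\<lambda>y. T y [a,b,c]) differentiable (at x)" using x by (rule smooth_on_differentiable)
  qed
  have p: "pd i (\<lambda>y. T y [k, j, l]) x = - pd i (\<lambda>y. T y [j, k, l]) x" "pd i (\<lambda>y. T y [j, l, k]) x = - pd i (\<lambda>y. T y [j, k, l]) x"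
    by (subst pm[symmetric], rule pd_cong[OF open_U x], rule T_skew; assumption)+
  have "T x [k, j, m] = - T x [j, k, m]" "T x [m, j, l] = - T x [j, m, l]" "T x [k, m, l] = - T x [m, k, l]" for m
    by (rule T_skew(1))+
  then show "cov_deriv \<Gamma> i T x [k, j, l] = - cov_deriv \<Gamma> i T x [j, k, l]"
    by (simp add: cov_deriv_act p sum_negf)
  have "T x [m, l, k] = - T x [m, k, l]" "T x [j, m, k] = - T x [j, k, m]" "T x [j, l, m] = - T x [j, m, l]" for m
    by (rule T_skew(2)[OF x])+
  then show "cov_deriv \<Gamma> i T x [j, l, k] = - cov_deriv \<Gamma> i T x [j, k, l]"
    by (simp add: cov_deriv_act p sum_negf)
qed

end

lemma fr_skew:
  assumes "distinct \<sigma>" "set \<sigma> = {..<length as}" "\<And>is. length is = length as \<Longrightarrow> t (map ((!) is) \<sigma>) = - t is"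
  shows "fr F t (map ((!) as) \<sigma>) = - fr F t as"
proof -
  have "fr F t (map ((!) as) \<sigma>) = fr F (\<lambda>is. t (map ((!) is) \<sigma>)) as" using fr_reorder[OF assms(1,2)] by simp
  also have "\<dots> = fr F (\<lambda>is. - t is) as" by (rule fr_cong) (rule assms(3))
  finally show ?thesis by (simp add: fr_minus)
qed

lemma fr_skew_3_0:
  assumes "\<And>a b c. t [b,a,c] = - t [a,b,c]" shows "fr F t [b,a,c] = - fr F t [a,b,c]"
proof -
  have "fr F t (map ((!) [a,b,c]) [1,0,2]) = - fr F t [a,b,c]"
  proof (rule fr_skew)
    fix "is" :: "7 list" assume "length is = length [a,b,c]"
    then obtain a' b' c' where "is": "is = [a',b',c']" by (auto simp: length_Suc_conv)
    show "t (map ((!) is) [1,0,2]) = - t is" using assms[of a' b' c'] by (simp add: "is")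
  qed (auto simp: lessThan_Suc)
  then show ?thesis by (simp del: fr.simps)
qed

lemma fr_skew_3_1:
  assumes "\<And>a b c. t [a,c,b] = - t [a,b,c]" shows "fr F t [a,c,b] = - fr F t [a,b,c]"
proof -
  have "fr F t (map ((!) [a,b,c]) [0,2,1]) = - fr F t [a,b,c]"
  proof (rule fr_skew)
    fix "is" :: "7 list" assume "length is = length [a,b,c]"
    then obtain a' b' c' where "is": "is = [a',b',c']" by (auto simp: length_Suc_conv)
    show "t (map ((!) is) [0,2,1]) = - t is" using assms[of a' b' c'] by (simp add: "is")
  qed (auto simp: lessThan_Suc)
  then show ?thesis by (simp del: fr.simps)
qed

lemma fr_skew_4_0:
  assumes "\<And>a b c d. t [b,a,c,d] = - t [a,b,c,d]" shows "fr F t [b,a,c,d] = - fr F t [a,b,c,d]"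
proof -
  have "fr F t (map ((!) [a,b,c,d]) [1,0,2,3]) = - fr F t [a,b,c,d]"
  proof (rule fr_skew)
    fix "is" :: "7 list" assume "length is = length [a,b,c,d]"
    then obtain a' b' c' d' where "is": "is = [a',b',c',d']" by (auto simp: length_Suc_conv)
    show "t (map ((!) is) [1,0,2,3]) = - t is" using assms[of a' b' c' d'] by (simp add: "is")
  qed (auto simp: lessThan_Suc)
  then show ?thesis by (simp del: fr.simps)
qed

lemma fr_skew_4_1:
  assumes "\<And>a b c d. t [a,c,b,d] = - t [a,b,c,d]" shows "fr F t [a,c,b,d] = - fr F t [a,b,c,d]"
proof -
  have "fr F t (map ((!) [a,b,c,d]) [0,2,1,3]) = - fr F t [a,b,c,d]"
  proof (rule fr_skew)
    fix "is" :: "7 list" assume "length is = length [a,b,c,d]"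
    then obtain a' b' c' d' where "is": "is = [a',b',c',d']" by (auto simp: length_Suc_conv)
    show "t (map ((!) is) [0,2,1,3]) = - t is" using assms[of a' b' c' d'] by (simp add: "is")
  qed (auto simp: lessThan_Suc)
  then show ?thesis by (simp del: fr.simps)
qed

lemma fr_skew_4_2:
  assumes "\<And>a b c d. t [a,b,d,c] = - t [a,b,c,d]" shows "fr F t [a,b,d,c] = - fr F t [a,b,c,d]"
proof -
  have "fr F t (map ((!) [a,b,c,d]) [0,1,3,2]) = - fr F t [a,b,c,d]"
  proof (rule fr_skew)
    fix "is" :: "7 list" assume "length is = length [a,b,c,d]"
    then obtain a' b' c' d' where "is": "is = [a',b',c',d']" by (auto simp: length_Suc_conv)
    show "t (map ((!) is) [0,1,3,2]) = - t is" using assms[of a' b' c' d'] by (simp add: "is")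
  qed (auto simp: lessThan_Suc)
  then show ?thesis by (simp del: fr.simps)
qed

section \<open>Components in an orthonormal frame at one point\<close>

locale orthonormal_frame_at = metric_chart +
  fixes x :: R7 and F :: "7 \<Rightarrow> R7"
  assumes x: "x \<in> U" and G_F: "\<And>i j. G x i j = (\<Sum>\<^sub>7a b. dl a b * (F a $ i * F b $ j))"
begin

lemma frame_ctr:
  "length as = m \<Longrightarrow> fr F (ctr (G x) n m t u) (as @ bs) = cn dl n (\<lambda>ks. fr F t (as @ ks)) (\<lambda>ls. fr F u (ls @ bs))"
  using fr_ctr[OF G_F] by (simp add: ctr_append)

text \<open>The Leibniz rule in frame components. \<open>F\<close> consists of vectors at the single
  point x; covariant derivatives are formed in coordinates and evaluated on \<open>F\<close>
  afterwards.\<close>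

lemma frame_nabt_ctr:
  assumes t: "smooth_field U (m + n) t" and u: "smooth_field U (n + r) u" and len: "length as = m" "length bs = r"
  shows "fr F (nabt \<Gamma> (\<lambda>y. ctr (G y) n m (t y) (u y)) x) (i # as @ bs) =
    cn dl n (\<lambda>ks. fr F (nabt \<Gamma> t x) (i # as @ ks)) (\<lambda>ls. fr F (u x) (ls @ bs))
    + cn dl n (\<lambda>ks. fr F (t x) (as @ ks)) (\<lambda>ls. fr F (nabt \<Gamma> u x) (i # ls @ bs))"
proof -
  have "fr F (\<lambda>is. cov_deriv \<Gamma> l (\<lambda>y. ctr (G y) n m (t y) (u y)) x is) (as @ bs)
     = cn dl n (\<lambda>ks. fr F (cov_deriv \<Gamma> l t x) (as @ ks)) (\<lambda>ls. fr F (u x) (ls @ bs))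
     + cn dl n (\<lambda>ks. fr F (t x) (as @ ks)) (\<lambda>ls. fr F (cov_deriv \<Gamma> l u x) (ls @ bs))" for l
  proof -
    have "fr F (\<lambda>is. cov_deriv \<Gamma> l (\<lambda>y. ctr (G y) n m (t y) (u y)) x is) (as @ bs)
      = fr F (\<lambda>is. ctr (G x) n m (cov_deriv \<Gamma> l t x) (u x) is + ctr (G x) n m (t x) (cov_deriv \<Gamma> l u x) is) (as @ bs)"
      by (rule fr_cong) (simp add: cov_deriv_ctr[where G = G and \<Gamma> = \<Gamma> and x = x and U = U and m = m and n = n and r = r and i = l, OF open_U x G_smooth G_parallel[OF x] t u] len)
    then show ?thesis by (simp add: fr_add frame_ctr[OF len(1)])
  qed
  then show ?thesis
    by (simp add: distrib_left sum.distrib cn_sum1 cn_sum2 cn_cmult1 cn_cmult2)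
qed

lemma frame_nabt_cmult:
  assumes "smooth_field U k t" "length as = k"
  shows "fr F (nabt \<Gamma> (\<lambda>y is. c * t y is) x) (i # as) = c * fr F (nabt \<Gamma> t x) (i # as)"
proof -
  have "fr F (\<lambda>is. nabt \<Gamma> (\<lambda>y is. c * t y is) x (l # is)) as = fr F (\<lambda>is. c * nabt \<Gamma> t x (l # is)) as" for l
    using assms by (intro fr_cong nabt_cmult[OF x]) auto
  then show ?thesis by (simp add: fr_cmult sum_distrib_left mult.left_commute)
qed

definition Tf where "Tf a b c = fr F (T x) [a,b,c]"
definition Df where "Df a b c d = fr F (nabt \<Gamma> T x) [a,b,c,d]"
definition Rf where "Rf a b c d = fr F (RL x) [a,b,c,d]"

lemma Tf_skew: "Tf b a c = - Tf a b c" "Tf a c b = - Tf a b c"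
  unfolding Tf_def by (rule fr_skew_3_0, rule T_skew(1), rule fr_skew_3_1, rule T_skew(2)[OF x])

lemma Df_skew: "Df i b a c = - Df i a b c" "Df i a c b = - Df i a b c"
  unfolding Df_def by (rule fr_skew_4_1, unfold nabt_Cons, rule cov_deriv_T_skew(1)[OF x],
    rule fr_skew_4_2, unfold nabt_Cons, rule cov_deriv_T_skew(2)[OF x])

lemma Rf_skew: "Rf b a c d = - Rf a b c d" "Rf a b d c = - Rf a b c d"
  unfolding Rf_def by (rule fr_skew_4_0, unfold RL_Rl, rule Rl_skew12, rule fr_skew_4_2, unfold RL_Rl, rule Rl_skew34[OF x])

lemma Rf_bianchi:
  "Rf i j k l + Rf j k i l + Rf k i j l = Df i j k l + Df j k i l + Df k i j l
    + (\<Sum>\<^sub>7a. Tf i j a * Tf a k l + Tf j k a * Tf a i l + Tf k i a * Tf a j l)"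
proof -
  let ?X = "ctr (G x) 1 2 (T x) (T x)" and ?N = "nabt \<Gamma> T x"
  let ?s = "\<lambda>t is. t is + (t (map ((!) is) [1,2,0,3]) + t (map ((!) is) [2,0,1,3])) :: real"
  have s: "fr F (?s t) [i,j,k,l] = fr F t [i,j,k,l] + (fr F t [j,k,i,l] + fr F t [k,i,j,l])" for t
    using fr_reorder[of "[1,2,0,3]" "[i,j,k,l]" F t] fr_reorder[of "[2,0,1,3]" "[i,j,k,l]" F t]
    by (auto simp: fr_add lessThan_Suc insert_commute numeral_eq_Suc simp del: fr.simps)
  have X: "fr F ?X [i,j,k,l] = (\<Sum>\<^sub>7a. Tf i j a * Tf a k l)" for i j k l
    using frame_ctr[of "[i,j]" 2 1 "T x" "T x" "[k,l]"] unfolding cn_dl_1 by (simp add: Tf_def del: fr.simps)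
  have X0: "?X [i,j,k,l] = (\<Sum>\<^sub>7a b. G x a b * (T x [i,j,a] * T x [b,k,l]))" for i j k l
    using ctr_append[of "[i,j]" 2 "G x" 1 "T x" "T x" "[k,l]"] by simp
  have "fr F (?s (RL x)) [i,j,k,l] = fr F (\<lambda>is. ?s ?N is + ?s ?X is) [i,j,k,l]"
  proof (rule fr_cong)
    fix "is" :: "7 list" assume "length is = length [i,j,k,l]"
    then obtain a b c d where "is": "is = [a,b,c,d]" by (auto simp: length_Suc_conv)
    show "?s (RL x) is = ?s ?N is + ?s ?X is"
      using bianchi[OF x, of a b c d] by (simp add: "is" X0 RL_def distrib_left sum.distrib del: One_nat_def)
  qed
  also have "\<dots> = fr F (?s ?N) [i,j,k,l] + fr F (?s ?X) [i,j,k,l]" by (rule fr_add)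
  finally show ?thesis unfolding s X by (simp add: Rf_def Df_def sum.distrib del: fr.simps)
qed

lemma frame_ricci:
  assumes t: "smooth_field U (length as) t"
  shows "fr F (nabt \<Gamma> (nabt \<Gamma> t) x) (i # j # as) - fr F (nabt \<Gamma> (nabt \<Gamma> t) x) (j # i # as)
    = - act (\<lambda>m k. Rf i j k m) (fr F (t x)) as - (\<Sum>\<^sub>7m. Tf i j m * fr F (nabt \<Gamma> t x) (m # as))"
proof -
  let ?N = "nabt \<Gamma> (nabt \<Gamma> t) x" and ?X = "ctr (G x) 1 2 (T x) (nabt \<Gamma> t x)"
  have X0: "?X (k # l # is) = (\<Sum>\<^sub>7m. (\<Gamma> x m k l - \<Gamma> x m l k) * cov_deriv \<Gamma> m t x is)" for k l "is"
  proof -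
    have "?X (k # l # is) = (\<Sum>\<^sub>7a m. G x m a * T x [k,l,a] * cov_deriv \<Gamma> m t x is)"
      using ctr_append[of "[k,l]" 2 "G x" 1 "T x" "nabt \<Gamma> t x" "is"] by (simp add: G_sym[OF x] mult.assoc)
    also have "\<dots> = (\<Sum>\<^sub>7m a. G x m a * T x [k,l,a] * cov_deriv \<Gamma> m t x is)" by (rule sum.swap)
    finally show ?thesis by (simp add: \<tau>_T[OF x] sum_distrib_right)
  qed
  have "fr F ?N (i # j # as) - fr F (\<lambda>is. ?N (is ! 1 # is ! 0 # drop 2 is)) (i # j # as)
    = fr F (\<lambda>is. - act (riem \<Gamma> (is ! 0) (is ! 1) x) (t x) (drop 2 is) - ?X is) (i # j # as)"
    unfolding fr_diff[symmetric]
  proof (rule fr_cong)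
    fix "is" :: "7 list" assume len: "length is = length (i # j # as)"
    then obtain k l js where "is": "is = k # l # js" "length js = length as" by (auto simp: length_Suc_conv)
    show "?N is - ?N (is ! 1 # is ! 0 # drop 2 is) = - act (riem \<Gamma> (is ! 0) (is ! 1) x) (t x) (drop 2 is) - ?X is"
      using ricci_identity[where \<Gamma> = \<Gamma>, OF open_U x \<Gamma>_smooth, of js t k l] t "is" by (simp add: X0 del: nabt_Cons One_nat_def)
  qed
  also have "\<dots> = - fr F (\<lambda>is. act (riem \<Gamma> (is ! 0) (is ! 1) x) (t x) (drop 2 is)) (i # j # as) - fr F ?X (i # j # as)"
    by (simp only: fr_diff fr_minus)
  also have "fr F ?X (i # j # as) = (\<Sum>\<^sub>7m. Tf i j m * fr F (nabt \<Gamma> t x) (m # as))"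
    using frame_ctr[of "[i,j]" 2 1 "T x" "nabt \<Gamma> t x" as] unfolding cn_dl_1 by (simp add: Tf_def del: fr.simps)
  \<comment> \<open>The vectors \<open>F i\<close> and \<open>F j\<close> fill the first index pair
    of the curvature. What remains is one endomorphism acting on \<open>t\<close>, which
    \<open>fr_act\<close> carries over to the frame.\<close>
  also have "fr F (\<lambda>is. act (riem \<Gamma> (is ! 0) (is ! 1) x) (t x) (drop 2 is)) (i # j # as) =
     fr F (act (\<lambda>m n. \<Sum>\<^sub>7k l. F i $ k * F j $ l * riem \<Gamma> k l x m n) (t x)) as"
  proof -
    have "act (\<lambda>m n. \<Sum>\<^sub>7k l. F i $ k * F j $ l * riem \<Gamma> k l x m n) (t x)
      = (\<lambda>js. \<Sum>\<^sub>7k l. F i $ k * F j $ l * act (riem \<Gamma> k l x) (t x) js)"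
      by (rule ext) (simp only: act_sum1 act_cmult1)
    then show ?thesis by (simp add: fr_sum fr_cmult sum_distrib_left mult.assoc)
  qed
  also have "\<dots> = act (\<lambda>m k. Rf i j k m) (fr F (t x)) as"
  proof (rule fr_act)
    fix c m
    have Rf: "Rf i j c n * F n $ m = (\<Sum>\<^sub>7k l p q. F i $ k * F j $ l * F c $ p * RL x [k,l,p,q] * (F n $ q * F n $ m))" for n
      by (simp add: Rf_def sum_distrib_left sum_distrib_right ac_simps)
    have "(\<Sum>\<^sub>7n. Rf i j c n * F n $ m) = (\<Sum>\<^sub>7k l p q n. F i $ k * F j $ l * F c $ p * RL x [k,l,p,q] * (F n $ q * F n $ m))"
    proof -
      have "(\<Sum>\<^sub>7n. Rf i j c n * F n $ m) = (\<Sum>\<^sub>7k n l p q. F i $ k * F j $ l * F c $ p * RL x [k,l,p,q] * (F n $ q * F n $ m))"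
        unfolding Rf by (rule sum.swap)
      also have "\<dots> = (\<Sum>\<^sub>7k l n p q. F i $ k * F j $ l * F c $ p * RL x [k,l,p,q] * (F n $ q * F n $ m))"
        by (intro sum.cong refl sum.swap)
      also have "\<dots> = (\<Sum>\<^sub>7k l p q n. F i $ k * F j $ l * F c $ p * RL x [k,l,p,q] * (F n $ q * F n $ m))"
        by (intro sum.cong refl sum_rot3)
      finally show ?thesis .
    qed
    also have "\<dots> = (\<Sum>\<^sub>7k l p q. F i $ k * F j $ l * F c $ p * RL x [k,l,p,q] * G x q m)"
      by (simp add: G_F flip: sum_distrib_left)
    also have "\<dots> = (\<Sum>\<^sub>7k l p. F i $ k * F j $ l * F c $ p * riem \<Gamma> k l x m p)"
      by (simp add: riem_RL[OF x] sum_distrib_left ac_simps)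
    also have "\<dots> = (\<Sum>\<^sub>7p k l. F i $ k * F j $ l * F c $ p * riem \<Gamma> k l x m p)" by (rule sum_rot3[symmetric])
    finally show "(\<Sum>\<^sub>7k. F c $ k * (\<Sum>\<^sub>7ka l. F i $ ka * F j $ l * riem \<Gamma> ka l x m k)) = (\<Sum>\<^sub>7n. Rf i j c n * F n $ m)"
      by (simp add: sum_distrib_left ac_simps)
  qed
  finally show ?thesis unfolding fr_swap_hd .
qed

end

context g2_chart begin

definition S :: local_field where "S x = ctr (G x) 2 1 (T x) (\<phi> x)"
text \<open>Built from the torsion by contractions, so that smoothness and covariant derivatives are
  governed by the tensor calculus above. On an integrable structure it agrees with
  \<open>lee_form\<close>, by \<open>lee_\<theta>\<close>.\<close>

definition \<theta> :: local_field where "\<theta> x is = - (1/6) * ctr (G x) 2 0 (S x) (\<phi> x) is"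

lemma S_smooth: "smooth_field U 2 S"
  using smooth_field_contraction[of 1 2 T 1 \<phi>] T_smooth \<phi>_smooth by (simp add: S_def[abs_def] numeral_eq_Suc)

lemma S_\<phi>_smooth: "smooth_field U 1 (\<lambda>y. ctr (G y) 2 0 (S y) (\<phi> y))"
  using smooth_field_contraction[of 0 2 S 1 \<phi>] S_smooth \<phi>_smooth by (simp add: numeral_eq_Suc)

lemma \<theta>_smooth: "smooth_field U 1 \<theta>"
  unfolding \<theta>_def by (rule smooth_field_cmult[OF open_U S_\<phi>_smooth])

lemma nabla_\<phi>: "x \<in> U \<Longrightarrow> length is = 4 \<Longrightarrow> nabt \<Gamma> \<phi> x is = 0"
  using \<phi>_parallel by (cases "is") simp_all

end

locale g2_frame = g2_chart +
  fixes x :: R7 and F :: "7 \<Rightarrow> R7"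
  assumes x_U: "x \<in> U" and adapted: "adapted_frame (\<phi> x) F"
begin

sublocale orthonormal_frame_at U "\<lambda>x. metric (\<phi> x)" \<Gamma> x F
  by unfold_locales (rule x_U, rule frame_G[OF adapted])

lemma frame_\<phi>: "fr F (\<phi> x) [a,b,c] = ph a b c"
  by (rule adapted_frame_phi[OF adapted])

lemma frame_nabla_\<phi>: "fr F (nabt \<Gamma> \<phi> x) (i # a # b # [c]) = 0"
proof -
  have "fr F (nabt \<Gamma> \<phi> x) [i,a,b,c] = fr F (\<lambda>is. 0) [i,a,b,c]"
    by (rule fr_cong) (simp add: nabla_\<phi>[OF x])
  then show ?thesis by (simp only: fr_zero)
qed

text \<open>Since \<nabla>\<nabla>\<phi> = 0, the Ricci identity says that the curvature
  endomorphisms annihilate \<phi>; \<open>skew_stabilizer\<close> then applies.\<close>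

lemma holonomy: "cph (\<lambda>k l. Rf i j k l) p = 0"
proof (rule skew_stabilizer)
  fix k l m
  have "nabt \<Gamma> (nabt \<Gamma> \<phi>) x is = 0" if len: "length is = length [i,j,k,l,m]" for "is"
  proof -
    obtain a js where "is": "is = a # js" "length js = 4" using len by (cases "is") simp_all
    have "cov_deriv \<Gamma> a (nabt \<Gamma> \<phi>) x js = cov_deriv \<Gamma> a (\<lambda>y js. 0) x js"
      by (rule cov_deriv_cong[OF x]) (simp add: nabla_\<phi> "is")
    then show ?thesis by (simp add: "is" cov_deriv_act act_def)
  qed
  then have n: "fr F (nabt \<Gamma> (nabt \<Gamma> \<phi>) x) [i,j,k,l,m] = 0" for i j
    using fr_cong[of "[i,j,k,l,m]" "nabt \<Gamma> (nabt \<Gamma> \<phi>) x" "\<lambda>_. 0" F] by (simp only: fr_zero) simp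
  have "act (\<lambda>m k. Rf i j k m) (fr F (\<phi> x)) [k,l,m] = 0"
    using frame_ricci[of "[k,l,m]" \<phi> i j] \<phi>_smooth n[of i j] n[of j i]
    by (simp add: frame_nabla_\<phi> numeral_eq_Suc del: fr.simps)
  then show "(\<Sum>\<^sub>7n. Rf i j k n * ph n l m) + (\<Sum>\<^sub>7n. Rf i j l n * ph k n m) + (\<Sum>\<^sub>7n. Rf i j m n * ph k l n) = 0"
    by (simp add: frame_\<phi> del: fr.simps One_nat_def)
qed (rule Rf_skew)

definition "Sf a b = fr F (S x) [a,b]"
definition "\<theta>f a = fr F (\<theta> x) [a]"
definition "DSf i a b = fr F (nabt \<Gamma> S x) [i,a,b]"
definition "Mf i a = fr F (nabt \<Gamma> \<theta> x) [i,a]"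

lemma Sf: "Sf a b = Sof Tf a b"
proof -
  have "Sf a b = (\<Sum>\<^sub>7i j. Tf a i j * ph i j b)"
    using frame_ctr[of "[a]" 1 2 "T x" "\<phi> x" "[b]"] unfolding cn_dl_2
    by (simp add: Sf_def S_def Tf_def frame_\<phi> del: fr.simps One_nat_def)
  then show ?thesis by (simp add: Sof_def cph_def ph_rot[of b] mult.commute)
qed

lemma DSf: "DSf i a b = Sof (Df i) a b"
proof -
  have "DSf i a b = (\<Sum>\<^sub>7j k. Df i a j k * ph j k b)"
    using frame_nabt_ctr[of 1 2 T 1 \<phi> "[a]" "[b]" i] T_smooth \<phi>_smooth unfolding cn_dl_2
    by (simp add: DSf_def S_def[abs_def] Df_def frame_\<phi> frame_nabla_\<phi> del: fr.simps One_nat_def)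
  then show ?thesis by (simp add: Sof_def cph_def ph_rot[of b] mult.commute)
qed

lemma \<theta>f: "\<theta>f a = thof Sf a"
proof -
  have "fr F (ctr (G x) 2 0 (S x) (\<phi> x)) [a] = (\<Sum>\<^sub>7i j. Sf i j * ph i j a)"
    using frame_ctr[of "[]" 0 2 "S x" "\<phi> x" "[a]"] unfolding cn_dl_2
    by (simp add: Sf_def frame_\<phi> del: fr.simps One_nat_def)
  then have "\<theta>f a = - (1/6) * (\<Sum>\<^sub>7i j. Sf i j * ph i j a)"
    unfolding \<theta>f_def \<theta>_def[abs_def] fr_cmult by simp
  then show ?thesis by (simp add: thof_def cph_def ph_rot[of a] mult.commute)
qed

lemma Mf: "Mf i a = thof (DSf i) a"
proof -
  have "fr F (nabt \<Gamma> (\<lambda>y. ctr (G y) 2 0 (S y) (\<phi> y)) x) (i # [] @ [a]) = (\<Sum>\<^sub>7j k. DSf i j k * ph j k a)"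
    using frame_nabt_ctr[of 0 2 S 1 \<phi> "[]" "[a]" i] S_smooth[unfolded numeral_2_eq_2] \<phi>_smooth unfolding cn_dl_2
    by (simp add: DSf_def frame_\<phi> frame_nabla_\<phi> del: fr.simps One_nat_def)
  then have "Mf i a = - (1/6) * (\<Sum>\<^sub>7j k. DSf i j k * ph j k a)"
    using frame_nabt_cmult[OF S_\<phi>_smooth, of "[a]" "-(1/6)" i]
    by (simp add: Mf_def \<theta>_def[abs_def] del: fr.simps One_nat_def)
  then show ?thesis by (simp add: thof_def cph_def ph_rot[of a] mult.commute)
qed

text \<open>\<phi> sees only the commutator of the two derivatives, whence the factor 1/2. The
  curvature term is linear in the curvature whatever the degree of \<open>t\<close>, so the
  instanton condition removes it, and the torsion contracted with \<phi> is S.\<close>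

lemma curl_nabla_nabla:
  assumes inst: "\<And>k l p. cph (\<lambda>i j. Rf i j k l) p = 0" and t: "smooth_field U (length as) t"
  shows "(\<Sum>\<^sub>7i j. ph p i j * fr F (nabt \<Gamma> (nabt \<Gamma> t) x) (i # j # as)) = - (1/2) * (\<Sum>\<^sub>7m. Sf m p * fr F (nabt \<Gamma> t x) (m # as))"
proof -
  define N where "N i j = fr F (nabt \<Gamma> (nabt \<Gamma> t) x) (i # j # as)" for i j
  define D where "D m = fr F (nabt \<Gamma> t x) (m # as)" for m
  have N: "N i j - N j i = - act (\<lambda>m k. Rf i j k m) (fr F (t x)) as - (\<Sum>\<^sub>7m. Tf i j m * D m)" for i j
    unfolding N_def D_def by (rule frame_ricci[OF t])
  have a: "(\<Sum>\<^sub>7i j. ph p i j * act (\<lambda>m k. Rf i j k m) u as) = 0" for u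
  proof -
    have "(\<Sum>\<^sub>7i j. ph p i j * act (\<lambda>m k. Rf i j k m) u as) = act (\<lambda>m k. \<Sum>\<^sub>7i j. ph p i j * Rf i j k m) u as"
      by (simp only: act_sum1 act_cmult1)
    also have "(\<lambda>m k. \<Sum>\<^sub>7i j. ph p i j * Rf i j k m) = (\<lambda>m k. 0)" using inst by (simp add: cph_def)
    finally show ?thesis by (simp add: act_zero1)
  qed
  have "2 * cph N p = cph (\<lambda>i j. N i j - N j i) p"
    using cph_transpose[of N p] by (simp add: cph_linear)
  also have "\<dots> = - (\<Sum>\<^sub>7i j. ph p i j * act (\<lambda>m k. Rf i j k m) (fr F (t x)) as) - (\<Sum>\<^sub>7i j m. ph p i j * (Tf i j m * D m))"
    unfolding N cph_def by (simp add: right_diff_distrib sum_subtractf sum_negf sum_distrib_left)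
  also have "\<dots> = - (\<Sum>\<^sub>7i j m. ph p i j * (Tf i j m * D m))" by (simp add: a)
  also have "(\<Sum>\<^sub>7i j m. ph p i j * (Tf i j m * D m)) = (\<Sum>\<^sub>7m i j. ph p i j * (Tf i j m * D m))" by (rule sum_rot3[symmetric])
  also have "\<dots> = (\<Sum>\<^sub>7m i j. ph p i j * Tf m i j * D m)"
  proof (intro sum.cong refl)
    fix m i j show "ph p i j * (Tf i j m * D m) = ph p i j * Tf m i j * D m"
      using Tf_skew(2)[of i j m] Tf_skew(1)[of i m j] by simp
  qed
  also have "\<dots> = (\<Sum>\<^sub>7m. Sf m p * D m)" by (simp add: Sf Sof_def cph_def sum_distrib_right)
  finally show ?thesis by (simp add: N_def D_def cph_def del: fr.simps One_nat_def)
qed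

end

section \<open>Contractions of the dual 4-form with itself\<close>

lemma ps_ps: "(\<Sum>\<^sub>7d e. ps i j d e * ps k l d e) = 4 * (dl i k * dl j l - dl i l * dl j k) + 2 * ps i j k l"
proof -
  have c: "cph (ps k l) q = 4 * ph q k l" for q
    using ps_ph4[of k l q] by (simp add: cph_def mult.commute)
  have "(\<Sum>\<^sub>7d e. ps i j d e * ps k l d e) = (\<Sum>\<^sub>7q. ph i j q * cph (ps k l) q) - ps k l i j + ps k l j i"
    by (rule psc)
  also have "(\<Sum>\<^sub>7q. ph i j q * cph (ps k l) q) = 4 * (\<Sum>\<^sub>7q. ph i j q * ph q k l)"
    by (simp add: c sum_distrib_left mult.left_commute)
  finally show ?thesis using ps_skew34[of k l i j] by (simp add: ph_ph' ps_pair[of k l])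
qed

lemma ps_ps3: "(\<Sum>\<^sub>7c d e. ps a c d e * ps b c d e) = 24 * dl a b"
proof -
  have "ps a c b c = 0" for c using ps_skew34[of c a c b] ps_skew12[of a c b c] ps_skew34[of a c b c] ps_skew23[of a c c b] by simp
  moreover have "(\<Sum>\<^sub>7c. dl c c) = 7" by (simp add: dl_def)
  ultimately show ?thesis
    unfolding ps_ps by (simp add: sum.distrib sum_subtractf algebra_simps flip: sum_distrib_left sum_distrib_right)
qed

text \<open>A pairing that depends only on the totally skew part of \<open>f\<close>. All terms of
  an alternation therefore contribute equally, which avoids alternating explicitly.\<close>

definition ps_inner :: "(7 \<Rightarrow> 7 \<Rightarrow> 7 \<Rightarrow> 7 \<Rightarrow> real) \<Rightarrow> real" where
  "ps_inner f = (\<Sum>\<^sub>7a b c d. f a b c d * ps a b c d)"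

lemma ps_inner_swap:
  "ps_inner (\<lambda>a b c d. f b a c d) = - ps_inner f"
  "ps_inner (\<lambda>a b c d. f a c b d) = - ps_inner f"
  "ps_inner (\<lambda>a b c d. f a b d c) = - ps_inner f"
proof -
  have e: "f b a c d * ps a b c d = - (f b a c d * ps b a c d)" "f a c b d * ps a b c d = - (f a c b d * ps a c b d)"
    "f a b d c * ps a b c d = - (f a b d c * ps a b d c)" for a b c d
    using ps_skew12[of a b c d] ps_skew23[of a b c d] ps_skew34[of a b c d] by simp_all
  have "(\<Sum>\<^sub>7a b c d. f b a c d * ps a b c d) = (\<Sum>\<^sub>7b a c d. f b a c d * ps a b c d)" by (rule sum.swap)
  also have "\<dots> = (\<Sum>\<^sub>7b a c d. - (f b a c d * ps b a c d))" by (intro sum.cong refl e)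
  finally show "ps_inner (\<lambda>a b c d. f b a c d) = - ps_inner f" by (simp add: ps_inner_def sum_negf)
  have "(\<Sum>\<^sub>7a b c d. f a c b d * ps a b c d) = (\<Sum>\<^sub>7a c b d. f a c b d * ps a b c d)" by (intro sum.cong refl sum.swap)
  also have "\<dots> = (\<Sum>\<^sub>7a c b d. - (f a c b d * ps a c b d))" by (intro sum.cong refl e)
  finally show "ps_inner (\<lambda>a b c d. f a c b d) = - ps_inner f" by (simp add: ps_inner_def sum_negf)
  have "(\<Sum>\<^sub>7a b c d. f a b d c * ps a b c d) = (\<Sum>\<^sub>7a b d c. f a b d c * ps a b c d)" by (intro sum.cong refl sum.swap)
  also have "\<dots> = (\<Sum>\<^sub>7a b d c. - (f a b d c * ps a b d c))" by (intro sum.cong refl e)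
  finally show "ps_inner (\<lambda>a b c d. f a b d c) = - ps_inner f" by (simp add: ps_inner_def sum_negf)
qed

text \<open>The six signed shuffles of type (2, 2), which occur in the exterior derivative of a
  parallel form. \<open>ps_inner_alt4\<close> does the same for the four shuffles of type (1,
  3).\<close>

lemma ps_inner_alt6:
  "ps_inner f - ps_inner (\<lambda>a b c d. f a c b d) + ps_inner (\<lambda>a b c d. f a d b c) + ps_inner (\<lambda>a b c d. f b c a d)
    - ps_inner (\<lambda>a b c d. f b d a c) + ps_inner (\<lambda>a b c d. f c d a b) = 6 * ps_inner f"
  using ps_inner_swap(2)[of f] ps_inner_swap(3)[of "\<lambda>a b c d. f a c b d"] ps_inner_swap(1)[of "\<lambda>a b c d. f a c b d"]
    ps_inner_swap(3)[of "\<lambda>a b c d. f b c a d"] ps_inner_swap(2)[of "\<lambda>a b c d. f b d a c"] by simp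

lemma ps_inner_alt4:
  "ps_inner f - ps_inner (\<lambda>a b c d. f b a c d) + ps_inner (\<lambda>a b c d. f c a b d) - ps_inner (\<lambda>a b c d. f d a b c) = 4 * ps_inner f"
  using ps_inner_swap(1)[of f] ps_inner_swap(2)[of "\<lambda>a b c d. f b a c d"] ps_inner_swap(3)[of "\<lambda>a b c d. f c a b d"] by simp

lemma ps_inner_linear:
  "ps_inner (\<lambda>a b c d. f a b c d + g a b c d) = ps_inner f + ps_inner g"
  "ps_inner (\<lambda>a b c d. f a b c d - g a b c d) = ps_inner f - ps_inner g"
  by (simp_all add: ps_inner_def sum.distrib sum_subtractf distrib_right left_diff_distrib)

lemma alternating_hodge:
  assumes "k + m = 7"
  shows "alternating m (hodge \<phi> k \<alpha>)"
  unfolding alternating_def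
proof (intro ballI allI impI)
  fix js p assume "js \<in> idx m" and p: "p permutes {..<m}"
  then have js: "length js = m" by simp
  define q where "q = map_permutation {..<m} ((+) k) p"
  have bij: "bij_betw ((+) k) {..<m} {k..<k+m}" by (rule bij_betw_byWitness[of _ "\<lambda>i. i - k"]) auto
  have q: "q permutes {k..<k+m}" unfolding q_def by (rule map_permutation_permutes[OF bij p])
  have s: "sign q = sign p" unfolding q_def by (rule sign_map_permutation[OF _ p]) auto
  have qk: "q (k + i) = k + p i" if "i < m" for i unfolding q_def using that by (intro map_permutation_apply) auto
  have pl: "permute_list q (is @ js) = is @ permute_list p js" if "length is = k" for "is" :: "7 list"
  proof (rule nth_equalityI)
    fix i assume "i < length (permute_list q (is @ js))"
    then have i: "i < k + m" by (simp add: that js)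
    show "permute_list q (is @ js) ! i = (is @ permute_list p js) ! i"
    proof (cases "i < k")
      case True
      then have "q i = i" using q by (simp add: permutes_def)
      then show ?thesis using True i by (simp add: permute_list_def that js nth_append del: upt_Suc)
    next
      case False
      then obtain l where l: "i = k + l" "l < m" using i by (metis less_imp_add_positive not_less_iff_gr_or_eq add_0_right nat_add_left_cancel_less)
      then show ?thesis using qk[OF l(2)] by (simp add: permute_list_def that js nth_append del: upt_Suc)
    qed
  qed (simp add: that js)
  have "q permutes {..<7}" using assms by (intro permutes_subset[OF q]) auto
  moreover have "alternating 7 (volume \<phi>)"
  proof -
    have "length [1,2,3,4,5,6,7::7] = 7" by simp
    then show ?thesis using alternating_coframe_wedge[of "[1,2,3,4,5,6,7]" "some_coframe \<phi>"] by (simp only: volume_def)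
  qed
  ultimately have "volume \<phi> (is @ permute_list p js) = of_int (sign p) * volume \<phi> (is @ js)" if "length is = k" for "is" :: "7 list"
    using pl[OF that] s that js assms unfolding alternating_def by (metis length_append length_idx)
  then show "hodge \<phi> k \<alpha> (permute_list p js) = of_int (sign p) * hodge \<phi> k \<alpha> js"
    by (simp add: hodge_def sum_distrib_left ac_simps)
qed

section \<open>Exterior derivatives of parallel forms\<close>

context metric_chart begin

lemma pd_parallel_3:
  assumes alt: "alternating 3 (t x)" and par: "cov_deriv \<Gamma> l t x [a,b,c] = 0"
  shows "pd l (\<lambda>y. t y [a,b,c]) x = (\<Sum>\<^sub>7m. \<Gamma> x m l a * t x [m,b,c]) - (\<Sum>\<^sub>7m. \<Gamma> x m l b * t x [m,a,c])
    + (\<Sum>\<^sub>7m. \<Gamma> x m l c * t x [m,a,b])"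
proof -
  have "t x [a,m,c] = - t x [m,a,c]" "t x [a,b,m] = t x [m,a,b]" for m
    using alternating_move[OF alt, of "[a]" "[c]" m] alternating_move[OF alt, of "[a,b]" "[]" m] by simp_all
  then show ?thesis using par by (simp add: cov_deriv_act sum_negf)
qed

lemma pd_parallel_4:
  assumes alt: "alternating 4 (t x)" and par: "cov_deriv \<Gamma> l t x [a,b,c,d] = 0"
  shows "pd l (\<lambda>y. t y [a,b,c,d]) x = (\<Sum>\<^sub>7m. \<Gamma> x m l a * t x [m,b,c,d]) - (\<Sum>\<^sub>7m. \<Gamma> x m l b * t x [m,a,c,d])
    + (\<Sum>\<^sub>7m. \<Gamma> x m l c * t x [m,a,b,d]) - (\<Sum>\<^sub>7m. \<Gamma> x m l d * t x [m,a,b,c])"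
proof -
  have "t x [a,m,c,d] = - t x [m,a,c,d]" "t x [a,b,m,d] = t x [m,a,b,d]" "t x [a,b,c,m] = - t x [m,a,b,c]" for m
    using alternating_move[OF alt, of "[a]" "[c,d]" m] alternating_move[OF alt, of "[a,b]" "[d]" m]
      alternating_move[OF alt, of "[a,b,c]" "[]" m] by simp_all
  then show ?thesis using par by (simp add: cov_deriv_act sum_negf)
qed

lemma torsion_ctr:
  assumes x: "x \<in> U"
  shows "ctr (G x) 1 2 (T x) t (i # j # is) = (\<Sum>\<^sub>7m. \<Gamma> x m i j * t (m # is)) - (\<Sum>\<^sub>7m. \<Gamma> x m j i * t (m # is))"
proof -
  have "ctr (G x) 1 2 (T x) t (i # j # is) = (\<Sum>\<^sub>7a m. G x m a * T x [i,j,a] * t (m # is))"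
    using ctr_append[of "[i,j]" 2 "G x" 1 "T x" t "is"] by (simp add: G_sym[OF x] mult.assoc)
  also have "\<dots> = (\<Sum>\<^sub>7m a. G x m a * T x [i,j,a] * t (m # is))" by (rule sum.swap)
  also have "\<dots> = (\<Sum>\<^sub>7m. (\<Gamma> x m i j - \<Gamma> x m j i) * t (m # is))" by (simp only: \<tau>_T[OF x] flip: sum_distrib_right)
  finally show ?thesis by (simp add: left_diff_distrib sum_subtractf)
qed

text \<open>The partial derivatives of a parallel form are Christoffel terms, and alternating them
  leaves the torsion. There is one term for each way of choosing the two slots of the torsion among
  the four.\<close>

lemma ext_d_parallel_3:
  assumes x: "x \<in> U" and alt: "alternating 3 (t x)" and par: "\<And>l is. length is = 3 \<Longrightarrow> cov_deriv \<Gamma> l t x is = 0"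
  shows "ext_d t x [i,j,k,l] = ctr (G x) 1 2 (T x) (t x) [i,j,k,l] - ctr (G x) 1 2 (T x) (t x) [i,k,j,l]
    + ctr (G x) 1 2 (T x) (t x) [i,l,j,k] + ctr (G x) 1 2 (T x) (t x) [j,k,i,l]
    - ctr (G x) 1 2 (T x) (t x) [j,l,i,k] + ctr (G x) 1 2 (T x) (t x) [k,l,i,j]"
proof -
  have p: "pd l (\<lambda>y. t y [a,b,c]) x = (\<Sum>\<^sub>7m. \<Gamma> x m l a * t x [m,b,c]) - (\<Sum>\<^sub>7m. \<Gamma> x m l b * t x [m,a,c])
    + (\<Sum>\<^sub>7m. \<Gamma> x m l c * t x [m,a,b])" for l a b c
    by (rule pd_parallel_3[OF alt par]) simp
  have "ext_d t x [i,j,k,l] = pd i (\<lambda>y. t y [j,k,l]) x - pd j (\<lambda>y. t y [i,k,l]) x + pd k (\<lambda>y. t y [i,j,l]) x - pd l (\<lambda>y. t y [i,j,k]) x"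
    by (simp add: ext_d_def eval_nat_numeral)
  then show ?thesis unfolding p torsion_ctr[OF x] by simp
qed

lemma ext_d_parallel_4:
  assumes x: "x \<in> U" and alt: "alternating 4 (t x)" and par: "\<And>l is. length is = 4 \<Longrightarrow> cov_deriv \<Gamma> l t x is = 0"
  shows "ext_d t x [i,j,k,l,n] = ctr (G x) 1 2 (T x) (t x) [i,j,k,l,n] - ctr (G x) 1 2 (T x) (t x) [i,k,j,l,n]
    + ctr (G x) 1 2 (T x) (t x) [i,l,j,k,n] - ctr (G x) 1 2 (T x) (t x) [i,n,j,k,l]
    + (ctr (G x) 1 2 (T x) (t x) [j,k,i,l,n] - ctr (G x) 1 2 (T x) (t x) [j,l,i,k,n] + ctr (G x) 1 2 (T x) (t x) [j,n,i,k,l]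
    + ctr (G x) 1 2 (T x) (t x) [k,l,i,j,n] - ctr (G x) 1 2 (T x) (t x) [k,n,i,j,l] + ctr (G x) 1 2 (T x) (t x) [l,n,i,j,k])"
proof -
  have p: "pd l (\<lambda>y. t y [a,b,c,d]) x = (\<Sum>\<^sub>7m. \<Gamma> x m l a * t x [m,b,c,d]) - (\<Sum>\<^sub>7m. \<Gamma> x m l b * t x [m,a,c,d])
    + (\<Sum>\<^sub>7m. \<Gamma> x m l c * t x [m,a,b,d]) - (\<Sum>\<^sub>7m. \<Gamma> x m l d * t x [m,a,b,c])" for l a b c d
    by (rule pd_parallel_4[OF alt par]) simp
  have "ext_d t x [i,j,k,l,n] = pd i (\<lambda>y. t y [j,k,l,n]) x - pd j (\<lambda>y. t y [i,k,l,n]) x + pd k (\<lambda>y. t y [i,j,l,n]) x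
    - pd l (\<lambda>y. t y [i,j,k,n]) x + pd n (\<lambda>y. t y [i,j,k,l]) x"
    by (simp add: ext_d_def eval_nat_numeral)
  then show ?thesis unfolding p torsion_ctr[OF x] by simp
qed

end

lemma sum_pairs_frame:
  assumes "\<And>i j. g i j = (\<Sum>\<^sub>7a. F a $ i * F a $ j)"
  shows "(\<Sum>\<^sub>7i j. g i j * t [i,j]) = (\<Sum>\<^sub>7a. fr F t [a,a])"
proof -
  have "(\<Sum>\<^sub>7i j. g i j * t [i,j]) = (\<Sum>\<^sub>7i j a. F a $ i * (F a $ j * t [i,j]))"
    by (simp add: assms sum_distrib_right mult.assoc)
  also have "\<dots> = (\<Sum>\<^sub>7a i j. F a $ i * (F a $ j * t [i,j]))" by (rule sum_rot3[symmetric])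
  finally show ?thesis by (simp add: sum_distrib_left)
qed

lemma raise_fr: "raise \<phi> \<alpha> is = fr (\<lambda>i. \<chi> j. matrix_inv (metric \<phi>) $ i $ j) \<alpha> is"
  unfolding eval_tensor_map[symmetric] eval_tensor_def raise_def by (simp add: mult.commute)

lemma raise_1: "raise \<phi> \<alpha> [i] = (\<Sum>\<^sub>7j. matrix_inv (metric \<phi>) $ i $ j * \<alpha> [j])"
  by (simp add: raise_fr)

lemma eps_Cons_distinct:
  assumes "length is = 7" "distinct is" "j < 7"
  shows "eps (l # take j is @ drop (Suc j) is) = (if l = is ! j then (-1) ^ j * eps is else 0)"
proof -
  have split: "is = take j is @ is ! j # drop (Suc j) is" using assms by (simp add: id_take_nth_drop)
  show ?thesis
  proof (cases "l = is ! j")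
    case True
    have "eps is = (-1) ^ j * eps (is ! j # take j is @ drop (Suc j) is)"
      using alternating_move[OF alternating_eps, of "take j is" "drop (Suc j) is" "is ! j"] split assms by simp
    then show ?thesis using True by (simp add: mult.assoc[symmetric] power_add[symmetric] flip: mult_2)
  next
    case False
    have "card (set is) = 7" using distinct_card[OF assms(2)] assms(1) by simp
    then have "set is = UNIV" using card_subset_eq[of "UNIV::7 set" "set is"] by simp
    then have "l \<in> set (take j is) \<union> set (drop (Suc j) is)"
      using False arg_cong[OF split, of set] by auto
    then have "\<not> distinct (l # take j is @ drop (Suc j) is)" by auto
    moreover have "length (l # take j is @ drop (Suc j) is) = 7" using assms by simp
    ultimately show ?thesis using False alternating_repeated[OF alternating_eps] by simp
  qed
qed

context g2_frame begin

lemma frame_metric: "fr F (metric_field \<phi> x) [a,b] = dl a b"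
proof -
  obtain H where HF: "dual_coframe H F" and A: "Defs.adapted (\<phi> x) H"
    using adapted_frame_coframe[OF adapted] by blast
  note H = dual_coframeD[OF HF]
  have "fr F (metric_field \<phi> x) [a,b] = (\<Sum>\<^sub>7i j k. H $ k $ i * F a $ i * (H $ k $ j * F b $ j))"
    by (simp add: metric_field_def metric_nth[OF A] sum_distrib_left ac_simps)
  also have "\<dots> = (\<Sum>\<^sub>7k i j. H $ k $ i * F a $ i * (H $ k $ j * F b $ j))" by (rule sum_rot3[symmetric])
  also have "\<dots> = (\<Sum>\<^sub>7k. dl k a * dl k b)" by (simp add: H(1) flip: sum_product)
  also have "\<dots> = dl a b" by (simp add: dl_sym)
  finally show ?thesis .
qed

lemma frame_\<psi>: "fr F (star_phi \<phi> x) [i,j,k,l] = ps i j k l"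
proof -
  have "fr F (star_phi \<phi> x) [i,j,k,l] = (\<Sum>as\<in>idx 3. fr F (\<phi> x) as * fr F (volume (\<phi> x)) (as @ [i,j,k,l])) / fact 3"
    unfolding star_phi_def by (rule fr_hodge[OF adapted])
  also have "\<dots> = (\<Sum>as\<in>idx 3. fr F (\<phi> x) as * eps (as @ [i,j,k,l])) / fact 3"
    by (intro arg_cong2[where f = "(/)"] sum.cong refl arg_cong2[where f = "(*)"] adapted_frame_volume[OF adapted]) simp
  also have "\<dots> = (\<Sum>\<^sub>7a b c. ph a b c * eps [a,b,c,i,j,k,l]) / 6"
    by (simp add: numeral_3_eq_3 sum_idx_Suc frame_\<phi> fact_numeral del: fr.simps)
  finally show ?thesis by (simp add: ph_eps)
qed

text \<open>\<open>star_phi\<close> is defined through a pointwise choice of coframe. This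
  expression in \<phi> and the metric is what allows it to be differentiated.\<close>

lemma \<psi>_formula:
  "star_phi \<phi> x [i,j,k,l] = ctr (G x) 1 2 (\<phi> x) (\<phi> x) [i,j,k,l] - gm x $ i $ k * gm x $ j $ l + gm x $ i $ l * gm x $ j $ k"
proof -
  obtain H where HF: "dual_coframe H F" using adapted_frame_coframe[OF adapted] by blast
  let ?g = "metric_field \<phi> x"
  let ?gg = "\<lambda>is. ?g [is ! 0, is ! 1] * ?g [is ! 2, is ! 3]"
  let ?u = "\<lambda>is. ctr (G x) 1 2 (\<phi> x) (\<phi> x) is - ?gg (map ((!) is) [0,2,1,3]) + ?gg (map ((!) is) [0,3,1,2])"
  have gg: "fr F ?gg [a,b,c,d] = dl a b * dl c d" for a b c d
  proof -
    have "fr F ?gg ([a,b] @ [c,d]) = fr F ?g [a,b] * fr F ?g [c,d]"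
      by (rule fr_split) (auto simp: length_Suc_conv metric_field_def)
    then show ?thesis by (simp add: frame_metric del: fr.simps)
  qed
  have "star_phi \<phi> x [i,j,k,l] = ?u [i,j,k,l]"
  proof (rule fr_inject[where t = "star_phi \<phi> x" and u = ?u and F = F and H = "\<lambda>i. \<chi> a. H $ a $ i"])
    show "(\<Sum>\<^sub>7a. (\<chi> a. H $ a $ i) $ a * F a $ j) = dl i j" for i j
      using dual_coframeD(2)[OF HF, of j i] by (simp add: mult.commute dl_sym)
    fix as :: "7 list" assume "length as = length [i,j,k,l]"
    then obtain a b c d where as: "as = [a,b,c,d]" by (auto simp: length_Suc_conv)
    have "fr F ?u [a,b,c,d] = fr F (ctr (G x) 1 2 (\<phi> x) (\<phi> x)) [a,b,c,d]
        - fr F (\<lambda>is. ?gg (map ((!) is) [0,2,1,3])) [a,b,c,d] + fr F (\<lambda>is. ?gg (map ((!) is) [0,3,1,2])) [a,b,c,d]"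
      by (simp only: fr_add fr_diff)
    also have "\<dots> = fr F (ctr (G x) 1 2 (\<phi> x) (\<phi> x)) [a,b,c,d] - fr F ?gg [a,c,b,d] + fr F ?gg [a,d,b,c]"
      using fr_reorder[of "[0,2,1,3]" "[a,b,c,d]" F ?gg] fr_reorder[of "[0,3,1,2]" "[a,b,c,d]" F ?gg]
      by (auto simp: lessThan_Suc insert_commute numeral_eq_Suc simp del: fr.simps)
    also have "fr F (ctr (G x) 1 2 (\<phi> x) (\<phi> x)) [a,b,c,d] = (\<Sum>\<^sub>7e. ph a b e * ph e c d)"
      using frame_ctr[of "[a,b]" 2 1 "\<phi> x" "\<phi> x" "[c,d]"] unfolding cn_dl_1 by (simp add: frame_\<phi> del: fr.simps)
    finally show "fr F (star_phi \<phi> x) as = fr F ?u as"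
      unfolding as frame_\<psi> gg by (simp only: ph_ph')
  qed
  then show ?thesis by (simp add: metric_field_def)
qed

end

context g2_chart begin

lemma metric_field_smooth: "smooth_field U 2 (metric_field \<phi>)"
  by (simp add: smooth_field_def metric_field_def gm_smooth)

lemma frame: assumes "x \<in> U" obtains F where "g2_frame U \<phi> \<Gamma> x F"
  using frame_exists[OF assms] assms g2_chart_axioms by (auto simp: g2_frame_def g2_frame_axioms_def)

lemma \<psi>_alternating: "alternating 4 (star_phi \<phi> x)"
  unfolding star_phi_def by (rule alternating_hodge) simp

text \<open>By \<open>\<psi>_formula\<close> the dual 4-form is composed of \<phi>, the metric and
  its inverse, and all of them are parallel.\<close>

lemma \<psi>_parallel:
  assumes x: "x \<in> U" and len: "length is = 4"
  shows "cov_deriv \<Gamma> l (star_phi \<phi>) x is = 0"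
proof -
  define c where "c = (\<lambda>y. ctr (G y) 1 2 (\<phi> y) (\<phi> y))"
  let ?u = "\<lambda>y is. c y is - gm y $ (is ! 0) $ (is ! 2) * gm y $ (is ! 1) $ (is ! 3) + gm y $ (is ! 0) $ (is ! 3) * gm y $ (is ! 1) $ (is ! 2)"
  obtain i j k m where "is": "is = [i,j,k,m]" using len by (auto simp: length_Suc_conv numeral_eq_Suc)
  have c: "smooth_field U 4 c"
    using smooth_field_contraction[of 2 1 \<phi> 2 \<phi>] \<phi>_smooth by (simp add: c_def numeral_eq_Suc)
  have dc: "(\<lambda>y. c y js) differentiable (at x)" if "length js = 4" for js
    by (rule smooth_on_differentiable[OF smooth_fieldD[OF c that] x])
  have c0: "cov_deriv \<Gamma> l c x [i,j,k,m] = 0"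
  proof -
    have "ctr (G x) 1 2 (cov_deriv \<Gamma> l \<phi> x) (\<phi> x) [i,j,k,m] = 0" "ctr (G x) 1 2 (\<phi> x) (cov_deriv \<Gamma> l \<phi> x) [i,j,k,m] = 0"
      using ctr_append[of "[i,j]" 2 "G x" 1 _ _ "[k,m]"] by (simp_all add: \<phi>_parallel[OF x])
    then show ?thesis
      using cov_deriv_ctr[where G = G and \<Gamma> = \<Gamma> and x = x and U = U and m = 2 and n = 1 and r = 2 and i = l and t = \<phi> and u = \<phi>,
        OF open_U x G_smooth G_parallel[OF x], of "[i,j,k,m]"] \<phi>_smooth by (simp add: c_def numeral_eq_Suc)
  qed
  have "cov_deriv \<Gamma> l (star_phi \<phi>) x is = cov_deriv \<Gamma> l ?u x is"
  proof (rule cov_deriv_cong[OF x])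
    fix y and js :: "7 list" assume y: "y \<in> U" and "length js = length is"
    then obtain a b c d where js: "js = [a,b,c,d]" using len by (auto simp: length_Suc_conv numeral_eq_Suc)
    obtain F where "g2_frame U \<phi> \<Gamma> y F" using frame[OF y] .
    then interpret g2_frame U \<phi> \<Gamma> y F .
    show "star_phi \<phi> y js = ?u y js" by (simp add: js \<psi>_formula c_def)
  qed
  also have "\<dots> = cov_deriv \<Gamma> l c x [i,j,k,m]"
  proof -
    have p: "pd l (\<lambda>y. ?u y [i,j,k,m]) x = pd l (\<lambda>y. c y [i,j,k,m]) x
      - (pd l (\<lambda>y. gm y $ i $ k) x * gm x $ j $ m + gm x $ i $ k * pd l (\<lambda>y. gm y $ j $ m) x)
      + (pd l (\<lambda>y. gm y $ i $ m) x * gm x $ j $ k + gm x $ i $ m * pd l (\<lambda>y. gm y $ j $ k) x)"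
      by (simp add: pd_add pd_diff pd_mult dc diff_gm[OF x] differentiable_mult differentiable_diff)
    show ?thesis unfolding "is" cov_deriv_act p gm_parallel[OF x]
      by (simp add: algebra_simps sum.distrib sum_subtractf sum_distrib_left)
  qed
  finally show ?thesis by (simp only: c0)
qed

end

context g2_frame begin

lemma frame_torsion_ctr:
  "fr F (ctr (G x) 1 2 (T x) t) (a # b # cs) = (\<Sum>\<^sub>7m. Tf a b m * fr F t (m # cs))"
  using frame_ctr[of "[a,b]" 2 1 "T x" t cs] unfolding cn_dl_1 by (simp add: Tf_def del: fr.simps)

text \<open>In the frame, d\<phi> is the alternation of T contracted with \<phi>. Its six terms pair
  equally with \<open>ps\<close>, and \<open>ps\<close> contracted with \<phi> is four times \<phi>;
  the product 6 * 4 cancels the 4! of the scalar product.\<close>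

lemma trace_Sf: "form_inner (\<phi> x) 4 (ext_d \<phi> x) (star_phi \<phi> x) = (\<Sum>\<^sub>7a. Sf a a)"
proof -
  let ?X = "ctr (G x) 1 2 (T x) (\<phi> x)"
  define X where "X a b c d = (\<Sum>\<^sub>7m. Tf a b m * ph m c d)" for a b c d
  have fX: "fr F ?X [a,b,c,d] = X a b c d" for a b c d
    by (simp add: frame_torsion_ctr frame_\<phi> X_def del: fr.simps One_nat_def)
  have d: "fr F (ext_d \<phi> x) [a,b,c,d] = X a b c d - X a c b d + X a d b c + X b c a d - X b d a c + X c d a b" for a b c d
  proof -
    let ?u = "\<lambda>is. ?X is - ?X (map ((!) is) [0,2,1,3]) + ?X (map ((!) is) [0,3,1,2]) + ?X (map ((!) is) [1,2,0,3])
      - ?X (map ((!) is) [1,3,0,2]) + ?X (map ((!) is) [2,3,0,1])"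
    have "fr F (ext_d \<phi> x) [a,b,c,d] = fr F ?u [a,b,c,d]"
    proof (rule fr_cong)
      fix js :: "7 list" assume "length js = length [a,b,c,d]"
      then obtain i j k l where js: "js = [i,j,k,l]" by (auto simp: length_Suc_conv)
      show "ext_d \<phi> x js = ?u js"
        using ext_d_parallel_3[where t = \<phi>, OF x \<phi>_alternating[OF x] \<phi>_parallel[OF x], of i j k l] by (simp add: js del: One_nat_def)
    qed
    also have "\<dots> = fr F ?X [a,b,c,d] - fr F ?X [a,c,b,d] + fr F ?X [a,d,b,c] + fr F ?X [b,c,a,d] - fr F ?X [b,d,a,c] + fr F ?X [c,d,a,b]"
      unfolding fr_add fr_diff
      using fr_reorder[of "[0,2,1,3]" "[a,b,c,d]" F ?X] fr_reorder[of "[0,3,1,2]" "[a,b,c,d]" F ?X]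
        fr_reorder[of "[1,2,0,3]" "[a,b,c,d]" F ?X] fr_reorder[of "[1,3,0,2]" "[a,b,c,d]" F ?X] fr_reorder[of "[2,3,0,1]" "[a,b,c,d]" F ?X]
      by (auto simp: lessThan_Suc insert_commute numeral_eq_Suc simp del: fr.simps)
    finally show ?thesis by (simp only: fX)
  qed
  have "form_inner (\<phi> x) 4 (ext_d \<phi> x) (star_phi \<phi> x) = (\<Sum>as\<in>idx 4. fr F (ext_d \<phi> x) as * fr F (star_phi \<phi> x) as) / fact 4"
    unfolding form_inner_def by (simp only: raise_inner[OF adapted])
  also have "(\<Sum>as\<in>idx 4. fr F (ext_d \<phi> x) as * fr F (star_phi \<phi> x) as) =
    (\<Sum>\<^sub>7a b c e. fr F (ext_d \<phi> x) [a,b,c,e] * fr F (star_phi \<phi> x) [a,b,c,e])"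
    by (simp add: eval_nat_numeral sum_idx_Suc del: fr.simps)
  also have "\<dots> = ps_inner (\<lambda>a b c d. X a b c d - X a c b d + X a d b c + X b c a d - X b d a c + X c d a b)"
    by (simp only: d frame_\<psi> ps_inner_def)
  also have "\<dots> = 6 * ps_inner X" using ps_inner_alt6[of X] by (simp only: ps_inner_linear)
  also have "ps_inner X = 4 * (\<Sum>\<^sub>7a. Sf a a)"
  proof -
    have "ps_inner X = (\<Sum>\<^sub>7a b c d m. ps a b c d * ph m c d * Tf a b m)"
      by (simp add: ps_inner_def X_def sum_distrib_right sum_distrib_left ac_simps)
    also have "\<dots> = (\<Sum>\<^sub>7a b m c d. ps a b c d * ph m c d * Tf a b m)"
      by (intro sum.cong refl sum_rot3[symmetric])
    also have "\<dots> = (\<Sum>\<^sub>7a b m. 4 * (ph m a b * Tf m a b))"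
    proof (intro sum.cong refl)
      fix a b m
      have "Tf a b m = Tf m a b" using Tf_skew(2)[of a b m] Tf_skew(1)[of a m b] by simp
      then show "(\<Sum>\<^sub>7c d. ps a b c d * ph m c d * Tf a b m) = 4 * (ph m a b * Tf m a b)"
        by (simp add: ps_ph4 flip: sum_distrib_right)
    qed
    also have "\<dots> = (\<Sum>\<^sub>7m a b. 4 * (ph m a b * Tf m a b))" by (rule sum_rot3[symmetric])
    finally show ?thesis by (simp add: Sf Sof_def cph_def sum_distrib_left)
  qed
  finally show ?thesis by (simp add: fact_numeral)
qed

text \<open>Contracting the two copies of \<phi> in the definition of \<theta> leaves
  \<open>ps\<close>, the Kronecker terms being traces of the torsion. The integrability equation
  produces \<theta> in this form.\<close>

lemma \<theta>f_ps: "(\<Sum>\<^sub>7b c d. ps a b c d * Tf b c d) = - 6 * \<theta>f a"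
proof -
  have "- 6 * \<theta>f a = (\<Sum>\<^sub>7l p. ph a l p * (\<Sum>\<^sub>7i j. ph p i j * Tf l i j))"
    by (simp add: \<theta>f thof_def cph_def Sf Sof_def)
  also have "\<dots> = (\<Sum>\<^sub>7l p i j. ph a l p * ph p i j * Tf l i j)" by (simp add: sum_distrib_left mult.assoc)
  also have "\<dots> = (\<Sum>\<^sub>7l i j p. ph a l p * ph p i j * Tf l i j)" by (intro sum.cong refl sum_rot3)
  also have "\<dots> = (\<Sum>\<^sub>7l i j. (dl a i * dl l j - dl a j * dl l i + ps a l i j) * Tf l i j)"
    by (simp only: ph_ph' flip: sum_distrib_right)
  also have "\<dots> = (\<Sum>\<^sub>7l i j. dl a i * (dl l j * Tf l i j)) - (\<Sum>\<^sub>7l i j. dl a j * (dl l i * Tf l i j)) + (\<Sum>\<^sub>7l i j. ps a l i j * Tf l i j)"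
    by (simp only: left_diff_distrib distrib_right sum.distrib sum_subtractf mult.assoc)
  also have "(\<Sum>\<^sub>7l i j. dl a i * (dl l j * Tf l i j)) = 0"
  proof -
    have "Tf l i l = 0" for l i using Tf_skew(1)[of l i l] Tf_skew(2)[of i l l] by simp
    then show ?thesis by (simp flip: sum_distrib_left)
  qed
  also have "(\<Sum>\<^sub>7l i j. dl a j * (dl l i * Tf l i j)) = 0"
  proof -
    have "Tf l l j = 0" for l j using Tf_skew(1)[of l l j] by simp
    then have z: "dl l i * Tf l i j = 0" for l i j by (simp add: dl_def)
    show ?thesis unfolding z by simp
  qed
  finally show ?thesis by simp
qed

text \<open>Wedging a 1-form with the dual 4-form is injective, so integrability determines the Lee
  form from the torsion. To extract it, the equation is paired with \<open>ps\<close> in the last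
  four slots: the left side gives 6 * 12 times \<theta>, the right side 168 - 4 * 24 times the Lee
  form, and both factors are 72.\<close>

lemma lee_frame:
  assumes int: "\<And>is. length is = 5 \<Longrightarrow> ext_d (star_phi \<phi>) x is = wedge 1 (lee_form \<phi> x) (star_phi \<phi> x) is"
  shows "fr F (lee_form \<phi> x) [a] = \<theta>f a"
proof -
  let ?X = "ctr (G x) 1 2 (T x) (star_phi \<phi> x)" and ?W = "\<lambda>is. lee_form \<phi> x [hd is] * star_phi \<phi> x (tl is)"
  define L where "L a = fr F (lee_form \<phi> x) [a]" for a
  define Y where "Y a b c d e = (\<Sum>\<^sub>7m. Tf a b m * ps m c d e)" for a b c d e
  have fX: "fr F ?X [a,b,c,d,e] = Y a b c d e" for a b c d e
    by (simp add: frame_torsion_ctr frame_\<psi> Y_def del: fr.simps One_nat_def)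
  have fW: "fr F ?W [a,b,c,d,e] = L a * ps b c d e" for a b c d e
  proof -
    have "fr F ?W ([a] @ [b,c,d,e]) = fr F (lee_form \<phi> x) [a] * fr F (star_phi \<phi> x) [b,c,d,e]"
      by (rule fr_split) (auto simp: length_Suc_conv)
    then show ?thesis by (simp add: L_def frame_\<psi> del: fr.simps)
  qed
  have set5: "{..<length [a,b,c,d,e]} = {0,1,2,3,4}" for a b c d e :: 7 by auto
  have re: "fr F (\<lambda>is. t (map ((!) is) \<sigma>)) [a,b,c,d,e] = fr F t (map ((!) [a,b,c,d,e]) \<sigma>)"
    if "distinct \<sigma>" "set \<sigma> = {0,1,2,3,4}" for t \<sigma> a b c d e
    by (rule fr_reorder[OF that(1)]) (simp only: that(2) set5)
  have main: "Y a b c d e - Y a c b d e + Y a d b c e - Y a e b c d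
     + (Y b c a d e - Y b d a c e + Y b e a c d + Y c d a b e - Y c e a b d + Y d e a b c)
     = L a * ps b c d e - (L b * ps a c d e - L c * ps a b d e + L d * ps a b c e - L e * ps a b c d)" for a b c d e
  proof -
    let ?u = "\<lambda>is. ?X is - ?X (map ((!) is) [0,2,1,3,4]) + ?X (map ((!) is) [0,3,1,2,4]) - ?X (map ((!) is) [0,4,1,2,3])
      + (?X (map ((!) is) [1,2,0,3,4]) - ?X (map ((!) is) [1,3,0,2,4]) + ?X (map ((!) is) [1,4,0,2,3])
        + ?X (map ((!) is) [2,3,0,1,4]) - ?X (map ((!) is) [2,4,0,1,3]) + ?X (map ((!) is) [3,4,0,1,2]))"
    let ?v = "\<lambda>is. ?W is - (?W (map ((!) is) [1,0,2,3,4]) - ?W (map ((!) is) [2,0,1,3,4]) + ?W (map ((!) is) [3,0,1,2,4])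
      - ?W (map ((!) is) [4,0,1,2,3]))"
    have "fr F ?u [a,b,c,d,e] = fr F ?v [a,b,c,d,e]"
    proof (rule fr_cong)
      fix js :: "7 list" assume "length js = length [a,b,c,d,e]"
      then obtain i j k l n where js: "js = [i,j,k,l,n]" by (auto simp: length_Suc_conv)
      have "ext_d (star_phi \<phi>) x js = ?u js"
        using ext_d_parallel_4[where t = "star_phi \<phi>", OF x \<psi>_alternating \<psi>_parallel[OF x], of i j k l n] by (simp add: js del: One_nat_def)
      moreover have "wedge 1 (lee_form \<phi> x) (star_phi \<phi> x) js = ?v js"
        by (subst wedge_1[OF \<psi>_alternating]) (simp_all add: js eval_nat_numeral)
      ultimately show "?u js = ?v js" using int[of js] by (simp add: js)
    qed
    moreover have "fr F ?u [a,b,c,d,e] = Y a b c d e - Y a c b d e + Y a d b c e - Y a e b c d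
     + (Y b c a d e - Y b d a c e + Y b e a c d + Y c d a b e - Y c e a b d + Y d e a b c)"
      unfolding fr_add fr_diff
      using re[of "[0,2,1,3,4]" ?X a b c d e] re[of "[0,3,1,2,4]" ?X a b c d e] re[of "[0,4,1,2,3]" ?X a b c d e]
        re[of "[1,2,0,3,4]" ?X a b c d e] re[of "[1,3,0,2,4]" ?X a b c d e] re[of "[1,4,0,2,3]" ?X a b c d e]
        re[of "[2,3,0,1,4]" ?X a b c d e] re[of "[2,4,0,1,3]" ?X a b c d e] re[of "[3,4,0,1,2]" ?X a b c d e]
      by (simp add: fX insert_commute del: fr.simps One_nat_def)
    moreover have "fr F ?v [a,b,c,d,e] = L a * ps b c d e - (L b * ps a c d e - L c * ps a b d e + L d * ps a b c e - L e * ps a b c d)"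
    proof -
      have "fr F ?v [a,b,c,d,e] = fr F ?W [a,b,c,d,e] - (fr F (\<lambda>is. ?W (map ((!) is) [1,0,2,3,4])) [a,b,c,d,e]
        - fr F (\<lambda>is. ?W (map ((!) is) [2,0,1,3,4])) [a,b,c,d,e] + fr F (\<lambda>is. ?W (map ((!) is) [3,0,1,2,4])) [a,b,c,d,e]
        - fr F (\<lambda>is. ?W (map ((!) is) [4,0,1,2,3])) [a,b,c,d,e])"
        by (simp only: fr_diff[of F "?W"] fr_diff fr_add)
      also have "\<dots> = fr F ?W [a,b,c,d,e] - (fr F ?W [b,a,c,d,e] - fr F ?W [c,a,b,d,e] + fr F ?W [d,a,b,c,e] - fr F ?W [e,a,b,c,d])"
        by (subst re, simp, simp add: insert_commute)+ (simp del: fr.simps)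
      finally show ?thesis by (simp only: fW)
    qed
    ultimately show ?thesis by simp
  qed
  have Y1: "ps_inner (\<lambda>b c d e. Y a b c d e) = 0"
  proof -
    have "ps_inner (\<lambda>b c d e. Y a b c d e) = (\<Sum>\<^sub>7b c d e m. ps m c d e * ps b c d e * Tf a b m)"
      by (simp add: ps_inner_def Y_def sum_distrib_right sum_distrib_left ac_simps)
    also have "\<dots> = (\<Sum>\<^sub>7b m c d e. ps m c d e * ps b c d e * Tf a b m)"
    proof (rule sum.cong[OF refl])
      fix b :: 7
      let ?f = "\<lambda>c d e m. ps m c d e * ps b c d e * Tf a b m"
      have "(\<Sum>\<^sub>7c d e m. ?f c d e m) = (\<Sum>\<^sub>7c m d e. ?f c d e m)" by (intro sum.cong refl sum_rot3[symmetric])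
      also have "\<dots> = (\<Sum>\<^sub>7m c d e. ?f c d e m)" by (rule sum.swap)
      finally show "(\<Sum>\<^sub>7c d e m. ?f c d e m) = (\<Sum>\<^sub>7m c d e. ?f c d e m)" .
    qed
    also have "\<dots> = (\<Sum>\<^sub>7b m. 24 * (dl m b * Tf a b m))" by (simp add: ps_ps3 mult.assoc[of 24] flip: sum_distrib_right)
    also have "\<dots> = 0"
    proof -
      have "Tf a b b = 0" for b using Tf_skew(2)[of a b b] by simp
      then show ?thesis by (simp flip: sum_distrib_left)
    qed
    finally show ?thesis .
  qed
  have Y2: "ps_inner (\<lambda>b c d e. Y b c a d e) = 12 * \<theta>f a" for a
  proof -
    have "ps_inner (\<lambda>b c d e. Y b c a d e) = (\<Sum>\<^sub>7b c d e m. ps m a d e * ps b c d e * Tf b c m)"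
      by (simp add: ps_inner_def Y_def sum_distrib_right sum_distrib_left ac_simps)
    also have "\<dots> = (\<Sum>\<^sub>7b c m d e. ps m a d e * ps b c d e * Tf b c m)" by (intro sum.cong refl sum_rot3[symmetric])
    also have "\<dots> = (\<Sum>\<^sub>7b c m. (4 * (dl m b * dl a c - dl m c * dl a b) + 2 * ps m a b c) * Tf b c m)"
      by (simp only: ps_ps flip: sum_distrib_right)
    also have "\<dots> = (\<Sum>\<^sub>7b c m. 2 * (- (ps a b c m * Tf b c m)))"
    proof (intro sum.cong refl)
      fix b c m
      have z: "dl m b * Tf b c m = 0" "dl m c * Tf b c m = 0"
        using Tf_skew(1)[of b c b] Tf_skew(2)[of c b b] Tf_skew(2)[of b c c] by (auto simp: dl_def)
      have "(4 * (dl m b * dl a c - dl m c * dl a b) + 2 * ps m a b c) * Tf b c m =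
        4 * dl a c * (dl m b * Tf b c m) - 4 * dl a b * (dl m c * Tf b c m) + 2 * ps m a b c * Tf b c m"
        by (simp add: algebra_simps)
      then show "(4 * (dl m b * dl a c - dl m c * dl a b) + 2 * ps m a b c) * Tf b c m = 2 * (- (ps a b c m * Tf b c m))"
        unfolding z using ps_rot[of m a b c] by simp
    qed
    also have "\<dots> = - 2 * (\<Sum>\<^sub>7b c m. ps a b c m * Tf b c m)" by (simp add: sum_distrib_left sum_negf)
    finally show ?thesis by (simp add: \<theta>f_ps)
  qed
  have L1: "ps_inner (\<lambda>b c d e. L a * ps b c d e) = 168 * L a" for a
  proof -
    have "ps_inner (\<lambda>b c d e. L a * ps b c d e) = L a * (\<Sum>\<^sub>7b c d e. ps b c d e * ps b c d e)"
      by (simp add: ps_inner_def sum_distrib_left mult.assoc)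
    also have "(\<Sum>\<^sub>7b c d e. ps b c d e * ps b c d e) = 168" by (simp add: ps_ps3) (simp add: dl_def)
    finally show ?thesis by simp
  qed
  have L2: "ps_inner (\<lambda>b c d e. L b * ps a c d e) = 24 * L a" for a
  proof -
    have "ps_inner (\<lambda>b c d e. L b * ps a c d e) = (\<Sum>\<^sub>7b. L b * (\<Sum>\<^sub>7c d e. ps a c d e * ps b c d e))"
      by (simp add: ps_inner_def sum_distrib_left mult.assoc)
    then show ?thesis by (simp add: ps_ps3 mult.left_commute[of _ 24] flip: sum_distrib_left)
  qed
  let ?Y = "Y a" and ?Z = "\<lambda>b c d e. Y b c a d e" and ?L = "\<lambda>b c d e. L b * ps a c d e"
  have "ps_inner (\<lambda>b c d e. ?Y b c d e - ?Y c b d e + ?Y d b c e - ?Y e b c d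
     + (?Z b c d e - ?Z b d c e + ?Z b e c d + ?Z c d b e - ?Z c e b d + ?Z d e b c))
     = ps_inner (\<lambda>b c d e. L a * ps b c d e - (?L b c d e - ?L c b d e + ?L d b c e - ?L e b c d))"
    by (simp only: main)
  then have "4 * ps_inner ?Y + 6 * ps_inner ?Z = ps_inner (\<lambda>b c d e. L a * ps b c d e) - 4 * ps_inner ?L"
    using ps_inner_alt4[of ?Y] ps_inner_alt6[of ?Z] ps_inner_alt4[of ?L] by (simp only: ps_inner_linear)
  then have "L a = \<theta>f a" by (simp add: Y1 Y2 L1 L2)
  then show ?thesis by (simp only: L_def)
qed

end

context orthonormal_frame_at begin

lemma frame_nabt_add:
  assumes "smooth_field U k t" "smooth_field U k u" "length as = k"
  shows "fr F (nabt \<Gamma> (\<lambda>y is. t y is + u y is) x) (i # as) = fr F (nabt \<Gamma> t x) (i # as) + fr F (nabt \<Gamma> u x) (i # as)"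
proof -
  have "nabt \<Gamma> (\<lambda>y is. t y is + u y is) x (l # is) = nabt \<Gamma> t x (l # is) + nabt \<Gamma> u x (l # is)" if "length is = k" for l "is"
    using smooth_on_differentiable[OF smooth_fieldD[OF assms(1) that] x] smooth_on_differentiable[OF smooth_fieldD[OF assms(2) that] x]
    by (simp add: cov_deriv_act act_add pd_add)
  then have "fr F (\<lambda>is. nabt \<Gamma> (\<lambda>y is. t y is + u y is) x (l # is)) as = fr F (\<lambda>is. nabt \<Gamma> t x (l # is) + nabt \<Gamma> u x (l # is)) as" for l
    using assms(3) by (intro fr_cong) auto
  then show ?thesis by (simp add: fr_add distrib_left sum.distrib)
qed

text \<open>The last hypothesis is needed because constant components make a scalar parallel, while
  for a tensor of positive degree this holds only if they are zero.\<close>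

lemma frame_nabt_0:
  assumes "\<And>y js. y \<in> U \<Longrightarrow> length js = length as \<Longrightarrow> t y js = c"  "as = [] \<or> c = 0"
  shows "fr F (nabt \<Gamma> t x) (i # as) = 0"
proof -
  have "nabt \<Gamma> t x is = 0" if len: "length is = Suc (length as)" for "is"
  proof -
    obtain l js where "is": "is = l # js" "length js = length as" using len by (auto simp: length_Suc_conv)
    have "cov_deriv \<Gamma> l t x js = cov_deriv \<Gamma> l (\<lambda>y js. c) x js"
      using assms(1) by (intro cov_deriv_cong[OF x]) (simp add: "is")
    also have "\<dots> = 0" using assms(2) "is"(2) by (auto simp: cov_deriv_act act_def)
    finally show ?thesis by (simp add: "is")
  qed
  then have "fr F (nabt \<Gamma> t x) (i # as) = fr F (\<lambda>_. 0) (i # as)" by (intro fr_cong) simp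
  then show ?thesis by (simp only: fr_zero)
qed

end

lemma sum_idx_Cons_distinct:
  assumes "length is = 7" "distinct (is :: 7 list)"
  shows "(\<Sum>j<7. f (is ! j)) = (\<Sum>\<^sub>7l. f l :: real)"
proof -
  have "card (set is) = 7" using distinct_card[OF assms(2)] assms(1) by simp
  then have "set is = UNIV" using card_subset_eq[of "UNIV::7 set" "set is"] by simp
  then have "bij_betw ((!) is) {..<7} UNIV" using bij_betw_nth[OF assms(2), of "{..<7}" UNIV] assms(1) by simp
  then show ?thesis by (rule sum.reindex_bij_betw)
qed

section \<open>Divergence and codifferential\<close>

context metric_chart begin

definition divg :: "local_field \<Rightarrow> R7 \<Rightarrow> real" where
  "divg V x = (\<Sum>\<^sub>7i j. G x i j * cov_deriv \<Gamma> i V x [j])"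

end

lemma (in orthonormal_frame_at) frame_divg: "divg V x = (\<Sum>\<^sub>7a. fr F (nabt \<Gamma> V x) [a,a])"
proof -
  have "G x i j = (\<Sum>\<^sub>7a. F a $ i * F a $ j)" for i j by (simp add: G_F flip: sum_distrib_left)
  from sum_pairs_frame[OF this, of "nabt \<Gamma> V x"] show ?thesis by (simp add: divg_def)
qed

context g2_chart begin

text \<open>The volume form is \<open>\<mu>\<close> up to a locally constant sign.\<close>

lemma codiff_divg:
  assumes x: "x \<in> U" and V: "smooth_field U 1 V" and \<alpha>: "\<And>y i. y \<in> U \<Longrightarrow> \<alpha> y [i] = V y [i]"
    and codiff: "codiff \<phi> 1 \<alpha> x [] = 0"
  shows "divg V x = 0"
proof -
  obtain W E s where W0: "open W" "x \<in> W" "W \<subseteq> U" "s \<noteq> 0" "\<forall>y\<in>W. adapted (\<phi> y) (E y) \<and> det (E y) = s * \<mu> y"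
    using local_det[OF x] .
  then have W: "open W" "x \<in> W" "W \<subseteq> U" "\<And>y. y \<in> W \<Longrightarrow> adapted (\<phi> y) (E y)"
    "s \<noteq> 0" "\<And>y. y \<in> W \<Longrightarrow> det (E y) = s * \<mu> y" by auto
  define u where "u l y = \<mu> y * (\<Sum>\<^sub>7j. G y l j * V y [j])" for l y
  define X where "X = ext_d (\<lambda>y. hodge (\<phi> y) 1 (\<alpha> y)) x"
  have hodge: "hodge (\<phi> y) 1 (\<alpha> y) js = s * (\<Sum>\<^sub>7l. u l y * eps (l # js))" if "length js = 6" "y \<in> W" for js y
  proof -
    have v: "volume (\<phi> y) (l # js) = s * \<mu> y * eps (l # js)" for l
      using volume_adapted[OF W(4)[OF that(2)], of "l # js"] that by (simp add: W(6))
    show ?thesis using W(3) that(2)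
      by (auto simp: hodge_def sum_idx_Suc raise_1 v u_def G_def \<alpha> subset_iff sum_distrib_left ac_simps)
  qed
  have du: "u l differentiable (at x)" for l
    unfolding u_def using smooth_on_differentiable[OF smooth_fieldD[OF V] x] diff_G[OF x] \<mu>_deriv(1)[OF x]
    by (intro differentiable_mult differentiable_sum) simp_all
  define d where "d = (\<Sum>\<^sub>7l. pd l (u l) x)"
  have X: "X is = s * d * eps is" if "length is = 7" "distinct is" for "is"
  proof -
    have "X is = (\<Sum>j<7. (-1) ^ j * (s * (\<Sum>\<^sub>7l. pd (is ! j) (u l) x * eps (l # take j is @ drop (Suc j) is))))"
      unfolding X_def ext_d_def that(1)
    proof (intro sum.cong refl arg_cong2[where f = "(*)"])
      fix j assume "j \<in> {..<7::nat}"
      then have len: "length (take j is @ drop (Suc j) is) = 6" using that(1) by simp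
      have "pd (is ! j) (\<lambda>y. hodge (\<phi> y) 1 (\<alpha> y) (take j is @ drop (Suc j) is)) x
        = pd (is ! j) (\<lambda>y. s * (\<Sum>\<^sub>7l. u l y * eps (l # take j is @ drop (Suc j) is))) x"
        by (rule pd_cong[OF W(1,2)]) (rule hodge[OF len])
      also have "\<dots> = s * (\<Sum>\<^sub>7l. pd (is ! j) (u l) x * eps (l # take j is @ drop (Suc j) is))"
        using du by (simp add: pd_mult pd_sum differentiable_mult differentiable_sum)
      finally show "pd (is ! j) (\<lambda>y. hodge (\<phi> y) 1 (\<alpha> y) (take j is @ drop (Suc j) is)) x
        = s * (\<Sum>\<^sub>7l. pd (is ! j) (u l) x * eps (l # take j is @ drop (Suc j) is))" .
    qed
    also have "\<dots> = (\<Sum>j<7. s * eps is * pd (is ! j) (u (is ! j)) x)"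
    proof (intro sum.cong refl)
      fix j assume j: "j \<in> {..<7::nat}"
      have "(\<Sum>\<^sub>7l. pd (is ! j) (u l) x * eps (l # take j is @ drop (Suc j) is)) = (-1) ^ j * eps is * pd (is ! j) (u (is ! j)) x"
        using j by (simp add: eps_Cons_distinct[OF that] if_distrib cong: if_cong)
      then show "(-1) ^ j * (s * (\<Sum>\<^sub>7l. pd (is ! j) (u l) x * eps (l # take j is @ drop (Suc j) is))) = s * eps is * pd (is ! j) (u (is ! j)) x"
        by (simp add: mult.assoc[symmetric] power_mult_distrib[symmetric])
    qed
    also have "\<dots> = s * eps is * d"
      unfolding d_def sum_distrib_left[symmetric] by (subst sum_idx_Cons_distinct[OF that]) (rule refl)
    finally show ?thesis by simp
  qed
  obtain F where F: "adapted_frame (\<phi> x) F" using frame_exists[OF x] by blast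
  let ?R = "\<lambda>i. (\<chi> j. matrix_inv (gm x) $ i $ j) :: R7"
  \<comment> \<open>The factor by which raising all indices of the volume form changes
    \<open>eps\<close>. It is nonzero because the inverse metric is invertible.\<close>
  define c where "c = s * \<mu> x * det (\<chi> a b. ?R b $ a)"
  have c: "c \<noteq> 0"
  proof -
    have "gm x ** matrix_inv (gm x) = mat 1" using matrix_inv_left_right[OF adapted_frame_G(2)[OF F]] by simp
    then have "det (gm x) * det (matrix_inv (gm x)) = 1" using det_mul[of "gm x" "matrix_inv (gm x)"] by simp
    moreover have "(\<chi> a b. ?R b $ a) = Finite_Cartesian_Product.transpose (matrix_inv (gm x))"
      by (simp add: Finite_Cartesian_Product.transpose_def)
    ultimately show ?thesis using W(5) \<mu>_pos[OF x] by (auto simp: c_def det_transpose)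
  qed
  have rv: "raise (\<phi> x) (volume (\<phi> x)) is = c * eps is" if "length is = 7" for "is"
  proof -
    have "raise (\<phi> x) (volume (\<phi> x)) is = fr ?R (\<lambda>is. s * \<mu> x * eps is) is"
      unfolding raise_fr by (rule fr_cong) (simp add: that volume_adapted[OF W(4)[OF W(2)]] W(6)[OF W(2)])
    then show ?thesis using fr_eps[OF that, of ?R] by (simp add: fr_cmult c_def)
  qed
  have "0 = hodge (\<phi> x) 7 X []" using codiff by (simp add: codiff_def X_def)
  then have "0 = (\<Sum>is\<in>idx 7. raise (\<phi> x) X is * volume (\<phi> x) is)" by (simp add: hodge_def)
  also have "\<dots> = (\<Sum>is\<in>idx 7. raise (\<phi> x) (volume (\<phi> x)) is * X is)"
    unfolding raise_inner[OF F] by (simp only: mult.commute)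
  also have "\<dots> = (\<Sum>is\<in>idx 7. c * s * d * (eps is)\<^sup>2)"
  proof (intro sum.cong refl)
    fix "is" assume "is \<in> idx 7"
    then have len: "length is = 7" by simp
    show "raise (\<phi> x) (volume (\<phi> x)) is * X is = c * s * d * (eps is)\<^sup>2"
    proof (cases "distinct is")
      case True then show ?thesis by (simp add: rv[OF len] X[OF len] power2_eq_square)
    next
      case False then show ?thesis using alternating_repeated[OF alternating_eps len] by (simp add: rv[OF len])
    qed
  qed
  also have "\<dots> = c * s * d * (\<Sum>is\<in>idx 7. (eps is)\<^sup>2)" by (simp only: sum_distrib_left)
  finally have z: "c * s * d * (\<Sum>is\<in>idx 7. (eps is)\<^sup>2) = 0" by simp
  \<comment> \<open>The sum of squares is nonzero since one of its terms is 1; hence the remaining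
    factor \<open>d\<close>, the coordinate divergence of the density, must vanish.\<close>
  have "(eps [1,2,3,4,5,6,7])\<^sup>2 \<le> (\<Sum>is\<in>idx 7. (eps is)\<^sup>2)"
    by (rule member_le_sum) simp_all
  then have "(\<Sum>is\<in>idx 7. (eps is)\<^sup>2) \<noteq> 0" unfolding eps_1 by auto
  then have "d = 0" using z c W(5) by simp
  moreover have "d = \<mu> x * divg V x" using divergence[OF x V] by (simp add: d_def u_def[abs_def] divg_def)
  ultimately show ?thesis using \<mu>_pos[OF x] by simp
qed

end

locale g2_chart_gauduchon = g2_chart +
  fixes r :: real
  assumes integrable: "\<And>x is. x \<in> U \<Longrightarrow> length is = 5 \<Longrightarrow>
      ext_d (star_phi \<phi>) x is = wedge 1 (lee_form \<phi> x) (star_phi \<phi> x) is"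
    and const_type: "\<And>x. x \<in> U \<Longrightarrow> form_inner (\<phi> x) 4 (ext_d \<phi> x) (star_phi \<phi> x) = r"
    and gauduchon: "\<And>x. x \<in> U \<Longrightarrow> codiff \<phi> 1 (lee_form \<phi>) x [] = 0"
begin

lemma lee_\<theta>: assumes x: "x \<in> U" shows "lee_form \<phi> x [i] = \<theta> x [i]"
proof -
  obtain F where "g2_frame U \<phi> \<Gamma> x F" using frame[OF x] .
  then interpret g2_frame U \<phi> \<Gamma> x F .
  obtain H where HF: "dual_coframe H F" using adapted_frame_coframe[OF adapted] by blast
  show ?thesis
  proof (rule fr_inject[where F = F and H = "\<lambda>i. \<chi> a. H $ a $ i"])
    show "(\<Sum>\<^sub>7a. (\<chi> a. H $ a $ i) $ a * F a $ j) = dl i j" for i j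
      using dual_coframeD(2)[OF HF, of j i] by (simp add: mult.commute dl_sym)
    fix as :: "7 list" assume "length as = length [i]"
    then obtain a where "as = [a]" by (auto simp: length_Suc_conv)
    then show "fr F (lee_form \<phi> x) as = fr F (\<theta> x) as"
      using lee_frame[OF integrable[OF x]] by (simp only: \<theta>f_def)
  qed
qed

lemma div_\<theta>: "x \<in> U \<Longrightarrow> divg \<theta> x = 0"
  by (rule codiff_divg[OF _ \<theta>_smooth lee_\<theta> gauduchon])

end

locale g2_frame_gauduchon = g2_chart_gauduchon + g2_frame
begin

text \<open>By \<open>trace_Sf\<close> the trace of S is the constant of the constant type
  condition, and taking traces commutes with \<nabla>.\<close>

lemma trace_DSf: "(\<Sum>\<^sub>7a. DSf i a a) = 0"
proof -
  let ?t = "\<lambda>y. ctr (G y) 2 0 (S y) (metric_field \<phi> y)"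
  have t: "?t y [] = r" if y: "y \<in> U" for y
  proof -
    obtain F where "g2_frame U \<phi> \<Gamma> y F" using frame[OF y] .
    then interpret y: g2_frame U \<phi> \<Gamma> y F .
    have "fr F (?t y) ([] @ []) = (\<Sum>\<^sub>7a b. y.Sf a b * dl a b)"
      unfolding y.frame_ctr[of "[]" 0, OF list.size(3)] cn_dl_2 by (simp add: y.Sf_def y.frame_metric del: fr.simps)
    then show ?thesis using y.trace_Sf const_type[OF y] by simp
  qed
  have "fr F (nabt \<Gamma> ?t x) (i # [] @ []) = (\<Sum>\<^sub>7a b. DSf i a b * dl a b)"
  proof -
    have "fr F (nabt \<Gamma> (metric_field \<phi>) x) [i,a,b] = 0" for a b
    proof -
      have "nabt \<Gamma> (metric_field \<phi>) x is = 0" if "length is = 3" for "is"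
        using metric_parallel[OF x] that by (cases "is") simp_all
      then have "fr F (nabt \<Gamma> (metric_field \<phi>) x) [i,a,b] = fr F (\<lambda>_. 0) [i,a,b]" by (intro fr_cong) simp
      then show ?thesis by (simp only: fr_zero)
    qed
    then show ?thesis
      using frame_nabt_ctr[of 0 2 S 0 "metric_field \<phi>" "[]" "[]" i] S_smooth[unfolded numeral_2_eq_2] metric_field_smooth
      unfolding cn_dl_2 by (simp add: DSf_def frame_metric del: fr.simps)
  qed
  moreover have "fr F (nabt \<Gamma> ?t x) [i] = 0" by (rule frame_nabt_0[where c = r]) (simp_all add: t)
  ultimately show ?thesis by simp
qed

lemma trace_Mf: "(\<Sum>\<^sub>7a. Mf a a) = 0"
  using div_\<theta>[OF x] by (simp add: frame_divg Mf_def del: fr.simps)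

end

section \<open>The vector fields\<close>

lemma smooth_field_add:
  "open U \<Longrightarrow> smooth_field U k t \<Longrightarrow> smooth_field U k u \<Longrightarrow> smooth_field U k (\<lambda>y is. t y is + u y is)"
  by (simp add: smooth_field_def smooth_on_add)

context g2_chart begin

definition W1 :: local_field where "W1 y = ctr (G y) 1 2 (nabt \<Gamma> S y) (\<theta> y)"
definition W2 :: local_field where "W2 y = ctr (G y) 1 1 (nabt \<Gamma> \<theta> y) (ctr (G y) 1 2 (\<phi> y) (\<theta> y))"
definition W3 :: local_field where "W3 y = ctr (G y) 2 1 (ctr (G y) 1 2 (nabt \<Gamma> S y) (S y)) (\<phi> y)"
text \<open>This is |\<theta>|^2 \<theta>, and \<open>q\<theta>\<close> is |S|^2 \<theta>: a scalar
  obtained by full contraction, multiplied by \<theta> through a contraction of zero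
  indices.\<close>

definition n\<theta> :: local_field where "n\<theta> y = ctr (G y) 0 0 (ctr (G y) 1 0 (\<theta> y) (\<theta> y)) (\<theta> y)"
definition q\<theta> :: local_field where "q\<theta> y = ctr (G y) 0 0 (ctr (G y) 2 0 (S y) (S y)) (\<theta> y)"
text \<open>The divergence of the curl alone is twice the square norm of the symmetrised
  \<nabla>\<theta>, minus half of the cubic term in which S is paired with \<nabla>S\<theta>. A
  quarter of |S|^2 \<theta> adds half of the term in which S is paired with its derivative along
  \<theta>. By \<open>first_order_relation\<close> the two cubic terms differ by a multiple of
  \<theta>(\<nabla>\<theta>)\<theta>, which -7 |\<theta>|^2 \<theta> removes.\<close>

definition V1 :: local_field where "V1 y is = ctr (G y) 2 1 (\<phi> y) (W1 y) is + (- 7 * n\<theta> y is + 1/4 * q\<theta> y is)"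
definition V2 :: local_field where "V2 y = ctr (G y) 2 1 (\<phi> y) (W2 y)"
definition V3 :: local_field where "V3 y = ctr (G y) 2 1 (\<phi> y) (W3 y)"

lemma contraction_smooth:
  assumes "smooth_field U k t" "smooth_field U l u" "k = m + n" "l = n + r" "p = m + r"
  shows "smooth_field U p (\<lambda>y. ctr (G y) n m (t y) (u y))"
  using smooth_field_contraction[of m n t r u] assms by simp

lemma nabla_smooth: "smooth_field U k t \<Longrightarrow> l = Suc k \<Longrightarrow> smooth_field U l (nabt \<Gamma> t)"
  using smooth_field_nabla by simp

lemma \<phi>\<theta>_smooth: "smooth_field U 2 (\<lambda>y. ctr (G y) 1 2 (\<phi> y) (\<theta> y))"
  by (rule contraction_smooth[OF \<phi>_smooth \<theta>_smooth]) simp_all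

lemma DS_S_smooth: "smooth_field U 3 (\<lambda>y. ctr (G y) 1 2 (nabt \<Gamma> S y) (S y))"
  by (rule contraction_smooth[OF nabla_smooth[OF S_smooth refl] S_smooth]) simp_all

lemma W_smooth: "smooth_field U 2 W1" "smooth_field U 2 W2" "smooth_field U 2 W3"
  unfolding W1_def[abs_def] W2_def[abs_def] W3_def[abs_def]
  by (rule contraction_smooth[OF nabla_smooth[OF S_smooth refl] \<theta>_smooth]
      contraction_smooth[OF nabla_smooth[OF \<theta>_smooth refl] \<phi>\<theta>_smooth]
      contraction_smooth[OF DS_S_smooth \<phi>_smooth]; simp)+

lemma norm_smooth: "smooth_field U 0 (\<lambda>y. ctr (G y) 1 0 (\<theta> y) (\<theta> y))" "smooth_field U 0 (\<lambda>y. ctr (G y) 2 0 (S y) (S y))"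
  by (rule contraction_smooth[OF \<theta>_smooth \<theta>_smooth] contraction_smooth[OF S_smooth S_smooth]; simp)+

lemma q\<theta>_smooth: "smooth_field U 1 n\<theta>" "smooth_field U 1 q\<theta>"
  unfolding n\<theta>_def[abs_def] q\<theta>_def[abs_def]
  by (rule contraction_smooth[OF norm_smooth(1) \<theta>_smooth] contraction_smooth[OF norm_smooth(2) \<theta>_smooth]; simp)+

lemma curl_smooth: "smooth_field U 2 W \<Longrightarrow> smooth_field U 1 (\<lambda>y. ctr (G y) 2 1 (\<phi> y) (W y))"
  by (rule contraction_smooth[OF \<phi>_smooth]) simp_all

lemma V_smooth: "smooth_field U 1 V1" "smooth_field U 1 V2" "smooth_field U 1 V3"
proof -
  show "smooth_field U 1 V1" unfolding V1_def[abs_def]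
    by (intro smooth_field_add smooth_field_cmult open_U curl_smooth W_smooth q\<theta>_smooth)
  show "smooth_field U 1 V2" "smooth_field U 1 V3"
    unfolding V2_def[abs_def] V3_def[abs_def] by (rule curl_smooth W_smooth)+
qed

end

context g2_frame begin

lemma frame_zero:
  assumes "\<And>as. length as = length is \<Longrightarrow> fr F t as = 0" shows "t is = 0"
proof -
  obtain H where HF: "dual_coframe H F" using adapted_frame_coframe[OF adapted] by blast
  have "t is = (\<lambda>_. 0) is"
  proof (rule fr_inject[where t = t and u = "\<lambda>_. 0" and F = F and H = "\<lambda>i. \<chi> a. H $ a $ i"])
    show "(\<Sum>\<^sub>7a. (\<chi> a. H $ a $ i) $ a * F a $ j) = dl i j" for i j
      using dual_coframeD(2)[OF HF, of j i] by (simp add: mult.commute dl_sym)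
  qed (simp add: assms fr_zero)
  then show ?thesis .
qed

text \<open>As \<phi> is parallel, the derivative falls on \<open>W\<close> only.\<close>

lemma divg_curl:
  assumes "smooth_field U 2 W"
  shows "divg (\<lambda>y. ctr (G y) 2 1 (\<phi> y) (W y)) x = (\<Sum>\<^sub>7i j k. ph i j k * fr F (nabt \<Gamma> W x) [i,j,k])"
  unfolding frame_divg using frame_nabt_ctr[of 1 2 \<phi> 0 W "[i]" "[]" i for i] \<phi>_smooth assms unfolding cn_dl_2
  by (simp add: frame_\<phi> frame_nabla_\<phi> del: fr.simps One_nat_def)

lemma \<phi>\<theta>f: "fr F (ctr (G x) 1 2 (\<phi> x) (\<theta> x)) [k,p] = (\<Sum>\<^sub>7b. ph k p b * \<theta>f b)"
  "fr F (nabt \<Gamma> (\<lambda>y. ctr (G y) 1 2 (\<phi> y) (\<theta> y)) x) [i,k,p] = (\<Sum>\<^sub>7b. ph k p b * Mf i b)"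
  using frame_ctr[of "[k,p]" 2 1 "\<phi> x" "\<theta> x" "[]"]
    frame_nabt_ctr[of 2 1 \<phi> 0 \<theta> "[k,p]" "[]" i] \<phi>_smooth \<theta>_smooth unfolding cn_dl_1
  by (simp_all add: frame_\<phi> frame_nabla_\<phi> \<theta>f_def Mf_def del: fr.simps One_nat_def)

lemma norm_f:
  "fr F (ctr (G x) 1 0 (\<theta> x) (\<theta> x)) [] = (\<Sum>\<^sub>7b. \<theta>f b * \<theta>f b)"
  "fr F (nabt \<Gamma> (\<lambda>y. ctr (G y) 1 0 (\<theta> y) (\<theta> y)) x) [i] = 2 * (\<Sum>\<^sub>7b. Mf i b * \<theta>f b)"
  "fr F (ctr (G x) 2 0 (S x) (S x)) [] = (\<Sum>\<^sub>7a b. Sf a b * Sf a b)"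
  "fr F (nabt \<Gamma> (\<lambda>y. ctr (G y) 2 0 (S y) (S y)) x) [i] = 2 * (\<Sum>\<^sub>7a b. DSf i a b * Sf a b)"
proof -
  show "fr F (ctr (G x) 1 0 (\<theta> x) (\<theta> x)) [] = (\<Sum>\<^sub>7b. \<theta>f b * \<theta>f b)"
    using frame_ctr[of "[]" 0 1 "\<theta> x" "\<theta> x" "[]"] unfolding cn_dl_1 by (simp add: \<theta>f_def del: fr.simps One_nat_def)
  show "fr F (ctr (G x) 2 0 (S x) (S x)) [] = (\<Sum>\<^sub>7a b. Sf a b * Sf a b)"
    using frame_ctr[of "[]" 0 2 "S x" "S x" "[]"] unfolding cn_dl_2 by (simp add: Sf_def del: fr.simps)
  show "fr F (nabt \<Gamma> (\<lambda>y. ctr (G y) 1 0 (\<theta> y) (\<theta> y)) x) [i] = 2 * (\<Sum>\<^sub>7b. Mf i b * \<theta>f b)"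
    using frame_nabt_ctr[of 0 1 \<theta> 0 \<theta> "[]" "[]" i] \<theta>_smooth unfolding cn_dl_1
    by (simp add: \<theta>f_def Mf_def mult.commute del: fr.simps One_nat_def)
  show "fr F (nabt \<Gamma> (\<lambda>y. ctr (G y) 2 0 (S y) (S y)) x) [i] = 2 * (\<Sum>\<^sub>7a b. DSf i a b * Sf a b)"
    using frame_nabt_ctr[of 0 2 S 0 S "[]" "[]" i] S_smooth S_smooth[unfolded numeral_2_eq_2] unfolding cn_dl_2
    by (simp add: Sf_def DSf_def mult.commute del: fr.simps)
qed

lemma n\<theta>f: "fr F (nabt \<Gamma> n\<theta> x) [i,j] = 2 * (\<Sum>\<^sub>7b. Mf i b * \<theta>f b) * \<theta>f j + (\<Sum>\<^sub>7b. \<theta>f b * \<theta>f b) * Mf i j"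
  using frame_nabt_ctr[of 0 0 "\<lambda>y. ctr (G y) 1 0 (\<theta> y) (\<theta> y)" 1 \<theta> "[]" "[j]" i] \<theta>_smooth norm_smooth(1)
  by (simp add: n\<theta>_def[abs_def] norm_f \<theta>f_def Mf_def del: fr.simps One_nat_def)

lemma q\<theta>f: "fr F (nabt \<Gamma> q\<theta> x) [i,j] = 2 * (\<Sum>\<^sub>7a b. DSf i a b * Sf a b) * \<theta>f j + (\<Sum>\<^sub>7a b. Sf a b * Sf a b) * Mf i j"
  using frame_nabt_ctr[of 0 0 "\<lambda>y. ctr (G y) 2 0 (S y) (S y)" 1 \<theta> "[]" "[j]" i] \<theta>_smooth norm_smooth(2)
  by (simp add: q\<theta>_def[abs_def] norm_f \<theta>f_def Mf_def del: fr.simps One_nat_def)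

definition "DDSf i j a b = fr F (nabt \<Gamma> (nabt \<Gamma> S) x) [i,j,a,b]"
definition "DMf i j a = fr F (nabt \<Gamma> (nabt \<Gamma> \<theta>) x) [i,j,a]"

lemma W1f: "fr F (nabt \<Gamma> W1 x) [i,j,k] = (\<Sum>\<^sub>7l. DDSf i j k l * \<theta>f l) + (\<Sum>\<^sub>7l. DSf j k l * Mf i l)"
  using frame_nabt_ctr[of 2 1 "nabt \<Gamma> S" 0 \<theta> "[j,k]" "[]" i] nabla_smooth[OF S_smooth, of 3] \<theta>_smooth unfolding cn_dl_1
  by (simp add: W1_def[abs_def] DDSf_def DSf_def \<theta>f_def Mf_def del: fr.simps One_nat_def)

lemma W2f: "fr F (nabt \<Gamma> W2 x) [i,j,p] = (\<Sum>\<^sub>7k. DMf i j k * (\<Sum>\<^sub>7b. ph k p b * \<theta>f b)) + (\<Sum>\<^sub>7k. Mf j k * (\<Sum>\<^sub>7b. ph k p b * Mf i b))"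
  using frame_nabt_ctr[of 1 1 "nabt \<Gamma> \<theta>" 1 "\<lambda>y. ctr (G y) 1 2 (\<phi> y) (\<theta> y)" "[j]" "[p]" i] nabla_smooth[OF \<theta>_smooth, of 2] \<phi>\<theta>_smooth unfolding cn_dl_1
  by (simp add: W2_def[abs_def] DMf_def Mf_def[of j] \<phi>\<theta>f del: fr.simps One_nat_def)

lemma DS_Sf: "fr F (nabt \<Gamma> (\<lambda>y. ctr (G y) 1 2 (nabt \<Gamma> S y) (S y)) x) [i,j,k,a] = (\<Sum>\<^sub>7l. DDSf i j k l * Sf l a) + (\<Sum>\<^sub>7l. DSf j k l * DSf i l a)"
  using frame_nabt_ctr[of 2 1 "nabt \<Gamma> S" 1 S "[j,k]" "[a]" i] nabla_smooth[OF S_smooth, of 3] S_smooth unfolding cn_dl_1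
  by (simp add: DDSf_def DSf_def Sf_def del: fr.simps One_nat_def)

lemma W3f: "fr F (nabt \<Gamma> W3 x) [i,j,p] = (\<Sum>\<^sub>7k a. ((\<Sum>\<^sub>7l. DDSf i j k l * Sf l a) + (\<Sum>\<^sub>7l. DSf j k l * DSf i l a)) * ph k a p)"
  using frame_nabt_ctr[of 1 2 "\<lambda>y. ctr (G y) 1 2 (nabt \<Gamma> S y) (S y)" 1 \<phi> "[j]" "[p]" i] DS_S_smooth \<phi>_smooth unfolding cn_dl_2
  by (simp add: W3_def[abs_def] DS_Sf frame_\<phi> frame_nabla_\<phi> del: fr.simps One_nat_def)

end

section \<open>The three divergences on an instanton\<close>

locale g2_chart_instanton = g2_chart_gauduchon +
  assumes instanton: "\<And>x F i j k. x \<in> U \<Longrightarrow> adapted_frame (\<phi> x) F \<Longrightarrow> (\<Sum>\<^sub>7a b. fr F (RL x) [a,b,i,j] * ph a b k) = 0"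

locale g2_frame_instanton = g2_chart_instanton + g2_frame
begin

sublocale g2_frame_gauduchon ..

lemma inst: "cph (\<lambda>i j. Rf i j k l) p = 0"
  using instanton[OF x adapted, of k l p] by (simp add: cph_def Rf_def ph_rot[of p] mult.commute del: fr.simps)

sublocale curv: g2_instanton_curvature Rf Df Tf
proof
  show "(\<Sum>\<^sub>7k l. Rf i j k l * ph k l p) = 0" for i j p
    using holonomy[of i j p] by (simp add: cph_def ph_rot[of p] mult.commute)
  show "(\<Sum>\<^sub>7i j. Rf i j k l * ph i j p) = 0" for k l p
    using inst[of k l p] by (simp add: cph_def ph_rot[of p] mult.commute)
qed (rule Rf_skew Tf_skew Df_skew Rf_bianchi)+

text \<open>The pointwise theory is entered in two stages: \<open>jet0\<close> makes S divergence
  free, which gives S\<theta> = 0 at every point, and only the derivative of that relation completes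
  the assumptions of \<open>jet\<close>.\<close>

sublocale jet0: g2_jet0 Tf Df
  by unfold_locales (rule Tf_skew Df_skew curv.star trace_DSf[unfolded DSf])+

lemma S_\<theta>: "(\<Sum>\<^sub>7q. Sf l q * \<theta>f q) = 0"
  using curv.S_th[OF jet0.DS_div2[unfolded jet0.DS_def], of l] by (simp add: Sf \<theta>f Sf[abs_def])

end

text \<open>Returned from frames to a coordinate identity on all of \<open>U\<close>, so that it can
  be differentiated in \<open>dS_\<theta>\<close>.\<close>

lemma (in g2_chart_instanton) S_\<theta>_0:
  assumes y: "y \<in> U" "length is = 1" shows "ctr (G y) 1 1 (S y) (\<theta> y) is = 0"
proof -
  obtain F where "g2_frame U \<phi> \<Gamma> y F" using frame[OF y(1)] .
  then interpret g2_frame U \<phi> \<Gamma> y F .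
  interpret g2_frame_instanton U \<phi> \<Gamma> r y F ..
  show ?thesis
  proof (rule frame_zero)
    fix as :: "7 list" assume "length as = length is"
    then obtain a where as: "as = [a]" using y(2) by (auto simp: length_Suc_conv)
    show "fr F (ctr (G y) 1 1 (S y) (\<theta> y)) as = 0"
      using frame_ctr[of "[a]" 1 1 "S y" "\<theta> y" "[]"] S_\<theta>[of a] unfolding cn_dl_1
      by (simp add: as Sf_def \<theta>f_def del: fr.simps One_nat_def)
  qed
qed

context g2_frame_instanton begin

lemma dS_\<theta>: "(\<Sum>\<^sub>7q. DSf i l q * \<theta>f q + Sf l q * Mf i q) = 0"
proof -
  have "fr F (nabt \<Gamma> (\<lambda>y. ctr (G y) 1 1 (S y) (\<theta> y)) x) [i,l] = 0"
    by (rule frame_nabt_0[where c = 0]) (simp_all add: S_\<theta>_0 del: One_nat_def)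
  then show ?thesis
    using frame_nabt_ctr[of 1 1 S 0 \<theta> "[l]" "[]" i] S_smooth \<theta>_smooth unfolding cn_dl_1
    by (simp add: Sf_def \<theta>f_def DSf_def Mf_def sum.distrib del: fr.simps One_nat_def)
qed

sublocale jet: g2_jet Tf Df
proof
  show "(\<Sum>\<^sub>7i. thof (Sof (Df i)) i) = 0" using trace_Mf by (simp add: Mf DSf[abs_def])
  show "(\<Sum>\<^sub>7q. Sof (Df i) l q * thof (Sof Tf) q + Sof Tf l q * thof (Sof (Df i)) q) = 0" for i l
    using dS_\<theta>[of i l] by (simp add: Sf \<theta>f Sf[abs_def] DSf Mf DSf[abs_def])
qed

lemma jet_S: "jet0.S = Sf" and jet_\<theta>: "jet0.\<theta> = \<theta>f" and jet_DS: "jet0.DS = DSf" and jet_M: "jet0.M = Mf"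
  by (simp_all add: jet0.S_def jet0.\<theta>_def jet0.DS_def jet0.M_def fun_eq_iff Sf \<theta>f Sf[abs_def] DSf Mf DSf[abs_def])

lemma curl_DDS: "(\<Sum>\<^sub>7i j. ph p i j * DDSf i j k l) = - (1/2) * (\<Sum>\<^sub>7m. Sf m p * DSf m k l)"
  using curl_nabla_nabla[OF inst, of "[k,l]" S p] S_smooth by (simp add: DDSf_def DSf_def numeral_2_eq_2 del: fr.simps)

lemma curl_DM: "(\<Sum>\<^sub>7i j. ph p i j * DMf i j k) = - (1/2) * (\<Sum>\<^sub>7m. Sf m p * Mf m k)"
  using curl_nabla_nabla[OF inst, of "[k]" \<theta> p] \<theta>_smooth by (simp add: DMf_def Mf_def del: fr.simps)

lemma curl_3: "(\<Sum>\<^sub>7i j p. ph i j p * (\<Sum>\<^sub>7k. X i j k * y k p)) = (\<Sum>\<^sub>7p k. (\<Sum>\<^sub>7i j. ph p i j * X i j k) * y k p)"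
proof -
  have "(\<Sum>\<^sub>7i j p. ph i j p * (\<Sum>\<^sub>7k. X i j k * y k p)) = (\<Sum>\<^sub>7i j p k. ph p i j * X i j k * y k p)"
    by (simp add: sum_distrib_left mult.assoc ph_rot[of p i j for p i j] cong: sum.cong)
  also have "\<dots> = (\<Sum>\<^sub>7p k i j. ph p i j * X i j k * y k p)" by (rule sum_swap22)
  finally show ?thesis by (simp only: sum_distrib_right)
qed

text \<open>\<open>curl_DDS\<close> replaces the second derivatives of S by first ones. In the
  divergences of |\<theta>|^2 \<theta> and |S|^2 \<theta> the terms with the trace of
  \<nabla>\<theta> vanish, and what is left is \<open>div_curl_S_th\<close>.\<close>

lemma divg_V1: "divg V1 x = 2 * (\<Sum>\<^sub>7i l. (Mf i l + Mf l i)\<^sup>2)"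
proof -
  have n: "smooth_field U 1 (\<lambda>y is. - 7 * n\<theta> y is)" "smooth_field U 1 (\<lambda>y is. 1/4 * q\<theta> y is)"
    by (rule smooth_field_cmult[OF open_U] q\<theta>_smooth)+
  note nq = smooth_field_add[OF open_U n]
  have e1: "fr F (nabt \<Gamma> V1 x) [i,i] = fr F (nabt \<Gamma> (\<lambda>y. ctr (G y) 2 1 (\<phi> y) (W1 y)) x) [i,i]
      + (- 7 * fr F (nabt \<Gamma> n\<theta> x) [i,i] + 1/4 * fr F (nabt \<Gamma> q\<theta> x) [i,i])" for i
  proof -
    have len: "length [i] = 1" by simp
    show ?thesis unfolding V1_def[abs_def] frame_nabt_add[OF curl_smooth[OF W_smooth(1)] nq len] frame_nabt_add[OF n len]
      frame_nabt_cmult[OF q\<theta>_smooth(1) len] frame_nabt_cmult[OF q\<theta>_smooth(2) len] by (rule refl)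
  qed
  have "divg V1 x = divg (\<lambda>y. ctr (G y) 2 1 (\<phi> y) (W1 y)) x - 7 * (\<Sum>\<^sub>7i. fr F (nabt \<Gamma> n\<theta> x) [i,i]) + 1/4 * (\<Sum>\<^sub>7i. fr F (nabt \<Gamma> q\<theta> x) [i,i])"
    unfolding frame_divg e1 by (simp add: sum.distrib sum_distrib_left sum_negf sum_subtractf del: fr.simps)
  also have "(\<Sum>\<^sub>7i. fr F (nabt \<Gamma> n\<theta> x) [i,i]) = 2 * (\<Sum>\<^sub>7a b. \<theta>f a * Mf a b * \<theta>f b)"
    unfolding n\<theta>f sum.distrib sum_distrib_left[of "\<Sum>\<^sub>7b. \<theta>f b * \<theta>f b", symmetric] trace_Mf
    by (simp add: sum_distrib_left sum_distrib_right ac_simps)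
  also have "(\<Sum>\<^sub>7i. fr F (nabt \<Gamma> q\<theta> x) [i,i]) = 2 * (\<Sum>\<^sub>7l a k. \<theta>f l * Sf a k * DSf l a k)"
    unfolding q\<theta>f sum.distrib sum_distrib_left[of "\<Sum>\<^sub>7a b. Sf a b * Sf a b", symmetric] trace_Mf
    by (simp add: sum_distrib_left sum_distrib_right ac_simps)
  also have "divg (\<lambda>y. ctr (G y) 2 1 (\<phi> y) (W1 y)) x = (\<Sum>\<^sub>7i j k. ph i j k * (\<Sum>\<^sub>7l. DDSf i j k l * \<theta>f l)) + (\<Sum>\<^sub>7i j k. ph i j k * (\<Sum>\<^sub>7l. DSf j k l * Mf i l))"
    unfolding divg_curl[OF W_smooth(1)] W1f by (simp add: distrib_left sum.distrib)
  also have "(\<Sum>\<^sub>7i j k. ph i j k * (\<Sum>\<^sub>7l. DDSf i j k l * \<theta>f l)) = - (\<Sum>\<^sub>7l a k. \<theta>f l * Sf a k * DSf a k l) / 2"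
  proof -
    have "(\<Sum>\<^sub>7i j k. ph i j k * (\<Sum>\<^sub>7l. DDSf i j k l * \<theta>f l)) = (\<Sum>\<^sub>7i j k l. ph k i j * DDSf i j k l * \<theta>f l)"
      by (simp add: sum_distrib_left mult.assoc ph_rot[of k i j for k i j] cong: sum.cong)
    also have "\<dots> = (\<Sum>\<^sub>7k l i j. ph k i j * DDSf i j k l * \<theta>f l)" by (rule sum_swap22)
    also have "\<dots> = - (1/2) * (\<Sum>\<^sub>7k l m. Sf m k * DSf m k l * \<theta>f l)"
      by (simp only: curl_DDS sum_distrib_right[symmetric]) (simp add: sum_distrib_left sum_distrib_right)
    also have "(\<Sum>\<^sub>7k l m. Sf m k * DSf m k l * \<theta>f l) = (\<Sum>\<^sub>7l m k. Sf m k * DSf m k l * \<theta>f l)" by (rule sum_rot3)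
    finally show ?thesis by (simp add: ac_simps)
  qed
  finally show ?thesis using jet.div_curl_S_th unfolding jet_S jet_\<theta> jet_DS jet_M by simp
qed

lemma divg_V2:
  assumes skew: "\<And>i j. Mf j i = - Mf i j"
  shows "divg V2 x = 3 * (\<Sum>\<^sub>7i b. (Mf i b)\<^sup>2)"
proof -
  interpret k: g2_jet_killing Tf Df by unfold_locales (unfold jet_M, rule skew)
  define P where "P k p = (\<Sum>\<^sub>7b. ph k p b * \<theta>f b)" for k p
  let ?Q = "\<lambda>i k p. \<Sum>\<^sub>7b. ph k p b * Mf i b"
  have "divg V2 x = (\<Sum>\<^sub>7i j p. ph i j p * (\<Sum>\<^sub>7k. DMf i j k * P k p)) + (\<Sum>\<^sub>7i j p. ph i j p * (\<Sum>\<^sub>7k. Mf j k * ?Q i k p))"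
    unfolding V2_def[abs_def] divg_curl[OF W_smooth(2)] W2f P_def by (simp only: distrib_left sum.distrib)
  also have "(\<Sum>\<^sub>7i j p. ph i j p * (\<Sum>\<^sub>7k. DMf i j k * P k p)) = (\<Sum>\<^sub>7p k. - (1/2) * (\<Sum>\<^sub>7m. Sf m p * Mf m k) * P k p)"
    unfolding curl_3 curl_DM by (rule refl)
  also have "\<dots> = - (1/2) * (\<Sum>\<^sub>7p k m. Sf m p * (Mf m k * P k p))"
    by (simp only: sum_distrib_left sum_distrib_right mult.assoc)
  also have "(\<Sum>\<^sub>7p k m. Sf m p * (Mf m k * P k p)) = (\<Sum>\<^sub>7m p k. Sf m p * (Mf m k * P k p))" by (rule sum_rot3[symmetric])
  also have "\<dots> = (\<Sum>\<^sub>7m p. Sf m p * (\<Sum>\<^sub>7k. Mf m k * P k p))" by (simp only: sum_distrib_left)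
  finally show ?thesis using k.div_curl_th_th unfolding jet_S jet_\<theta> jet_M P_def by simp
qed

lemma divg_V3:
  assumes zero: "\<And>i j. Mf i j = 0"
  shows "divg V3 x = (\<Sum>\<^sub>7i a l. (DSf i a l)\<^sup>2)"
proof -
  interpret k: g2_jet_parallel_lee Tf Df by unfold_locales (unfold jet_M, rule zero)
  \<comment> \<open>Collects the factors without second derivatives, so that the contraction over i
    and j in front of \<open>DDSf\<close> can be carried out by \<open>curl_DDS\<close>.\<close>
  define Y where "Y k l p = (\<Sum>\<^sub>7a. Sf l a * ph k a p)" for k l p
  have Y: "(\<Sum>\<^sub>7k a. (\<Sum>\<^sub>7l. X k l * Sf l a) * ph k a p) = (\<Sum>\<^sub>7k l. X k l * Y k l p)" for X p
  proof (rule sum.cong[OF refl])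
    fix k
    have "(\<Sum>\<^sub>7a. (\<Sum>\<^sub>7l. X k l * Sf l a) * ph k a p) = (\<Sum>\<^sub>7a l. X k l * (Sf l a * ph k a p))"
      by (simp only: sum_distrib_right mult.assoc)
    also have "\<dots> = (\<Sum>\<^sub>7l a. X k l * (Sf l a * ph k a p))" by (rule sum.swap)
    finally show "(\<Sum>\<^sub>7a. (\<Sum>\<^sub>7l. X k l * Sf l a) * ph k a p) = (\<Sum>\<^sub>7l. X k l * Y k l p)"
      by (simp only: Y_def sum_distrib_left)
  qed
  have "divg V3 x = (\<Sum>\<^sub>7i j p. ph i j p * (\<Sum>\<^sub>7k a. (\<Sum>\<^sub>7l. DDSf i j k l * Sf l a) * ph k a p))
      + (\<Sum>\<^sub>7i j p. ph i j p * (\<Sum>\<^sub>7k a. (\<Sum>\<^sub>7l. DSf j k l * DSf i l a) * ph k a p))"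
    unfolding V3_def[abs_def] divg_curl[OF W_smooth(3)] W3f by (simp only: distrib_left distrib_right sum.distrib)
  also have "(\<Sum>\<^sub>7i j p. ph i j p * (\<Sum>\<^sub>7k a. (\<Sum>\<^sub>7l. DDSf i j k l * Sf l a) * ph k a p))
      = (\<Sum>\<^sub>7b p. - (1/2) * (Sf b p * (\<Sum>\<^sub>7k a. (\<Sum>\<^sub>7l. DSf b k l * Sf l a) * ph k a p)))"
  proof -
    have "(\<Sum>\<^sub>7i j p. ph i j p * (\<Sum>\<^sub>7k l. DDSf i j k l * Y k l p)) = (\<Sum>\<^sub>7p i j. ph p i j * (\<Sum>\<^sub>7k l. DDSf i j k l * Y k l p))"
      by (subst sum_rot3[symmetric]) (simp only: ph_cyc)
    also have "\<dots> = (\<Sum>\<^sub>7p i j k l. ph p i j * DDSf i j k l * Y k l p)" by (simp only: sum_distrib_left mult.assoc)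
    also have "\<dots> = (\<Sum>\<^sub>7p k l i j. ph p i j * DDSf i j k l * Y k l p)" by (intro sum.cong refl sum_swap22)
    also have "\<dots> = (\<Sum>\<^sub>7p k l m. - (1/2) * (Sf m p * (DSf m k l * Y k l p)))"
      by (simp only: curl_DDS sum_distrib_right[symmetric]) (simp only: sum_distrib_left sum_distrib_right mult.assoc)
    also have "\<dots> = (\<Sum>\<^sub>7p m k l. - (1/2) * (Sf m p * (DSf m k l * Y k l p)))" by (intro sum.cong refl sum_rot3[symmetric])
    also have "\<dots> = (\<Sum>\<^sub>7m p k l. - (1/2) * (Sf m p * (DSf m k l * Y k l p)))" by (rule sum.swap)
    finally show ?thesis unfolding Y by (simp only: sum_distrib_left)
  qed
  finally show ?thesis using k.div_curl_S_S unfolding jet_S jet_DS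
    by (simp only: sum_distrib_left[symmetric])
qed

end

section \<open>The instanton condition in arbitrary orthonormal frames\<close>

lemma orthonormal_frame_inverse:
  assumes "orthonormal_frame \<phi> F"
  shows "matrix_inv (metric \<phi>) $ i $ j = (\<Sum>\<^sub>7a. F a $ i * F a $ j)"
proof -
  define P :: "real^7^7" where "P = (\<chi> i a. F a $ i)"
  let ?t = "Finite_Cartesian_Product.transpose P"
  have g: "gprod \<phi> (F a) (F b) = (?t ** (metric \<phi> ** P)) $ a $ b" for a b
    by (simp add: gprod_def P_def inner_vec_def matrix_vector_mult_def matrix_matrix_mult_def Finite_Cartesian_Product.transpose_def)
  then have "?t ** (metric \<phi> ** P) = mat 1"
    using assms by (simp add: orthonormal_frame_def vec_eq_iff mat_def)
  then have "(?t ** metric \<phi>) ** P = mat 1" by (simp add: matrix_mul_assoc)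
  then have "P ** (?t ** metric \<phi>) = mat 1" by (simp add: matrix_left_right_inverse)
  then have 1: "(P ** ?t) ** metric \<phi> = mat 1" by (simp add: matrix_mul_assoc)
  then have inv: "invertible (metric \<phi>)" by (meson invertible_left_inverse)
  have "P ** ?t = P ** ?t ** (metric \<phi> ** matrix_inv (metric \<phi>))" by (simp add: matrix_inv_left_right[OF inv])
  also have "\<dots> = matrix_inv (metric \<phi>)" by (simp add: matrix_mul_assoc 1)
  finally have "matrix_inv (metric \<phi>) = P ** ?t" ..
  then show ?thesis by (simp add: P_def matrix_matrix_mult_def Finite_Cartesian_Product.transpose_def)
qed

context g2_frame begin

sublocale bi: g2_bianchi Rf Df Tf
  by unfold_locales (rule Rf_skew Tf_skew Df_skew Rf_bianchi)+

lemma orthonormal: "orthonormal_frame (\<phi> x) F"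
proof -
  have "gprod (\<phi> x) (F a) (F b) = fr F (metric_field \<phi> x) [a,b]" for a b
    by (simp add: gprod_def inner_vec_def matrix_vector_mult_def metric_field_def mult.commute[of "F b $ _"])
  then show ?thesis by (simp only: orthonormal_frame_def frame_metric dl_def) simp
qed

lemma parallel_torsion_instanton:
  assumes par: "\<And>l is. length is = 3 \<Longrightarrow> cov_deriv \<Gamma> l T x is = 0"
  shows "cph (\<lambda>i j. Rf i j k l) p = 0"
proof -
  have "Df i j k l = 0" for i j k l
  proof -
    have "nabt \<Gamma> T x is = 0" if "length is = 4" for "is" using par that by (cases "is") simp_all
    then have "fr F (nabt \<Gamma> T x) [i,j,k,l] = fr F (\<lambda>_. 0) [i,j,k,l]" by (intro fr_cong) simp
    then show ?thesis by (simp only: Df_def fr_zero)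
  qed
  then have "Rf i j k l = Rf k l i j" for i j k l using bi.octahedron[of i j k l] by simp
  then have "cph (\<lambda>i j. Rf i j k l) p = cph (\<lambda>i j. Rf k l i j) p" by (simp add: cph_def)
  then show ?thesis by (simp add: holonomy)
qed

end

context g2_chart begin

text \<open>The curvature contracted with \<phi> is a tensor, and the sums in the condition are its
  components in whichever orthonormal frame is used. If they vanish in one adapted frame, the tensor
  vanishes and so do its components in every other frame.\<close>

lemma instanton_frames:
  assumes x: "x \<in> U"
  shows "(\<forall>F. orthonormal_frame (\<phi> x) F \<longrightarrow> (\<forall>i j k. (\<Sum>a\<in>UNIV. \<Sum>b\<in>UNIV.
       eval_tensor (curvature_field \<phi> \<Gamma> x) [F a, F b, F i, F j] * eval_tensor (\<phi> x) [F a, F b, F k]) = 0))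
    \<longleftrightarrow> (\<forall>F. adapted_frame (\<phi> x) F \<longrightarrow> (\<forall>i j k. (\<Sum>\<^sub>7a b. fr F (RL x) [a,b,i,j] * ph a b k) = 0))"
proof -
  let ?Q = "\<lambda>F i j k. \<Sum>\<^sub>7a b. fr F (RL x) [a,b,i,j] * fr F (\<phi> x) [a,b,k]"
  have ev: "(\<Sum>a\<in>UNIV. \<Sum>b\<in>UNIV. eval_tensor (curvature_field \<phi> \<Gamma> x) [F a, F b, F i, F j] * eval_tensor (\<phi> x) [F a, F b, F k]) = ?Q F i j k" for F i j k
  proof (intro sum.cong refl arg_cong2[where f = "(*)"])
    fix a b
    show "eval_tensor (\<phi> x) [F a, F b, F k] = fr F (\<phi> x) [a,b,k]"
      using eval_tensor_map[of "\<phi> x" F "[a,b,k]"] by (simp only: list.map)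
    have "eval_tensor (curvature_field \<phi> \<Gamma> x) [F a, F b, F i, F j] = fr F (curvature_field \<phi> \<Gamma> x) [a,b,i,j]"
      using eval_tensor_map[of "curvature_field \<phi> \<Gamma> x" F "[a,b,i,j]"] by (simp only: list.map)
    also have "\<dots> = fr F (RL x) [a,b,i,j]"
    proof (rule fr_cong)
      fix js :: "7 list" assume "length js = length [a,b,i,j]"
      then obtain k l m n where "js = [k,l,m,n]" by (auto simp: length_Suc_conv)
      then show "curvature_field \<phi> \<Gamma> x js = RL x js" by (simp add: curvature_field_Rl[OF x] RL_Rl)
    qed
    finally show "eval_tensor (curvature_field \<phi> \<Gamma> x) [F a, F b, F i, F j] = fr F (RL x) [a,b,i,j]" .
  qed
  \<comment> \<open>The index pair of the curvature that is to be contracted is moved to the end,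
    where \<open>ctr\<close> contracts.\<close>
  define Z where "Z = ctr (G x) 2 2 (\<lambda>is. RL x (map ((!) is) [2,3,0,1])) (\<phi> x)"
  have Z: "fr F Z [i,j,k] = ?Q F i j k" if F: "\<And>i j. G x i j = (\<Sum>\<^sub>7a. F a $ i * F a $ j)" for F i j k
  proof -
    interpret orthonormal_frame_at U "\<lambda>x. metric (\<phi> x)" \<Gamma> x F
      by unfold_locales (simp_all add: x F flip: sum_distrib_left)
    have "fr F (\<lambda>is. RL x (map ((!) is) [2,3,0,1])) [i,j,a,b] = fr F (RL x) (map ((!) [i,j,a,b]) [2,3,0,1])" for a b
      by (rule fr_reorder) (auto simp: lessThan_Suc)
    then show ?thesis
      using frame_ctr[of "[i,j]" 2 2 "\<lambda>is. RL x (map ((!) is) [2,3,0,1])" "\<phi> x" "[k]"] unfolding cn_dl_2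
      by (simp add: Z_def del: fr.simps)
  qed
  obtain F where "g2_frame U \<phi> \<Gamma> x F" using frame[OF x] .
  then interpret g2_frame U \<phi> \<Gamma> x F .
  have GF: "G x i j = (\<Sum>\<^sub>7a. F' a $ i * F' a $ j)" if "orthonormal_frame (\<phi> x) F'" for F' i j
    using orthonormal_frame_inverse[OF that] by (simp add: G_def)
  show ?thesis
  proof
    assume *: "\<forall>F. orthonormal_frame (\<phi> x) F \<longrightarrow> (\<forall>i j k. (\<Sum>a\<in>UNIV. \<Sum>b\<in>UNIV.
       eval_tensor (curvature_field \<phi> \<Gamma> x) [F a, F b, F i, F j] * eval_tensor (\<phi> x) [F a, F b, F k]) = 0)"
    show "\<forall>F. adapted_frame (\<phi> x) F \<longrightarrow> (\<forall>i j k. (\<Sum>\<^sub>7a b. fr F (RL x) [a,b,i,j] * ph a b k) = 0)"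
    proof (intro allI impI)
      fix F' i j k assume F': "adapted_frame (\<phi> x) F'"
      interpret f: g2_frame U \<phi> \<Gamma> x F' using F' by unfold_locales (simp_all add: x)
      have "?Q F' i j k = 0" using * f.orthonormal unfolding ev by blast
      then show "(\<Sum>\<^sub>7a b. fr F' (RL x) [a,b,i,j] * ph a b k) = 0" by (simp only: f.frame_\<phi>)
    qed
  next
    assume *: "\<forall>F. adapted_frame (\<phi> x) F \<longrightarrow> (\<forall>i j k. (\<Sum>\<^sub>7a b. fr F (RL x) [a,b,i,j] * ph a b k) = 0)"
    have "Z is = 0" if len: "length is = 3" for "is"
    proof (rule frame_zero)
      fix as :: "7 list" assume "length as = length is"
      then obtain i j k where as: "as = [i,j,k]" using len by (auto simp: length_Suc_conv numeral_3_eq_3)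
      have "?Q F i j k = 0" using * adapted by (simp only: frame_\<phi>)
      then show "fr F Z as = 0" using Z[OF GF[OF orthonormal]] by (simp only: as)
    qed
    then have "fr F' Z [i,j,k] = 0" for F' i j k
      using fr_cong[of "[i,j,k]" Z "\<lambda>_. 0" F'] by (simp only: fr_zero) simp
    then show "\<forall>F. orthonormal_frame (\<phi> x) F \<longrightarrow> (\<forall>i j k. (\<Sum>a\<in>UNIV. \<Sum>b\<in>UNIV.
       eval_tensor (curvature_field \<phi> \<Gamma> x) [F a, F b, F i, F j] * eval_tensor (\<phi> x) [F a, F b, F k]) = 0)"
      unfolding ev using Z[OF GF] by simp
  qed
qed

lemma parallel_torsion_frames:
  assumes par: "\<And>l is. length is = 3 \<Longrightarrow> cov_deriv \<Gamma> l T x is = 0" and F: "adapted_frame (\<phi> x) F" and x: "x \<in> U"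
  shows "(\<Sum>\<^sub>7a b. fr F (RL x) [a,b,i,j] * ph a b k) = 0"
proof -
  interpret g2_frame U \<phi> \<Gamma> x F using F by unfold_locales (simp_all add: x)
  show ?thesis using parallel_torsion_instanton[OF par, of i j k]
    by (simp add: cph_def Rf_def ph_rot[of k] mult.commute del: fr.simps)
qed

lemma cov_deriv_torsion:
  assumes "x \<in> U" "length is = 3"
  shows "cov_deriv \<Gamma> l (torsion_field \<phi> \<Gamma>) x is = cov_deriv \<Gamma> l T x is"
proof (rule cov_deriv_cong[OF assms(1)])
  fix y and js :: "7 list" assume "y \<in> U" "length js = length is"
  then obtain i j k where "js = [i,j,k]" using assms(2) by (auto simp: length_Suc_conv numeral_3_eq_3)
  then show "torsion_field \<phi> \<Gamma> y js = T y js" by (simp add: torsion_field_T)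
qed

end

context g2_chart_instanton begin

lemma frame_instanton: assumes "x \<in> U" obtains F where "g2_frame_instanton U \<phi> \<Gamma> r x F"
proof -
  obtain F where "g2_frame U \<phi> \<Gamma> x F" using frame[OF assms] .
  then interpret g2_frame U \<phi> \<Gamma> x F .
  have "g2_frame_instanton U \<phi> \<Gamma> r x F" ..
  then show ?thesis by (rule that)
qed

lemma divg_V1_nonneg: assumes "x \<in> U" shows "divg V1 x \<ge> 0"
proof -
  obtain F where "g2_frame_instanton U \<phi> \<Gamma> r x F" using frame_instanton[OF assms] .
  then interpret g2_frame_instanton U \<phi> \<Gamma> r x F .
  show ?thesis unfolding divg_V1 by (intro mult_nonneg_nonneg sum_nonneg) simp_all
qed

lemma Mf_skew:
  assumes "divg V1 x = 0" "g2_frame_instanton U \<phi> \<Gamma> r x F"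
  shows "g2_frame.Mf \<phi> \<Gamma> x F j i = - g2_frame.Mf \<phi> \<Gamma> x F i j"
proof -
  interpret g2_frame_instanton U \<phi> \<Gamma> r x F by (rule assms(2))
  have "(\<Sum>\<^sub>7i l. (Mf i l + Mf l i)\<^sup>2) = 0" using assms(1) divg_V1 by simp
  then have "(Mf i j + Mf j i)\<^sup>2 = 0" by (simp add: sum_nonneg_eq_0_iff sum_nonneg)
  then show ?thesis by simp
qed

lemma divg_V2_nonneg:
  assumes "x \<in> U" "divg V1 x = 0" shows "divg V2 x \<ge> 0"
proof -
  obtain F where F: "g2_frame_instanton U \<phi> \<Gamma> r x F" using frame_instanton[OF assms(1)] .
  then interpret g2_frame_instanton U \<phi> \<Gamma> r x F .
  show ?thesis unfolding divg_V2[OF Mf_skew[OF assms(2) F]] by (intro mult_nonneg_nonneg sum_nonneg) simp_all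
qed

lemma Mf_0:
  assumes "divg V1 x = 0" "divg V2 x = 0" "g2_frame_instanton U \<phi> \<Gamma> r x F"
  shows "g2_frame.Mf \<phi> \<Gamma> x F i j = 0"
proof -
  interpret g2_frame_instanton U \<phi> \<Gamma> r x F by (rule assms(3))
  have "(\<Sum>\<^sub>7i b. (Mf i b)\<^sup>2) = 0" using assms(2) divg_V2[OF Mf_skew[OF assms(1,3)]] by simp
  then show ?thesis by (simp add: sum_nonneg_eq_0_iff sum_nonneg)
qed

lemma divg_V3_nonneg:
  assumes "x \<in> U" "divg V1 x = 0" "divg V2 x = 0" shows "divg V3 x \<ge> 0"
proof -
  obtain F where F: "g2_frame_instanton U \<phi> \<Gamma> r x F" using frame_instanton[OF assms(1)] .
  then interpret g2_frame_instanton U \<phi> \<Gamma> r x F .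
  show ?thesis unfolding divg_V3[OF Mf_0[OF assms(2,3) F]] by (intro sum_nonneg) simp_all
qed

lemma torsion_parallel:
  assumes "x \<in> U" "divg V1 x = 0" "divg V2 x = 0" "divg V3 x = 0" and len: "length is = 3"
  shows "cov_deriv \<Gamma> l T x is = 0"
proof -
  obtain F where F: "g2_frame_instanton U \<phi> \<Gamma> r x F" using frame_instanton[OF assms(1)] .
  then interpret g2_frame_instanton U \<phi> \<Gamma> r x F .
  have "(\<Sum>\<^sub>7i a l. (DSf i a l)\<^sup>2) = 0" using assms(4) divg_V3[OF Mf_0[OF assms(2,3) F]] by simp
  then have "DSf i a l = 0" for i a l by (simp add: sum_nonneg_eq_0_iff sum_nonneg)
  then have "Sof (Df i) a l = 0" for i a l by (simp add: DSf)
  then have D: "Df i j k l = 0" for i j k l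
    using T_of_S[of "Df i" j k l, OF Df_skew] by (simp add: thof_def cph_def)
  have "nabt \<Gamma> T x (l # is) = 0"
  proof (rule frame_zero)
    fix as :: "7 list" assume "length as = length (l # is)"
    then have "length as = Suc (Suc (Suc (Suc 0)))" using len by simp
    then obtain a b c d where as: "as = [a,b,c,d]" unfolding length_Suc_conv by blast
    show "fr F (nabt \<Gamma> T x) as = 0" unfolding as using D[of a b c d] by (simp only: Df_def)
  qed
  then show ?thesis by simp
qed

end

section \<open>The divergence theorem\<close>

locale manifold =
  fixes X :: "'a topology" and A :: "'a chart set"
  assumes manifold: "smooth_7_manifold X A"
begin

definition \<kappa> :: "'a chart \<Rightarrow> R7 \<Rightarrow> 'a" where "\<kappa> c = inv_into (fst c) (snd c)"

lemma chart_open: "c \<in> A \<Longrightarrow> openin X (fst c)" "c \<in> A \<Longrightarrow> open (chart_image c)"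
  and chart_homeo: "c \<in> A \<Longrightarrow> homeomorphic_map (subtopology X (fst c)) (top_of_set (chart_image c)) (snd c)"
  and transition_smooth: "c \<in> A \<Longrightarrow> c' \<in> A \<Longrightarrow> smooth_on (overlap c c') (\<lambda>x. transition c c' x $ k)"
  and charts_cover: "(\<Union>c\<in>A. fst c) = topspace X"
  and hausdorff: "Hausdorff_space X"
  using manifold by (auto simp: smooth_7_manifold_def)

lemma chart_subset: "c \<in> A \<Longrightarrow> fst c \<subseteq> topspace X"
  using charts_cover by blast

lemma chart_inj: assumes "c \<in> A" shows "inj_on (snd c) (fst c)"
  using homeomorphic_imp_injective_map[OF chart_homeo[OF assms]] chart_subset[OF assms] by (simp add: topspace_subtopology Int_absorb1)

lemma \<kappa>_chart [simp]: "c \<in> A \<Longrightarrow> q \<in> fst c \<Longrightarrow> \<kappa> c (snd c q) = q"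
  by (simp add: \<kappa>_def chart_inj)

lemma chart_\<kappa> [simp]: "y \<in> chart_image c \<Longrightarrow> snd c (\<kappa> c y) = y"
  and \<kappa>_in: "y \<in> chart_image c \<Longrightarrow> \<kappa> c y \<in> fst c"
  by (simp_all add: \<kappa>_def chart_image_def f_inv_into_f inv_into_into)

lemma transition_\<kappa>: "transition c c' x = snd c' (\<kappa> c x)"
  by (simp add: transition_def \<kappa>_def)

lemma overlap_iff: "c \<in> A \<Longrightarrow> x \<in> overlap c c' \<longleftrightarrow> x \<in> chart_image c \<and> \<kappa> c x \<in> fst c'"
  unfolding overlap_def chart_image_def by auto

lemma open_chart_map: assumes "c \<in> A" "openin X W" shows "open (snd c ` (fst c \<inter> W))"
proof -
  have "openin (subtopology X (fst c)) (fst c \<inter> W)" using assms(2) by (auto simp: openin_subtopology)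
  then have "openin (top_of_set (chart_image c)) (snd c ` (fst c \<inter> W))"
    using homeomorphic_imp_open_map[OF chart_homeo[OF assms(1)]] by (simp add: open_map_def)
  then show ?thesis using openin_open_eq[OF chart_open(2)[OF assms(1)]] by blast
qed

lemma open_overlap: "c \<in> A \<Longrightarrow> c' \<in> A \<Longrightarrow> open (overlap c c')"
  unfolding overlap_def by (intro open_chart_map chart_open(1))

lemma overlap_transition:
  assumes "c \<in> A" "c' \<in> A" "x \<in> overlap c c'"
  shows "transition c c' x \<in> overlap c' c" "\<kappa> c' (transition c c' x) = \<kappa> c x" "transition c' c (transition c c' x) = x"
    "x \<in> chart_image c" "transition c c' x \<in> chart_image c'"
proof -
  have x: "x \<in> chart_image c" "\<kappa> c x \<in> fst c'" using assms by (simp_all add: overlap_iff)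
  have k: "\<kappa> c x \<in> fst c" by (rule \<kappa>_in[OF x(1)])
  show 2: "\<kappa> c' (transition c c' x) = \<kappa> c x" using x assms by (simp add: transition_\<kappa>)
  show "x \<in> chart_image c" by (rule x)
  show 5: "transition c c' x \<in> chart_image c'" using x by (simp add: transition_\<kappa> chart_image_def)
  show "transition c c' x \<in> overlap c' c" using assms(2) 2 5 k by (simp add: overlap_iff)
  show "transition c' c (transition c c' x) = x" using x 2 by (simp add: transition_\<kappa>[of c'])
qed

lemma transition_image: assumes "c \<in> A" "c' \<in> A" shows "transition c c' ` overlap c c' = overlap c' c"
proof
  show "overlap c' c \<subseteq> transition c c' ` overlap c c'"
    using overlap_transition[OF assms(2,1)] by (metis image_eqI subsetI)
qed (use overlap_transition[OF assms] in auto)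

lemma transition_inj: "c \<in> A \<Longrightarrow> c' \<in> A \<Longrightarrow> inj_on (transition c c') (overlap c c')"
  using overlap_transition by (metis inj_onI)

lemma transition_has_derivative:
  assumes "c \<in> A" "c' \<in> A" "x \<in> overlap c c'"
  shows "(transition c c' has_derivative (\<lambda>h. \<chi> k. \<Sum>\<^sub>7i. h $ i * jacobian c c' x i $ k)) (at x)"
proof -
  have "((\<lambda>x. transition c c' x $ k) has_derivative (\<lambda>h. \<Sum>\<^sub>7i. h $ i * jacobian c c' x i $ k)) (at x)" for k
    using has_derivative_pd[OF smooth_on_differentiable[OF transition_smooth[OF assms(1,2)] assms(3)]] by (simp add: jacobian_def)
  then show ?thesis
    by (subst has_derivative_componentwise_within) (auto simp: Basis_vec_def inner_axis)
qed

lemma chain: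
  assumes "c \<in> A" "c' \<in> A" "x \<in> overlap c c'" "f differentiable (at (transition c c' x))"
  shows "pd i (\<lambda>y. f (transition c c' y)) x = (\<Sum>\<^sub>7k. jacobian c c' x i $ k * pd k f (transition c c' x))"
    "(\<lambda>y. f (transition c c' y)) differentiable (at x)"
proof -
  have d: "((\<lambda>y. f (transition c c' y)) has_derivative
     (\<lambda>h. \<Sum>\<^sub>7k. (\<chi> k. \<Sum>\<^sub>7i. h $ i * jacobian c c' x i $ k) $ k * pd k f (transition c c' x))) (at x)"
    using has_derivative_compose[OF transition_has_derivative[OF assms(1-3)] has_derivative_pd[OF assms(4)]] .
  show "(\<lambda>y. f (transition c c' y)) differentiable (at x)" using d unfolding differentiable_def by blast
  show "pd i (\<lambda>y. f (transition c c' y)) x = (\<Sum>\<^sub>7k. jacobian c c' x i $ k * pd k f (transition c c' x))"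
    using pd_eqI[OF d, of i] by (simp add: axis_def if_distrib if_distribR cong: if_cong)
qed

lemma jacobian_smooth: "c \<in> A \<Longrightarrow> c' \<in> A \<Longrightarrow> smooth_on (overlap c c') (\<lambda>x. jacobian c c' x i $ k)"
  by (simp add: jacobian_def smooth_on_pd transition_smooth)

text \<open>The transformation law alone. In contrast to \<open>differential_form\<close> it covers
  tensors without symmetry, such as \<nabla>S; smoothness is carried separately by
  \<open>smooth_field\<close>.\<close>

definition tensor_field :: "nat \<Rightarrow> 'a field \<Rightarrow> bool" where
  "tensor_field k t \<longleftrightarrow> (\<forall>c\<in>A. \<forall>c'\<in>A. \<forall>x\<in>overlap c c'. \<forall>is. length is = k \<longrightarrow>
     t c x is = fr (jacobian c c' x) (t c' (transition c c' x)) is)"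

lemma tensor_fieldD:
  "tensor_field k t \<Longrightarrow> c \<in> A \<Longrightarrow> c' \<in> A \<Longrightarrow> x \<in> overlap c c' \<Longrightarrow> length is = k \<Longrightarrow>
   t c x is = fr (jacobian c c' x) (t c' (transition c c' x)) is"
  by (simp add: tensor_field_def)

lemma tensor_field_cmult: "tensor_field k t \<Longrightarrow> tensor_field k (\<lambda>c x is. r * t c x is)"
  by (simp add: tensor_field_def fr_cmult)

lemma tensor_field_add: "tensor_field k t \<Longrightarrow> tensor_field k u \<Longrightarrow> tensor_field k (\<lambda>c x is. t c x is + u c x is)"
  by (simp add: tensor_field_def fr_add)

end

text \<open>The hypothesis on the derivative of \<open>J\<close> is the transformation law of
  connection coefficients: \<open>C\<close> holds those of the source chart, \<open>B\<close> those
  of the target chart in the direction of differentiation. Accordingly \<open>B\<close> acts before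
  the pull-back and \<open>C\<close> after it.\<close>

lemma pd_fr:
  assumes dJ: "\<And>i k. (\<lambda>y. J y i $ k) differentiable (at x)"
    and J: "\<And>i k. pd l (\<lambda>y. J y i $ k) x = (\<Sum>\<^sub>7m. C m i * J x m $ k) - (\<Sum>\<^sub>7b. B k b * J x i $ b)"
    and "\<And>js. length js = length is \<Longrightarrow> (\<lambda>y. u y js) differentiable (at x)"
  shows "pd l (\<lambda>y. fr (J y) (u y) is) x = fr (J x) (\<lambda>js. pd l (\<lambda>y. u y js) x - act B (u x) js) is + act C (fr (J x) (u x)) is
    \<and> (\<lambda>y. fr (J y) (u y) is) differentiable (at x)"
  using assms(3)
proof (induction "is" arbitrary: u)
  case Nil
  have "(\<lambda>y. u y []) differentiable (at x)" by (rule Nil) simp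
  then show ?case by simp
next
  case (Cons i "is")
  let ?u = "\<lambda>k y js. u y (k # js)"
  have IH: "pd l (\<lambda>y. fr (J y) (?u k y) is) x = fr (J x) (\<lambda>js. pd l (\<lambda>y. u y (k # js)) x - act B (?u k x) js) is + act C (fr (J x) (?u k x)) is"
    "(\<lambda>y. fr (J y) (?u k y) is) differentiable (at x)" for k
    using Cons.IH[of "?u k"] Cons.prems by simp_all
  have d: "(\<lambda>y. \<Sum>\<^sub>7k. J y i $ k * fr (J y) (?u k y) is) differentiable (at x)"
    by (intro differentiable_sum ballI differentiable_mult dJ IH) simp
  have "pd l (\<lambda>y. \<Sum>\<^sub>7k. J y i $ k * fr (J y) (?u k y) is) x =
     (\<Sum>\<^sub>7k. ((\<Sum>\<^sub>7m. C m i * J x m $ k) - (\<Sum>\<^sub>7b. B k b * J x i $ b)) * fr (J x) (?u k x) is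
       + J x i $ k * (fr (J x) (\<lambda>js. pd l (\<lambda>y. u y (k # js)) x - act B (?u k x) js) is + act C (fr (J x) (?u k x)) is))"
    by (simp add: pd_sum pd_mult dJ IH J differentiable_mult)
  also have "\<dots> = (\<Sum>\<^sub>7k m. C m i * J x m $ k * fr (J x) (?u k x) is) - (\<Sum>\<^sub>7k b. B k b * J x i $ b * fr (J x) (?u k x) is)
     + (\<Sum>\<^sub>7k. J x i $ k * fr (J x) (\<lambda>js. pd l (\<lambda>y. u y (k # js)) x - act B (?u k x) js) is) + (\<Sum>\<^sub>7k. J x i $ k * act C (fr (J x) (?u k x)) is)"
    by (simp add: distrib_left left_diff_distrib sum.distrib sum_subtractf sum_distrib_right)
  also have "(\<Sum>\<^sub>7k m. C m i * J x m $ k * fr (J x) (?u k x) is) = (\<Sum>\<^sub>7m. C m i * (\<Sum>\<^sub>7k. J x m $ k * fr (J x) (?u k x) is))"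
    by (subst sum.swap) (simp add: sum_distrib_left mult.assoc)
  also have "(\<Sum>\<^sub>7k. J x i $ k * act C (fr (J x) (?u k x)) is) = act C (\<lambda>js. \<Sum>\<^sub>7k. J x i $ k * fr (J x) (?u k x) js) is"
    by (simp add: act_sum act_cmult)
  also have "(\<Sum>\<^sub>7k b. B k b * J x i $ b * fr (J x) (?u k x) is) = (\<Sum>\<^sub>7b. J x i $ b * (\<Sum>\<^sub>7k. B k b * fr (J x) (?u k x) is))"
    by (subst sum.swap) (simp add: sum_distrib_left ac_simps)
  finally show ?case using d
    by (simp add: fr_diff fr_add fr_sum fr_cmult right_diff_distrib sum_subtractf distrib_left sum.distrib)
qed

locale connection_manifold = manifold X A for X :: "'a topology" and A +
  fixes \<Gamma> :: "'a connection"
  assumes connection: "linear_connection A \<Gamma>"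
begin

lemma \<Gamma>_smooth: "c \<in> A \<Longrightarrow> smooth_on (chart_image c) (\<lambda>x. \<Gamma> c x k i j)"
  using connection by (simp add: linear_connection_def)

lemma pd_jacobian:
  assumes "c \<in> A" "c' \<in> A" "x \<in> overlap c c'"
  shows "pd i (\<lambda>y. jacobian c c' y j $ k) x = (\<Sum>\<^sub>7m. \<Gamma> c x m i j * jacobian c c' x m $ k)
    - (\<Sum>\<^sub>7a b. jacobian c c' x i $ a * jacobian c c' x j $ b * \<Gamma> c' (transition c c' x) k a b)"
  using connection assms by (simp add: linear_connection_def)

lemma tensor_field_nabla:
  assumes t: "tensor_field k t" and smooth: "\<And>c. c \<in> A \<Longrightarrow> smooth_field (chart_image c) k (t c)"
  shows "tensor_field (Suc k) (\<lambda>c. nabt (\<Gamma> c) (t c))"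
  unfolding tensor_field_def
proof (intro ballI allI impI)
  fix c c' x and ls :: "7 list" assume c: "c \<in> A" "c' \<in> A" "x \<in> overlap c c'" and "length ls = Suc k"
  then obtain l "is" where ls: "ls = l # is" "length is = k" by (auto simp: length_Suc_conv)
  let ?J = "jacobian c c'" and ?\<tau> = "transition c c'"
  let ?B = "\<lambda>k b. \<Sum>\<^sub>7a. ?J x l $ a * \<Gamma> c' (?\<tau> x) k a b"
  have d': "(\<lambda>y. t c' y js) differentiable (at (?\<tau> x))" if "length js = k" for js
    using smooth_on_differentiable[OF smooth_fieldD[OF smooth[OF c(2)] that]] overlap_transition(5)[OF c] by blast
  have J: "pd l (\<lambda>y. ?J y i $ k) x = (\<Sum>\<^sub>7m. \<Gamma> c x m l i * ?J x m $ k) - (\<Sum>\<^sub>7b. ?B k b * ?J x i $ b)" for i k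
  proof -
    have "(\<Sum>\<^sub>7a b. ?J x l $ a * ?J x i $ b * \<Gamma> c' (?\<tau> x) k a b) = (\<Sum>\<^sub>7b a. ?J x l $ a * ?J x i $ b * \<Gamma> c' (?\<tau> x) k a b)"
      by (rule sum.swap)
    then show ?thesis using pd_jacobian[OF c, of l i k] by (simp add: sum_distrib_right sum_distrib_left ac_simps)
  qed
  have "pd l (\<lambda>y. t c y is) x = pd l (\<lambda>y. fr (?J y) (t c' (?\<tau> y)) is) x"
    by (rule pd_cong[OF open_overlap[OF c(1,2)] c(3)]) (rule tensor_fieldD[OF t c(1,2) _ ls(2)])
  also have "\<dots> = fr (?J x) (\<lambda>js. pd l (\<lambda>y. t c' (?\<tau> y) js) x - act ?B (t c' (?\<tau> x)) js) is
      + act (\<lambda>m k. \<Gamma> c x m l k) (fr (?J x) (t c' (?\<tau> x))) is"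
    by (rule conjunct1[OF pd_fr[OF smooth_on_differentiable[OF jacobian_smooth[OF c(1,2)] c(3)] J]])
       (rule chain(2)[OF c d'], simp add: ls(2))
  also have "act (\<lambda>m k. \<Gamma> c x m l k) (fr (?J x) (t c' (?\<tau> x))) is = act (\<lambda>m k. \<Gamma> c x m l k) (t c x) is"
    by (rule act_cong) (simp add: tensor_fieldD[OF t c] ls(2))
  also have "fr (?J x) (\<lambda>js. pd l (\<lambda>y. t c' (?\<tau> y) js) x - act ?B (t c' (?\<tau> x)) js) is
     = fr (?J x) (\<lambda>js. \<Sum>\<^sub>7a. ?J x l $ a * cov_deriv (\<Gamma> c') a (t c') (?\<tau> x) js) is"
  proof (rule fr_cong)
    fix js :: "7 list" assume "length js = length is"
    then have "pd l (\<lambda>y. t c' (?\<tau> y) js) x = (\<Sum>\<^sub>7a. ?J x l $ a * pd a (\<lambda>y. t c' y js) (?\<tau> x))"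
      using chain(1)[OF c d', of js l] ls(2) by simp
    then show "pd l (\<lambda>y. t c' (?\<tau> y) js) x - act ?B (t c' (?\<tau> x)) js = (\<Sum>\<^sub>7a. ?J x l $ a * cov_deriv (\<Gamma> c') a (t c') (?\<tau> x) js)"
      by (simp add: cov_deriv_act act_sum1 act_cmult1 right_diff_distrib sum_subtractf)
  qed
  finally show "nabt (\<Gamma> c) (t c) x ls = fr (?J x) (nabt (\<Gamma> c') (t c') (?\<tau> x)) ls"
    by (simp add: ls cov_deriv_act[of "\<Gamma> c"] fr_sum fr_cmult)
qed

end

section \<open>Integrals of compactly supported functions on the model space\<close>

lemma compact_support_box:
  fixes f :: "R7 \<Rightarrow> real"
  assumes "\<And>x. x \<notin> cball z r \<Longrightarrow> f x = 0" "cball z r \<subseteq> cbox a b"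
  shows "(\<lambda>x. if x \<in> cbox a b then f x else 0) = f"
  using assms by (auto simp: fun_eq_iff simp del: mem_cball)

lemma cball_cbox: obtains a b where "cball z r \<subseteq> cbox a (b :: R7)" "box a b \<noteq> {}"
proof -
  have "bounded (cball z (max r 1))" by simp
  then obtain a where a: "cball z (max r 1) \<subseteq> box (- a) a" using bounded_subset_box_symmetric by metis
  then have "z \<in> box (-a) a" by auto
  then have "box (-a) a \<noteq> {}" by auto
  moreover have "cball z r \<subseteq> cbox (-a) a" using a box_subset_cbox[of "-a" a] by force
  ultimately show ?thesis using that by blast
qed

lemma absolutely_integrable_compact_support:
  fixes f :: "R7 \<Rightarrow> real"
  assumes "continuous_on UNIV f" "\<And>x. x \<notin> cball z r \<Longrightarrow> f x = 0"
  shows "f absolutely_integrable_on UNIV"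
proof -
  obtain a b where ab: "cball z r \<subseteq> cbox a b" using cball_cbox by blast
  have "f absolutely_integrable_on cbox a b"
    by (rule absolutely_integrable_continuous) (rule continuous_on_subset[OF assms(1)], simp)
  then have "(\<lambda>x. if x \<in> cbox a b then f x else 0) absolutely_integrable_on UNIV"
    by (simp only: absolutely_integrable_restrict_UNIV)
  moreover have "(\<lambda>x. if x \<in> cbox a b then f x else 0) = f" by (rule compact_support_box[OF assms(2) ab])
  ultimately show ?thesis by (metis (no_types))
qed

lemma integral_compact_support:
  fixes f :: "R7 \<Rightarrow> real"
  assumes "\<And>x. x \<notin> cball z r \<Longrightarrow> f x = 0" "cball z r \<subseteq> cbox a b"
  shows "integral (cbox a b) f = integral UNIV f"
  using integral_restrict_UNIV[of "cbox a b" f] compact_support_box[of z r f a b, OF assms] by metis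

lemma integral_translation_UNIV:
  fixes f :: "R7 \<Rightarrow> real"
  assumes "f absolutely_integrable_on UNIV" "continuous_on UNIV f"
  shows "integral UNIV (\<lambda>x. f (c + x)) = integral UNIV f"
proof -
  have m: "f \<in> borel_measurable borel" using assms(2) by (rule borel_measurable_continuous_onI)
  have i: "integrable lborel f"
    using assms(1) m by (simp add: set_integrable_def integrable_completion)
  have i': "integrable lborel (\<lambda>x. f (c + x))"
  proof -
    have "integrable (distr lborel borel ((+) c)) f" using i by (simp only: lborel_distr_plus)
    then show ?thesis using m by (subst (asm) integrable_distr_eq) simp_all
  qed
  have "integral UNIV f = integral\<^sup>L (distr lborel borel ((+) c)) f" using i by (simp only: lborel_distr_plus integral_lborel)
  also have "\<dots> = (\<integral>x. f (c + x) \<partial>lborel)" using m by (subst integral_distr) simp_all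
  also have "\<dots> = integral UNIV (\<lambda>x. f (c + x))" using i' by (simp only: integral_lborel)
  finally show ?thesis ..
qed

text \<open>The integral of \<open>f\<close> does not change under translation along axis i.
  Differentiating it under the integral sign with respect to the translation gives the integral of
  \<open>pd i f\<close>.\<close>

lemma integral_pd_0:
  fixes f :: "R7 \<Rightarrow> real"
  assumes C1: "Ck 1 UNIV f" and supp: "\<And>x. x \<notin> cball z r \<Longrightarrow> f x = 0"
  shows "integral UNIV (pd i f) = 0"
proof -
  have d: "f differentiable (at x)" for x using C1 by simp
  have cpd: "continuous_on UNIV (pd i f)" using C1 by simp
  have cont: "continuous_on UNIV f"
    using d by (intro continuous_at_imp_continuous_on ballI differentiable_imp_continuous_within)
  \<comment> \<open>The radius is enlarged by 1, so that one box contains the supports of all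
    translates by at most 1.\<close>
  obtain a b where ab: "cball z (r + 1) \<subseteq> cbox a b" using cball_cbox by blast
  let ?e = "axis i 1 :: R7"
  have out: "f (s *\<^sub>R ?e + x) = 0" if "\<bar>s\<bar> \<le> 1" "x \<notin> cball z (r + 1)" for s x
  proof (rule supp)
    have "norm (z - x) \<le> norm (z - (s *\<^sub>R ?e + x)) + norm (s *\<^sub>R ?e)" using norm_triangle_ineq[of "z - (s *\<^sub>R ?e + x)" "s *\<^sub>R ?e"] by simp
    then show "s *\<^sub>R ?e + x \<notin> cball z r" using that by (simp add: dist_norm)
  qed
  have der: "((\<lambda>s. f (s *\<^sub>R ?e + x)) has_field_derivative pd i f (s *\<^sub>R ?e + x)) (at s)" for s x
  proof -
    have g: "((\<lambda>s. s *\<^sub>R ?e + x) has_derivative (\<lambda>h. h *\<^sub>R ?e)) (at s)" by (auto intro!: derivative_eq_intros)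
    from has_derivative_compose[OF g has_derivative_pd[OF d]]
    have "((\<lambda>s. f (s *\<^sub>R ?e + x)) has_derivative (\<lambda>h. \<Sum>\<^sub>7j. (h *\<^sub>R ?e) $ j * pd j f (s *\<^sub>R ?e + x))) (at s)" .
    moreover have "(\<lambda>h. \<Sum>\<^sub>7j. (h *\<^sub>R ?e) $ j * pd j f (s *\<^sub>R ?e + x)) = (*) (pd i f (s *\<^sub>R ?e + x))"
      by (auto simp: fun_eq_iff axis_def if_distrib if_distribR cong: if_cong)
    ultimately show ?thesis by (simp add: has_field_derivative_def)
  qed
  let ?I = "{-1<..<1::real}"
  have "((\<lambda>s. integral (cbox a b) (\<lambda>x. f (s *\<^sub>R ?e + x))) has_field_derivative integral (cbox a b) (\<lambda>x. pd i f (0 *\<^sub>R ?e + x))) (at 0 within ?I)"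
  proof (rule leibniz_rule_field_derivative[where fx = "\<lambda>s x. pd i f (s *\<^sub>R ?e + x)"])
    show "(\<lambda>x. f (s *\<^sub>R ?e + x)) integrable_on cbox a b" for s
      by (intro integrable_continuous continuous_on_compose2[OF cont]) (auto intro!: continuous_intros)
    show "continuous_on (?I \<times> cbox a b) (\<lambda>(s, x). pd i f (s *\<^sub>R ?e + x))"
      unfolding case_prod_unfold by (rule continuous_on_compose2[OF cpd]) (auto intro!: continuous_intros)
    show "((\<lambda>s. f (s *\<^sub>R ?e + x)) has_field_derivative pd i f (s *\<^sub>R ?e + x)) (at s within ?I)" for s x
      by (rule has_field_derivative_at_within[OF der])
    show "(0::real) \<in> ?I" "convex ?I" by simp_all
  qed
  then have 1: "((\<lambda>s. integral (cbox a b) (\<lambda>x. f (s *\<^sub>R ?e + x))) has_field_derivative integral (cbox a b) (pd i f)) (at 0)"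
    using at_within_open[of 0 ?I] by (simp only: open_greaterThanLessThan scaleR_zero_left add_0 greaterThanLessThan_iff) simp
  have const: "integral (cbox a b) (\<lambda>x. f (s *\<^sub>R ?e + x)) = integral UNIV f" if "s \<in> ?I" for s
  proof -
    have "integral (cbox a b) (\<lambda>x. f (s *\<^sub>R ?e + x)) = integral UNIV (\<lambda>x. f (s *\<^sub>R ?e + x))"
      by (rule integral_compact_support[OF out ab]) (use that in auto)
    then show ?thesis
      using integral_translation_UNIV[OF absolutely_integrable_compact_support[OF cont supp] cont] by simp
  qed
  have "((\<lambda>s. integral (cbox a b) (\<lambda>x. f (s *\<^sub>R ?e + x))) has_field_derivative 0) (at 0)"
    by (rule has_field_derivative_transform_within_open[of "\<lambda>_. integral UNIV f" _ _ ?I]) (auto simp: const)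
  from DERIV_unique[OF 1 this] have "integral (cbox a b) (pd i f) = 0" .
  moreover have "pd i f x = 0" if "x \<notin> cball z (r + 1)" for x
  proof -
    have "pd i f x = pd i (\<lambda>_. 0) x"
    proof (rule pd_cong[of "- cball z (r + 1)"])
      show "f y = 0" if "y \<in> - cball z (r + 1)" for y using out[of 0 y] that by simp
    qed (use that in auto)
    then show ?thesis by simp
  qed
  then have "integral (cbox a b) (pd i f) = integral UNIV (pd i f)" by (rule integral_compact_support[OF _ ab])
  ultimately show ?thesis by simp
qed

lemma change_of_variables:
  fixes f :: "R7 \<Rightarrow> real" and g :: "R7 \<Rightarrow> R7"
  assumes S: "S \<in> sets lebesgue" and der: "\<And>x. x \<in> S \<Longrightarrow> (g has_derivative g' x) (at x within S)" and inj: "inj_on g S"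
    and f: "f absolutely_integrable_on (g ` S)"
  shows "(\<lambda>x. \<bar>det (matrix (g' x))\<bar> * f (g x)) absolutely_integrable_on S"
    "integral S (\<lambda>x. \<bar>det (matrix (g' x))\<bar> * f (g x)) = integral (g ` S) f"
proof -
  \<comment> \<open>\<open>v\<close> identifies the reals with \<open>real^1\<close>, since the
    change of variables theorem is applied to functions with values in a space
    \<open>real^'n\<close>.\<close>
  define v :: "real \<Rightarrow> real^1" where "v = (\<lambda>a. \<chi> i. a)"
  have vb: "v a \<bullet> b = a" if b: "b \<in> Basis" for a b
  proof -
    obtain i where "b = axis i (1::real)" using b by (auto simp: Basis_vec_def)
    then show ?thesis by (simp add: inner_axis v_def)
  qed
  have v1: "axis 1 1 \<in> (Basis :: (real^1) set)" by (auto simp: Basis_vec_def)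
  have ai: "(\<lambda>x. v (h x)) absolutely_integrable_on T" if h: "h absolutely_integrable_on T" for h :: "R7 \<Rightarrow> real" and T
    by (rule absolutely_integrable_componentwise) (simp only: vb h)
  have ai': "h absolutely_integrable_on T" if h: "(\<lambda>x. v (h x)) absolutely_integrable_on T" for h :: "R7 \<Rightarrow> real" and T
    using absolutely_integrable_component[OF h, of "axis 1 1"] by (simp only: vb[OF v1])
  have int: "integral T h = integral T (\<lambda>x. v (h x)) \<bullet> axis 1 1" if h: "(\<lambda>x. v (h x)) absolutely_integrable_on T" for h :: "R7 \<Rightarrow> real" and T
    using integral_component_eq[OF set_lebesgue_integral_eq_integral(1)[OF h], of "axis 1 1"] by (simp only: vb[OF v1])
  let ?h = "\<lambda>x. \<bar>det (matrix (g' x))\<bar> * f (g x)"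
  have vs: "(\<lambda>x. \<bar>det (matrix (g' x))\<bar> *\<^sub>R v (f (g x))) = (\<lambda>x. v (?h x))" by (simp add: fun_eq_iff v_def vec_eq_iff)
  have "(\<lambda>x. v (?h x)) absolutely_integrable_on S \<and> integral S (\<lambda>x. v (?h x)) = integral (g ` S) (\<lambda>x. v (f x))"
    using has_absolute_integral_change_of_variables[OF S der inj, of "\<lambda>x. v (f x)" "integral (g ` S) (\<lambda>x. v (f x))"] ai[OF f]
    unfolding vs by blast
  then have h: "(\<lambda>x. v (?h x)) absolutely_integrable_on S" and e: "integral S (\<lambda>x. v (?h x)) = integral (g ` S) (\<lambda>x. v (f x))"
    by blast+
  show "?h absolutely_integrable_on S" by (rule ai'[OF h])
  show "integral S ?h = integral (g ` S) f" by (simp only: int[OF h] int[OF ai[OF f]] e)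
qed

lemma integral_nonneg_0:
  fixes f :: "R7 \<Rightarrow> real"
  assumes "continuous_on UNIV f" "\<And>x. x \<notin> cball z r \<Longrightarrow> f x = 0" "\<And>x. f x \<ge> 0" "integral UNIV f = 0"
  shows "f x = 0"
proof (cases "x \<in> cball z r")
  case True
  obtain a b where ab: "cball z r \<subseteq> cbox a b" "box a b \<noteq> {}" using cball_cbox by blast
  have cont: "continuous_on (cbox a b) f" by (rule continuous_on_subset[OF assms(1)]) simp
  have "integral (cbox a b) f = 0" using integral_compact_support[OF assms(2) ab(1)] assms(4) by simp
  then have "(f has_integral 0) (cbox a b)" using integrable_continuous[OF cont] by (metis integrable_integral)
  then show ?thesis using has_integral_0_cbox_imp_0[OF cont assms(3)] ab True by blast
qed (rule assms(2))

lemma Ck_sum: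
  assumes "open S" "\<And>a. a \<in> I \<Longrightarrow> Ck k S (f a)" shows "Ck k S (\<lambda>x. \<Sum>a\<in>I. f a x)"
  using assms(2) by (induction I rule: infinite_finite_induct) (simp_all add: Ck_const Ck_add[OF assms(1)])

text \<open>The square of the positive part is of class C^1, with derivative
  \<open>2 * max 0 s\<close>. This makes bump functions available without exponentials; the
  divergence theorem differentiates them once.\<close>

lemma Ck_1_posq:
  assumes "open S" "Ck 1 S w" shows "Ck 1 S (\<lambda>y. (max 0 (w y))\<^sup>2)"
proof -
  have q: "((\<lambda>s. (max 0 s)\<^sup>2) has_real_derivative 2 * max 0 s) (at s)" for s :: real
  proof -
    consider "s > 0" | "s < 0" | "s = 0" by linarith
    then show ?thesis
    proof cases
      case 1
      have "((\<lambda>s. s\<^sup>2) has_real_derivative 2 * s) (at s)" by (auto intro!: derivative_eq_intros)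
      then show ?thesis using 1 has_field_derivative_transform_within_open[of "\<lambda>s. s\<^sup>2" "2 * s" s "{0<..}"] by simp
    next
      case 2
      have "((\<lambda>s. 0) has_real_derivative 0) (at s)" by simp
      then show ?thesis using 2 has_field_derivative_transform_within_open[of "\<lambda>s. 0" 0 s "{..<0}" "\<lambda>s. (max 0 s)\<^sup>2"] by simp
    next
      case 3
      have "((\<lambda>h. ((max 0 (0 + h))\<^sup>2 - (max 0 0)\<^sup>2) / h) \<longlongrightarrow> 0) (at (0::real))"
      proof (rule Lim_null_comparison)
        show "\<forall>\<^sub>F h in at (0::real). norm (((max 0 (0 + h))\<^sup>2 - (max 0 0)\<^sup>2) / h) \<le> \<bar>h\<bar>"
          by (rule always_eventually) (auto simp: max_def power2_eq_square)
        show "((\<lambda>h. \<bar>h\<bar>) \<longlongrightarrow> 0) (at (0::real))" by (auto intro!: tendsto_eq_intros)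
      qed
      then show ?thesis by (simp add: 3 DERIV_def)
    qed
  qed
  have d: "((\<lambda>y. (max 0 (w y))\<^sup>2) has_derivative (\<lambda>h. (\<Sum>\<^sub>7i. h $ i * pd i w x) * (2 * max 0 (w x)))) (at x)" if "x \<in> S" for x
    by (rule DERIV_compose_FDERIV[where g = w, OF q has_derivative_pd]) (use assms that in simp)
  have p: "pd i (\<lambda>y. (max 0 (w y))\<^sup>2) x = 2 * max 0 (w x) * pd i w x" if "x \<in> S" for i x
    using pd_eqI[OF d[OF that], of i] by (simp add: axis_def if_distrib if_distribR mult.commute cong: if_cong)
  have wc: "continuous_on S w" using Ck_SucD[of 0 S w] assms(2) by simp
  have pc: "continuous_on S (pd i w)" for i using assms(2) by simp
  have "continuous_on S (pd i (\<lambda>y. (max 0 (w y))\<^sup>2))" for i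
  proof -
    have "continuous_on S (\<lambda>x. 2 * max 0 (w x) * pd i w x)" by (intro continuous_intros wc pc)
    then show ?thesis by (rule continuous_on_eq) (simp add: p)
  qed
  moreover have "(\<lambda>y. (max 0 (w y))\<^sup>2) differentiable (at x)" if "x \<in> S" for x
    using d[OF that] unfolding differentiable_def by blast
  ultimately show ?thesis by simp
qed

section \<open>Bump functions and a partition of unity of class C^1\<close>

context manifold begin

definition C1 :: "('a \<Rightarrow> real) \<Rightarrow> bool" where
  "C1 f \<longleftrightarrow> (\<forall>c\<in>A. Ck 1 (chart_image c) (\<lambda>y. f (\<kappa> c y)))"

definition ball_in :: "'a chart \<Rightarrow> R7 \<Rightarrow> real \<Rightarrow> 'a set" where
  "ball_in c z r = {q \<in> fst c. snd c q \<in> cball z r}"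

text \<open>The set is the image of a compact ball under the continuous inverse of the chart, hence
  compact, and compact sets are closed in a Hausdorff space. Closedness permits extension by zero
  beyond the chart domain.\<close>

lemma closed_ball_in:
  assumes c: "c \<in> A" and zr: "cball z r \<subseteq> chart_image c" shows "closedin X (ball_in c z r)"
proof -
  obtain g where g: "homeomorphic_maps (subtopology X (fst c)) (top_of_set (chart_image c)) (snd c) g"
    using chart_homeo[OF c] by (auto simp: homeomorphic_map_maps)
  have gq: "g (snd c q) = q" if "q \<in> fst c" for q
    using g that chart_subset[OF c] by (auto simp: homeomorphic_maps_def topspace_subtopology)
  have "g y = \<kappa> c y" if y: "y \<in> cball z r" for y
  proof -
    have y: "y \<in> chart_image c" using y zr by blast
    from gq[OF \<kappa>_in[OF y]] show ?thesis by (simp only: chart_\<kappa>[OF y])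
  qed
  then have im: "g ` cball z r = \<kappa> c ` cball z r" by (rule image_cong[OF refl])
  have cont: "continuous_map (top_of_set (chart_image c)) (subtopology X (fst c)) g" using g by (simp add: homeomorphic_maps_def)
  have "compactin (top_of_set (chart_image c)) (cball z r)" using zr by (simp add: compactin_subtopology compactin_euclidean_iff)
  from image_compactin[OF this cont] have "compactin X (\<kappa> c ` cball z r)" by (simp add: compactin_subtopology im)
  moreover have "\<kappa> c ` cball z r = ball_in c z r"
  proof (intro equalityI subsetI)
    fix q assume "q \<in> \<kappa> c ` cball z r"
    then obtain y where y: "q = \<kappa> c y" "y \<in> cball z r" by blast
    then have "y \<in> chart_image c" using zr by blast
    then show "q \<in> ball_in c z r" using y \<kappa>_in[of y c] by (simp only: ball_in_def mem_Collect_eq chart_\<kappa>)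
  next
    fix q assume "q \<in> ball_in c z r"
    then have q: "q \<in> fst c" "snd c q \<in> cball z r" by (simp_all only: ball_in_def mem_Collect_eq)
    then show "q \<in> \<kappa> c ` cball z r" using \<kappa>_chart[OF c q(1)] by (metis imageI)
  qed
  ultimately show ?thesis using compactin_imp_closedin[OF hausdorff] by simp
qed

lemma open_off_ball:
  assumes c: "c \<in> A" "c' \<in> A" and zr: "cball z r \<subseteq> chart_image c"
  shows "open {y \<in> chart_image c'. \<kappa> c' y \<notin> ball_in c z r}"
proof -
  have "{y \<in> chart_image c'. \<kappa> c' y \<notin> ball_in c z r} = snd c' ` (fst c' \<inter> (topspace X - ball_in c z r))"
  proof (intro equalityI subsetI)
    fix y assume "y \<in> {y \<in> chart_image c'. \<kappa> c' y \<notin> ball_in c z r}"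
    then have y: "y \<in> chart_image c'" "\<kappa> c' y \<notin> ball_in c z r" by blast+
    have "\<kappa> c' y \<in> fst c' \<inter> (topspace X - ball_in c z r)" using y \<kappa>_in[OF y(1)] chart_subset[OF c(2)] by blast
    then show "y \<in> snd c' ` (fst c' \<inter> (topspace X - ball_in c z r))" using chart_\<kappa>[OF y(1)] by (metis imageI)
  next
    fix y assume "y \<in> snd c' ` (fst c' \<inter> (topspace X - ball_in c z r))"
    then obtain q where q: "y = snd c' q" "q \<in> fst c'" "q \<notin> ball_in c z r" by blast
    then show "y \<in> {y \<in> chart_image c'. \<kappa> c' y \<notin> ball_in c z r}"
      using \<kappa>_chart[OF c(2) q(2)] by (simp add: chart_image_def)
  qed
  then show ?thesis using open_chart_map[OF c(2)] closed_ball_in[OF c(1) zr] by (simp add: openin_diff)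
qed

definition bump :: "'a chart \<Rightarrow> R7 \<Rightarrow> real \<Rightarrow> 'a \<Rightarrow> real" where
  "bump c z r q = (if q \<in> fst c then (max 0 (r\<^sup>2 - (\<Sum>\<^sub>7k. (snd c q $ k - z $ k) * (snd c q $ k - z $ k))))\<^sup>2 else 0)"

lemma dist_sum: "(\<Sum>\<^sub>7k. (y $ k - z $ k) * (y $ k - z $ k)) = (dist y z)\<^sup>2" for y z :: R7
  by (simp add: dist_norm power2_norm_eq_inner inner_vec_def)

lemma bump_0:
  assumes "0 < r" "q \<notin> ball_in c z r" shows "bump c z r q = 0"
proof (cases "q \<in> fst c")
  case True
  then have "r \<le> dist (snd c q) z" using assms(2) by (simp add: ball_in_def dist_commute)
  then have "r\<^sup>2 \<le> (dist (snd c q) z)\<^sup>2" using assms(1) by (intro power_mono) simp_all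
  then show ?thesis by (simp add: bump_def dist_sum max_def)
qed (simp add: bump_def)

lemma bump_pos: "q \<in> fst c \<Longrightarrow> dist z (snd c q) < r \<Longrightarrow> bump c z r q > 0"
proof -
  assume "q \<in> fst c" "dist z (snd c q) < r"
  moreover then have "(dist (snd c q) z)\<^sup>2 < r\<^sup>2" by (intro power_strict_mono) (simp_all add: dist_commute)
  ultimately show ?thesis unfolding bump_def dist_sum by (simp add: max_def)
qed

text \<open>At points of the chart domain the bump is a polynomial expression followed by the
  squared positive part. At other points the complement of the closed ball is a neighbourhood on
  which it is zero.\<close>

lemma bump_C1:
  assumes c: "c \<in> A" and r: "0 < r" and zr: "cball z r \<subseteq> chart_image c" shows "C1 (bump c z r)"
  unfolding C1_def
proof (intro ballI Ck_local)
  fix c' x assume c': "c' \<in> A" and x: "x \<in> chart_image c'"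
  show "\<exists>W. open W \<and> x \<in> W \<and> Ck 1 W (\<lambda>y. bump c z r (\<kappa> c' y))"
  proof (cases "\<kappa> c' x \<in> fst c")
    case True
    have W: "open (overlap c' c)" by (rule open_overlap[OF c' c])
    have t: "Ck 1 (overlap c' c) (\<lambda>y. transition c' c y $ k)" for k
      using transition_smooth[OF c' c] by (simp only: smooth_on_def)
    have d: "Ck 1 (overlap c' c) (\<lambda>y. transition c' c y $ k - z $ k)" for k
      using Ck_add[OF W t Ck_const, of k "- z $ k"] by simp
    have "Ck 1 (overlap c' c) (\<lambda>y. (max 0 (r\<^sup>2 + (- 1) * (\<Sum>\<^sub>7k. (transition c' c y $ k - z $ k) * (transition c' c y $ k - z $ k))))\<^sup>2)"
      by (intro Ck_1_posq Ck_add Ck_mult Ck_sum Ck_const W d)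
    then have "Ck 1 (overlap c' c) (\<lambda>y. bump c z r (\<kappa> c' y))"
      by (rule Ck_cong[OF W, rotated]) (simp add: bump_def overlap_iff[OF c'] transition_\<kappa>)
    then show ?thesis using W x True overlap_iff[OF c'] by blast
  next
    case False
    let ?W = "{y \<in> chart_image c'. \<kappa> c' y \<notin> ball_in c z r}"
    have W: "open ?W" by (rule open_off_ball[OF c c' zr])
    have "Ck 1 ?W (\<lambda>y. bump c z r (\<kappa> c' y))"
      by (rule Ck_cong[OF W _ Ck_const[of 1 _ 0]]) (simp add: bump_0[OF r])
    then show ?thesis using W x False by (auto simp: ball_in_def)
  qed
qed

lemma partition_of_unity:
  assumes comp: "compact_space X"
  obtains I :: "'a set" and ch z r \<rho> where "finite I"
    "\<forall>p\<in>I. ch p \<in> A \<and> cball (z p) (r p) \<subseteq> chart_image (ch p) \<and> C1 (\<rho> p) \<and> (\<forall>q. \<rho> p q \<ge> 0) \<and>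
       (\<forall>q. q \<notin> ball_in (ch p) (z p) (r p) \<longrightarrow> \<rho> p q = 0)"
    "\<forall>q\<in>topspace X. (\<Sum>p\<in>I. \<rho> p q) = 1"
proof -
  define ch where "ch p = (SOME c. c \<in> A \<and> p \<in> fst c)" for p
  define r where "r p = (SOME s. 0 < s \<and> cball (snd (ch p) p) s \<subseteq> chart_image (ch p))" for p
  have ch: "ch p \<in> A \<and> p \<in> fst (ch p) \<and> 0 < r p \<and> cball (snd (ch p) p) (r p) \<subseteq> chart_image (ch p)" if "p \<in> topspace X" for p
  proof -
    have "\<exists>c. c \<in> A \<and> p \<in> fst c" using that charts_cover by blast
    from someI_ex[OF this] have c: "ch p \<in> A" "p \<in> fst (ch p)" by (simp_all only: ch_def)
    then have "snd (ch p) p \<in> chart_image (ch p)" by (simp add: chart_image_def)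
    from open_contains_cball[THEN iffD1, rule_format, OF chart_open(2)[OF c(1)] this]
    have "\<exists>s. 0 < s \<and> cball (snd (ch p) p) s \<subseteq> chart_image (ch p)" by simp
    from someI_ex[OF this] show ?thesis using c by (simp only: r_def)
  qed
  define z where "z p = snd (ch p) p" for p
  define W where "W p = {q \<in> fst (ch p). snd (ch p) q \<in> ball (z p) (r p)}" for p
  have W: "openin X (W p)" if "p \<in> topspace X" for p
  proof -
    have "continuous_map (subtopology X (fst (ch p))) (top_of_set (chart_image (ch p))) (snd (ch p))"
      using chart_homeo ch[OF that] homeomorphic_imp_continuous_map by blast
    then have "continuous_map (subtopology X (fst (ch p))) euclidean (snd (ch p))" using continuous_map_into_fulltopology by blast
    then have "openin (subtopology X (fst (ch p))) {q \<in> topspace (subtopology X (fst (ch p))). snd (ch p) q \<in> ball (z p) (r p)}"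
      by (rule openin_continuous_map_preimage) simp
    moreover have "{q \<in> topspace (subtopology X (fst (ch p))). snd (ch p) q \<in> ball (z p) (r p)} = W p"
      using chart_subset[OF conjunct1[OF ch[OF that]]] by (auto simp: W_def)
    ultimately show ?thesis using chart_open(1) ch[OF that] openin_trans_full by metis
  qed
  have "\<exists>\<F>. finite \<F> \<and> \<F> \<subseteq> W ` topspace X \<and> topspace X \<subseteq> \<Union>\<F>"
  proof (rule compactinD)
    show "compactin X (topspace X)" using comp by (simp add: compact_space_def)
    show "topspace X \<subseteq> \<Union>(W ` topspace X)" using ch by (force simp: W_def z_def)
  qed (use W in auto)
  then obtain I where I: "finite I" "I \<subseteq> topspace X" "topspace X \<subseteq> \<Union>(W ` I)" by (metis finite_subset_image)
  define \<eta> where "\<eta> p = bump (ch p) (z p) (r p)" for p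
  define \<sigma> where "\<sigma> q = (\<Sum>p\<in>I. \<eta> p q)" for q
  have \<eta>0: "\<eta> p q \<ge> 0" for p q by (simp add: \<eta>_def bump_def)
  have \<sigma>: "\<sigma> q > 0" if q: "q \<in> topspace X" for q
  proof -
    obtain p where p: "p \<in> I" "q \<in> W p" using I q by blast
    then have "\<eta> p q > 0" unfolding \<eta>_def by (intro bump_pos) (auto simp: W_def)
    then show ?thesis unfolding \<sigma>_def using I(1) p(1) \<eta>0 by (metis sum_pos2)
  qed
  have C\<eta>: "C1 (\<eta> p)" if "p \<in> I" for p
    unfolding \<eta>_def using ch that I(2) by (intro bump_C1) (auto simp: z_def)
  have C\<sigma>: "C1 (\<lambda>q. inverse (\<sigma> q))"
    unfolding C1_def
  proof (intro ballI Ck_inverse)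
    fix c assume c: "c \<in> A"
    show "open (chart_image c)" by (rule chart_open(2)[OF c])
    then show "Ck 1 (chart_image c) (\<lambda>y. \<sigma> (\<kappa> c y))" unfolding \<sigma>_def using C\<eta> c by (intro Ck_sum) (auto simp: C1_def)
    show "\<sigma> (\<kappa> c y) \<noteq> 0" if "y \<in> chart_image c" for y using \<sigma>[of "\<kappa> c y"] \<kappa>_in[OF that] chart_subset[OF c] by force
  qed
  \<comment> \<open>Outside \<open>topspace X\<close> the second factor gets the default 0; inside,
    \<sigma> is positive. So \<rho> is nonnegative everywhere.\<close>
  define \<rho> where "\<rho> p q = \<eta> p q * (if q \<in> topspace X then inverse (\<sigma> q) else 0)" for p q
  have \<rho>C: "C1 (\<rho> p)" if "p \<in> I" for p
    unfolding C1_def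
  proof
    fix c assume c: "c \<in> A"
    have C: "Ck 1 (chart_image c) (\<lambda>y. \<eta> p (\<kappa> c y) * inverse (\<sigma> (\<kappa> c y)))"
      using C\<eta>[OF that] C\<sigma> c by (intro Ck_mult chart_open(2)) (auto simp: C1_def)
    have e: "\<eta> p (\<kappa> c y) * inverse (\<sigma> (\<kappa> c y)) = \<rho> p (\<kappa> c y)" if "y \<in> chart_image c" for y
    proof -
      have "\<kappa> c y \<in> topspace X" using \<kappa>_in[OF that] chart_subset[OF c] by blast
      then show ?thesis by (simp add: \<rho>_def)
    qed
    show "Ck 1 (chart_image c) (\<lambda>y. \<rho> p (\<kappa> c y))"
      by (rule Ck_cong[where g = "\<lambda>y. \<rho> p (\<kappa> c y)", OF chart_open(2)[OF c] e C])
  qed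
  show ?thesis
  proof (rule that[of I ch z r \<rho>])
    show "finite I" by (rule I)
    show "\<forall>p\<in>I. ch p \<in> A \<and> cball (z p) (r p) \<subseteq> chart_image (ch p) \<and> C1 (\<rho> p) \<and> (\<forall>q. \<rho> p q \<ge> 0) \<and>
       (\<forall>q. q \<notin> ball_in (ch p) (z p) (r p) \<longrightarrow> \<rho> p q = 0)"
    proof
      fix p assume p: "p \<in> I"
      then have pX: "p \<in> topspace X" using I(2) by blast
      have "\<rho> p q \<ge> 0" for q
      proof -
        have "(if q \<in> topspace X then inverse (\<sigma> q) else 0) \<ge> 0" using less_imp_le[OF \<sigma>[of q]] by simp
        then show ?thesis unfolding \<rho>_def by (rule mult_nonneg_nonneg[OF \<eta>0])
      qed
      moreover have "\<rho> p q = 0" if "q \<notin> ball_in (ch p) (z p) (r p)" for q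
        using bump_0[OF _ that] ch[OF pX] by (simp add: \<rho>_def \<eta>_def)
      ultimately show "ch p \<in> A \<and> cball (z p) (r p) \<subseteq> chart_image (ch p) \<and> C1 (\<rho> p) \<and> (\<forall>q. \<rho> p q \<ge> 0) \<and>
         (\<forall>q. q \<notin> ball_in (ch p) (z p) (r p) \<longrightarrow> \<rho> p q = 0)"
        using \<rho>C[OF p] ch[OF pX] by (simp add: z_def)
    qed
    show "\<forall>q\<in>topspace X. (\<Sum>p\<in>I. \<rho> p q) = 1"
    proof
      fix q assume q: "q \<in> topspace X"
      then have "(\<Sum>p\<in>I. \<rho> p q) = \<sigma> q * inverse (\<sigma> q)" by (simp add: \<rho>_def \<sigma>_def sum_distrib_right)
      then show "(\<Sum>p\<in>I. \<rho> p q) = 1" using \<sigma>[OF q] by simp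
    qed
  qed
qed

end

section \<open>Vector densities and integration by parts\<close>

context manifold begin

definition extend :: "'a chart \<Rightarrow> (R7 \<Rightarrow> real) \<Rightarrow> R7 \<Rightarrow> real" where
  "extend c h y = (if y \<in> chart_image c then h y else 0)"

lemma Ck_extend:
  assumes c: "c \<in> A" and zr: "cball z r \<subseteq> chart_image c" and h: "Ck k (chart_image c) h"
    and supp: "\<And>y. y \<in> chart_image c \<Longrightarrow> y \<notin> cball z r \<Longrightarrow> h y = 0"
  shows "Ck k UNIV (extend c h)"
proof (rule Ck_local)
  fix x :: R7
  show "\<exists>W. open W \<and> x \<in> W \<and> Ck k W (extend c h)"
  proof (cases "x \<in> chart_image c")
    case True
    have "Ck k (chart_image c) (extend c h)"
      by (rule Ck_cong[where f = h and g = "extend c h", OF chart_open(2)[OF c] _ h]) (simp add: extend_def)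
    then show ?thesis using True chart_open(2)[OF c] by blast
  next
    case False
    have o: "open (- cball z r)" by (simp add: open_Compl)
    have "Ck k (- cball z r) (extend c h)"
      by (rule Ck_cong[where f = "\<lambda>_. 0" and g = "extend c h", OF o _ Ck_const]) (use supp in \<open>simp add: extend_def\<close>)
    then show ?thesis using False zr o by blast
  qed
qed

lemma extend_0: "(\<And>y. y \<in> chart_image c \<Longrightarrow> y \<notin> cball z r \<Longrightarrow> h y = 0) \<Longrightarrow> y \<notin> cball z r \<Longrightarrow> extend c h y = 0"
  by (simp add: extend_def del: mem_cball)

lemma integrable_extend:
  assumes "c \<in> A" "cball z r \<subseteq> chart_image c" "continuous_on (chart_image c) h"
    "\<And>y. y \<in> chart_image c \<Longrightarrow> y \<notin> cball z r \<Longrightarrow> h y = 0"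
  shows "extend c h absolutely_integrable_on UNIV" "continuous_on UNIV (extend c h)"
proof -
  show c: "continuous_on UNIV (extend c h)" using Ck_extend[of c z r 0 h] assms by simp
  show "extend c h absolutely_integrable_on UNIV"
    by (rule absolutely_integrable_compact_support[OF c extend_0]) (rule assms(4))
qed

lemma not_ball_in: "y \<in> chart_image c \<Longrightarrow> y \<notin> cball z r \<Longrightarrow> \<kappa> c y \<notin> ball_in c z r"
  by (simp only: ball_in_def mem_Collect_eq chart_\<kappa> simp_thms)

end

text \<open>\<open>w\<close> is a vector density, in the application the volume density times a
  vector field. The factor |det| in its transformation law makes the pairing with a differential,
  \<open>along\<close>, a density that can be integrated in any chart.\<close>

locale compact_density = manifold X A for X :: "'a topology" and A +
  fixes w :: "'a chart \<Rightarrow> 7 \<Rightarrow> R7 \<Rightarrow> real"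
  assumes compact: "compact_space X"
    and w_C1: "\<And>c i. c \<in> A \<Longrightarrow> Ck 1 (chart_image c) (w c i)"
    and w_transform: "\<And>c c' x k. c \<in> A \<Longrightarrow> c' \<in> A \<Longrightarrow> x \<in> overlap c c' \<Longrightarrow>
      \<bar>det (\<chi> k i. jacobian c c' x i $ k)\<bar> * w c' k (transition c c' x) = (\<Sum>\<^sub>7i. jacobian c c' x i $ k * w c i x)"
begin

definition D :: "'a chart \<Rightarrow> R7 \<Rightarrow> real" where "D c x = (\<Sum>\<^sub>7i. pd i (w c i) x)"
definition along :: "'a chart \<Rightarrow> ('a \<Rightarrow> real) \<Rightarrow> R7 \<Rightarrow> real" where
  "along c f x = (\<Sum>\<^sub>7i. w c i x * pd i (\<lambda>y. f (\<kappa> c y)) x)"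

lemma along_transform:
  assumes f: "C1 f" and c: "c \<in> A" "c' \<in> A" "x \<in> overlap c c'"
  shows "along c f x = \<bar>det (\<chi> k i. jacobian c c' x i $ k)\<bar> * along c' f (transition c c' x)"
proof -
  let ?J = "jacobian c c' x" and ?P = "\<lambda>k. pd k (\<lambda>y. f (\<kappa> c' y)) (transition c c' x)"
  have d: "(\<lambda>y. f (\<kappa> c' y)) differentiable (at (transition c c' x))"
    using f c overlap_transition(5)[OF c] by (simp add: C1_def)
  have "pd i (\<lambda>y. f (\<kappa> c y)) x = (\<Sum>\<^sub>7k. ?J i $ k * ?P k)" for i
  proof -
    have "pd i (\<lambda>y. f (\<kappa> c y)) x = pd i (\<lambda>y. f (\<kappa> c' (transition c c' y))) x"
      by (rule pd_cong[OF open_overlap[OF c(1,2)] c(3)]) (simp only: overlap_transition(2)[OF c(1,2)])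
    then show ?thesis using chain(1)[OF c d] by simp
  qed
  then have "along c f x = (\<Sum>\<^sub>7i k. ?J i $ k * w c i x * ?P k)" by (simp add: along_def sum_distrib_left ac_simps)
  also have "\<dots> = (\<Sum>\<^sub>7k i. ?J i $ k * w c i x * ?P k)" by (rule sum.swap)
  also have "\<dots> = (\<Sum>\<^sub>7k. \<bar>det (\<chi> k i. ?J i $ k)\<bar> * w c' k (transition c c' x) * ?P k)"
    by (simp only: w_transform[OF c] sum_distrib_right[symmetric])
  finally show ?thesis by (simp add: along_def sum_distrib_left mult.assoc)
qed

lemma along_0:
  assumes c: "c \<in> A" "c' \<in> A" and zr: "cball z r \<subseteq> chart_image c" and f: "\<And>q. q \<notin> ball_in c z r \<Longrightarrow> f q = 0"
    and x: "x \<in> chart_image c'" "\<kappa> c' x \<notin> ball_in c z r"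
  shows "along c' f x = 0"
proof -
  have "pd i (\<lambda>y. f (\<kappa> c' y)) x = pd i (\<lambda>y. 0) x" for i
    by (rule pd_cong[OF open_off_ball[OF c zr]]) (use x f in auto)
  then show ?thesis by (simp add: along_def)
qed

lemma along_continuous: "C1 f \<Longrightarrow> c \<in> A \<Longrightarrow> continuous_on (chart_image c) (along c f)"
proof -
  assume a: "C1 f" "c \<in> A"
  have "continuous_on (chart_image c) (w c i)" for i using Ck_SucD[of 0] w_C1[OF a(2)] by simp
  moreover have "continuous_on (chart_image c) (pd i (\<lambda>y. f (\<kappa> c y)))" for i using a by (simp add: C1_def)
  ultimately show ?thesis unfolding along_def[abs_def] by (intro continuous_intros)
qed

lemma C1_continuous: "C1 f \<Longrightarrow> c \<in> A \<Longrightarrow> continuous_on (chart_image c) (\<lambda>y. f (\<kappa> c y))"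
  using Ck_SucD[of 0 "chart_image c" "\<lambda>y. f (\<kappa> c y)"] by (simp add: C1_def)

lemma D_continuous: "c \<in> A \<Longrightarrow> continuous_on (chart_image c) (D c)"
  unfolding D_def[abs_def] using w_C1 by (intro continuous_intros) simp

text \<open>The divergence of f w has integral zero in one chart, as f is supported in a ball there;
  the product rule splits it into the two integrals.\<close>

lemma integral_divergence:
  assumes f: "C1 f" and c: "c \<in> A" and zr: "cball z r \<subseteq> chart_image c" and supp: "\<And>q. q \<notin> ball_in c z r \<Longrightarrow> f q = 0"
  shows "integral UNIV (extend c (\<lambda>y. f (\<kappa> c y) * D c y)) = - integral UNIV (extend c (along c f))"
proof -
  let ?h = "\<lambda>i y. f (\<kappa> c y) * w c i y"
  have h0: "?h i y = 0" if "y \<in> chart_image c" "y \<notin> cball z r" for i y using supp[OF not_ball_in[OF that]] by simp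
  have fC: "Ck 1 (chart_image c) (\<lambda>y. f (\<kappa> c y))" using f c by (simp only: C1_def)
  have hC: "Ck 1 (chart_image c) (?h i)" for i by (rule Ck_mult[OF chart_open(2)[OF c] fC w_C1[OF c]])
  have C: "Ck 1 UNIV (extend c (?h i))" for i by (rule Ck_extend[OF c zr hC h0])
  have z: "integral UNIV (pd i (extend c (?h i))) = 0" for i
    by (rule integral_pd_0[OF C]) (rule extend_0[OF h0])
  have pi: "pd i (extend c (?h i)) absolutely_integrable_on UNIV" for i
  proof (rule absolutely_integrable_compact_support)
    show "continuous_on UNIV (pd i (extend c (?h i)))" using C[of i] by simp
    fix x assume x: "x \<notin> cball z r"
    have "pd i (extend c (?h i)) x = pd i (\<lambda>_. 0) x"
      by (rule pd_cong[of "- cball z r"]) (use x extend_0[OF h0] in \<open>auto simp del: mem_cball\<close>)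
    then show "pd i (extend c (?h i)) x = 0" by simp
  qed
  have eq: "(\<Sum>\<^sub>7i. pd i (extend c (?h i)) y) = extend c (\<lambda>y. f (\<kappa> c y) * D c y) y + extend c (along c f) y" for y
  proof (cases "y \<in> chart_image c")
    case True
    have "pd i (extend c (?h i)) y = pd i (?h i) y" for i
      by (rule pd_cong[OF chart_open(2)[OF c] True]) (simp add: extend_def)
    moreover have "pd i (?h i) y = pd i (\<lambda>y. f (\<kappa> c y)) y * w c i y + f (\<kappa> c y) * pd i (w c i) y" for i
      by (rule pd_mult) (use fC w_C1[OF c] True in simp_all)
    ultimately show ?thesis using True by (simp add: extend_def D_def along_def sum.distrib sum_distrib_left ac_simps)
  next
    case False
    then have "y \<notin> cball z r" using zr by blast
    then have "pd i (extend c (?h i)) y = pd i (\<lambda>_. 0) y" for i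
      by (intro pd_cong[of "- cball z r"]) (use extend_0[OF h0] in \<open>auto simp del: mem_cball\<close>)
    then show ?thesis using False by (simp add: extend_def)
  qed
  have a0: "along c f y = 0" if "y \<in> chart_image c" "y \<notin> cball z r" for y
    by (rule along_0[OF c c zr supp that(1) not_ball_in[OF that]])
  have i1: "extend c (along c f) absolutely_integrable_on UNIV"
    by (rule integrable_extend(1)[OF c zr along_continuous[OF f c] a0])
  have i2: "extend c (\<lambda>y. f (\<kappa> c y) * D c y) absolutely_integrable_on UNIV"
    by (rule integrable_extend(1)[OF c zr]) (intro continuous_intros C1_continuous[OF f c] D_continuous[OF c], use supp not_ball_in in simp)
  have "0 = (\<Sum>\<^sub>7i. integral UNIV (pd i (extend c (?h i))))" by (simp add: z)
  also have "\<dots> = integral UNIV (\<lambda>y. \<Sum>\<^sub>7i. pd i (extend c (?h i)) y)"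
    using pi by (intro integral_sum[symmetric]) (auto intro: set_lebesgue_integral_eq_integral(1))
  also have "\<dots> = integral UNIV (extend c (\<lambda>y. f (\<kappa> c y) * D c y)) + integral UNIV (extend c (along c f))"
    unfolding eq by (rule integral_add) (rule set_lebesgue_integral_eq_integral(1)[OF i2] set_lebesgue_integral_eq_integral(1)[OF i1])+
  finally show ?thesis by simp
qed

text \<open>\<open>f\<close> is supported in one chart and \<open>g\<close> in the other, so the
  integrand lives on the overlap in both. There the change of variables formula matches the density
  law of \<open>along\<close>.\<close>

lemma integral_along:
  assumes f: "C1 f" "c \<in> A" "cball z r \<subseteq> chart_image c" "\<And>q. q \<notin> ball_in c z r \<Longrightarrow> f q = 0"
    and g: "C1 g" "c' \<in> A" "cball z' r' \<subseteq> chart_image c'" "\<And>q. q \<notin> ball_in c' z' r' \<Longrightarrow> g q = 0"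
  shows "extend c (\<lambda>y. g (\<kappa> c y) * along c f y) absolutely_integrable_on UNIV"
    "extend c' (\<lambda>y. g (\<kappa> c' y) * along c' f y) absolutely_integrable_on UNIV"
    "integral UNIV (extend c (\<lambda>y. g (\<kappa> c y) * along c f y)) = integral UNIV (extend c' (\<lambda>y. g (\<kappa> c' y) * along c' f y))"
proof -
  let ?h = "\<lambda>c. extend c (\<lambda>y. g (\<kappa> c y) * along c f y)" and ?S = "overlap c c'" and ?\<tau> = "transition c c'"
  have a0: "along c f y = 0" if "y \<in> chart_image c" "y \<notin> cball z r" for y
    by (rule along_0[OF f(2) f(2) f(3) f(4) that(1) not_ball_in[OF that]])
  show "?h c absolutely_integrable_on UNIV"
    by (rule integrable_extend(1)[OF f(2,3)]) (intro continuous_intros C1_continuous along_continuous f g, simp add: a0 del: mem_cball)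
  show i': "?h c' absolutely_integrable_on UNIV"
    by (rule integrable_extend(1)[OF g(2,3)]) (intro continuous_intros C1_continuous along_continuous f g, use g(4) not_ball_in in simp)
  have S: "?S \<in> sets lebesgue" using open_overlap[OF f(2) g(2)] by (simp add: borel_open sets_completionI_sets)
  have S': "overlap c' c \<in> sets lebesgue" using open_overlap[OF g(2) f(2)] by (simp add: borel_open sets_completionI_sets)
  let ?d = "\<lambda>x h. (\<chi> k. \<Sum>\<^sub>7i. h $ i * jacobian c c' x i $ k) :: R7"
  have m: "matrix (?d x) = (\<chi> k i. jacobian c c' x i $ k)" for x
    by (simp add: matrix_def vec_eq_iff axis_def if_distrib if_distribR cong: if_cong)
  have "integral UNIV (?h c) = integral ?S (?h c)"
  proof -
    have "(\<lambda>y. if y \<in> ?S then ?h c y else 0) = ?h c"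
      using overlap_iff[OF f(2)] g(4) by (auto simp: fun_eq_iff extend_def ball_in_def)
    then show ?thesis using integral_restrict_UNIV[of ?S "?h c"] by simp
  qed
  also have "\<dots> = integral ?S (\<lambda>x. \<bar>det (matrix (?d x))\<bar> * ?h c' (?\<tau> x))"
  proof (rule integral_cong)
    fix x assume x: "x \<in> ?S"
    note o = overlap_transition[OF f(2) g(2) x]
    show "?h c x = \<bar>det (matrix (?d x))\<bar> * ?h c' (?\<tau> x)"
      using along_transform[OF f(1,2) g(2) x] o(2,4,5) by (simp add: extend_def m)
  qed
  also have "\<dots> = integral (?\<tau> ` ?S) (?h c')"
  proof (rule change_of_variables(2)[OF S])
    show "(?\<tau> has_derivative ?d x) (at x within ?S)" if "x \<in> ?S" for x
      by (rule has_derivative_at_withinI[OF transition_has_derivative[OF f(2) g(2) that]])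
    show "inj_on ?\<tau> ?S" by (rule transition_inj[OF f(2) g(2)])
    show "?h c' absolutely_integrable_on ?\<tau> ` ?S"
      unfolding transition_image[OF f(2) g(2)] by (rule set_integrable_subset[OF i' S']) simp
  qed
  also have "\<dots> = integral UNIV (?h c')"
  proof -
    have "?h c' y = 0" if "y \<notin> overlap c' c" for y
    proof (cases "y \<in> chart_image c'")
      case True
      then have "\<kappa> c' y \<notin> ball_in c z r" using that overlap_iff[OF g(2)] by (auto simp: ball_in_def)
      then show ?thesis using along_0[OF f(2) g(2) f(3) f(4) True] by (simp add: extend_def)
    qed (simp add: extend_def)
    then have "(\<lambda>y. if y \<in> overlap c' c then ?h c' y else 0) = ?h c'" by (auto simp: fun_eq_iff)
    then show ?thesis using integral_restrict_UNIV[of "overlap c' c" "?h c'"] by (simp add: transition_image[OF f(2) g(2)])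
  qed
  finally show "integral UNIV (?h c) = integral UNIV (?h c')" .
qed

text \<open>Each term of the partition of unity is integrated by parts in its own chart. Inserting
  the partition once more and moving every term to the chart of the inserted function, by
  \<open>integral_along\<close>, the sum over the first index becomes the derivative of the constant
  1. The nonnegative integrands then have integral zero and vanish. The conclusion names one chart
  around q; \<open>divergence_zero\<close> carries it to the others.\<close>

theorem divergence_theorem:
  assumes nonneg: "\<And>c x. c \<in> A \<Longrightarrow> x \<in> chart_image c \<Longrightarrow> D c x \<ge> 0" and q: "q \<in> topspace X"
  shows "\<exists>c\<in>A. q \<in> fst c \<and> D c (snd c q) = 0"
proof -
  obtain I :: "'a set" and ch z r \<rho> where I: "finite I"
    and P: "\<forall>p\<in>I. ch p \<in> A \<and> cball (z p) (r p) \<subseteq> chart_image (ch p) \<and> C1 (\<rho> p) \<and> (\<forall>q. \<rho> p q \<ge> 0) \<and>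
       (\<forall>q. q \<notin> ball_in (ch p) (z p) (r p) \<longrightarrow> \<rho> p q = 0)"
    and sum1: "\<forall>q\<in>topspace X. (\<Sum>p\<in>I. \<rho> p q) = 1"
    using partition_of_unity[OF compact] .
  have P1: "ch p \<in> A" "cball (z p) (r p) \<subseteq> chart_image (ch p)" "C1 (\<rho> p)" "\<rho> p q \<ge> 0"
    "q \<notin> ball_in (ch p) (z p) (r p) \<Longrightarrow> \<rho> p q = 0" if "p \<in> I" for p q using P that by blast+
  have sum1': "(\<Sum>p\<in>I. \<rho> p (\<kappa> c y)) = 1" if "c \<in> A" "y \<in> chart_image c" for c y
    using sum1 \<kappa>_in[OF that(2)] chart_subset[OF that(1)] by blast
  let ?h = "\<lambda>a b c. extend c (\<lambda>y. \<rho> b (\<kappa> c y) * along c (\<rho> a) y)"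
  let ?E = "\<lambda>b. extend (ch b) (\<lambda>y. \<rho> b (\<kappa> (ch b) y) * D (ch b) y)"
  have i: "?h a b (ch a) absolutely_integrable_on UNIV" "?h a b (ch b) absolutely_integrable_on UNIV"
    "integral UNIV (?h a b (ch a)) = integral UNIV (?h a b (ch b))" if "a \<in> I" "b \<in> I" for a b
    by (rule integral_along[OF P1(3)[OF that(1)] P1(1)[OF that(1)] P1(2)[OF that(1)] P1(5)[OF that(1)] P1(3)[OF that(2)] P1(1)[OF that(2)] P1(2)[OF that(2)] P1(5)[OF that(2)]]; assumption)+
  have one: "integral UNIV (extend (ch a) (along (ch a) (\<rho> a))) = (\<Sum>b\<in>I. integral UNIV (?h a b (ch b)))" if a: "a \<in> I" for a
  proof -
    have "extend (ch a) (along (ch a) (\<rho> a)) = (\<lambda>y. \<Sum>b\<in>I. ?h a b (ch a) y)"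
    proof
      fix y show "extend (ch a) (along (ch a) (\<rho> a)) y = (\<Sum>b\<in>I. ?h a b (ch a) y)"
        using sum1'[OF P1(1)[OF a], of y] by (simp add: extend_def flip: sum_distrib_right)
    qed
    then have "integral UNIV (extend (ch a) (along (ch a) (\<rho> a))) = (\<Sum>b\<in>I. integral UNIV (?h a b (ch a)))"
      using integral_sum[OF I, of "\<lambda>b. ?h a b (ch a)" UNIV] set_lebesgue_integral_eq_integral(1)[OF i(1)[OF a]] by simp
    then show ?thesis using i(3)[OF a] by simp
  qed
  \<comment> \<open>With b fixed, the sum over a differentiates the sum of the partition of unity,
    which is the constant 1 on the chart.\<close>
  have zero: "(\<Sum>a\<in>I. integral UNIV (?h a b (ch b))) = 0" if b: "b \<in> I" for b
  proof -
    have "(\<Sum>a\<in>I. ?h a b (ch b) y) = 0" for y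
    proof (cases "y \<in> chart_image (ch b)")
      case True
      have d: "(\<lambda>y. \<rho> a (\<kappa> (ch b) y)) differentiable (at y)" if "a \<in> I" for a
        using P1(3)[OF that] P1(1)[OF b] True by (simp add: C1_def)
      have "(\<Sum>a\<in>I. along (ch b) (\<rho> a) y) = (\<Sum>\<^sub>7i. w (ch b) i y * (\<Sum>a\<in>I. pd i (\<lambda>y. \<rho> a (\<kappa> (ch b) y)) y))"
        unfolding along_def by (subst sum.swap) (simp add: sum_distrib_left)
      also have "\<dots> = 0"
      proof -
        have "(\<Sum>a\<in>I. pd i (\<lambda>y. \<rho> a (\<kappa> (ch b) y)) y) = 0" for i
        proof -
          have "(\<Sum>a\<in>I. pd i (\<lambda>y. \<rho> a (\<kappa> (ch b) y)) y) = pd i (\<lambda>y. \<Sum>a\<in>I. \<rho> a (\<kappa> (ch b) y)) y"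
            using d by (intro pd_sum[symmetric])
          also have "\<dots> = pd i (\<lambda>y. 1) y"
            by (rule pd_cong[OF chart_open(2)[OF P1(1)[OF b]] True]) (rule sum1'[OF P1(1)[OF b]])
          finally show ?thesis by simp
        qed
        then show ?thesis by simp
      qed
      finally show ?thesis using True by (simp add: extend_def flip: sum_distrib_left)
    qed (simp add: extend_def)
    then show ?thesis
      using integral_sum[OF I, of "\<lambda>a. ?h a b (ch b)" UNIV] set_lebesgue_integral_eq_integral(1)[OF i(2)[OF _ b]] by simp
  qed
  have supp: "\<rho> b (\<kappa> (ch b) y) * D (ch b) y = 0" if "b \<in> I" "y \<in> chart_image (ch b)" "y \<notin> cball (z b) (r b)" for b y
    using P1(5)[OF that(1) not_ball_in[OF that(2,3)]] by simp
  have cont: "continuous_on UNIV (?E b)" if b: "b \<in> I" for b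
    by (rule integrable_extend(2)[OF P1(1)[OF b] P1(2)[OF b] _ supp[OF b]])
       (intro continuous_intros C1_continuous[OF P1(3)[OF b] P1(1)[OF b]] D_continuous[OF P1(1)[OF b]])
  have E0: "?E b y \<ge> 0" if b: "b \<in> I" for b y
    using P1(4)[OF b] nonneg[OF P1(1)[OF b]] by (simp add: extend_def)
  have intE: "integral UNIV (?E b) \<ge> 0" if "b \<in> I" for b
    by (rule integral_nonneg)
       (use E0[OF that] set_lebesgue_integral_eq_integral(1)[OF absolutely_integrable_compact_support[OF cont[OF that] extend_0[OF supp[OF that]]]] in auto)
  have "(\<Sum>b\<in>I. integral UNIV (?E b)) = (\<Sum>a\<in>I. - (\<Sum>b\<in>I. integral UNIV (?h a b (ch b))))"
    by (intro sum.cong refl) (simp add: integral_divergence[OF P1(3,1,2) P1(5)] one)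
  also have "\<dots> = - (\<Sum>b\<in>I. \<Sum>a\<in>I. integral UNIV (?h a b (ch b)))" unfolding sum_negf by (subst sum.swap) (rule refl)
  finally have "(\<Sum>b\<in>I. integral UNIV (?E b)) = 0" by (simp add: zero)
  then have iE: "integral UNIV (?E b) = 0" if "b \<in> I" for b using that intE by (simp add: sum_nonneg_eq_0_iff[OF I])
  have Ez: "?E b y = 0" if "b \<in> I" for b y
    by (rule integral_nonneg_0[OF cont[OF that] extend_0[OF supp[OF that]] E0[OF that] iE[OF that]])
  obtain b where b: "b \<in> I" "\<rho> b q \<noteq> 0" using sum1 q by (metis sum.neutral zero_neq_one)
  then have "q \<in> ball_in (ch b) (z b) (r b)" using P1(5) by blast
  then have qb: "q \<in> fst (ch b)" by (simp add: ball_in_def)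
  then have "snd (ch b) q \<in> chart_image (ch b)" by (simp add: chart_image_def)
  then have "\<rho> b q * D (ch b) (snd (ch b) q) = 0" using Ez[OF b(1), of "snd (ch b) q"] qb P1(1)[OF b(1)] by (simp add: extend_def)
  then show ?thesis using b qb P1(1)[OF b(1)] by auto
qed

end

section \<open>Globalisation\<close>

locale g2_manifold = connection_manifold X A \<Gamma> for X :: "'a topology" and A \<Gamma> +
  fixes \<phi> :: "'a field"
  assumes g2: "g2_structure A \<phi>" and characteristic: "characteristic_connection A \<phi> \<Gamma>" and compact_X: "compact_space X"
begin

lemma chart: assumes c: "c \<in> A" shows "g2_chart (chart_image c) (\<phi> c) (\<Gamma> c)"
proof
  show "open (chart_image c)" by (rule chart_open(2)[OF c])
  show "smooth_field (chart_image c) 3 (\<phi> c)" using g2 c by (simp add: g2_structure_def differential_form_def smooth_field_def)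
  show "alternating 3 (\<phi> c x)" if "x \<in> chart_image c" for x using g2 c that by (simp add: g2_structure_def differential_form_def)
  show "\<exists>W E. open W \<and> x \<in> W \<and> W \<subseteq> chart_image c \<and> (\<forall>a i. smooth_on W (\<lambda>y. E y $ a $ i)) \<and> (\<forall>y\<in>W. adapted (\<phi> c y) (E y))"
    if "x \<in> chart_image c" for x using g2 c that by (simp add: g2_structure_def)
  show "smooth_on (chart_image c) (\<lambda>x. \<Gamma> c x k i j)" for k i j by (rule \<Gamma>_smooth[OF c])
  show "cov_deriv (\<Gamma> c) l (metric_field (\<phi> c)) x is = 0" if "x \<in> chart_image c" "length is = 2" for x l "is"
    using characteristic c that by (simp add: characteristic_connection_def parallel_def)
  show "cov_deriv (\<Gamma> c) l (\<phi> c) x is = 0" if "x \<in> chart_image c" "length is = 3" for x l "is"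
    using characteristic c that by (simp add: characteristic_connection_def parallel_def)
  show "alternating 3 (torsion_field (\<phi> c) (\<Gamma> c) x)" if "x \<in> chart_image c" for x
    using characteristic c that by (simp add: characteristic_connection_def)
qed

abbreviation "gG c \<equiv> metric_chart.G (\<lambda>x. metric (\<phi> c x))"
abbreviation "gT c \<equiv> metric_chart.T (\<lambda>x. metric (\<phi> c x)) (\<Gamma> c)"
abbreviation "g\<mu> c \<equiv> metric_chart.\<mu> (\<lambda>x. metric (\<phi> c x))"
abbreviation "gdiv c \<equiv> metric_chart.divg (\<lambda>x. metric (\<phi> c x)) (\<Gamma> c)"
abbreviation "gS c \<equiv> g2_chart.S (\<phi> c) (\<Gamma> c)"
abbreviation "g\<theta> c \<equiv> g2_chart.\<theta> (\<phi> c) (\<Gamma> c)"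
abbreviation "gV1 c \<equiv> g2_chart.V1 (\<phi> c) (\<Gamma> c)"
abbreviation "gV2 c \<equiv> g2_chart.V2 (\<phi> c) (\<Gamma> c)"
abbreviation "gV3 c \<equiv> g2_chart.V3 (\<phi> c) (\<Gamma> c)"

section \<open>Transformation of the local constructions between charts\<close>

lemma \<phi>_tensor: "tensor_field 3 \<phi>"
  using g2 by (simp add: g2_structure_def differential_form_def tensor_field_def eval_tensor_map)

lemma jacobian_inverse:
  assumes c: "c \<in> A" "c' \<in> A" "x \<in> overlap c c'"
  shows "(\<Sum>\<^sub>7k. jacobian c c' x i $ k * jacobian c' c (transition c c' x) k $ j) = dl i j"
proof -
  note o = overlap_transition[OF c]
  have d: "(\<lambda>y. transition c' c y $ j) differentiable (at (transition c c' x))"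
    by (rule smooth_on_differentiable[OF transition_smooth[OF c(2,1)] o(1)])
  have "(\<Sum>\<^sub>7k. jacobian c c' x i $ k * jacobian c' c (transition c c' x) k $ j) = pd i (\<lambda>y. transition c' c (transition c c' y) $ j) x"
    using chain(1)[OF c d] by (simp add: jacobian_def)
  also have "\<dots> = pd i (\<lambda>y. y $ j) x"
    by (rule pd_cong[OF open_overlap[OF c(1,2)] c(3)]) (simp add: overlap_transition(3)[OF c(1,2)])
  also have "\<dots> = dl i j"
    using pd_eqI[OF bounded_linear_imp_has_derivative[OF bounded_linear_vec_nth[of j]], of i x] by (simp add: axis_def dl_def eq_commute)
  finally show ?thesis .
qed

definition Jm :: "'a chart \<Rightarrow> 'a chart \<Rightarrow> R7 \<Rightarrow> real^7^7" where
  "Jm c c' x = (\<chi> k i. jacobian c c' x i $ k)"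

lemma Jm_invertible: assumes c: "c \<in> A" "c' \<in> A" "x \<in> overlap c c'" shows "invertible (Jm c c' x)"
proof -
  have "(\<Sum>\<^sub>7k. jacobian c' c (transition c c' x) k $ j * jacobian c c' x i $ k) = dl j i" for i j
    using jacobian_inverse[OF c, of i j] by (simp add: mult.commute dl_sym[of j])
  then have "Jm c' c (transition c c' x) ** Jm c c' x = mat 1"
    by (simp add: Jm_def vec_eq_iff matrix_matrix_mult_def mat_def dl_def)
  then show ?thesis by (meson invertible_left_inverse)
qed

text \<open>The metric is chosen in each chart separately, through a coframe adapted to \<phi>.
  Pulling an adapted coframe back by the Jacobian shows that these choices fit together to a tensor
  and a density.\<close>

lemma adapted_transform:
  assumes c: "c \<in> A" "c' \<in> A" "x \<in> overlap c c'" and E: "adapted (\<phi> c' (transition c c' x)) E"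
  shows "adapted (\<phi> c x) (E ** Jm c c' x)"
  unfolding adapted_def
proof (intro conjI ballI)
  show "invertible (E ** Jm c c' x)" using E Jm_invertible[OF c] by (simp add: adapted_def invertible_mult)
  fix "is" :: "7 list" assume "is \<in> idx 3"
  then have len: "length is = 3" by simp
  then obtain i j k where "is": "is = [i,j,k]" by (auto simp: length_Suc_conv numeral_3_eq_3)
  have "\<phi> c x is = fr (jacobian c c' x) (\<phi> c' (transition c c' x)) is" by (rule tensor_fieldD[OF \<phi>_tensor c len])
  also have "\<dots> = fr (jacobian c c' x) (fr (\<lambda>i. \<chi> a. E $ a $ i) phl) is"
  proof (rule fr_cong)
    fix js :: "7 list" assume l: "length js = length is"
    then obtain a b d where js: "js = [a,b,d]" using len by (auto simp: length_Suc_conv numeral_3_eq_3)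
    have "\<phi> c' (transition c c' x) js = g2_model E js" using E l len unfolding adapted_def by (metis length_idx)
    then show "\<phi> c' (transition c c' x) js = fr (\<lambda>i. \<chi> a. E $ a $ i) phl js" by (simp only: js g2_model_fr)
  qed
  also have "\<dots> = fr (\<lambda>i. \<chi> a. (E ** Jm c c' x) $ a $ i) phl is"
  proof -
    have "(\<lambda>i. \<Sum>\<^sub>7b. jacobian c c' x i $ b *\<^sub>R (\<chi> a. E $ a $ b)) = (\<lambda>i. \<chi> a. (E ** Jm c c' x) $ a $ i)"
      by (simp add: fun_eq_iff vec_eq_iff matrix_matrix_mult_def Jm_def mult.commute)
    then show ?thesis by (simp only: fr_fr)
  qed
  finally show "\<phi> c x is = g2_model (E ** Jm c c' x) is" by (simp only: "is" g2_model_fr)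
qed

lemma metric_transform:
  assumes c: "c \<in> A" "c' \<in> A" "x \<in> overlap c c'"
  shows "metric (\<phi> c x) = Finite_Cartesian_Product.transpose (Jm c c' x) ** metric (\<phi> c' (transition c c' x)) ** Jm c c' x"
proof -
  interpret c': g2_chart "chart_image c'" "\<phi> c'" "\<Gamma> c'" by (rule chart[OF c(2)])
  obtain E where E: "adapted (\<phi> c' (transition c c' x)) E" using c'.coframe[OF overlap_transition(5)[OF c]] by blast
  show ?thesis
    unfolding metric_adapted[OF E] metric_adapted[OF adapted_transform[OF c E]] by (simp add: matrix_transpose_mul matrix_mul_assoc)
qed

lemma metric_transform_nth:
  assumes c: "c \<in> A" "c' \<in> A" "x \<in> overlap c c'"
  shows "metric (\<phi> c x) $ i $ j = (\<Sum>\<^sub>7k l. jacobian c c' x i $ k * (jacobian c c' x j $ l * metric (\<phi> c' (transition c c' x)) $ k $ l))"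
proof -
  have "metric (\<phi> c x) $ i $ j = (\<Sum>\<^sub>7l k. jacobian c c' x i $ k * (jacobian c c' x j $ l * metric (\<phi> c' (transition c c' x)) $ k $ l))"
    unfolding metric_transform[OF c]
    by (simp add: matrix_matrix_mult_def Finite_Cartesian_Product.transpose_def Jm_def sum_distrib_right sum_distrib_left ac_simps)
  also have "\<dots> = (\<Sum>\<^sub>7k l. jacobian c c' x i $ k * (jacobian c c' x j $ l * metric (\<phi> c' (transition c c' x)) $ k $ l))"
    by (rule sum.swap)
  finally show ?thesis .
qed

lemma G_transform:
  assumes c: "c \<in> A" "c' \<in> A" "x \<in> overlap c c'"
  shows "gG c' (transition c c' x) k l = (\<Sum>\<^sub>7a b. gG c x a b * (jacobian c c' x a $ k * jacobian c c' x b $ l))"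
proof -
  interpret c: g2_chart "chart_image c" "\<phi> c" "\<Gamma> c" by (rule chart[OF c(1)])
  interpret c': g2_chart "chart_image c'" "\<phi> c'" "\<Gamma> c'" by (rule chart[OF c(2)])
  let ?J = "Jm c c' x" and ?g = "metric (\<phi> c x)" and ?g' = "metric (\<phi> c' (transition c c' x))"
  let ?t = "Finite_Cartesian_Product.transpose ?J"
  have inv: "invertible ?g" "invertible ?g'"
    using c.gm_det[OF overlap_transition(4)[OF c]] c'.gm_det[OF overlap_transition(5)[OF c]] by (simp_all add: invertible_det_nz)
  have "?J ** matrix_inv ?g ** ?t ** ?g' ** ?J = ?J ** matrix_inv ?g ** ?g"
    by (simp add: metric_transform[OF c] matrix_mul_assoc)
  also have "\<dots> = ?J" using matrix_inv_left_right(2)[OF inv(1)] by (simp add: matrix_mul_assoc[symmetric])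
  finally have "?J ** matrix_inv ?g ** ?t ** ?g' ** ?J ** matrix_inv ?J = ?J ** matrix_inv ?J" by simp
  then have "?J ** matrix_inv ?g ** ?t ** ?g' = mat 1"
    using matrix_inv_left_right(1)[OF Jm_invertible[OF c]] by (simp add: matrix_mul_assoc[symmetric])
  then have "?J ** matrix_inv ?g ** ?t ** ?g' ** matrix_inv ?g' = matrix_inv ?g'" by simp
  then have e: "matrix_inv ?g' = ?J ** matrix_inv ?g ** ?t"
    using matrix_inv_left_right(1)[OF inv(2)] by (simp add: matrix_mul_assoc[symmetric])
  have "gG c' (transition c c' x) k l = (\<Sum>\<^sub>7b a. gG c x a b * (jacobian c c' x a $ k * jacobian c c' x b $ l))"
    unfolding c.G_def c'.G_def e
    by (simp add: matrix_matrix_mult_def Finite_Cartesian_Product.transpose_def Jm_def sum_distrib_right sum_distrib_left ac_simps)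
  also have "\<dots> = (\<Sum>\<^sub>7a b. gG c x a b * (jacobian c c' x a $ k * jacobian c c' x b $ l))" by (rule sum.swap)
  finally show ?thesis .
qed

lemma \<mu>_transform:
  assumes c: "c \<in> A" "c' \<in> A" "x \<in> overlap c c'"
  shows "g\<mu> c x = \<bar>det (Jm c c' x)\<bar> * g\<mu> c' (transition c c' x)"
proof -
  interpret c: g2_chart "chart_image c" "\<phi> c" "\<Gamma> c" by (rule chart[OF c(1)])
  interpret c': g2_chart "chart_image c'" "\<phi> c'" "\<Gamma> c'" by (rule chart[OF c(2)])
  have "det (metric (\<phi> c x)) = (det (Jm c c' x))\<^sup>2 * det (metric (\<phi> c' (transition c c' x)))"
    unfolding metric_transform[OF c] by (simp add: det_mul det_transpose power2_eq_square)
  then show ?thesis by (simp add: c.\<mu>_def c'.\<mu>_def real_sqrt_mult)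
qed

lemma tensor_field_ctr:
  assumes t: "tensor_field (m + n) t" and u: "tensor_field (n + r) u"
  shows "tensor_field (m + r) (\<lambda>c x. ctr (gG c x) n m (t c x) (u c x))"
  unfolding tensor_field_def
proof (intro ballI allI impI)
  fix c c' x and "is" :: "7 list" assume c: "c \<in> A" "c' \<in> A" "x \<in> overlap c c'" and len: "length is = m + r"
  define as bs where "as = take m is" and "bs = drop m is"
  have ab: "is = as @ bs" "length as = m" "length bs = r" using len by (simp_all add: as_def bs_def)
  let ?J = "jacobian c c' x" and ?y = "transition c c' x"
  have "ctr (gG c x) n m (t c x) (u c x) is = cn (gG c x) n (\<lambda>ks. fr ?J (t c' ?y) (as @ ks)) (\<lambda>ls. fr ?J (u c' ?y) (ls @ bs))"
    unfolding ab(1) ctr_append[OF ab(2)]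
    by (rule cn_cong) (simp_all add: tensor_fieldD[OF t c] tensor_fieldD[OF u c] ab)
  also have "\<dots> = fr ?J (ctr (gG c' ?y) n m (t c' ?y) (u c' ?y)) (as @ bs)"
    unfolding fr_ctr[OF G_transform[OF c] ab(2)] ctr_append[OF ab(2)] by (rule refl)
  finally show "ctr (gG c x) n m (t c x) (u c x) is = fr ?J (ctr (gG c' ?y) n m (t c' ?y) (u c' ?y)) is" by (simp only: ab(1))
qed

lemma tensor_field_cong:
  assumes t: "tensor_field k t" and e: "\<And>c x is. c \<in> A \<Longrightarrow> length is = k \<Longrightarrow> u c x is = t c x is"
  shows "tensor_field k u"
  unfolding tensor_field_def
proof (intro ballI allI impI)
  fix c c' x and "is" :: "7 list" assume c: "c \<in> A" "c' \<in> A" "x \<in> overlap c c'" and len: "length is = k"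
  have "u c x is = fr (jacobian c c' x) (t c' (transition c c' x)) is" using e[OF c(1) len] tensor_fieldD[OF t c len] by simp
  also have "\<dots> = fr (jacobian c c' x) (u c' (transition c c' x)) is" by (rule fr_cong) (simp add: e[OF c(2)] len)
  finally show "u c x is = fr (jacobian c c' x) (u c' (transition c c' x)) is" .
qed

text \<open>The inhomogeneous term in the law for connection coefficients is a second derivative of
  the transition map. It is symmetric in i and j and cancels in the torsion.\<close>

lemma torsion_transform:
  assumes c: "c \<in> A" "c' \<in> A" "x \<in> overlap c c'"
  shows "(\<Sum>\<^sub>7m. (\<Gamma> c x m i j - \<Gamma> c x m j i) * jacobian c c' x m $ k) =
    (\<Sum>\<^sub>7a b. jacobian c c' x i $ a * (jacobian c c' x j $ b * (\<Gamma> c' (transition c c' x) k a b - \<Gamma> c' (transition c c' x) k b a)))"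
proof -
  let ?J = "jacobian c c' x" and ?\<Gamma> = "\<Gamma> c' (transition c c' x)"
  have s: "pd i (\<lambda>y. jacobian c c' y j $ k) x = pd j (\<lambda>y. jacobian c c' y i $ k) x"
    unfolding jacobian_def using pd_commute[OF open_overlap[OF c(1,2)] transition_smooth[OF c(1,2)] c(3)] by simp
  have w: "(\<Sum>\<^sub>7a b. ?J j $ a * ?J i $ b * ?\<Gamma> k a b) = (\<Sum>\<^sub>7a b. ?J j $ b * ?J i $ a * ?\<Gamma> k b a)" by (rule sum.swap)
  show ?thesis
    using pd_jacobian[OF c, of i j k] pd_jacobian[OF c, of j i k] s w
    by (simp add: left_diff_distrib right_diff_distrib sum_subtractf ac_simps)
qed

lemma T_tensor: "tensor_field 3 gT"
  unfolding tensor_field_def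
proof (intro ballI allI impI)
  fix c c' x and "is" :: "7 list" assume c: "c \<in> A" "c' \<in> A" "x \<in> overlap c c'" and len: "length is = 3"
  then obtain i j l where "is": "is = [i,j,l]" by (auto simp: length_Suc_conv numeral_3_eq_3)
  interpret c: g2_chart "chart_image c" "\<phi> c" "\<Gamma> c" by (rule chart[OF c(1)])
  interpret c': g2_chart "chart_image c'" "\<phi> c'" "\<Gamma> c'" by (rule chart[OF c(2)])
  let ?J = "jacobian c c' x" and ?y = "transition c c' x"
  let ?t = "\<lambda>k a b. \<Gamma> c' ?y k a b - \<Gamma> c' ?y k b a"
  define Y where "Y k = (\<Sum>\<^sub>7n. ?J l $ n * metric (\<phi> c' ?y) $ k $ n)" for k
  have g: "metric (\<phi> c x) $ m $ l = (\<Sum>\<^sub>7k. ?J m $ k * Y k)" for m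
    by (simp add: metric_transform_nth[OF c] Y_def sum_distrib_left)
  have "gT c x is = (\<Sum>\<^sub>7m k. (\<Gamma> c x m i j - \<Gamma> c x m j i) * ?J m $ k * Y k)"
    by (simp add: "is" c.T_def g sum_distrib_left mult.assoc)
  also have "\<dots> = (\<Sum>\<^sub>7k m. (\<Gamma> c x m i j - \<Gamma> c x m j i) * ?J m $ k * Y k)" by (rule sum.swap)
  also have "\<dots> = (\<Sum>\<^sub>7k a b. ?J i $ a * (?J j $ b * (?t k a b * Y k)))"
    by (simp only: torsion_transform[OF c] sum_distrib_right[symmetric]) (simp only: sum_distrib_right mult.assoc)
  also have "\<dots> = (\<Sum>\<^sub>7a b k. ?J i $ a * (?J j $ b * (?t k a b * Y k)))" by (rule sum_rot3)
  also have "\<dots> = (\<Sum>\<^sub>7a b. ?J i $ a * (?J j $ b * (\<Sum>\<^sub>7k n. ?J l $ n * (?t k a b * metric (\<phi> c' ?y) $ k $ n))))"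
    by (simp add: Y_def sum_distrib_left mult.left_commute)
  also have "\<dots> = (\<Sum>\<^sub>7a b. ?J i $ a * (?J j $ b * (\<Sum>\<^sub>7n k. ?J l $ n * (?t k a b * metric (\<phi> c' ?y) $ k $ n))))"
    by (intro sum.cong refl arg_cong2[where f = "(*)"] sum.swap)
  finally show "gT c x is = fr ?J (gT c' ?y) is"
    by (simp add: "is" c'.T_def sum_distrib_left)
qed

lemma ctr_tensor:
  assumes "tensor_field k t" "tensor_field l u" "k = m + n" "l = n + r" "p = m + r"
  shows "tensor_field p (\<lambda>c x. ctr (gG c x) n m (t c x) (u c x))"
  using tensor_field_ctr[of m n t r u] assms by simp

lemma nabla_tensor:
  assumes "tensor_field k t" "\<And>c. c \<in> A \<Longrightarrow> smooth_field (chart_image c) k (t c)" "l = Suc k"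
  shows "tensor_field l (\<lambda>c. nabt (\<Gamma> c) (t c))"
  using tensor_field_nabla[OF assms(1,2)] assms(3) by simp

lemma S_tensor: "tensor_field 2 gS"
  by (rule tensor_field_cong[OF ctr_tensor[OF T_tensor \<phi>_tensor, of 1 2 1]]) (simp_all add: g2_chart.S_def[OF chart])

lemma \<theta>_tensor: "tensor_field 1 g\<theta>"
  by (rule tensor_field_cong[OF tensor_field_cmult[OF ctr_tensor[OF S_tensor \<phi>_tensor, of 0 2 1], of _ "- (1/6)"]])
     (simp_all add: g2_chart.\<theta>_def[OF chart])

lemma DS_tensor: "tensor_field 3 (\<lambda>c. nabt (\<Gamma> c) (gS c))"
  by (rule nabla_tensor[OF S_tensor g2_chart.S_smooth[OF chart]]) simp_all

lemma D\<theta>_tensor: "tensor_field 2 (\<lambda>c. nabt (\<Gamma> c) (g\<theta> c))"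
  by (rule nabla_tensor[OF \<theta>_tensor g2_chart.\<theta>_smooth[OF chart]]) simp_all

lemma curl_tensor: "tensor_field 2 W \<Longrightarrow> tensor_field 1 (\<lambda>c x. ctr (gG c x) 2 1 (\<phi> c x) (W c x))"
  by (rule ctr_tensor[OF \<phi>_tensor]) simp_all

lemma W1_tensor: "tensor_field 2 (\<lambda>c. g2_chart.W1 (\<phi> c) (\<Gamma> c))"
  by (rule tensor_field_cong[OF ctr_tensor[OF DS_tensor \<theta>_tensor, of 2 1 0]]) (simp_all add: g2_chart.W1_def[OF chart])

lemma W2_tensor: "tensor_field 2 (\<lambda>c. g2_chart.W2 (\<phi> c) (\<Gamma> c))"
  by (rule tensor_field_cong[OF ctr_tensor[OF D\<theta>_tensor ctr_tensor[OF \<phi>_tensor \<theta>_tensor, of 2 1 0 2], of 1 1 1]])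
     (simp_all add: g2_chart.W2_def[OF chart])

lemma W3_tensor: "tensor_field 2 (\<lambda>c. g2_chart.W3 (\<phi> c) (\<Gamma> c))"
  by (rule tensor_field_cong[OF ctr_tensor[OF ctr_tensor[OF DS_tensor S_tensor, of 2 1 1 3] \<phi>_tensor, of 1 2 1]])
     (simp_all add: g2_chart.W3_def[OF chart])

lemma n\<theta>_tensor: "tensor_field 1 (\<lambda>c. g2_chart.n\<theta> (\<phi> c) (\<Gamma> c))"
  by (rule tensor_field_cong[OF ctr_tensor[OF ctr_tensor[OF \<theta>_tensor \<theta>_tensor, of 0 1 0 0] \<theta>_tensor, of 0 0 1]])
     (simp_all add: g2_chart.n\<theta>_def[OF chart])

lemma q\<theta>_tensor: "tensor_field 1 (\<lambda>c. g2_chart.q\<theta> (\<phi> c) (\<Gamma> c))"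
  by (rule tensor_field_cong[OF ctr_tensor[OF ctr_tensor[OF S_tensor S_tensor, of 0 2 0 0] \<theta>_tensor, of 0 0 1]])
     (simp_all add: g2_chart.q\<theta>_def[OF chart])

lemma V_tensor: "tensor_field 1 gV1" "tensor_field 1 gV2" "tensor_field 1 gV3"
proof -
  show "tensor_field 1 gV1"
    by (rule tensor_field_cong[OF tensor_field_add[OF curl_tensor[OF W1_tensor]
          tensor_field_add[OF tensor_field_cmult[OF n\<theta>_tensor, of "-7"] tensor_field_cmult[OF q\<theta>_tensor, of "1/4"]]]])
       (simp add: g2_chart.V1_def[OF chart])
  show "tensor_field 1 gV2"
    by (rule tensor_field_cong[OF curl_tensor[OF W2_tensor]]) (simp add: g2_chart.V2_def[OF chart])
  show "tensor_field 1 gV3"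
    by (rule tensor_field_cong[OF curl_tensor[OF W3_tensor]]) (simp add: g2_chart.V3_def[OF chart])
qed

lemma divg_transform:
  assumes V: "tensor_field 1 V" and smooth: "\<And>c. c \<in> A \<Longrightarrow> smooth_field (chart_image c) 1 (V c)"
    and c: "c \<in> A" "c' \<in> A" "x \<in> overlap c c'"
  shows "gdiv c (V c) x = gdiv c' (V c') (transition c c' x)"
proof -
  interpret c: g2_chart "chart_image c" "\<phi> c" "\<Gamma> c" by (rule chart[OF c(1)])
  interpret c': g2_chart "chart_image c'" "\<phi> c'" "\<Gamma> c'" by (rule chart[OF c(2)])
  let ?J = "jacobian c c' x" and ?y = "transition c c' x"
  let ?X = "\<lambda>k l. cov_deriv (\<Gamma> c') k (V c') ?y [l]"
  have N: "tensor_field 2 (\<lambda>c. nabt (\<Gamma> c) (V c))" by (rule nabla_tensor[OF V smooth]) simp_all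
  have X: "cov_deriv (\<Gamma> c) i (V c) x [j] = (\<Sum>\<^sub>7k l. ?J i $ k * (?J j $ l * ?X k l))" for i j
    using tensor_fieldD[OF N c, of "[i,j]"] by (simp add: sum_distrib_left)
  have "gdiv c (V c) x = (\<Sum>\<^sub>7i j k l. gG c x i j * (?J i $ k * ?J j $ l) * ?X k l)"
    by (simp add: c.divg_def X sum_distrib_left mult.assoc)
  also have "\<dots> = (\<Sum>\<^sub>7k l i j. gG c x i j * (?J i $ k * ?J j $ l) * ?X k l)" by (rule sum_swap22)
  also have "\<dots> = gdiv c' (V c') ?y" by (simp only: c'.divg_def G_transform[OF c] sum_distrib_right)
  finally show ?thesis .
qed

text \<open>With the index of V raised and the volume density as factor, V becomes a vector density
  whose coordinate divergence is a positive multiple of \<open>gdiv\<close>. The divergence theorem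
  gives zero in some chart around the point, and \<open>divg_transform\<close> carries this to the
  chart \<open>c\<close>.\<close>

theorem divergence_zero:
  assumes V: "tensor_field 1 V" and smooth: "\<And>c. c \<in> A \<Longrightarrow> smooth_field (chart_image c) 1 (V c)"
    and nonneg: "\<And>c x. c \<in> A \<Longrightarrow> x \<in> chart_image c \<Longrightarrow> gdiv c (V c) x \<ge> 0"
    and c: "c \<in> A" "x \<in> chart_image c"
  shows "gdiv c (V c) x = 0"
proof -
  define w where "w c i y = g\<mu> c y * (\<Sum>\<^sub>7j. gG c y i j * V c y [j])" for c i y
  interpret compact_density X A w
  proof
    show "compact_space X" by (rule compact_X)
    fix c i assume c: "c \<in> A"
    interpret c: g2_chart "chart_image c" "\<phi> c" "\<Gamma> c" by (rule chart[OF c])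
    have \<mu>c: "continuous_on (chart_image c) (g\<mu> c)"
      using c.\<mu>_deriv(1) by (intro continuous_at_imp_continuous_on ballI differentiable_imp_continuous_within)
    have "continuous_on (chart_image c) (pd l (g\<mu> c))" for l
    proof -
      have "continuous_on (chart_image c) (\<lambda>x. (\<Sum>\<^sub>7m. \<Gamma> c x m l m) * g\<mu> c x)"
        by (intro continuous_intros \<mu>c smooth_on_continuous[OF \<Gamma>_smooth[OF c]])
      then show ?thesis by (rule continuous_on_eq) (simp add: c.\<mu>_deriv(2))
    qed
    then have \<mu>C: "Ck 1 (chart_image c) (g\<mu> c)" using c.\<mu>_deriv(1) by simp
    have "smooth_on (chart_image c) (\<lambda>y. \<Sum>\<^sub>7j. gG c y i j * V c y [j])"
      by (intro smooth_on_sum smooth_on_mult chart_open(2)[OF c] c.G_smooth smooth_fieldD[OF smooth[OF c]]) simp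
    then have "Ck 1 (chart_image c) (\<lambda>y. \<Sum>\<^sub>7j. gG c y i j * V c y [j])" by (simp only: smooth_on_def)
    then show "Ck 1 (chart_image c) (w c i)" unfolding w_def[abs_def] by (rule Ck_mult[OF chart_open(2)[OF c] \<mu>C])
  next
    fix c c' x k assume c: "c \<in> A" "c' \<in> A" "x \<in> overlap c c'"
    let ?J = "jacobian c c' x" and ?y = "transition c c' x"
    have Vx: "V c x [j] = (\<Sum>\<^sub>7l. ?J j $ l * V c' ?y [l])" for j using tensor_fieldD[OF V c, of "[j]"] by simp
    have "(\<Sum>\<^sub>7i. ?J i $ k * (\<Sum>\<^sub>7j. gG c x i j * V c x [j])) = (\<Sum>\<^sub>7i j l. gG c x i j * (?J i $ k * ?J j $ l) * V c' ?y [l])"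
      by (simp add: Vx sum_distrib_left ac_simps)
    also have "\<dots> = (\<Sum>\<^sub>7l i j. gG c x i j * (?J i $ k * ?J j $ l) * V c' ?y [l])" by (rule sum_rot3[symmetric])
    also have "\<dots> = (\<Sum>\<^sub>7l. gG c' ?y k l * V c' ?y [l])" by (simp only: G_transform[OF c] sum_distrib_right)
    finally have "g\<mu> c x * (\<Sum>\<^sub>7i. ?J i $ k * (\<Sum>\<^sub>7j. gG c x i j * V c x [j])) = g\<mu> c x * (\<Sum>\<^sub>7l. gG c' ?y k l * V c' ?y [l])" by simp
    then show "\<bar>det (\<chi> k i. ?J i $ k)\<bar> * w c' k ?y = (\<Sum>\<^sub>7i. ?J i $ k * w c i x)"
      by (simp add: w_def \<mu>_transform[OF c] Jm_def sum_distrib_left mult.assoc mult.left_commute[of "?J _ $ _"])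
  qed
  have Dw: "D c y = g\<mu> c y * gdiv c (V c) y" if c: "c \<in> A" "y \<in> chart_image c" for c y
  proof -
    interpret c: g2_chart "chart_image c" "\<phi> c" "\<Gamma> c" by (rule chart[OF c(1)])
    show ?thesis unfolding D_def unfolding w_def[abs_def] using c.divergence[OF c(2) smooth[OF c(1)]] by (simp add: c.divg_def)
  qed
  have pos: "g\<mu> c y > 0" if c: "c \<in> A" "y \<in> chart_image c" for c y
  proof -
    interpret c: g2_chart "chart_image c" "\<phi> c" "\<Gamma> c" by (rule chart[OF c(1)])
    show ?thesis by (rule c.\<mu>_pos[OF c(2)])
  qed
  have "D c y \<ge> 0" if "c \<in> A" "y \<in> chart_image c" for c y
    using Dw[OF that] nonneg[OF that] pos[OF that] by simp
  moreover have "\<kappa> c x \<in> topspace X" using \<kappa>_in[OF c(2)] chart_subset[OF c(1)] by blast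
  ultimately obtain c' where c': "c' \<in> A" "\<kappa> c x \<in> fst c'" "D c' (snd c' (\<kappa> c x)) = 0"
    using divergence_theorem by blast
  then have o: "x \<in> overlap c c'" using overlap_iff[OF c(1)] c(2) by blast
  have y: "transition c c' x \<in> chart_image c'" by (rule overlap_transition(5)[OF c(1) c'(1) o])
  have "gdiv c' (V c') (transition c c' x) = 0"
    using c'(3) Dw[OF c'(1) y] pos[OF c'(1) y] by (simp add: transition_\<kappa>)
  then show ?thesis using divg_transform[OF V smooth c(1) c'(1) o] by simp
qed

end

theorem theorem1p4:
  fixes X :: "'a topology" and A :: "'a chart set"
    and \<phi> :: "'a field" and \<Gamma> :: "'a connection"
  assumes "smooth_7_manifold X A"
    and "compact_space X"
    and "g2_structure A \<phi>"
    and "constant_type A \<phi>"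
    and "gauduchon_g2 A \<phi>"
    and "characteristic_connection A \<phi> \<Gamma>"
  shows "g2_instanton A \<phi> \<Gamma> \<longleftrightarrow>
    parallel A \<Gamma> 3 (\<lambda>c. torsion_field (\<phi> c) (\<Gamma> c))"
proof -
  interpret g2_manifold X A \<Gamma> \<phi>
    by unfold_locales (use assms in \<open>simp_all add: characteristic_connection_def\<close>)
  obtain r where r: "\<forall>c\<in>A. \<forall>x\<in>chart_image c. form_inner (\<phi> c x) 4 (ext_d (\<phi> c) x) (star_phi (\<phi> c) x) = r"
    using assms(4) by (auto simp: constant_type_def)
  have gauduchon: "g2_chart_gauduchon (chart_image c) (\<phi> c) (\<Gamma> c) r" if c: "c \<in> A" for c
    using chart[OF c] assms(4,5) r c
    by (simp add: g2_chart_gauduchon_def g2_chart_gauduchon_axioms_def constant_type_def integrable_g2_def gauduchon_g2_def)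
  have frames: "g2_instanton A \<phi> \<Gamma> \<longleftrightarrow> (\<forall>c\<in>A. \<forall>x\<in>chart_image c. \<forall>F. adapted_frame (\<phi> c x) F \<longrightarrow>
      (\<forall>i j k. (\<Sum>\<^sub>7a b. fr F (metric_chart.RL (\<lambda>x. metric (\<phi> c x)) (\<Gamma> c) x) [a,b,i,j] * ph a b k) = 0))"
    unfolding g2_instanton_def using g2_chart.instanton_frames[OF chart] by simp
  show ?thesis
  proof
    assume "g2_instanton A \<phi> \<Gamma>"
    then have inst: "g2_chart_instanton (chart_image c) (\<phi> c) (\<Gamma> c) r" if c: "c \<in> A" for c
      unfolding frames using gauduchon[OF c] c by (simp add: g2_chart_instanton_def g2_chart_instanton_axioms_def)
    \<comment> \<open>Nonnegativity of each divergence presupposes that the earlier ones vanish at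
      the same point, so the global argument is carried out for one field after the other.\<close>
    have V1: "gdiv c (gV1 c) x = 0" if "c \<in> A" "x \<in> chart_image c" for c x
      using divergence_zero[OF V_tensor(1) g2_chart.V_smooth(1)[OF chart] g2_chart_instanton.divg_V1_nonneg[OF inst]] that by blast
    have V2: "gdiv c (gV2 c) x = 0" if "c \<in> A" "x \<in> chart_image c" for c x
      using divergence_zero[OF V_tensor(2) g2_chart.V_smooth(2)[OF chart] g2_chart_instanton.divg_V2_nonneg[OF inst _ V1]] that by blast
    have V3: "gdiv c (gV3 c) x = 0" if "c \<in> A" "x \<in> chart_image c" for c x
      using divergence_zero[OF V_tensor(3) g2_chart.V_smooth(3)[OF chart] g2_chart_instanton.divg_V3_nonneg[OF inst _ V1 V2]] that by blast
    show "parallel A \<Gamma> 3 (\<lambda>c. torsion_field (\<phi> c) (\<Gamma> c))"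
      unfolding parallel_def
    proof (intro ballI allI)
      fix c x l and "is" :: "7 list" assume c: "c \<in> A" "x \<in> chart_image c" and "is \<in> idx 3"
      then have len: "length is = 3" by simp
      show "cov_deriv (\<Gamma> c) l (torsion_field (\<phi> c) (\<Gamma> c)) x is = 0"
        using g2_chart_instanton.torsion_parallel[OF inst[OF c(1)] c(2) V1[OF c] V2[OF c] V3[OF c] len]
          g2_chart.cov_deriv_torsion[OF chart[OF c(1)] c(2) len] by simp
    qed
  next
    assume par: "parallel A \<Gamma> 3 (\<lambda>c. torsion_field (\<phi> c) (\<Gamma> c))"
    show "g2_instanton A \<phi> \<Gamma>"
      unfolding frames
    proof (intro ballI allI impI)
      fix c x F i j k assume c: "c \<in> A" "x \<in> chart_image c" and F: "adapted_frame (\<phi> c x) F"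
      show "(\<Sum>\<^sub>7a b. fr F (metric_chart.RL (\<lambda>x. metric (\<phi> c x)) (\<Gamma> c) x) [a,b,i,j] * ph a b k) = 0"
      proof (rule g2_chart.parallel_torsion_frames[OF chart[OF c(1)] _ F c(2)])
        fix l and "is" :: "7 list" assume "length is = 3"
        then show "cov_deriv (\<Gamma> c) l (gT c) x is = 0"
          using par c g2_chart.cov_deriv_torsion[OF chart[OF c(1)] c(2), of "is" l] by (simp add: parallel_def)
      qed
    qed
  qed
qed

end
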